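(* Let $p>1$, $N>p$, $p^*=Np/(N-p)$, $\Omega\subset\mathbb{R}^N$ a bounded connected open set with $C^{1,\alpha}$ boundary, and $V\in L^\infty(\Omega)$ changing sign. Let $g:\mathbb{R}\times\Omega\times\mathbb{R}\to\mathbb{R}$ be a Carathéodory function such that for every bounded set $J\subset\mathbb{R}$ there is a continuous function $\bar f:[0,\infty)\to[0,\infty)$ with $|g(\lambda,x,s)|\le\bar f(|s|)$ for a.e. $x\in\Omega$ and all $(\lambda,s)\in J\times\mathbb{R}$, where: $\bar f(0)=0$; $\bar f$ is strictly increasing; $\lim_{s\to+\infty}\bar f(s)/s^{p^*-1}=0$; with $\bar F(s)=\int_0^s\bar f$, there exist $s_0>0$, $c_0>1$ with $s\bar f(s)/\bar F(s)\ge c_0$ for $s>s_0$; there is $\delta_0>0$ with $\bar f>0$ on $(0,\delta_0)$; and $\lim_{s\to0}\bar f(s)/s^{p-1}=0$. Consider $$(P_\lambda):\quad -\Delta_p u=\lambda V(x)|u|^{p-2}u+g(\lambda,x,u)\ \text{in }\Omega,\qquad u=0\ \text{on }\partial\Omega,$$ and let $\mathscr S$ be the closure in $E=\mathbb{R}\times W_0^{1,p}(\Omega)$ of the set of pairs $(\lambda,u)$ with $u\neq0$ a weak solution of $(P_\lambda)$. Let $\mu_1$ be either $\lambda_1(V)$ or $\lambda_{-1}(V)$. Then there exists a maximal closed connected set $\mathscr C\subset\mathscr S$ containing $(\mu_1,0)$ such that either (i) $\mathscr C$ is unbounded in $E$, or (ii) $\mathscr C$ contains a point $(\tilde\lambda,0)$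 where $\tilde\lambda\ne\mu_1$ is an eigenvalue of $-\Delta_p\varphi=\lambda V|\varphi|^{p-2}\varphi$ in $\Omega$, $\varphi=0$ on $\partial\Omega$.
   Context: $E$ carries the norm $|\lambda|+\|u\|$, $\|u\|=(\int_\Omega|\nabla u|^p)^{1/p}$. Weak solution: $u\in W_0^{1,p}(\Omega)$ with $\int_\Omega|\nabla u|^{p-2}\nabla u\cdot\nabla\psi=\int_\Omega(\lambda V|u|^{p-2}u+g(\lambda,x,u))\psi$ for all $\psi\in W_0^{1,p}(\Omega)$. Principal eigenvalues: $\lambda_1(V)=\inf\{\int_\Omega|\nabla u|^p: u\in W_0^{1,p},\int_\Omega V|u|^p=1\}$ and $\lambda_{-1}(V)=-\inf\{\int_\Omega|\nabla u|^p: u\in W_0^{1,p},\int_\Omega V|u|^p=-1\}$. *)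

theory Defs
  imports "HOL-Analysis.Analysis"
begin

text \<open>Locally near each boundary point, Omega is the subgraph (in the direction of a unit
vector e) of a C^{1,alpha} function of the coordinates orthogonal to e.  The function h is
taken on the whole space but required to be constant along e, so it is a function on the
hyperplane orthogonal to e.\<close>

definition C1alpha_boundary :: "'a::euclidean_space set \<Rightarrow> real \<Rightarrow> bool" where
  "C1alpha_boundary \<Omega> \<alpha> \<longleftrightarrow>
     (\<forall>x0\<in>frontier \<Omega>. \<exists>r>0. \<exists>e::'a. \<exists>h::'a \<Rightarrow> real. \<exists>Dh::'a \<Rightarrow> 'a. \<exists>L.
        norm e = 1 \<and>
        (\<forall>y. h y = h (y - (y \<bullet> e) *\<^sub>R e)) \<and>
        (\<forall>y. (h has_derivative (\<lambda>v. Dh y \<bullet> v)) (at y)) \<and>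
        (\<forall>y z. norm (Dh y - Dh z) \<le> L * dist y z powr \<alpha>) \<and>
        \<Omega> \<inter> ball x0 r = {y \<in> ball x0 r. y \<bullet> e < h y})"

definition test_pair :: "'a::euclidean_space set \<Rightarrow> ('a \<Rightarrow> real) \<Rightarrow> ('a \<Rightarrow> 'a) \<Rightarrow> bool" where
  "test_pair \<Omega> \<phi> g \<longleftrightarrow>
     continuous_on UNIV g \<and> (\<forall>x. (\<phi> has_derivative (\<lambda>v. g x \<bullet> v)) (at x)) \<and>
     compact (closure {x. \<phi> x \<noteq> 0}) \<and> closure {x. \<phi> x \<noteq> 0} \<subseteq> \<Omega>"

definition has_weak_gradient :: "'a::euclidean_space set \<Rightarrow> ('a \<Rightarrow> real) \<Rightarrow> ('a \<Rightarrow> 'a) \<Rightarrow> bool" where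
  "has_weak_gradient \<Omega> u G \<longleftrightarrow>
     u \<in> borel_measurable (lebesgue_on \<Omega>) \<and> G \<in> borel_measurable (lebesgue_on \<Omega>) \<and>
     (\<forall>K. compact K \<and> K \<subseteq> \<Omega> \<longrightarrow> integrable (lebesgue_on K) u \<and> integrable (lebesgue_on K) G) \<and>
     (\<forall>\<phi> g. test_pair \<Omega> \<phi> g \<longrightarrow>
        (\<integral>x. u x *\<^sub>R g x \<partial>lebesgue_on \<Omega>) = - (\<integral>x. \<phi> x *\<^sub>R G x \<partial>lebesgue_on \<Omega>))"

definition wgrad :: "'a::euclidean_space set \<Rightarrow> ('a \<Rightarrow> real) \<Rightarrow> 'a \<Rightarrow> 'a" where
  "wgrad \<Omega> u = (SOME G. has_weak_gradient \<Omega> u G)"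

definition Lp_on :: "'a::euclidean_space set \<Rightarrow> real \<Rightarrow> ('a \<Rightarrow> 'b::euclidean_space) \<Rightarrow> bool" where
  "Lp_on \<Omega> p f \<longleftrightarrow> f \<in> borel_measurable (lebesgue_on \<Omega>) \<and>
     integrable (lebesgue_on \<Omega>) (\<lambda>x. norm (f x) powr p)"

definition W0 :: "'a::euclidean_space set \<Rightarrow> real \<Rightarrow> ('a \<Rightarrow> real) set" where
  "W0 \<Omega> p = {u. \<exists>G. has_weak_gradient \<Omega> u G \<and> Lp_on \<Omega> p u \<and> Lp_on \<Omega> p G \<and>
      (\<exists>\<phi>s gs. (\<forall>k. test_pair \<Omega> (\<phi>s k) (gs k)) \<and>
         (\<lambda>k. \<integral>x. \<bar>\<phi>s k x - u x\<bar> powr p \<partial>lebesgue_on \<Omega>) \<longlonglongrightarrow> 0 \<and>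
         (\<lambda>k. \<integral>x. norm (gs k x - G x) powr p \<partial>lebesgue_on \<Omega>) \<longlonglongrightarrow> 0)}"

definition Wnorm :: "'a::euclidean_space set \<Rightarrow> real \<Rightarrow> ('a \<Rightarrow> real) \<Rightarrow> real" where
  "Wnorm \<Omega> p u = (\<integral>x. norm (wgrad \<Omega> u x) powr p \<partial>lebesgue_on \<Omega>) powr (1 / p)"

definition Edist :: "'a::euclidean_space set \<Rightarrow> real \<Rightarrow> real \<times> ('a \<Rightarrow> real) \<Rightarrow> real \<times> ('a \<Rightarrow> real) \<Rightarrow> real" where
  "Edist \<Omega> p z w = \<bar>fst z - fst w\<bar> + Wnorm \<Omega> p (\<lambda>x. snd z x - snd w x)"

definition Ecarrier :: "'a::euclidean_space set \<Rightarrow> real \<Rightarrow> (real \<times> ('a \<Rightarrow> real)) set" where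
  "Ecarrier \<Omega> p = UNIV \<times> W0 \<Omega> p"

text \<open>The (pseudo)metric topology of E, generated by the open balls (functions agreeing
a.e. are topologically indistinguishable, which models the quotient by a.e. equality).\<close>
definition Etop :: "'a::euclidean_space set \<Rightarrow> real \<Rightarrow> (real \<times> ('a \<Rightarrow> real)) topology" where
  "Etop \<Omega> p = topology_generated_by
     {{w \<in> Ecarrier \<Omega> p. Edist \<Omega> p z w < r} | z r. z \<in> Ecarrier \<Omega> p \<and> r > 0}"

definition weak_solution ::
  "'a::euclidean_space set \<Rightarrow> real \<Rightarrow> ('a \<Rightarrow> real) \<Rightarrow> (real \<Rightarrow> 'a \<Rightarrow> real \<Rightarrow> real) \<Rightarrow> real \<Rightarrow> ('a \<Rightarrow> real) \<Rightarrow> bool" where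
  "weak_solution \<Omega> p V g lam u \<longleftrightarrow> u \<in> W0 \<Omega> p \<and>
     (\<forall>\<psi>\<in>W0 \<Omega> p.
        (\<integral>x. norm (wgrad \<Omega> u x) powr (p - 2) * (wgrad \<Omega> u x \<bullet> wgrad \<Omega> \<psi> x) \<partial>lebesgue_on \<Omega>) =
        (\<integral>x. (lam * V x * \<bar>u x\<bar> powr (p - 2) * u x + g lam x (u x)) * \<psi> x \<partial>lebesgue_on \<Omega>))"

definition nontrivial_on :: "'a::euclidean_space set \<Rightarrow> ('a \<Rightarrow> real) \<Rightarrow> bool" where
  "nontrivial_on \<Omega> u \<longleftrightarrow> \<not> (AE x in lebesgue_on \<Omega>. u x = 0)"

definition is_eigenvalue :: "'a::euclidean_space set \<Rightarrow> real \<Rightarrow> ('a \<Rightarrow> real) \<Rightarrow> real \<Rightarrow> bool" where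
  "is_eigenvalue \<Omega> p V lam \<longleftrightarrow>
     (\<exists>\<phi>. nontrivial_on \<Omega> \<phi> \<and> weak_solution \<Omega> p V (\<lambda>_ _ _. 0) lam \<phi>)"

definition lambda1 :: "'a::euclidean_space set \<Rightarrow> real \<Rightarrow> ('a \<Rightarrow> real) \<Rightarrow> real" where
  "lambda1 \<Omega> p V = Inf {(\<integral>x. norm (wgrad \<Omega> u x) powr p \<partial>lebesgue_on \<Omega>) | u.
      u \<in> W0 \<Omega> p \<and> (\<integral>x. V x * \<bar>u x\<bar> powr p \<partial>lebesgue_on \<Omega>) = 1}"

definition lambda_neg1 :: "'a::euclidean_space set \<Rightarrow> real \<Rightarrow> ('a \<Rightarrow> real) \<Rightarrow> real" where
  "lambda_neg1 \<Omega> p V = - Inf {(\<integral>x. norm (wgrad \<Omega> u x) powr p \<partial>lebesgue_on \<Omega>) | u.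
      u \<in> W0 \<Omega> p \<and> (\<integral>x. V x * \<bar>u x\<bar> powr p \<partial>lebesgue_on \<Omega>) = -1}"

definition sol_closure ::
  "'a::euclidean_space set \<Rightarrow> real \<Rightarrow> ('a \<Rightarrow> real) \<Rightarrow> (real \<Rightarrow> 'a \<Rightarrow> real \<Rightarrow> real) \<Rightarrow> (real \<times> ('a \<Rightarrow> real)) set" where
  "sol_closure \<Omega> p V g = Etop \<Omega> p closure_of
     {(lam, u). nontrivial_on \<Omega> u \<and> weak_solution \<Omega> p V g lam u}"

definition caratheodory :: "'a::euclidean_space set \<Rightarrow> (real \<Rightarrow> 'a \<Rightarrow> real \<Rightarrow> real) \<Rightarrow> bool" where
  "caratheodory \<Omega> g \<longleftrightarrow>
     (\<forall>lam s. (\<lambda>x. g lam x s) \<in> borel_measurable (lebesgue_on \<Omega>)) \<and>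
     (AE x in lebesgue_on \<Omega>. continuous_on UNIV (\<lambda>(lam, s). g lam x s))"

definition good_majorant :: "real \<Rightarrow> real \<Rightarrow> (real \<Rightarrow> real) \<Rightarrow> bool" where
  "good_majorant p pstar f \<longleftrightarrow>
     continuous_on {0..} f \<and> (\<forall>s\<ge>0. f s \<ge> 0) \<and>
     f 0 = 0 \<and> strict_mono_on {0..} f \<and>
     ((\<lambda>s. f s / s powr (pstar - 1)) \<longlongrightarrow> 0) at_top \<and>
     (\<exists>s0>0. \<exists>c0>1. \<forall>s>s0. s * f s / integral {0..s} f \<ge> c0) \<and>
     (\<exists>\<delta>0>0. \<forall>s. 0 < s \<and> s < \<delta>0 \<longrightarrow> f s > 0) \<and>
     ((\<lambda>s. f s / s powr (p - 1)) \<longlongrightarrow> 0) (at_right 0)"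

end

theory Submission
imports Defs "HOL-Library.Diagonal_Subsequence"
begin

text \<open>Only nonnegative solutions are needed, and no degree theory.  Truncating the nonlinearity at the positive part
of u and adding a constant t > 0 to the right-hand side gives a fixed point problem u = K(t, lambda, u) for a compact
map K whose solutions are nonnegative.  For lambda below the principal eigenvalue the problem is coercive near u = 0.
For lambda above it and t > 0, Picone's inequality (the test function |phi|^p (u + e)^(1 - p)) excludes small
solutions.  If the component of the bifurcation point were bounded and met the trivial line only there, it could be
separated from the other solutions, and K together with a suitable map of the parameter would be a compact map
without fixed points, against Schauder's theorem.  Normalised solutions u / |u| with u tending to 0 converge to
eigenfunctions, which identifies the second alternative.  The eigenvalue lambda_(-1) is reduced to lambda_1 by
replacing V and lambda by -V and -lambda.\<close>

text \<open>As t tends to 0 from above, fixed points of small norm can persist only over parameters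
  at most \<open>l1\<close>. The trivial half-line ending at \<open>(l1, 0)\<close> thus acts as a
  branch with a free end, and this replaces a change of degree. Two obstacles shape the
  construction. First, trivial solutions exist for every parameter, also far to the left, where
  other solutions may approach them; the compact map is therefore multiplied by a cutoff that
  switches it off left of \<open>l1/4\<close> away from the continuum, and on the transition
  interval from \<open>l1/4\<close> to \<open>l1/2\<close> coercivity survives a factor between 0
  and 1. Second, that \<open>(l1, 0)\<close> lies in the closure of the nontrivial solutions is
  itself part of the claim; the continuum is built in that closure with the point added, and its
  being unbounded or meeting another trivial point then forces the point into the closure. Functions
  are kept as representatives, so norms are seminorms and equalities read
  \<open>N (...) = 0\<close>.\<close>

abbreviation (input) LIMSEQ_ascii ("((_)/ ----> (_))" [60, 60] 60) where "X ----> L \<equiv> X \<longlonglongrightarrow> L"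

lemmas Bintegrable_add = Bochner_Integration.integrable_add
lemmas Bintegrable_bound = Bochner_Integration.integrable_bound
lemmas Bintegrable_cong = Bochner_Integration.integrable_cong
lemmas Bintegrable_diff = Bochner_Integration.integrable_diff
lemmas Bintegrable_sum = Bochner_Integration.integrable_sum
lemmas Bintegral_add = Bochner_Integration.integral_add
lemmas Bintegral_diff = Bochner_Integration.integral_diff
lemmas Bintegral_sum = Bochner_Integration.integral_sum

lemma subseq_tendsto: "X ----> L ==> strict_mono r ==> (%k. X (r k)) ----> L"
using LIMSEQ_subseq_LIMSEQ[of X L r] by (simp add: o_def)

lemma recip_tendsto: "(%k. 1 / real (Suc k)) ----> 0"
using LIMSEQ_inverse_real_of_nat by (simp add: inverse_eq_divide)

section \<open>Fixed points and continua in seminormed spaces\<close>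

text \<open>Coordinates are indexed by a finite set, not by a type: the uses below are grid
  directions and the cells of a partition, whose number depends on the data.\<close>

lemma finite_coords_convergent_subseq:
fixes w :: "nat => 'z => real"
assumes "finite Z" "!!n z. z:Z==>abs (w n z)<=B"
shows "EX r. strict_mono (r::nat=>nat)&(ALL z:Z. convergent (%n. w (r n) z))"
using assms
proof (induction Z rule: finite_induct)
case empty thus ?case by (auto intro!: exI[of _ id] simp: strict_mono_id)
next
case (insert z Z)
then obtain r where r: "strict_mono (r::nat=>nat)" "ALL z:Z. convergent (%n. w (r n) z)" by auto
have "bounded (range (%n. w (r n) z))" using insert.prems by (auto simp: bounded_iff)
then obtain l s where s: "strict_mono (s::nat=>nat)" "((%n. w (r n) z) \<circ> s)---->l"
 using bounded_imp_convergent_subsequence by blast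
have "convergent (%n. w ((r \<circ> s) n) y)" if "y:insert z Z" for y
proof (cases "y = z")
 case True thus ?thesis using s by (auto simp: convergent_def o_def)
next
 case False
 hence "convergent (%n. w (r n) y)" using r that by auto
 from convergent_subseq_convergent[OF this s(1)] show ?thesis by (simp add: o_def)
qed
thus ?case using strict_mono_o[OF r(1) s(1)] by blast
qed

text \<open>Brouwer's theorem on a cube whose dimension \<open>m\<close> is a variable, since in
  Schauder's theorem it is the size of a finite net. Points are sequences, of which the first
  \<open>m\<close> entries have to be fixed. On ever finer grids Kuhn's combinatorial lemma supplies
  a cell where each coordinate is weakly decreased at one vertex and weakly increased at another;
  the cells shrink to a fixed point.\<close>

lemma brouwer_nat_cube:
fixes f :: "(nat => real) => nat => real"
assumes cont: "!!c ck i. i < m==>(!!k j. 0<=ck k j&ck k j<=1)==>(!!j. (%k. ck k j)---->c j) ==>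
      (%k::nat. f (ck k) i)---->f c i"
 and bnd: "!!c i. i < m==>(!!j. 0<=c j&c j<=1)==>0<=f c i&f c i<=1"
shows "EX c. (ALL i. 0<=c i&c i<=1)&(ALL i<m. f c i = c i)"
proof -
define emb where "emb p x i = (if i < m then min 1 (real (x i) / real p) else 0)" for p and x :: "nat => nat" and i
have emb01: "0<=emb p x i&emb p x i<=1" for p x i by (auto simp: emb_def)
define nb where "nb q r \<longleftrightarrow> (ALL j<m. q j<=r j&r j<=q j + 1)" for q r :: "nat => nat"
have "EX q. (ALL i<m. q i < Suc k)&(ALL i<m. EX r s. nb q r&nb q s &
    f (emb (Suc k) r) i<=emb (Suc k) r i&f (emb (Suc k) s) i>=emb (Suc k) s i)" for k
proof -
 \<comment> \<open>Label 1 marks grid points whose i-th coordinate is moved down by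
   \<open>f\<close>. On the faces the values are forced as Kuhn's lemma demands, and there
   \<open>bnd\<close> still gives the inequalities \<open>l1\<close> and \<open>l0\<close>.\<close>
 define lab where "lab x i = (if x i = 0 then 0 else if x i = Suc k \<or> f (emb (Suc k) x) i < emb (Suc k) x i then 1 else (0::nat))" for x i
 obtain q where q: "ALL i<m. q i < Suc k"
   "ALL i<m. EX r s. (ALL j<m. q j<=r j&r j<=q j + 1)&(ALL j<m. q j<=s j&s j<=q j + 1)&lab r i~=lab s i"
  by (rule kuhn_lemma[of "Suc k" m lab]) (auto simp: lab_def)
 have l1: "f (emb (Suc k) x) i<=emb (Suc k) x i" if "lab x i = 1" "i < m" for x i
  using that bnd[OF that(2), of "emb (Suc k) x"] emb01 by (auto simp: lab_def emb_def split: if_splits)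
 have l0: "f (emb (Suc k) x) i>=emb (Suc k) x i" if "lab x i~=1" "i < m" for x i
  using that bnd[OF that(2), of "emb (Suc k) x"] emb01 by (auto simp: lab_def emb_def split: if_splits)
 have "lab x i = 0 \<or> lab x i = 1" for x i by (auto simp: lab_def)
 hence *: "EX r s. nb q r&nb q s&lab r i = 1&lab s i~=1" if "i < m" for i
  using q(2) that unfolding nb_def by metis
 have "EX r s. nb q r&nb q s&f (emb (Suc k) r) i<=emb (Suc k) r i&f (emb (Suc k) s) i>=emb (Suc k) s i" if i: "i < m" for i
 proof -
  obtain r s where "nb q r" "nb q s" "lab r i = 1" "lab s i~=1" using *[OF i] by blast
  thus ?thesis using l1[of r i] l0[of s i] i by blast
 qed
 thus ?thesis using q(1) by (intro exI[of _ q]) simp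
qed
hence "EX q. ALL k. (ALL i<m. q k i < Suc k)&(ALL i<m. EX r s. nb (q k) r&nb (q k) s &
    f (emb (Suc k) r) i<=emb (Suc k) r i&f (emb (Suc k) s) i>=emb (Suc k) s i)" by (intro choice) simp
then obtain q where q: "!!k i. i < m==>q k i < Suc k"
 "!!k i. i < m==>EX r s. nb (q k) r&nb (q k) s &
    f (emb (Suc k) r) i<=emb (Suc k) r i&f (emb (Suc k) s) i>=emb (Suc k) s i" by blast
define P where "P k i p \<longleftrightarrow> nb (q k) (fst p)&nb (q k) (snd p) &
    f (emb (Suc k) (fst p)) i<=emb (Suc k) (fst p) i&f (emb (Suc k) (snd p)) i>=emb (Suc k) (snd p) i" for k i p
have "EX p. P k i p" if "i < m" for k i using q(2)[OF that, of k] unfolding P_def by simp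
hence P: "P k i (SOME p. P k i p)" if "i < m" for k i using that by (simp add: someI_ex)
define r where "r k i = fst (SOME p. P k i p)" for k i
define s where "s k i = snd (SOME p. P k i p)" for k i
have rs: "!!k i j. i < m==>j < m==>q k j<=r k i j&r k i j<=q k j + 1"
  "!!k i j. i < m==>j < m==>q k j<=s k i j&s k i j<=q k j + 1"
  "!!k i. i < m==>f (emb (Suc k) (r k i)) i<=emb (Suc k) (r k i) i"
  "!!k i. i < m==>f (emb (Suc k) (s k i)) i>=emb (Suc k) (s k i) i"
 using P unfolding P_def nb_def r_def s_def by blast+
define x where "x k = emb (Suc k) (q k)" for k
obtain t :: "nat => nat" where t: "strict_mono t" "ALL i<m. convergent (%k. x (t k) i)"
 using finite_coords_convergent_subseq[of "{..<m}" x 1] emb01 by (auto simp: x_def)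
define c where "c i = (if i < m then lim (%k. x (t k) i) else 0)" for i
have xc: "(%k. x (t k) i)---->c i" for i
proof (cases "i < m")
 case True thus ?thesis using t by (auto simp: c_def convergent_LIMSEQ_iff)
next
 case False thus ?thesis by (auto simp: c_def x_def emb_def)
qed
have inv0: "(%k. 1 / real (Suc (t k)))---->0"
 by (rule subseq_tendsto[OF recip_tendsto t(1)])
\<comment> \<open>The vertices of the k-th cell lie within \<open>1 / real (Suc k)\<close> of its
  corner in each coordinate, so they share the limit \<open>c\<close>, and both one-sided
  inequalities pass to it.\<close>
have near: "(%k. emb (Suc (t k)) (y (t k)) i)---->c i"
 if y: "!!k j. j < m==>q k j<=y k j&y k j<=q k j + 1" for y i
proof (cases "i < m")
 case True
 have "abs (emb (Suc k) (y k) i - x k i)<=1 / real (Suc k)" for k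
 proof -
  have mm: "A<=B==>B<=A + d==>abs (min 1 B - min 1 A)<=d" for A B d :: real by (auto simp: min_def abs_if)
  have *: "real (q k i) / real (Suc k)<=real (y k i) / real (Suc k)" using y[OF True, of k]
   by (intro divide_right_mono) auto
  moreover have "real (y k i) / real (Suc k)<=(real (q k i) + 1) / real (Suc k)" using y[OF True, of k]
   by (intro divide_right_mono) auto
  moreover have "(real (q k i) + 1) / real (Suc k) = real (q k i) / real (Suc k) + 1 / real (Suc k)" by (simp add: add_divide_distrib)
  ultimately have "real (y k i) / real (Suc k)<=real (q k i) / real (Suc k) + 1 / real (Suc k)" by linarith
  thus ?thesis using True * unfolding emb_def x_def by (simp only: if_True mm)
 qed
 hence "(%k. emb (Suc (t k)) (y (t k)) i - x (t k) i)---->0"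
  by (intro Lim_null_comparison[OF _ inv0]) auto
 from tendsto_add[OF this xc[of i]] show ?thesis by simp
next
 case False thus ?thesis by (auto simp: c_def emb_def)
qed
have c01: "0<=c i&c i<=1" for i
 using LIMSEQ_le_const[OF xc[of i], of 0] LIMSEQ_le_const2[OF xc[of i], of 1] emb01 by (auto simp: x_def)
have "f c i = c i" if i: "i < m" for i
proof (rule antisym)
 have nr: "(%k. emb (Suc (t k)) (r (t k) i) j)---->c j" for j
  by (rule near[where y="%k. r k i"]) (use rs(1) i in blast)
 have ns: "(%k. emb (Suc (t k)) (s (t k) i) j)---->c j" for j
  by (rule near[where y="%k. s k i"]) (use rs(2) i in blast)
 have "(%k. f (emb (Suc (t k)) (r (t k) i)) i)---->f c i" using nr emb01 by (intro cont[OF i]) auto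
 from LIMSEQ_le[OF this nr[of i]] show "f c i<=c i" using rs(3)[OF i] by auto
 have "(%k. f (emb (Suc (t k)) (s (t k) i)) i)---->f c i" using ns emb01 by (intro cont[OF i]) auto
 from LIMSEQ_le[OF ns[of i] this] show "c i<=f c i" using rs(4)[OF i] by auto
qed
thus ?thesis using c01 by blast
qed

section \<open>Schauder's theorem in a seminormed function space\<close>

locale seminormed =
fixes W :: "('x => real) set" and N :: "('x => real) => real"
assumes zero: "(%_. 0):W"
 and add: "!!u v. u:W==>v:W==>(%x. u x + v x):W"
 and scale: "!!c u. u:W==>(%x. c * u x):W"
 and N_nonneg: "!!u. 0<=N u"
 and N_scale: "!!c u. u:W==>N (%x. c * u x) = abs c * N u"
 and N_tri: "!!u v. u:W==>v:W==>N (%x. u x + v x)<=N u + N v"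
begin

lemma diff: "u:W==>v:W==>(%x. u x - v x):W"
using add[of u "%x. (-1) * v x"] scale[of v "-1"] by simp

lemma N_zero [simp]: "N (%x. 0) = 0"
using N_scale[OF zero, of 0] by simp

lemma N_minus_commute: "u:W==>v:W==>N (%x. u x - v x) = N (%x. v x - u x)"
using N_scale[OF diff[of u v], of "-1"] by simp

lemma N_diff_tri: "u:W==>v:W==>w:W==>N (%x. u x - w x)<=N (%x. u x - v x) + N (%x. v x - w x)"
using N_tri[OF diff[of u v] diff[of v w]] by simp

lemma N_le_diff: "u:W==>v:W==>N u<=N v + N (%x. u x - v x)"
using N_tri[OF _ diff[of u v], of v] by simp

lemma N_abs_diff: "u:W==>v:W==>abs (N u - N v)<=N (%x. u x - v x)"
using N_le_diff[of u v] N_le_diff[of v u] N_minus_commute[of u v] by auto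

lemma N_tendsto:
assumes "!!k. u k:W" "v:W" "(%k. N (%x. u k x - v x))---->0"
shows "(%k. N (u k))---->N v"
proof -
have "(%k. N (u k) - N v)---->0"
 by (rule Lim_null_comparison[OF _ assms(3)]) (use N_abs_diff assms in auto)
thus ?thesis by (simp add: LIM_zero_iff)
qed

lemma sum_in: "(!!i. i < m==>ks i:W)==>(%x. \<Sum>i<m. c i * ks i x):W" for m :: nat
by (induction m) (auto simp: zero intro!: add scale)

lemma N_sum: "(!!i. i < m==>ks i:W)==>N (%x. \<Sum>i<m. c i * ks i x)<=(\<Sum>i<(m::nat). abs (c i) * N (ks i))"
proof (induction m)
case 0 thus ?case by simp
next
case (Suc m)
have "N (%x. \<Sum>i<Suc m. c i * ks i x)<=N (%x. \<Sum>i<m. c i * ks i x) + N (%x. c m * ks m x)"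
 using N_tri[OF sum_in[of m ks c] scale[of "ks m" "c m"]] Suc by simp
thus ?case using Suc N_scale[of "ks m" "c m"] by simp
qed

text \<open>The parameter is treated as one more coordinate. The second component is composed with
  Schauder's projection onto the span of a finite net, and Brouwer's theorem is applied to parameter
  and weights together. So the parameter equation is met exactly, the other one up to
  \<open>e\<close>. As \<open>U\<close> acts on all of \<open>W\<close>, no convex domain has to be
  preserved.\<close>

lemma schauder:
fixes ell :: "real => ('x => real) => real" and U :: "real => ('x => real) => 'x => real"
assumes ab: "a < b"
 and ell: "!!l u. l:{a..b}==>u:W==>ell l u:{a..b}"
 and U: "!!l u. l:{a..b}==>u:W==>U l u:W"
 and ell_c: "!!lk l uk u. (!!k. lk k:{a..b})==>l:{a..b}==>(!!k. uk k:W)==>u:W==>lk---->l ==>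
   (%k::nat. N (%x. uk k x - u x))---->0==>(%k. ell (lk k) (uk k))---->ell l u"
 and U_c: "!!lk l uk u. (!!k. lk k:{a..b})==>l:{a..b}==>(!!k. uk k:W)==>u:W==>lk---->l ==>
   (%k::nat. N (%x. uk k x - u x))---->0==>(%k. N (%x. U (lk k) (uk k) x - U l u x))---->0"
 and tb: "!!e. e > 0==>EX F. finite F&F \<subseteq> W&(ALL l:{a..b}. ALL u:W. EX k:F. N (%x. U l u x - k x) < e)"
 and e: "e > 0"
shows "EX l:{a..b}. EX u:W. ell l u = l&N (%x. u x - U l u x) < e"
proof -
obtain F where F: "finite F" "F \<subseteq> W" "!!l u. l:{a..b}==>u:W==>EX k:F. N (%x. U l u x - k x) < e"
 using tb[OF e] by blast
obtain kl where kl: "set kl = F" using F(1) finite_list by blast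
define m where "m = length kl"
have klW: "kl ! i:W" if "i < m" for i using that kl F(2) m_def nth_mem by blast
define lam where "lam c = a + (b - a) * c (0::nat)" for c
define cb where "cb c = (%x. \<Sum>i<m. c (Suc i) * (kl ! i) x)" for c
define w where "w i v = max 0 (e - N (%x. v x - (kl ! i) x))" for i v
define sw where "sw v = (\<Sum>i<m. w i v)" for v
define V where "V c = U (lam c) (cb c)" for c
\<comment> \<open>Coordinate 0 is the parameter rescaled to the unit interval; coordinate
  \<open>Suc i\<close> is the normalised weight of the i-th net point. The weights of a general
  point of the cube need not sum to 1, which is harmless because \<open>cb c\<close> lies in
  \<open>W\<close> anyway.\<close>
define f where "f c j = (case j of 0 => (ell (lam c) (cb c) - a) / (b - a) | Suc i => w i (V c) / sw (V c))" for c j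
have w0: "0<=w i v" for i v by (auto simp: w_def)
have lam_in: "lam c:{a..b}" if "!!j. 0<=c j&c j<=1" for c
proof -
 have "(b - a) * c 0<=(b - a) * 1" using that[of 0] ab by (intro mult_left_mono) auto
 hence "a + (b - a) * c 0<=b" by (simp add: algebra_simps)
 thus ?thesis using that[of 0] ab by (auto simp: lam_def)
qed
have cb_in: "cb c:W" for c unfolding cb_def by (rule sum_in[OF klW])
have V_in: "V c:W" if "!!j. 0<=c j&c j<=1" for c unfolding V_def using U[OF lam_in[of c, OF that] cb_in] .
have swpos: "sw (V c) > 0" if c: "!!j. 0<=c j&c j<=1" for c
proof -
 have "EX k:F. N (%x. V c x - k x) < e" unfolding V_def by (rule F(3)) (rule lam_in[of c, OF c], rule cb_in)
 then obtain k where k: "k:F" "N (%x. V c x - k x) < e" by (elim bexE)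
 obtain i where i: "i < m" "kl ! i = k" using k(1) unfolding kl[symmetric] in_set_conv_nth m_def by (elim exE conjE)
 hence "w i (V c) > 0" using k by (simp add: w_def)
 thus ?thesis unfolding sw_def using i w0 by (intro sum_pos2[of _ i]) auto
qed
have ex: "EX c. (ALL i. 0<=c i&c i<=1)&(ALL i<Suc m. f c i = c i)"
proof (rule brouwer_nat_cube)
 fix c :: "nat => real" and i assume i: "i < Suc m" and c: "!!j. 0<=c j&c j<=1"
 show "0<=f c i&f c i<=1"
 proof (cases i)
  case 0
  thus ?thesis using ell[OF lam_in[of c, OF c] cb_in[of c]] ab by (auto simp: f_def divide_simps)
 next
  case (Suc k)
  have "w k (V c)<=sw (V c)" unfolding sw_def by (rule member_le_sum) (use Suc i w0 in auto)
  thus ?thesis using swpos[of c, OF c] w0 Suc by (auto simp: f_def divide_simps)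
 qed
next
 fix c :: "nat => real" and ck i assume i: "i < Suc m" and ck: "!!k j. 0<=ck k j&ck k j<=1" and lim: "!!j. (%k. ck k j)---->c j"
 have c: "0<=c j&c j<=1" for j
  using LIMSEQ_le_const[OF lim[of j], of 0] LIMSEQ_le_const2[OF lim[of j], of 1] ck by auto
 have l: "(%k. lam (ck k))---->lam c" unfolding lam_def by (intro tendsto_intros lim)
 have "(%k. \<Sum>i<m. abs (ck k (Suc i) - c (Suc i)) * N (kl ! i))---->(\<Sum>i<m. abs (c (Suc i) - c (Suc i)) * N (kl ! i))"
  by (intro tendsto_intros lim)
 hence s0: "(%k. \<Sum>i<m. abs (ck k (Suc i) - c (Suc i)) * N (kl ! i))---->0" by simp
 have cbd: "(%x. cb (ck k) x - cb c x) = (%x. \<Sum>i<m. (ck k (Suc i) - c (Suc i)) * (kl ! i) x)" for k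
  by (auto simp: cb_def sum_subtractf algebra_simps)
 have cc: "(%k. N (%x. cb (ck k) x - cb c x))---->0"
  by (rule Lim_null_comparison[OF _ s0]) (use N_sum[OF klW] N_nonneg in \<open>auto simp: cbd\<close>)
 have VV: "(%k. N (%x. V (ck k) x - V c x))---->0" unfolding V_def
  by (rule U_c[OF lam_in lam_in cb_in cb_in l cc]) (use ck c in auto)
 have ww: "(%k. w j (V (ck k)))---->w j (V c)" if "j < m" for j
 proof -
  have "(%k. N (%x. V (ck k) x - (kl ! j) x))---->N (%x. V c x - (kl ! j) x)"
   using N_tendsto[of "%k x. V (ck k) x - (kl ! j) x" "%x. V c x - (kl ! j) x"] VV diff V_in ck c klW[OF that] by auto
  thus ?thesis unfolding w_def by (intro tendsto_intros)
 qed
 have ss: "(%k. sw (V (ck k)))---->sw (V c)" unfolding sw_def by (intro tendsto_sum ww) auto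
 show "(%k. f (ck k) i)---->f c i"
 proof (cases i)
  case 0
  have "(%k. ell (lam (ck k)) (cb (ck k)))---->ell (lam c) (cb c)"
   by (rule ell_c[OF lam_in lam_in cb_in cb_in l cc]) (use ck c in auto)
  hence "(%k. (ell (lam (ck k)) (cb (ck k)) - a) / (b - a))---->(ell (lam c) (cb c) - a) / (b - a)"
   using ab by (intro tendsto_intros) auto
  thus ?thesis using 0 by (simp add: f_def)
 next
  case (Suc j)
  hence "(%k. w j (V (ck k)) / sw (V (ck k)))---->w j (V c) / sw (V c)"
   using swpos[of c, OF c] i by (intro tendsto_divide ww ss) auto
  thus ?thesis using Suc by (simp add: f_def)
 qed
qed
then obtain c where c: "!!i. 0<=c i&c i<=1" "!!i. i < Suc m==>f c i = c i" by blast
define S where "S = sw (V c)"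
have S: "S > 0" unfolding S_def by (rule swpos[of c, OF c(1)])
have cS: "c (Suc i) = w i (V c) / S" if "i < m" for i using c(2)[of "Suc i"] that by (simp add: f_def S_def)
have "c 0 = (ell (lam c) (cb c) - a) / (b - a)" using c(2)[of 0] by (simp add: f_def)
hence 1: "ell (lam c) (cb c) = lam c" unfolding lam_def using ab by (simp add: field_simps)
\<comment> \<open>At the fixed point the coordinates are the normalised weights, so here they do sum
  to 1 and \<open>cb c\<close> is a convex combination.\<close>
have sum1: "(\<Sum>i<m. c (Suc i)) = 1" using S cS by (simp add: sum_divide_distrib[symmetric] sw_def[symmetric] S_def)
have "(%x. cb c x - V c x) = (%x. \<Sum>i<m. c (Suc i) * ((kl ! i) x - V c x))"
proof
 fix x
 have "(\<Sum>i<m. c (Suc i) * ((kl ! i) x - V c x)) = cb c x - (\<Sum>i<m. c (Suc i)) * V c x"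
  by (simp add: cb_def right_diff_distrib sum_subtractf sum_distrib_right)
 thus "cb c x - V c x = (\<Sum>i<m. c (Suc i) * ((kl ! i) x - V c x))" using sum1 by simp
qed
hence "N (%x. cb c x - V c x)<=(\<Sum>i<m. abs (c (Suc i)) * N (%x. (kl ! i) x - V c x))"
 using N_sum[of m "%i x. (kl ! i) x - V c x" "%i. c (Suc i)"] diff klW V_in[of c, OF c(1)] by simp
\<comment> \<open>Only net points closer than \<open>e\<close> to \<open>V c\<close> carry a
  positive weight, and some weight is positive; hence the strict inequality.\<close>
also have "... < (\<Sum>i<m. c (Suc i) * e)"
proof (rule sum_strict_mono_ex1)
 have le: "abs (c (Suc i)) * N (%x. (kl ! i) x - V c x)<=c (Suc i) * e&(c (Suc i) > 0-->abs (c (Suc i)) * N (%x. (kl ! i) x - V c x) < c (Suc i) * e)" if "i < m" for i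
 proof (cases "c (Suc i) = 0")
  case False
  hence "w i (V c)~=0" using cS[OF that] by auto
  hence "N (%x. (kl ! i) x - V c x) < e" using N_minus_commute[OF V_in[of c, OF c(1)] klW[OF that]] by (auto simp: w_def max_def split: if_splits)
  thus ?thesis using c(1)[of "Suc i"] False by (auto simp: abs_if)
 qed auto
 show "finite {..<m}" by simp
 show "ALL i:{..<m}. abs (c (Suc i)) * N (%x. (kl ! i) x - V c x)<=c (Suc i) * e" using le by auto
 have "EX i<m. c (Suc i)~=0" using sum1 by (metis lessThan_iff sum.neutral zero_neq_one)
 thus "EX i:{..<m}. abs (c (Suc i)) * N (%x. (kl ! i) x - V c x) < c (Suc i) * e" using le c(1)
  by (metis lessThan_iff order_less_le)
qed
also have "... = e" using sum1 by (simp add: sum_distrib_right[symmetric])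
finally show ?thesis using 1 lam_in[of c, OF c(1)] cb_in unfolding V_def by blast
qed

end

section \<open>Chain components in a compact pseudometric space\<close>

locale pseudometric_on =
fixes E :: "'z set" and d :: "'z => 'z => real"
assumes refl: "!!z. z:E==>d z z = 0"
 and sym: "!!z w. z:E==>w:E==>d z w = d w z"
 and tri: "!!x y z. x:E==>y:E==>z:E==>d x z<=d x y + d y z"
begin

lemma nonneg: "z:E==>w:E==>0<=d z w"
using tri[of z w z] refl[of z] sym[of z w] by auto

text \<open>At a fixed step size this set has distance at least \<open>e\<close> from the rest of
  \<open>K\<close>, which a connected component need not have; the separation argument lives on this
  gap.\<close>

definition chain_comp :: "'z set => 'z => real => 'z set" where
"chain_comp K x e = {z. (x, z):{(a, b). a:K&b:K&d a b < e}\<^sup>*}"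

definition seq_cpt :: "'z set => bool" where
"seq_cpt K \<longleftrightarrow> (ALL z::nat=>'z. range z \<subseteq> K-->(EX r l. strict_mono (r::nat=>nat)&l:K&(%k. d (z (r k)) l)---->0))"

lemma seq_cptD:
assumes "seq_cpt K" "!!k. z k:K"
obtains r l where "strict_mono (r::nat=>nat)" "l:K" "(%k. d (z (r k)) l)---->0"
proof -
have "range z \<subseteq> K" using assms(2) by blast
thus ?thesis using assms(1) that unfolding seq_cpt_def by blast
qed

lemma chain_comp_step: "z:chain_comp K x e==>z:K==>w:K==>d z w < e==>w:chain_comp K x e"
unfolding chain_comp_def by (auto intro: rtrancl.rtrancl_into_rtrancl)

lemma chain_comp_sub: "x:K==>chain_comp K x e \<subseteq> K"
unfolding chain_comp_def by (auto elim: rtranclE)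

lemma chain_comp_self: "x:chain_comp K x e"
unfolding chain_comp_def by auto

lemma chain_comp_mono: "e<=e'==>chain_comp K x e \<subseteq> chain_comp K x e'"
unfolding chain_comp_def by (auto intro: rtrancl_mono[THEN subsetD, rotated])

text \<open>One further step of a chain leads from a late member of the sequence to the limit, and
  the components decrease with the step size; so the limit belongs to all of them.\<close>

lemma chain_comp_limit:
assumes K: "K \<subseteq> E" and x: "x:K"
 and cpt: "seq_cpt K"
 and z: "!!n. z n:chain_comp K x (1 / real (Suc n))"
shows "EX r l. strict_mono r&l:(\<Inter>n. chain_comp K x (1 / real (Suc n)))&(%k. d (z (r k)) l)---->0"
proof -
have zK: "z n:K" for n using z chain_comp_sub[OF x] by blast
obtain r l where r: "strict_mono r" "l:K" "(%k. d (z (r k)) l)---->0" by (rule seq_cptD[OF cpt, of z]) (use zK in auto)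
have "l:chain_comp K x (1 / real (Suc n))" for n
proof -
 have "eventually (%k. d (z (r k)) l < 1 / real (Suc n)) sequentially"
  by (rule order_tendstoD[OF r(3)]) auto
 from eventually_conj[OF this eventually_ge_at_top[of n]] obtain k where k: "k>=n" "d (z (r k)) l < 1 / real (Suc n)"
  by (auto simp: eventually_sequentially)
 have "n<=r k" using k(1) seq_suble[OF r(1), of k] by linarith
 hence "1 / real (Suc (r k))<=1 / real (Suc n)" by (intro divide_left_mono) auto
 hence "z (r k):chain_comp K x (1 / real (Suc n))" using chain_comp_mono[of _ _ K x] z[of "r k"] by (meson subsetD)
 thus ?thesis by (rule chain_comp_step[OF _ zK r(2) k(2)])
qed
thus ?thesis using r by blast
qed

text \<open>In a compact pseudometric space the intersection of the chain components is connected: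
for fine chains every step stays near one of two separated closed pieces.\<close>
lemma chain_comp_connected:
assumes K: "K \<subseteq> E" and x: "x:K"
 and cpt: "seq_cpt K"
 and D: "D = (\<Inter>n. chain_comp K x (1 / real (Suc n)))"
 and P: "P1 \<union> P2 = D" "x:P1"
 and cl1: "!!z l. (!!k::nat. z k:P1)==>l:D==>(%k. d (z k) l)---->0==>l ~: P2"
 and cl2: "!!z l. (!!k::nat. z k:P2)==>l:D==>(%k. d (z k) l)---->0==>l ~: P1"
shows "P2 = {}"
proof (rule ccontr)
assume "P2~={}"
then obtain y where y: "y:P2" by blast
have DK: "D \<subseteq> K" using D chain_comp_sub[OF x] by blast
have inE: "z:E" if "z:D" for z using that DK K by blast
have inE1: "z:E" if "z:P1" for z using that P inE by blast
have inE2: "z:E" if "z:P2" for z using that P inE by blast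
\<comment> \<open>Otherwise points of the two pieces approach each other and have a common limit in
  \<open>D\<close>, which the closedness assumptions exclude from both.\<close>
have "EX \<delta>>0. ALL a:P1. ALL b:P2. d a b>=\<delta>"
proof (rule ccontr)
 assume n: "~ ?thesis"
 have "EX p. fst p:P1&snd p:P2&d (fst p) (snd p) < 1 / real (Suc n)" for n
 proof -
  have "1 / real (Suc n) > 0" by simp
  with n obtain a b where "a:P1" "b:P2" "~ 1 / real (Suc n)<=d a b" by (metis (no_types))
  thus ?thesis by (intro exI[of _ "(a, b)"]) (simp add: not_le)
 qed
 hence "EX p. ALL n. fst (p n):P1&snd (p n):P2&d (fst (p n)) (snd (p n)) < 1 / real (Suc n)"
  by (intro choice) blast
 then obtain p where p: "!!n. fst (p n):P1" "!!n. snd (p n):P2" "!!n. d (fst (p n)) (snd (p n)) < 1 / real (Suc n)" by blast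
 define a where "a n = fst (p n)" for n
 define b where "b n = snd (p n)" for n
 have ab: "!!n. a n:P1" "!!n. b n:P2" "!!n. d (a n) (b n) < 1 / real (Suc n)"
  using p by (auto simp: a_def b_def)
 have bD: "b n:chain_comp K x (1 / real (Suc n))" for n using ab(2) P D by blast
 obtain r l where r: "strict_mono r" "l:D" "(%k. d (b (r k)) l)---->0"
  using chain_comp_limit[OF K x cpt, of b] bD unfolding D by blast
 have inv: "(%k. 1 / real (Suc (r k)))---->0"
  by (rule subseq_tendsto[OF recip_tendsto r(1)])
 have al0: "(%k. 1 / real (Suc (r k)) + d (b (r k)) l)---->0" using tendsto_add[OF inv r(3)] by simp
 have al: "(%k. d (a (r k)) l)---->0"
 proof (rule Lim_null_comparison[OF _ al0], intro always_eventually allI)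
  fix k
  have "d (a (r k)) l<=d (a (r k)) (b (r k)) + d (b (r k)) l"
   by (rule tri) (use inE1 inE2 ab inE r(2) in auto)
  moreover have "0<=d (a (r k)) l" by (rule nonneg) (use inE1 ab inE r(2) in auto)
  ultimately show "norm (d (a (r k)) l)<=1 / real (Suc (r k)) + d (b (r k)) l" using ab(3)[of "r k"] by simp
 qed
 have "l ~: P2" by (rule cl1[OF _ r(2) al]) (rule ab)
 moreover have "l ~: P1" by (rule cl2[OF _ r(2) r(3)]) (rule ab)
 ultimately show False using P r(2) by blast
qed
then obtain \<delta> where \<delta>: "\<delta> > 0" "!!a b. a:P1==>b:P2==>d a b>=\<delta>" by blast
have "EX n. ALL z:chain_comp K x (1 / real (Suc n)). EX p:D. d z p < \<delta> / 3"
proof (rule ccontr)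
 assume n: "~ ?thesis"
 have "EX z. ALL n. z n:chain_comp K x (1 / real (Suc n))&(ALL p:D. ~ d (z n) p < \<delta> / 3)"
  by (intro choice) (use n in blast)
 then obtain z where z: "!!n. z n:chain_comp K x (1 / real (Suc n))" "!!n p. p:D==>~ d (z n) p < \<delta> / 3" by blast
 obtain r l where r: "strict_mono r" "l:D" "(%k. d (z (r k)) l)---->0"
  using chain_comp_limit[OF K x cpt, of z] z(1) unfolding D by blast
 have "eventually (%k. d (z (r k)) l < \<delta> / 3) sequentially"
  by (rule order_tendstoD[OF r(3)]) (use \<delta> in auto)
 thus False using z(2)[OF r(2)] by (auto simp: eventually_sequentially)
qed
then obtain n0 where n0: "!!z. z:chain_comp K x (1 / real (Suc n0))==>EX p:D. d z p < \<delta> / 3" by blast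
obtain n1 where n1: "1 / real (Suc n1) < \<delta> / 3" using nat_approx_posE[of "\<delta> / 3"] \<delta>(1) by auto
define n where "n = max n0 n1"
have n: "1 / real (Suc n) < \<delta> / 3"
proof -
 have "1 / real (Suc n)<=1 / real (Suc n1)" by (intro divide_left_mono) (auto simp: n_def)
 thus ?thesis using n1 by linarith
qed
have nn0: "1 / real (Suc n)<=1 / real (Suc n0)" by (intro divide_left_mono) (auto simp: n_def)
\<comment> \<open>The chain is fine enough to stay near \<open>D\<close>, and a step shorter than a
  third of the distance cannot pass from the neighbourhood of \<open>P1\<close> to that of
  \<open>P2\<close>.\<close>
have near: "EX p:P1. d z p < \<delta> / 3" if "(x, z):{(a, b). a:K&b:K&d a b < 1 / real (Suc n)}\<^sup>*" for z
 using that
proof (induction rule: rtrancl_induct)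
 case base
 thus ?case using P(2) refl[of x] inE1[of x] \<delta>(1) by (intro bexI[of _ x]) auto
next
 case (step z w)
 then obtain p where p: "p:P1" "d z p < \<delta> / 3" by blast
 have zw: "z:E" "w:E" "d z w < \<delta> / 3" using step K n by auto
 have "w:chain_comp K x (1 / real (Suc n))" unfolding chain_comp_def
  using rtrancl.rtrancl_into_rtrancl[OF step(1,2)] by simp
 hence "w:chain_comp K x (1 / real (Suc n0))" using chain_comp_mono[OF nn0] by blast
 then obtain p' where p': "p':D" "d w p' < \<delta> / 3" using n0 by blast
 show ?case
 proof (cases "p':P1")
  case False
  hence p2: "p':P2" using p' P by blast
  have "d p p'<=d p z + d z p'" by (rule tri) (use p inE1 zw p' inE in auto)
  moreover have "d z p'<=d z w + d w p'" by (rule tri) (use p inE1 zw p' inE in auto)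
  moreover have "d p z = d z p" by (rule sym) (use p inE1 zw in auto)
  ultimately show ?thesis using \<delta>(2)[OF p(1) p2] p p' zw by linarith
 qed (use p' in auto)
qed
have "y:chain_comp K x (1 / real (Suc n))" using y P D by blast
then obtain p where p: "p:P1" "d y p < \<delta> / 3" using near unfolding chain_comp_def by blast
moreover have "d y p = d p y" by (rule sym) (use inE1 inE2 y p in auto)
ultimately show False using \<delta>(2)[OF p(1) y] \<delta>(1) by linarith
qed

end

text \<open>If no finite net existed, points with mutual distances at least \<open>e\<close> could
  be chosen greedily, against the convergence of a subsequence. It converts compactness given by
  subsequences into the nets that Schauder's projection needs; the limit is asked to lie in
  \<open>W\<close> only.\<close>

lemma (in seminormed) tot_bdd:
assumes X: "X \<subseteq> W" and cpt: "!!x. range x \<subseteq> X==>EX r w. strict_mono (r::nat=>nat)&w:W&(%k. N (%t. x (r k) t - w t))---->0"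
 and e: "e > 0"
shows "EX F. finite F&F \<subseteq> W&(ALL x:X. EX k:F. N (%t. x t - k t) < e)"
proof (rule ccontr)
assume n: "~ ?thesis"
have "EX f::nat => 'x => real. ALL n. f n:X&(ALL i<n. ~ N (%t. f n t - f i t) < e)"
proof (rule dependent_wellorder_choice)
 fix n and f :: "nat => 'x => real" assume f: "!!y. y < n==>f y:X&(ALL i<y. ~ N (%t. f y t - f i t) < e)"
 have "f y:X" if "y < n" for y using f[OF that] by blast
 hence fW: "f ` {..<n} \<subseteq> W" using X by blast
 have "~ (finite (f ` {..<n})&f ` {..<n} \<subseteq> W&(ALL x:X. EX k:f ` {..<n}. N (%t. x t - k t) < e))"
  by (rule notI, rule notE[OF n], rule exI)
 then obtain x where x: "x:X" "ALL k:f ` {..<n}. ~ N (%t. x t - k t) < e" using fW by blast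
 show "EX r. r:X&(ALL i<n. ~ N (%t. r t - f i t) < e)"
 proof (intro exI[of _ x] conjI allI impI)
  fix i assume "i < n"
  hence "f i:f ` {..<n}" by (intro imageI) simp
  thus "~ N (%t. x t - f i t) < e" by (rule x(2)[THEN bspec])
 qed (rule x(1))
qed simp
then obtain f :: "nat => 'x => real" where f0: "ALL n. f n:X&(ALL i<n. ~ N (%t. f n t - f i t) < e)" by (rule exE)
have f: "f n:X" "i < n==>~ N (%t. f n t - f i t) < e" for n i
 using f0 by auto
obtain r w where r: "strict_mono (r::nat=>nat)" "w:W" "(%k. N (%t. f (r k) t - w t))---->0" using cpt[of f] f(1) by blast
have "eventually (%k. N (%t. f (r k) t - w t) < e / 2) sequentially"
 by (rule order_tendstoD[OF r(3)]) (use e in auto)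
then obtain k where "ALL n>=k. N (%t. f (r n) t - w t) < e / 2"
 unfolding eventually_sequentially by (rule exE)
hence k: "N (%t. f (r k) t - w t) < e / 2" "N (%t. f (r (Suc k)) t - w t) < e / 2" by simp_all
have W: "f (r k):W" "f (r (Suc k)):W" using f(1) X by auto
have "N (%t. f (r (Suc k)) t - f (r k) t)<=N (%t. f (r (Suc k)) t - w t) + N (%t. w t - f (r k) t)"
 by (rule N_diff_tri) (use W r in auto)
hence "N (%t. f (r (Suc k)) t - f (r k) t) < e" using k N_minus_commute[OF W(1) r(2)] by linarith
moreover have "r k < r (Suc k)" using r(1) by (simp add: strict_mono_Suc_iff)
ultimately show False using f(2) by blast
qed

section \<open>The pseudometric space of pairs and its topology\<close>

context seminormed begin

definition dE :: "real \<times> ('x => real) => real \<times> ('x => real) => real" where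
"dE z w = abs (fst z - fst w) + N (%x. snd z x - snd w x)"

definition carr :: "(real \<times> ('x => real)) set" where "carr = UNIV \<times> W"

definition topE :: "(real \<times> ('x => real)) topology" where
"topE = topology_generated_by {{w:carr. dE z w < r} | z r. z:carr&r > 0}"

lemma carr_iff: "z:carr \<longleftrightarrow> snd z:W" by (cases z) (auto simp: carr_def)

sublocale pm: pseudometric_on carr dE
proof
show "z:carr==>dE z z = 0" for z by (simp add: dE_def)
show "z:carr==>w:carr==>dE z w = dE w z" for z w
 using N_minus_commute[of "snd z" "snd w"] by (simp add: dE_def carr_iff abs_minus_commute)
show "dE x z<=dE x y + dE y z" if "x:carr" "y:carr" "z:carr" for x y z
 using N_diff_tri[of "snd x" "snd y" "snd z"] that by (auto simp: dE_def carr_iff)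
qed

text \<open>The topology has the balls as a subbase. The triangle inequality shows that they form a
  base, after which closedness can be tested by sequences.\<close>

lemma openin_topE: "openin topE U \<longleftrightarrow> U \<subseteq> carr&(ALL z:U. EX r>0. ALL w:carr. dE z w < r-->w:U)"
proof
assume "openin topE U"
hence "generate_topology_on {{w:carr. dE z w < r} | z r. z:carr&r > 0} U"
 by (simp add: topE_def openin_topology_generated_by_iff)
thus "U \<subseteq> carr&(ALL z:U. EX r>0. ALL w:carr. dE z w < r-->w:U)"
proof induction
 case Empty thus ?case by auto
next
 case (Int a b)
 have "EX r>0. ALL w:carr. dE z w < r-->w:a \<inter> b" if "z:a \<inter> b" for z
 proof -
  have "z:a" "z:b" using that by auto
  then obtain r1 r2 where "r1 > 0" "ALL w:carr. dE z w < r1-->w:a" "r2 > 0" "ALL w:carr. dE z w < r2-->w:b"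
   using Int.IH by (elim conjE) (drule (1) bspec, drule (1) bspec, elim exE conjE)
  thus ?thesis by (intro exI[of _ "min r1 r2"]) simp
 qed
 thus ?case using Int by blast
next
 case (UN K)
 thus ?case by blast
next
 case (Basis s)
 then obtain z r where s: "s = {w:carr. dE z w < r}" "z:carr" "r > 0" by blast
 have "EX r>0. ALL w:carr. dE y w < r-->w:s" if y: "y:s" for y
 proof (intro exI conjI ballI impI)
  show "r - dE z y > 0" using y s by auto
  fix w assume w: "w:carr" "dE y w < r - dE z y"
  have "dE z w<=dE z y + dE y w" by (rule pm.tri) (use w y s in auto)
  thus "w:s" using w s by auto
 qed
 thus ?case using s by blast
qed
next
assume U: "U \<subseteq> carr&(ALL z:U. EX r>0. ALL w:carr. dE z w < r-->w:U)"
let ?B = "{{w:carr. dE z w < r} | z r. z:carr&r > 0}"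
have "U = \<Union>{b \<in> ?B. b \<subseteq> U}"
proof
 show "U \<subseteq> \<Union>{b \<in> ?B. b \<subseteq> U}"
 proof
  fix z assume z: "z:U"
  then obtain r where r: "r > 0" "ALL w:carr. dE z w < r-->w:U" using U by blast
  have zc: "z:carr" using z U by blast
  have "{w:carr. dE z w < r}:?B" using zc r by blast
  moreover have "{w:carr. dE z w < r} \<subseteq> U" using r by blast
  moreover have "z:{w:carr. dE z w < r}" using zc r pm.refl by simp
  ultimately show "z:\<Union>{b \<in> ?B. b \<subseteq> U}" by blast
 qed
qed blast
also have "openin topE ..." unfolding topE_def openin_topology_generated_by_iff
 by (rule generate_topology_on.UN) (auto intro: generate_topology_on.Basis)
finally show "openin topE U" .
qed

lemma topspace_topE [simp]: "topspace topE = carr"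
proof
show "topspace topE \<subseteq> carr" using openin_topE openin_topspace by blast
have "openin topE carr" by (auto simp: openin_topE intro: exI[of _ 1])
thus "carr \<subseteq> topspace topE" by (rule openin_subset)
qed

lemma closedin_topE:
assumes "P \<subseteq> carr" "!!z l. (!!k::nat. z k:P)==>l:carr==>(%k. dE (z k) l)---->0==>l:P"
shows "closedin topE P"
proof -
have "EX r>0. ALL w:carr. dE z w < r-->w:carr - P" if z: "z:carr - P" for z
proof (rule ccontr)
 assume n: "~ ?thesis"
 have "EX w. w:P&dE z w < 1 / real (Suc k)" for k
 proof -
  have "1 / real (Suc k) > 0" by simp
  thus ?thesis using n by blast
 qed
 hence "EX w. ALL k. w k:P&dE z (w k) < 1 / real (Suc k)" by (intro choice) blast
 then obtain w where w: "!!k. w k:P" "!!k. dE z (w k) < 1 / real (Suc k)" by blast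
 have wc: "w k:carr" for k using w assms(1) by blast
 have zc: "z:carr" using z by blast
 have "(%k. dE (w k) z)---->0"
 proof (rule Lim_null_comparison[OF _ LIMSEQ_inverse_real_of_nat], intro always_eventually allI)
  fix k show "norm (dE (w k) z)<=inverse (real (Suc k))"
   using w(2)[of k] pm.sym[OF wc zc] pm.nonneg[OF wc zc] by (simp add: inverse_eq_divide)
 qed
 from assms(2)[OF w(1) zc this] z show False by blast
qed
hence "openin topE (carr - P)" unfolding openin_topE by blast
thus ?thesis using assms(1) by (simp add: closedin_def)
qed

lemma closedin_topE_limit:
assumes "closedin topE P" "!!k::nat. z k:P" "l:carr" "(%k. dE (z k) l)---->0"
shows "l:P"
proof (rule ccontr)
assume "l ~: P"
hence l: "l:carr - P" using assms by blast
have "openin topE (carr - P)" using assms(1) by (simp add: closedin_def)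
then obtain r where r: "r > 0" "!!w. w:carr==>dE l w < r==>w:carr - P" using l unfolding openin_topE by blast
have "eventually (%k. dE (z k) l < r) sequentially" by (rule order_tendstoD[OF assms(4)]) (use r in auto)
then obtain k where k: "dE (z k) l < r" by (auto simp: eventually_sequentially)
have "z k:carr" using assms(1,2) closedin_subset by fastforce
thus False using r(2)[of "z k"] k pm.sym[of l "z k"] assms by auto
qed

end

text \<open>In the application \<open>K t l u\<close> solves the equation with the truncated
  right-hand side at \<open>u\<close>, increased by t. \<open>K_compact\<close> joins compactness
  and continuity: a subsequence of images converges, and the limit is the image of \<open>u\<close>
  whenever the arguments converge to \<open>u\<close>. \<open>perturbed_limit\<close> carries
  Picone's inequality: limits as t tends to 0 lie in \<open>S\<close>, unless they are trivial over
  parameters at most \<open>l1\<close>. The factor \<open>b\<close> in \<open>coercive\<close>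
  anticipates the cutoff by which \<open>K\<close> will be multiplied.\<close>

locale bifurcation = seminormed W N for W :: "('x => real) set" and N +
fixes K :: "real => real => ('x => real) => 'x => real"
 and S :: "(real \<times> ('x => real)) set" and l1 rho0 :: real
assumes l1_pos: "l1 > 0" and rho0: "rho0 > 0"
 and K_in: "!!t l u. 0<=t==>u:W==>K t l u:W"
 and K_compact: "!!t tk l lk uk B. (!!k::nat. 0<=tk k)==>tk---->t==>lk---->l==>(!!k. uk k:W) ==>
   (!!k. N (uk k)<=B)==>EX r w. strict_mono (r::nat=>nat)&w:W &
    (%k. N (%x. K (tk (r k)) (lk (r k)) (uk (r k)) x - w x))---->0 &
    (ALL u:W. (%k. N (%x. uk k x - u x))---->0-->N (%x. w x - K t l u x) = 0)"
 and S_sub: "S \<subseteq> carr"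
 and S_closed: "!!z l. (!!k::nat. z k:S)==>l:carr==>(%k. dE (z k) l)---->0==>l:S"
 and S_compact: "!!z B. (!!k::nat. z k:S)==>(!!k. abs (fst (z k)) + N (snd (z k))<=B) ==>
   EX r l. strict_mono (r::nat=>nat)&l:S&(%k. dE (z (r k)) l)---->0"
 and perturbed_limit: "!!tk lk uk l v. (!!k::nat. 0 < tk k)==>tk---->0==>lk---->l==>(!!k. uk k:W)==>v:W ==>
   (%k. N (%x. uk k x - v x))---->0==>(!!k. N (%x. uk k x - K (tk k) (lk k) (uk k) x) = 0) ==>
   (l, v):S \<or> N v = 0&l<=l1"
 and no_bif_below: "!!l. l1/4<=l==>l < l1==>(l, %_. 0) ~: S"
 and coercive: "!!l b u. l1/4<=l==>l<=l1/2==>0<=b==>b<=1==>u:W==>N u<=rho0 ==>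
   N (%x. u x - b * K 0 l u x) = 0==>N u = 0"
begin

text \<open>The last clause of \<open>K_compact\<close> identifies the limits of subsequences; the
  usual subsequence argument turns this into continuity.\<close>

lemma K_cont:
assumes t: "0<=t" and l: "lk---->l" and u: "!!k. uk k:W" "u:W" and c: "(%k. N (%x. uk k x - u x))---->0"
shows "(%k::nat. N (%x. K t (lk k) (uk k) x - K t l u x))---->0"
proof -
define a where "a k = N (%x. K t (lk k) (uk k) x - K t l u x)" for k
have "a---->0"
proof (rule ccontr)
 assume "~ a---->0"
 then obtain e where e: "e > 0" "\<exists>\<^sub>F n in sequentially. ~ dist (a n) 0 < e"
  unfolding tendsto_iff by (auto simp: frequently_def)
 hence "infinite {n. ~ dist (a n) 0 < e}" by (simp add: cofinite_eq_sequentially[symmetric] INFM_iff_infinite)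
 then obtain s :: "nat => nat" where s: "strict_mono s" "!!n. s n:{n. ~ dist (a n) 0 < e}"
  using infinite_enumerate by blast
 have ls: "(%k. lk (s k))---->l" by (rule subseq_tendsto[OF l s(1)])
 have cs: "(%k. N (%x. uk (s k) x - u x))---->0" by (rule subseq_tendsto[OF c s(1)])
 have "convergent (%k. N (uk (s k)))" using N_tendsto[of "%k. uk (s k)" u, OF u(1) u(2) cs] by (auto simp: convergent_def)
 then obtain B where B: "!!k. N (uk (s k))<=B"
  by (metis Bseq_def convergent_imp_Bseq real_norm_def abs_le_iff)
 have "EX r w. strict_mono (r::nat=>nat)&w:W &
    (%k. N (%x. K t (lk (s (r k))) (uk (s (r k))) x - w x))---->0 &
    (ALL u:W. (%k. N (%x. uk (s k) x - u x))---->0-->N (%x. w x - K t l u x) = 0)"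
  by (rule K_compact[of "%_. t" t "%k. lk (s k)" l "%k. uk (s k)" B]) (use t ls u B in auto)
 then obtain r w where r: "strict_mono r" "w:W" "(%k. N (%x. K t (lk (s (r k))) (uk (s (r k))) x - w x))---->0"
   "N (%x. w x - K t l u x) = 0" using u cs by blast
 have "a (s (r k))<=N (%x. K t (lk (s (r k))) (uk (s (r k))) x - w x)" for k
  using N_diff_tri[OF K_in[OF t u(1)[of "s (r k)"]] r(2) K_in[OF t u(2)], of "lk (s (r k))" l] r(4) by (simp add: a_def)
 hence "(%k. a (s (r k)))---->0"
  by (intro Lim_null_comparison[OF _ r(3)] always_eventually allI) (simp add: a_def N_nonneg)
 hence "eventually (%k. dist (a (s (r k))) 0 < e) sequentially" using e(1) by (rule tendstoD)
 thus False using s(2) by (auto simp: eventually_sequentially)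
qed
thus ?thesis unfolding a_def[abs_def] .
qed

text \<open>Images converge along a subsequence, hence so do the arguments, which are close to
  multiples of the images. Weights and perturbation may vary with the index, so that the lemma
  serves both the approximate fixed points from Schauder's theorem and the passage of t to
  0.\<close>

lemma fixpoint_limit:
assumes l: "!!k. abs (lk k)<=L" and u: "!!k::nat. uk k:W" "!!k. N (uk k)<=B" and c: "!!k. 0<=ck k&ck k<=(1::real)"
 and t: "!!k. 0<=tk k" "tk---->t"
 and f: "(%k. N (%x. uk k x - ck k * K (tk k) (lk k) (uk k) x))---->0"
shows "EX r l u c. strict_mono (r::nat=>nat)&abs l<=L&u:W&0<=c&c<=1&(%k. lk (r k))---->l &
  (%k. N (%x. uk (r k) x - u x))---->0&(%k. ck (r k))---->c&N (%x. u x - c * K t l u x) = 0"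
proof -
have "seq_compact {-L..L}" "seq_compact {0..1::real}" by (simp_all add: compact_imp_seq_compact)
moreover have "ALL k. lk k:{-L..L}" using l by (auto simp: abs_le_iff) (metis minus_le_iff)
ultimately obtain l r1 where r1: "l:{-L..L}" "strict_mono (r1::nat=>nat)" "(lk \<circ> r1)---->l"
 unfolding seq_compact_def by metis
have "ALL k. (ck \<circ> r1) k:{0..1}" using c by auto
then obtain cc r2 where r2: "cc:{0..1}" "strict_mono (r2::nat=>nat)" "((ck \<circ> r1) \<circ> r2)---->cc"
 using \<open>seq_compact {0..1::real}\<close> unfolding seq_compact_def by metis
define s where "s = r1 \<circ> r2"
have s: "strict_mono s" unfolding s_def by (rule strict_mono_o[OF r1(2) r2(2)])
have ls: "(%k. lk (s k))---->l" using LIMSEQ_subseq_LIMSEQ[OF r1(3) r2(2)] by (simp add: o_def s_def)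
have cs: "(%k. ck (s k))---->cc" using r2(3) by (simp add: o_def s_def)
have ts: "(%k. tk (s k))---->t" by (rule subseq_tendsto[OF t(2) s])
have t0: "0<=t" by (rule LIMSEQ_le_const[OF t(2)]) (use t in auto)
obtain r w where r: "strict_mono (r::nat=>nat)" "w:W"
    "(%k. N (%x. K (tk (s (r k))) (lk (s (r k))) (uk (s (r k))) x - w x))---->0"
 using K_compact[of "%k. tk (s k)" t "%k. lk (s k)" l "%k. uk (s k)" B] t ts ls u by blast
define q where "q = s \<circ> r"
have q: "strict_mono q" unfolding q_def by (rule strict_mono_o[OF s r(1)])
have lq: "(%k. lk (q k))---->l" using LIMSEQ_subseq_LIMSEQ[OF ls r(1)] by (simp add: o_def q_def)
have cq: "(%k. ck (q k))---->cc" using LIMSEQ_subseq_LIMSEQ[OF cs r(1)] by (simp add: o_def q_def)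
have tq: "(%k. tk (q k))---->t" by (rule subseq_tendsto[OF t(2) q])
define Kq where "Kq k = K (tk (q k)) (lk (q k)) (uk (q k))" for k
have Kq: "Kq k:W" for k unfolding Kq_def by (rule K_in) (use t u in auto)
have Kw: "(%k. N (%x. Kq k x - w x))---->0" using r(3) by (simp add: Kq_def q_def)
define v where "v x = cc * w x" for x
have v: "v:W" unfolding v_def by (rule scale[OF r(2)])
have uv: "(%k. N (%x. uk (q k) x - v x))---->0"
proof (rule Lim_null_comparison)
 have "(%k. N (%x. uk (q k) x - ck (q k) * Kq k x))---->0"
  using LIMSEQ_subseq_LIMSEQ[OF f q] by (simp add: o_def Kq_def)
 moreover have "(%k. abs (ck (q k) - cc))---->0" using tendsto_rabs[OF LIM_zero[OF cq]] by simp
 ultimately have "(%k. N (%x. uk (q k) x - ck (q k) * Kq k x) + (N (%x. Kq k x - w x) + abs (ck (q k) - cc) * N w))---->0 + (0 + 0 * N w)"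
  by (intro tendsto_intros Kw)
 thus "(%k. N (%x. uk (q k) x - ck (q k) * Kq k x) + (N (%x. Kq k x - w x) + abs (ck (q k) - cc) * N w))---->0" by simp
 show "\<forall>\<^sub>F k in sequentially. norm (N (%x. uk (q k) x - v x))<=N (%x. uk (q k) x - ck (q k) * Kq k x) + (N (%x. Kq k x - w x) + abs (ck (q k) - cc) * N w)"
 proof (intro always_eventually allI)
  fix k
  have 1: "N (%x. uk (q k) x - v x)<=N (%x. uk (q k) x - ck (q k) * Kq k x) + N (%x. ck (q k) * Kq k x - v x)"
   by (rule N_diff_tri) (use u v Kq scale in auto)
  have 2: "N (%x. ck (q k) * Kq k x - v x)<=N (%x. ck (q k) * Kq k x - ck (q k) * w x) + N (%x. ck (q k) * w x - v x)"
   by (rule N_diff_tri) (use r v Kq scale in auto)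
  have 3: "N (%x. ck (q k) * Kq k x - ck (q k) * w x) = abs (ck (q k)) * N (%x. Kq k x - w x)"
   using N_scale[OF diff[OF Kq[of k] r(2)], of "ck (q k)"] by (simp add: right_diff_distrib)
  have 4: "N (%x. ck (q k) * w x - v x) = abs (ck (q k) - cc) * N w"
   using N_scale[OF r(2), of "ck (q k) - cc"] by (simp add: v_def left_diff_distrib)
  have 5: "abs (ck (q k)) * N (%x. Kq k x - w x)<=1 * N (%x. Kq k x - w x)"
   by (rule mult_right_mono) (use c[of "q k"] N_nonneg in auto)
  show "norm (N (%x. uk (q k) x - v x))<=N (%x. uk (q k) x - ck (q k) * Kq k x) + (N (%x. Kq k x - w x) + abs (ck (q k) - cc) * N w)"
   using 1 2 3 4 5 N_nonneg[of "%x. uk (q k) x - v x"] by simp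
 qed
qed
\<comment> \<open>Now that the arguments are known to converge to \<open>v\<close>, a second use of
  \<open>K_compact\<close> identifies the limit of the images with \<open>K t l v\<close>.\<close>
obtain r' w' where r': "strict_mono (r'::nat=>nat)" "w':W"
    "(%k. N (%x. Kq (r' k) x - w' x))---->0" "N (%x. w' x - K t l v x) = 0"
 using K_compact[of "%k. tk (q k)" t "%k. lk (q k)" l "%k. uk (q k)" B] t tq lq u v uv unfolding Kq_def by blast
have "(%k. N (%x. Kq (r' k) x - w x))---->0" by (rule subseq_tendsto[OF Kw r'(1)])
from tendsto_add[OF this r'(3)] have z: "(%k. N (%x. Kq (r' k) x - w x) + N (%x. Kq (r' k) x - w' x))---->0" by simp
have "N (%x. w x - w' x)<=0"
proof (rule LIMSEQ_le_const[OF z], intro exI[of _ 0] allI impI)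
 fix k
 show "N (%x. w x - w' x)<=N (%x. Kq (r' k) x - w x) + N (%x. Kq (r' k) x - w' x)"
  using N_diff_tri[OF r(2) Kq[of "r' k"] r'(2)] N_minus_commute[OF r(2) Kq[of "r' k"]] by simp
qed
hence "N (%x. w x - K t l v x)<=0"
 using N_diff_tri[OF r(2) r'(2) K_in[OF t0 v], of l] r'(4) by simp
hence "N (%x. w x - K t l v x) = 0" using N_nonneg antisym by blast
hence "N (%x. v x - cc * K t l v x) = 0"
 using N_scale[OF diff[OF r(2) K_in[OF t0 v, of l]], of cc] by (simp add: v_def right_diff_distrib)
thus ?thesis using q r1(1) v r2(1) lq uv cq by (intro exI[of _ q] exI[of _ l] exI[of _ v] exI[of _ cc]) auto
qed

end

section \<open>Separation of the bifurcation point\<close>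

definition clip :: "real => real" where "clip t = max 0 (min 1 t)"

lemma clip01: "0<=clip t" "clip t<=1" by (auto simp: clip_def)
lemma clip_1: "1<=t==>clip t = 1" by (auto simp: clip_def)
lemma clip_0: "t<=0==>clip t = 0" by (auto simp: clip_def)
lemma tendsto_clip: "(f \<longlongrightarrow> l) F==>((%x. clip (f x)) \<longlongrightarrow> clip l) F"
unfolding clip_def by (intro tendsto_intros)

context bifurcation begin

definition bp :: "real \<times> ('x => real)" where "bp = (l1, %_. 0)"
text \<open>Whether \<open>bp\<close> belongs to \<open>S\<close> is known only after the
  alternative has been proved. It is added here together with all pairs at distance 0 from it, which
  keeps the set closed.\<close>

definition SP :: "(real \<times> ('x => real)) set" where "SP = S \<union> {z:carr. dE bp z = 0}"
definition nE :: "real \<times> ('x => real) => real" where "nE z = abs (fst z) + N (snd z)"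

lemma bp_carr: "bp:carr" by (simp add: bp_def carr_iff zero)
lemma bp_SP: "bp:SP" using bp_carr pm.refl by (simp add: SP_def)
lemma SP_sub: "SP \<subseteq> carr" using S_sub by (auto simp: SP_def)

lemma dE_bp: "z:carr==>dE bp z = abs (fst z - l1) + N (snd z)"
using N_minus_commute[OF zero, of "snd z"] by (simp add: dE_def bp_def carr_iff)

lemma nE_diff: "z:carr==>w:carr==>nE z<=nE w + dE z w"
using N_le_diff[of "snd z" "snd w"] by (auto simp: nE_def dE_def carr_iff)

lemma dE_limitD:
assumes "!!k. z k:carr" "l:carr" "(%k. dE (z k) l)---->0"
shows "(%k. fst (z k))---->fst l" "(%k. N (%x. snd (z k) x - snd l x))---->0" "(%k. N (snd (z k)))---->N (snd l)"
proof -
show 1: "(%k. N (%x. snd (z k) x - snd l x))---->0"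
 by (rule Lim_null_comparison[OF _ assms(3)]) (auto simp: dE_def N_nonneg)
show "(%k. N (snd (z k)))---->N (snd l)" by (rule N_tendsto[OF _ _ 1]) (use assms carr_iff in auto)
have "(%k. fst (z k) - fst l)---->0"
 by (rule Lim_null_comparison[OF _ assms(3)]) (auto simp: dE_def N_nonneg)
thus "(%k. fst (z k))---->fst l" by (simp add: LIM_zero_iff)
qed

lemma dE_limitI:
assumes "(%k. lk k)---->l" "(%k. N (%x. uk k x - u x))---->0"
shows "(%k. dE (lk k, uk k) (l, u))---->0"
unfolding dE_def using tendsto_add[OF tendsto_rabs[OF LIM_zero[OF assms(1)]] assms(2)] by simp

lemma SP_closed:
assumes z: "!!k::nat. z k:SP" and l: "l:carr" "(%k. dE (z k) l)---->0"
shows "l:SP"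
proof (cases "infinite {k. z k:S}")
case True
then obtain r :: "nat => nat" where r: "strict_mono r" "!!k. r k:{k. z k:S}" using infinite_enumerate by blast
have "l:S" by (rule S_closed[of "%k. z (r k)"]) (use r l LIMSEQ_subseq_LIMSEQ[OF l(2) r(1)] in \<open>auto simp: o_def\<close>)
thus ?thesis by (simp add: SP_def)
next
case False
hence "eventually (%k. z k ~: S) sequentially"
 by (simp add: cofinite_eq_sequentially[symmetric] eventually_cofinite)
hence ev: "eventually (%k. dE bp (z k) = 0) sequentially"
 by (rule eventually_mono) (use z SP_def in auto)
have "dE bp l<=0"
proof (rule tendsto_lowerbound[OF l(2)])
 show "\<forall>\<^sub>F k in sequentially. dE bp l<=dE (z k) l" using ev
 proof (rule eventually_mono)
  fix k assume "dE bp (z k) = 0"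
  moreover have "dE bp l<=dE bp (z k) + dE (z k) l" by (rule pm.tri) (use z SP_sub l bp_carr in auto)
  ultimately show "dE bp l<=dE (z k) l" by simp
 qed
qed simp
hence "dE bp l = 0" using pm.nonneg[OF bp_carr l(1)] by linarith
thus ?thesis using l by (simp add: SP_def)
qed

lemma SP_compact:
assumes z: "!!k::nat. z k:SP" "!!k. nE (z k)<=B"
shows "EX r l. strict_mono (r::nat=>nat)&l:SP&(%k. dE (z (r k)) l)---->0"
proof (cases "infinite {k. z k:S}")
case True
then obtain r :: "nat => nat" where r: "strict_mono r" "!!k. r k:{k. z k:S}" using infinite_enumerate by blast
obtain s l where s: "strict_mono (s::nat=>nat)" "l:S" "(%k. dE (z (r (s k))) l)---->0"
 using S_compact[of "%k. z (r k)" B] r z(2) unfolding nE_def by auto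
thus ?thesis using strict_mono_o[OF r(1) s(1)] by (intro exI[of _ "r \<circ> s"] exI[of _ l]) (auto simp: SP_def)
next
case False
hence "infinite (- {k. z k:S})" by (metis finite_Un infinite_UNIV_nat Compl_partition)
then obtain r :: "nat => nat" where r: "strict_mono r" "!!k. r k:- {k. z k:S}" using infinite_enumerate by blast
have "z (r k):carr&dE bp (z (r k)) = 0" for k using r(2)[of k] z(1)[of "r k"] by (auto simp: SP_def)
hence "dE (z (r k)) bp = 0" for k using pm.sym[OF bp_carr, of "z (r k)"] by auto
thus ?thesis using r(1) bp_SP by (intro exI[of _ r] exI[of _ bp]) auto
qed

text \<open>Because \<open>c\<close> vanishes for large norm, the product of \<open>c\<close> and
  \<open>K\<close> has relatively compact range although \<open>K\<close> is defined on all of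
  \<open>W\<close>. Schauder's theorem gives approximate fixed points, and these converge to an
  exact one.\<close>

lemma exact_fixpoint:
assumes L: "L > 0" and t: "0<=t"
 and ell: "!!l u. abs l<=L==>u:W==>abs (ell (l, u))<=L" and c01: "!!z. 0<=c z&c z<=(1::real)"
 and c0: "!!l u. u:W==>N u > R==>c (l, u) = 0"
 and cont: "!!z w. (!!k::nat. z k:carr)==>w:carr==>(%k. dE (z k) w)---->0 ==>
   (%k. ell (z k))---->ell w&(%k. c (z k))---->c w"
shows "EX l u. abs l<=L&u:W&ell (l, u) = l&N (%x. u x - c (l, u) * K t l u x) = 0"
proof -
define U where "U l u = (%x. c (l, u) * K t l u x)" for l u
have U_in: "U l u:W" if "u:W" for l u unfolding U_def by (rule scale[OF K_in[OF t that]])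
have tri3: "N (%x. a * f x - b * g x)<=abs a * N (%x. f x - g x) + abs (a - b) * N g" if "f:W" "g:W" for a b f g
proof -
 have "N (%x. a * f x - b * g x)<=N (%x. a * f x - a * g x) + N (%x. a * g x - b * g x)"
  by (rule N_diff_tri) (use that scale in auto)
 also have "N (%x. a * f x - a * g x) = abs a * N (%x. f x - g x)" using N_scale[OF diff[OF that], of a] by (simp add: right_diff_distrib)
 also have "N (%x. a * g x - b * g x) = abs (a - b) * N g" using N_scale[OF that(2), of "a - b"] by (simp add: left_diff_distrib)
 finally show ?thesis .
qed
have main: "EX l:{-L..L}. EX u:W. ell (l, u) = l&N (%x. u x - U l u x) < e" if e: "e > 0" for e
proof (rule schauder[where a = "-L" and b = L and ell = "%l u. ell (l, u)" and U = U])
 show "- L < L" using L by simp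
 show "ell (l, u):{- L..L}" if "l:{- L..L}" "u:W" for l u using ell[of l u] that by (auto simp: abs_le_iff)
 show "U l u:W" if "u:W" for l u using U_in[OF that] .
next
 fix lk l uk u assume lk: "!!k::nat. lk k:{- L..L}" "l:{- L..L}" and uk: "!!k. uk k:W" "u:W" and lim: "lk---->l" "(%k. N (%x. uk k x - u x))---->0"
 have d: "(%k. dE (lk k, uk k) (l, u))---->0" by (rule dE_limitI[OF lim])
 have ct: "(%k. ell (lk k, uk k))---->ell (l, u)&(%k. c (lk k, uk k))---->c (l, u)"
  by (rule cont[OF _ _ d]) (use uk carr_iff in auto)
 thus "(%k. ell (lk k, uk k))---->ell (l, u)" by blast
 have Kc: "(%k. N (%x. K t (lk k) (uk k) x - K t l u x))---->0" by (rule K_cont[OF t lim(1) uk lim(2)])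
 have "(%k. abs (c (lk k, uk k)) * N (%x. K t (lk k) (uk k) x - K t l u x) + abs (c (lk k, uk k) - c (l, u)) * N (K t l u))
   ---->abs (c (l, u)) * 0 + abs (c (l, u) - c (l, u)) * N (K t l u)"
  using ct by (intro tendsto_intros Kc) auto
 hence z: "(%k. abs (c (lk k, uk k)) * N (%x. K t (lk k) (uk k) x - K t l u x) + abs (c (lk k, uk k) - c (l, u)) * N (K t l u))---->0"
  by simp
 show "(%k. N (%x. U (lk k) (uk k) x - U l u x))---->0"
  by (rule Lim_null_comparison[OF _ z]) (auto simp: U_def N_nonneg intro!: always_eventually tri3 K_in[OF t] uk)
next
 fix e :: real assume e: "e > 0"
 define X where "X = {U l u | l u. l:{-L..L}&u:W}"
 have "EX F. finite F&F \<subseteq> W&(ALL x:X. EX k:F. N (%t. x t - k t) < e)"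
 proof (rule tot_bdd[OF _ _ e])
  show "X \<subseteq> W" using U_in by (auto simp: X_def)
  fix x :: "nat => 'x => real" assume "range x \<subseteq> X"
  hence "ALL k. EX p. x k = U (fst p) (snd p)&fst p:{-L..L}&snd p:W" by (force simp: X_def)
  then obtain p where p: "!!k. x k = U (fst (p k)) (snd (p k))" "!!k. fst (p k):{-L..L}" "!!k. snd (p k):W" by metis
  \<comment> \<open>Where the norm exceeds \<open>R\<close> the weight is 0, so the argument may be
    replaced by the zero function; the image is unchanged and the arguments of \<open>K\<close>
    become bounded.\<close>
  define v where "v k = (if N (snd (p k)) > R then (%_. 0) else snd (p k))" for k
  define ck where "ck k = (if N (snd (p k)) > R then 0 else c (p k))" for k
  have xk: "x k = (%y. ck k * K t (fst (p k)) (v k) y)" for k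
   using c0[OF p(3)[of k], of "fst (p k)"] p(1)[of k] by (auto simp: U_def v_def ck_def)
  have v: "v k:W" "N (v k)<=max R 0" for k using p(3) zero by (auto simp: v_def)
  have "seq_compact {-L..L}" "seq_compact {0..1::real}" by (simp_all add: compact_imp_seq_compact)
  moreover have "ALL k. fst (p k):{-L..L}" using p by blast
  ultimately obtain l r1 where r1: "l:{-L..L}" "strict_mono (r1::nat=>nat)" "((%k. fst (p k)) \<circ> r1)---->l"
   unfolding seq_compact_def by metis
  have "ALL k. (ck \<circ> r1) k:{0..1}" using c01 by (auto simp: ck_def)
  then obtain cc r2 where r2: "cc:{0..1}" "strict_mono (r2::nat=>nat)" "((ck \<circ> r1) \<circ> r2)---->cc"
   using \<open>seq_compact {0..1::real}\<close> unfolding seq_compact_def by metis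
  define s where "s = r1 \<circ> r2"
  have s: "strict_mono s" unfolding s_def by (rule strict_mono_o[OF r1(2) r2(2)])
  have ls: "(%k. fst (p (s k)))---->l" using LIMSEQ_subseq_LIMSEQ[OF r1(3) r2(2)] by (simp add: o_def s_def)
  have cs: "(%k. ck (s k))---->cc" using r2(3) by (simp add: o_def s_def)
  obtain r w where r: "strict_mono (r::nat=>nat)" "w:W"
    "(%k. N (%x. K t (fst (p (s (r k)))) (v (s (r k))) x - w x))---->0"
   using K_compact[of "%k. t" t "%k. fst (p (s k))" l "%k. v (s k)" "max R 0"] t ls v by fastforce
  have cr: "(%k. ck (s (r k)))---->cc" by (rule subseq_tendsto[OF cs r(1)])
  have "(%k. abs (ck (s (r k))) * N (%x. K t (fst (p (s (r k)))) (v (s (r k))) x - w x) + abs (ck (s (r k)) - cc) * N w)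
    ---->abs cc * 0 + abs (cc - cc) * N w"
   by (intro tendsto_intros r(3) cr)
  hence z: "(%k. abs (ck (s (r k))) * N (%x. K t (fst (p (s (r k)))) (v (s (r k))) x - w x) + abs (ck (s (r k)) - cc) * N w)---->0" by simp
  have "(%k. N (%y. x ((s \<circ> r) k) y - cc * w y))---->0"
   by (rule Lim_null_comparison[OF _ z]) (auto simp: xk N_nonneg intro!: always_eventually tri3 K_in[OF t] v r)
  thus "EX r w. strict_mono (r::nat=>nat)&w:W&(%k. N (%t. x (r k) t - w t))---->0"
   using strict_mono_o[OF s r(1)] scale[OF r(2)] by blast
 qed
 then obtain F where F: "finite F" "F \<subseteq> W" "!!x. x:X==>EX k:F. N (%t. x t - k t) < e" by blast
 have "EX k:F. N (%x. U l u x - k x) < e" if "l:{-L..L}" "u:W" for l u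
  by (rule F(3)) (use that X_def in blast)
 thus "EX F. finite F&F \<subseteq> W&(ALL l:{- L..L}. ALL u:W. EX k:F. N (%x. U l u x - k x) < e)" using F by blast
qed (rule e)
have "ALL k. EX p. abs (fst p)<=L&snd p:W&ell p = fst p&N (%x. snd p x - U (fst p) (snd p) x) < 1 / real (Suc k)"
proof
 fix k
 obtain l u where "l:{-L..L}" "u:W" "ell (l, u) = l" "N (%x. u x - U l u x) < 1 / real (Suc k)"
  using main[of "1 / real (Suc k)"] by auto
 thus "EX p. abs (fst p)<=L&snd p:W&ell p = fst p&N (%x. snd p x - U (fst p) (snd p) x) < 1 / real (Suc k)"
  by (intro exI[of _ "(l, u)"]) (auto simp: abs_le_iff)
qed
then obtain p where p: "!!k. abs (fst (p k))<=L" "!!k. snd (p k):W" "!!k. ell (p k) = fst (p k)"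
  "!!k. N (%x. snd (p k) x - U (fst (p k)) (snd (p k)) x) < 1 / real (Suc k)" by metis
have bd: "N (snd (p k))<=max R 1" for k
proof (rule ccontr)
 assume n: "~ ?thesis"
 hence "c (p k) = 0" using c0[OF p(2)[of k], of "fst (p k)"] by simp
 hence "N (snd (p k)) < 1 / real (Suc k)" using p(4)[of k] by (simp add: U_def)
 moreover have "1 / real (Suc k)<=1" by simp
 ultimately show False using n by linarith
qed
have f: "(%k. N (%x. snd (p k) x - c (p k) * K t (fst (p k)) (snd (p k)) x))---->0"
 by (rule Lim_null_comparison[OF _ LIMSEQ_inverse_real_of_nat])
   (use p(4) N_nonneg in \<open>auto simp: U_def inverse_eq_divide less_imp_le\<close>)
obtain r l u cc where r: "strict_mono (r::nat=>nat)" "abs l<=L" "u:W" "(%k. fst (p (r k)))---->l"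
  "(%k. N (%x. snd (p (r k)) x - u x))---->0" "(%k. c (p (r k)))---->cc" "N (%x. u x - cc * K t l u x) = 0"
 using fixpoint_limit[of "%k. fst (p k)" L "%k. snd (p k)" "max R 1" "%k. c (p k)" "%k. t" t, OF p(1) p(2) bd c01 t tendsto_const f] by blast
have d: "(%k. dE (p (r k)) (l, u))---->0" using dE_limitI[OF r(4,5)] by simp
have ct: "(%k. ell (p (r k)))---->ell (l, u)&(%k. c (p (r k)))---->c (l, u)"
 by (rule cont[OF _ _ d]) (use p r carr_iff in auto)
have "ell (l, u) = l" using ct r(4) p(3) LIMSEQ_unique by auto
moreover have "cc = c (l, u)" using ct r(6) LIMSEQ_unique by blast
ultimately show ?thesis using r by blast
qed

definition dA :: "(real \<times> ('x => real)) set => real \<times> ('x => real) => real" where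
"dA A z = (INF w\<in>A. dE z w)"

lemma dA_le: "A \<subseteq> carr==>w:A==>z:carr==>dA A z<=dE z w"
unfolding dA_def by (rule cINF_lower) (auto intro!: bdd_belowI[of _ 0] pm.nonneg)

lemma dA_less: "A \<subseteq> carr==>A~={}==>z:carr==>dA A z < r==>EX w:A. dE z w < r"
unfolding dA_def by (subst (asm) cINF_less_iff) (auto intro!: bdd_belowI[of _ 0] pm.nonneg)

lemma dA_ge: "A~={}==>(!!w. w:A==>r<=dE z w)==>r<=dA A z"
unfolding dA_def by (rule cINF_greatest)

lemma dA_lip:
assumes A: "A \<subseteq> carr" "A~={}" and z: "z:carr" "w:carr"
shows "abs (dA A z - dA A w)<=dE z w"
proof -
have *: "dA A z - dE z w<=dA A w" if z: "z:carr" "w:carr" for z w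
proof (rule dA_ge[OF A(2)])
 fix y assume y: "y:A"
 have "dE z y<=dE z w + dE w y" by (rule pm.tri) (use z y A in auto)
 thus "dA A z - dE z w<=dE w y" using dA_le[OF A(1) y z(1)] by linarith
qed
show ?thesis using *[OF z] *[OF z(2) z(1)] pm.sym[OF z] by linarith
qed

lemma dA_tendsto:
assumes A: "A \<subseteq> carr" "A~={}" and z: "!!k. z k:carr" "w:carr" "(%k. dE (z k) w)---->0"
shows "(%k. dA A (z k))---->dA A w"
proof -
have "(%k. dA A (z k) - dA A w)---->0"
 by (rule Lim_null_comparison[OF _ z(3)]) (use dA_lip[OF A z(1) z(2)] in auto)
thus ?thesis by (simp add: LIM_zero_iff)
qed

end

context bifurcation begin

lemma SP_triv:
assumes "(l, u):SP" "N u = 0"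
shows "(l, %_. 0):SP" "l1/4<=l==>l1<=l"
proof -
have u: "u:W" using assms(1) SP_sub carr_iff by force
have "dE (l, u) (l, %_. 0) = 0" using assms(2) by (simp add: dE_def)
thus sp: "(l, %_. 0):SP"
 using SP_closed[of "%_. (l, u)" "(l, %_. 0)"] assms(1) by (simp add: carr_iff zero)
assume l: "l1/4<=l"
show "l1<=l"
proof (rule ccontr)
 assume n: "~ l1<=l"
 hence "(l, %_. 0) ~: S" using no_bif_below l by auto
 hence "dE bp (l, %_. 0) = 0" using sp by (simp add: SP_def)
 thus False using n by (simp add: dE_bp carr_iff zero)
qed
qed

text \<open>Otherwise a chain component \<open>A\<close> is separated from the rest of \<open>SP\<close>.  Turning \<open>K\<close> into a map
\<open>c K\<close> that vanishes on the far left, the fixed points of the perturbed map split into those near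
\<open>A\<close> or the trivial line, and the others; sending \<open>\<lambda>\<close> to \<open>L\<close> on the first and to \<open>-L\<close> on the
second piece gives a compact map without fixed points, against Schauder.\<close>
lemma continuum_reaches:
assumes M: "M>=l1 + 1"
shows "EX D. D \<subseteq> SP&connectedin topE D&bp:D&((EX z:D. M<=nE z) \<or> (EX l<=l1/2. (l, %_. 0):D))"
proof -
\<comment> \<open>The margin 1 above \<open>M\<close> serves the gap \<open>AB\<close> below: points
  of \<open>SP\<close> outside \<open>KM\<close> have distance more than 1 from points with
  \<open>nE\<close> less than \<open>M\<close>.\<close>
define KM where "KM = {z:SP. nE z<=M + 1}"
have KMc: "KM \<subseteq> carr" using SP_sub by (auto simp: KM_def)
have nE_bp: "nE bp = l1" using l1_pos by (simp add: nE_def bp_def)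
have bpK: "bp:KM" using bp_SP nE_bp M by (simp add: KM_def)
have KMcl: "l:KM" if "!!k::nat. z k:KM" "l:carr" "(%k. dE (z k) l)---->0" for z l
proof -
 have zc: "z k:carr" for k using that KMc by blast
 have 1: "l:SP" by (rule SP_closed[OF _ that(2,3)]) (use that(1) KM_def in auto)
 have "(%k. nE (z k))---->nE l" unfolding nE_def
  by (intro tendsto_intros dE_limitD[OF zc that(2,3)])
 hence "nE l<=M + 1" by (rule LIMSEQ_le_const2) (use that(1) KM_def in auto)
 thus ?thesis using 1 by (simp add: KM_def)
qed
have cpt: "pm.seq_cpt KM" unfolding pm.seq_cpt_def
proof (intro allI impI)
 fix z :: "nat => real \<times> ('x => real)" assume z: "range z \<subseteq> KM"
 hence zk: "z k:KM" for k by blast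
 obtain r l where r: "strict_mono (r::nat=>nat)" "l:SP" "(%k. dE (z (r k)) l)---->0"
  using SP_compact[of z "M + 1"] zk KM_def by auto
 have "l:KM" by (rule KMcl[OF _ _ r(3)]) (use zk r SP_sub in auto)
 thus "EX r l. strict_mono (r::nat=>nat)&l:KM&(%k. dE (z (r k)) l)---->0" using r by blast
qed
define AA where "AA n = pm.chain_comp KM bp (1 / real (Suc n))" for n
define D where "D = (\<Inter>n. AA n)"
have AAK: "AA n \<subseteq> KM" for n unfolding AA_def by (rule pm.chain_comp_sub[OF bpK])
have bpA: "bp:AA n" for n unfolding AA_def by (rule pm.chain_comp_self)
have AAmono: "AA n \<subseteq> AA m" if "m<=n" for m n unfolding AA_def
 by (rule pm.chain_comp_mono) (use that in \<open>auto intro!: divide_left_mono\<close>)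
have AAstep: "w:AA n" if "z:AA n" "w:KM" "dE z w < 1 / real (Suc n)" for z w n
 using pm.chain_comp_step[of z KM bp "1 / real (Suc n)" w] that AAK unfolding AA_def by blast
have AAlim: "EX r l. strict_mono (r::nat=>nat)&l:D&(%k. dE (z (r k)) l)---->0" if "!!n. z n:AA n" for z
 using pm.chain_comp_limit[OF KMc bpK cpt, of z] that unfolding AA_def D_def by blast
have DK: "D \<subseteq> KM" using AAK by (auto simp: D_def)
have Dcl: "l:D" if "!!k::nat. z k:D" "l:carr" "(%k. dE (z k) l)---->0" for z l
proof -
 have lK: "l:KM" by (rule KMcl[OF _ that(2,3)]) (use that(1) DK in blast)
 have "l:AA n" for n
 proof -
  have "eventually (%k. dE (z k) l < 1 / real (Suc n)) sequentially" by (rule order_tendstoD[OF that(3)]) auto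
  then obtain k where "dE (z k) l < 1 / real (Suc n)" by (auto simp: eventually_sequentially)
  moreover have "z k:AA n" using that(1)[of k] by (auto simp: D_def)
  ultimately show ?thesis using AAstep[OF _ lK] by blast
 qed
 thus ?thesis by (simp add: D_def)
qed
have Dconn: "connectedin topE D"
proof (rule ccontr)
 assume nc: "~ connectedin topE D"
 have Dc: "D \<subseteq> topspace topE" using DK KMc by auto
 obtain E1 E2 where E: "openin topE E1" "openin topE E2" "D \<subseteq> E1 \<union> E2" "E1 \<inter> E2 \<inter> D = {}" "E1 \<inter> D~={}" "E2 \<inter> D~={}"
  using nc Dc unfolding connectedin by blast
 have sep: "(D \<inter> F2) = {}" if F: "openin topE F1" "openin topE F2" "D \<subseteq> F1 \<union> F2" "F1 \<inter> F2 \<inter> D = {}" "bp:F1" for F1 F2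
 proof (rule pm.chain_comp_connected[OF KMc bpK cpt])
  show "D = (\<Inter>n. pm.chain_comp KM bp (1 / real (Suc n)))" by (simp add: D_def AA_def)
  show "(D \<inter> F1) \<union> (D \<inter> F2) = D" using F by blast
  show "bp:D \<inter> F1" using F bpA by (simp add: D_def)
  have cl: "l ~: D \<inter> G2" if G: "openin topE G2" "F1 \<inter> F2 \<inter> D = {}" "!!k. z k:D" "!!k. z k ~: G2" "l:D" "(%k. dE (z k) l)---->0" for z l G2
  proof
   assume l: "l:D \<inter> G2"
   then obtain r where r: "r > 0" "!!w. w:carr==>dE l w < r==>w:G2" using G(1) unfolding openin_topE by blast
   have "eventually (%k. dE (z k) l < r) sequentially" by (rule order_tendstoD[OF G(6)]) (use r in auto)
   then obtain k where k: "dE (z k) l < r" by (auto simp: eventually_sequentially)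
   have "z k:carr" "l:carr" using G(3)[of k] G(5) DK KMc by auto
   thus False using r(2)[of "z k"] k G(4)[of k] pm.sym[of l "z k"] by auto
  qed
  show "l ~: D \<inter> F2" if "!!k. z k:D \<inter> F1" "l:D" "(%k. dE (z k) l)---->0" for z l
   by (rule cl[OF F(2) F(4) _ _ that(2,3)]) (use that(1) F(4) in blast)+
  show "l ~: D \<inter> F1" if "!!k. z k:D \<inter> F2" "l:D" "(%k. dE (z k) l)---->0" for z l
   by (rule cl[OF F(1) F(4) _ _ that(2,3)]) (use that(1) F(4) in blast)+
 qed
 have "bp:D" using bpA by (simp add: D_def)
 then consider "bp:E1" | "bp:E2" using E by blast
 thus False
 proof cases
  case 1 thus ?thesis using sep[OF E(1-4)] E by blast
 next
  case 2
  have "D \<inter> E1 = {}" by (rule sep[OF E(2,1)]) (use E 2 in blast)+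
  thus ?thesis using E by blast
 qed
qed
show ?thesis
proof (rule ccontr)
 assume neg: "~ ?thesis"
 have "D \<subseteq> SP" using DK by (auto simp: KM_def)
 moreover have "bp:D" using bpA by (simp add: D_def)
 ultimately have "~ ((EX z:D. M<=nE z) \<or> (EX l<=l1/2. (l, %_. 0):D))"
  using neg Dconn by blast
 hence neg1: "!!z. z:D==>nE z < M" and neg2: "!!l. l<=l1/2==>(l, %_. 0) ~: D"
  using not_le by blast+
 \<comment> \<open>Between \<open>l1/4\<close> and \<open>l1\<close> nothing bifurcates, so
   excluding trivial points up to \<open>l1/2\<close> already excludes them up to
   \<open>3*l1/4\<close>. The margin will absorb the width of the tube around
   \<open>A\<close>.\<close>
 have neg3: "(l, u) ~: D" if "N u = 0" "l<=3*l1/4" for l u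
 proof
  assume D: "(l, u):D"
  hence uc: "(l, u):carr" using DK KMc by blast
  have "dE (l, u) (l, %_. 0) = 0" using that by (simp add: dE_def)
  hence "(l, %_. 0):D" using Dcl[of "%_. (l, u)" "(l, %_. 0)"] D by (simp add: carr_iff zero)
  moreover have "(l, u):SP" using D DK by (auto simp: KM_def)
  hence "l < l1/4" using SP_triv(2)[of l u] that l1_pos by linarith
  ultimately show False using neg2[of l] l1_pos by auto
 qed
 \<comment> \<open>The strict bounds on \<open>D\<close> extend to a chain component with positive
   step size, because a sequence violating them would have a limit in \<open>D\<close>.\<close>
 have c1: "EX n. ALL z:AA n. nE z < M"
 proof (rule ccontr)
  assume n: "~ ?thesis"
  have "EX z. ALL n. z n:AA n&M<=nE (z n)" by (intro choice) (use n not_le in blast)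
  then obtain z where z: "!!n. z n:AA n" "!!n. M<=nE (z n)" by blast
  obtain r l where r: "strict_mono (r::nat=>nat)" "l:D" "(%k. dE (z (r k)) l)---->0" using AAlim[of z] z by blast
  have zc: "z k:carr" "l:carr" for k using z AAK KMc DK r by blast+
  have "(%k. nE (z (r k)))---->nE l" unfolding nE_def by (intro tendsto_intros dE_limitD[OF zc(1) zc(2) r(3)])
  hence "M<=nE l" by (rule LIMSEQ_le_const) (use z in auto)
  thus False using neg1[OF r(2)] by simp
 qed
 have c2: "EX n. ALL z:AA n. fst z<=3*l1/4-->1 / real (Suc n)<=N (snd z)"
 proof (rule ccontr)
  assume n: "~ ?thesis"
  have "EX z. ALL n. z n:AA n&fst (z n)<=3*l1/4&N (snd (z n)) < 1 / real (Suc n)" by (intro choice) (use n not_le in blast)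
  then obtain z where z: "!!n. z n:AA n" "!!n. fst (z n)<=3*l1/4" "!!n. N (snd (z n)) < 1 / real (Suc n)" by blast
  obtain r l where r: "strict_mono (r::nat=>nat)" "l:D" "(%k. dE (z (r k)) l)---->0" using AAlim[of z] z by blast
  have zc: "z k:carr" "l:carr" for k using z AAK KMc DK r by blast+
  note lim = dE_limitD[OF zc(1) zc(2) r(3)]
  have f: "fst l<=3*l1/4" by (rule LIMSEQ_le_const2[OF lim(1)]) (use z in auto)
  have inv: "(%k. 1 / real (Suc (r k)))---->0"
   by (rule subseq_tendsto[OF recip_tendsto r(1)])
  have "N (snd l)<=0" by (rule LIMSEQ_le[OF lim(3) inv]) (use z less_imp_le in blast)
  hence "N (snd l) = 0" using N_nonneg antisym by blast
  thus False using neg3[of "snd l" "fst l"] f r(2) by simp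
 qed
 obtain n1 n2 where n1: "!!z. z:AA n1==>nE z < M" and n2: "!!z. z:AA n2==>fst z<=3*l1/4==>1 / real (Suc n2)<=N (snd z)"
  using c1 c2 by blast
 define A where "A = AA (max n1 n2)"
 define e where "e = 1 / real (Suc (max n1 n2))"
 define s1 where "s1 = 1 / real (Suc n2)"
 have e: "0 < e" "e<=1" by (auto simp: e_def)
 have s1: "s1 > 0" by (simp add: s1_def)
 have A1: "nE z < M" if "z:A" for z using n1[of z] AAmono[of n1 "max n1 n2"] that unfolding A_def by auto
 have A2: "s1<=N (snd z)" if "z:A" "fst z<=3*l1/4" for z
  using n2[of z] AAmono[of n2 "max n1 n2"] that unfolding A_def s1_def by auto
 have Ac: "A \<subseteq> carr" "A~={}" "bp:A" using AAK KMc bpA unfolding A_def by blast+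
 have AB: "e<=dE z w" if z: "z:A" and w: "w:SP" "w ~: A" for z w
 proof (cases "w:KM")
  case True thus ?thesis using AAstep[of z "max n1 n2" w] z w unfolding A_def e_def by force
 next
  case False
  hence "nE w > M + 1" using w by (simp add: KM_def)
  moreover have "nE w<=nE z + dE w z" by (rule nE_diff) (use w SP_sub z Ac in auto)
  moreover have "dE w z = dE z w" by (rule pm.sym) (use w SP_sub z Ac in auto)
  ultimately show ?thesis using A1[OF z] e by linarith
 qed
 \<comment> \<open>The remaining solutions stay away from the trivial line over this interval: a
   limit on the line would have parameter \<open>l1\<close>, that is, distance 0 from
   \<open>bp\<close>, which lies in \<open>A\<close>.\<close>
 have "EX s>0. ALL w:SP - A. l1/4<=fst w&fst w<=l1 + s-->s<=N (snd w)"
 proof (rule ccontr)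
  assume n: "~ ?thesis"
  have "EX w. w:SP - A&l1/4<=fst w&fst w<=l1 + 1 / real (Suc k)&N (snd w) < 1 / real (Suc k)" for k
  proof -
   have "1 / real (Suc k) > 0" by simp
   thus ?thesis using n not_le by blast
  qed
  hence "EX w. ALL k. w k:SP - A&l1/4<=fst (w k)&fst (w k)<=l1 + 1 / real (Suc k)&N (snd (w k)) < 1 / real (Suc k)"
   by (intro choice) blast
  then obtain w where w: "!!k. w k:SP - A" "!!k. l1/4<=fst (w k)" "!!k. fst (w k)<=l1 + 1 / real (Suc k)"
    "!!k. N (snd (w k)) < 1 / real (Suc k)" by blast
  have le1: "1 / real (Suc k)<=1" for k by simp
  have wb: "nE (w k)<=l1 + 2" for k
   using w(2)[of k] w(3)[of k] w(4)[of k] le1[of k] l1_pos unfolding nE_def by linarith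
  have wS: "w k:SP" for k using w(1) by blast
  obtain r l where r: "strict_mono (r::nat=>nat)" "l:SP" "(%k. dE (w (r k)) l)---->0"
   using SP_compact[of w "l1 + 2"] wS wb by blast
  have wc: "w k:carr" "l:carr" for k using wS r SP_sub by blast+
  note lim = dE_limitD[OF wc(1) wc(2) r(3)]
  have inv: "(%k. 1 / real (Suc (r k)))---->0"
   by (rule subseq_tendsto[OF recip_tendsto r(1)])
  have "N (snd l)<=0" by (rule LIMSEQ_le[OF lim(3) inv]) (use w less_imp_le in blast)
  hence N0: "N (snd l) = 0" using N_nonneg antisym by blast
  have f1: "l1/4<=fst l" by (rule LIMSEQ_le_const[OF lim(1)]) (use w in auto)
  have "(%k. l1 + 1 / real (Suc (r k)))---->l1 + 0" by (intro tendsto_intros inv)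
  from LIMSEQ_le[OF lim(1) this] w(3) have f2: "fst l<=l1" by auto
  have "fst l = l1" using SP_triv(2)[of "fst l" "snd l"] r(2) N0 f1 f2 by simp
  hence "dE bp l = 0" using dE_bp[OF wc(2)] N0 by simp
  have "eventually (%k. dE (w (r k)) l < e) sequentially" by (rule order_tendstoD[OF r(3)]) (use e in auto)
  then obtain k where k: "dE (w (r k)) l < e" by (auto simp: eventually_sequentially)
  have "dE bp (w (r k))<=dE bp l + dE l (w (r k))" by (rule pm.tri) (use wc bp_carr in auto)
  moreover have "dE l (w (r k)) = dE (w (r k)) l" by (rule pm.sym) (use wc in auto)
  ultimately have "dE bp (w (r k)) < e" using k \<open>dE bp l = 0\<close> by linarith
  moreover have "e<=dE bp (w (r k))" by (rule AB) (use Ac w in auto)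
  ultimately show False by linarith
 qed
 then obtain s2 where s2: "s2 > 0" "!!w. w:SP==>w ~: A==>l1/4<=fst w==>fst w<=l1 + s2==>s2<=N (snd w)" by blast
 \<comment> \<open>\<open>r\<close> is the width of a tube around \<open>A\<close>,
   \<open>rho\<close> the height of a slab along the trivial half-line. \<open>2*r < e\<close> keeps
   other solutions out of the tube and \<open>rho < s2\<close> out of the slab;
   \<open>12*r <= l1\<close> and \<open>rho + 3*r < s1\<close> make the slab disjoint from the tube
   of triple width over parameters up to \<open>l1/2\<close>.\<close>
 define r where "r = min (e/4) (min (l1/12) (s1/8))"
 define rho where "rho = min (s2/2) (min (s1/2) (min rho0 1))"
 have r: "0 < r" "2*r < e" "12*r<=l1" "8*r<=s1" "r<=1" using e l1_pos s1 by (auto simp: r_def)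
 have rho: "0 < rho" "rho < s2" "rho + 3*r < s1" "rho<=rho0" "rho<=1" using s1 s2 rho0 r by (auto simp: rho_def)
 \<comment> \<open>At both ends of the parameter interval the distance to \<open>A\<close> is then
   at least 5, hence at least five tube widths.\<close>
 define L where "L = M + l1 + 5"
 have Lp: "L > 0" using M l1_pos by (simp add: L_def)
 define a where "a = dA A"
 \<comment> \<open>\<open>tb\<close> is at most 0 exactly on the trivial half-line with parameters
   up to \<open>l1\<close>. So \<open>q\<close> is small on the tube and on the slab, and
   \<open>1/2 <= q <= 1\<close> is a transition zone around their union.\<close>
 define tb where "tb z = max (N (snd z)) (fst z - l1)" for z :: "real \<times> ('x => real)"
 define q where "q z = min (a z / r) (tb z / rho)" for z
 \<comment> \<open>A fixed point must have parameter \<open>L\<close> where \<open>q <= 1/2\<close>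
   and \<open>-L\<close> where \<open>q >= 1\<close>, in both cases far from \<open>A\<close>.
   \<open>\<beta>\<close> weakens \<open>K\<close> only left of \<open>l1/2\<close> and outside the
   tube of double width; \<open>c\<close> also cuts off large norms.\<close>
 define ell where "ell z = L - 2*L*clip (2 * q z - 1)" for z
 define \<beta> where "\<beta> z = max (clip (3 - a z / r)) (clip ((fst z - l1/4) / (l1/4)))" for z
 define c where "c z = \<beta> z * clip (M + 5 - N (snd z))" for z
 have \<beta>01: "0<=\<beta> z&\<beta> z<=1" for z using clip01 by (auto simp: \<beta>_def le_max_iff_disj)
 have c01: "0<=c z&c z<=1" for z unfolding c_def using \<beta>01[of z] clip01 by (auto intro: mult_nonneg_nonneg mult_le_one)
 have a_tend: "(%k. a (z k))---->a w" if "!!k. z k:carr" "w:carr" "(%k. dE (z k) w)---->0" for z w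
  unfolding a_def by (rule dA_tendsto[OF Ac(1,2) that])
 have q_tend: "(%k. q (z k))---->q w" if "!!k. z k:carr" "w:carr" "(%k. dE (z k) w)---->0" for z w
  unfolding q_def tb_def using r rho by (intro tendsto_intros a_tend[OF that] dE_limitD[OF that]) auto
 have \<beta>_tend: "(%k. \<beta> (z k))---->\<beta> w" if "!!k. z k:carr" "w:carr" "(%k. dE (z k) w)---->0" for z w
  unfolding \<beta>_def using r l1_pos by (intro tendsto_intros tendsto_clip a_tend[OF that] dE_limitD[OF that]) auto
 have cont: "(%k. ell (z k))---->ell w&(%k. c (z k))---->c w"
  if "!!k::nat. z k:carr" "w:carr" "(%k. dE (z k) w)---->0" for z w
  unfolding ell_def c_def by (intro conjI tendsto_intros tendsto_clip q_tend[OF that] \<beta>_tend[OF that] dE_limitD[OF that])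
 have ell_le: "abs (ell z)<=L" for z
 proof -
  have "0<=L * clip (2 * q z - 1)" "L * clip (2 * q z - 1)<=L * 1" using Lp clip01 by (auto intro: mult_nonneg_nonneg mult_left_mono)
  thus ?thesis unfolding ell_def abs_le_iff by (auto simp: algebra_simps)
 qed
 have afar: "5<=a z" if "z:carr" "abs (fst z)>=L" for z unfolding a_def
 proof (rule dA_ge[OF Ac(2)])
  fix w assume w: "w:A"
  have "abs (fst w) < M" using A1[OF w] N_nonneg[of "snd w"] by (simp add: nE_def)
  moreover have "abs (fst z) - abs (fst w)<=dE z w" unfolding dE_def using N_nonneg[of "%x. snd z x - snd w x"] by linarith
  ultimately show "5<=dE z w" using that l1_pos by (simp add: L_def)
 qed
 have small: "N (snd z) < M + 4" if z: "z:carr" "q z<=1" for z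
 proof (cases "a z / r<=1")
  case True
  hence "a z < 2 * r" using r by (simp add: divide_simps)
  then obtain w where w: "w:A" "dE z w < 2*r" using dA_less[OF Ac(1,2) z(1)] a_def by blast
  have "nE z<=nE w + dE z w" by (rule nE_diff) (use z w Ac in auto)
  thus ?thesis using w r A1[OF w(1)] unfolding nE_def by linarith
 next
  case False
  hence "tb z / rho<=1" using z(2) unfolding q_def by linarith
  hence "tb z<=rho" using rho by (simp add: divide_simps)
  thus ?thesis using rho M l1_pos by (simp add: tb_def)
 qed
 \<comment> \<open>Counterexamples for t tending to 0 converge to some \<open>z\<close> in the
   transition zone. Each position of \<open>z\<close> is excluded in turn: near \<open>A\<close>, in
   the slab right of \<open>l1/2\<close>, and in the slab left of it.\<close>
 have zone: "EX t>0. ALL l u. abs l<=L&u:W&1/2<=q (l, u)&q (l, u)<=1-->N (%x. u x - c (l, u) * K t l u x)~=0"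
 proof (rule ccontr)
  assume n: "~ ?thesis"
  have "EX p. ALL k. abs (fst (p k))<=L&snd (p k):W&1/2<=q (p k)&q (p k)<=1 &
    N (%x. snd (p k) x - c (p k) * K (1 / real (Suc k)) (fst (p k)) (snd (p k)) x) = 0"
  proof (intro choice allI)
   fix k
   have "1 / real (Suc k) > 0" by simp
   then obtain l u where "abs l<=L&u:W&1/2<=q (l, u)&q (l, u)<=1&N (%x. u x - c (l, u) * K (1 / real (Suc k)) l u x) = 0"
    using n by blast
   thus "EX p. abs (fst p)<=L&snd p:W&1/2<=q p&q p<=1 &
    N (%x. snd p x - c p * K (1 / real (Suc k)) (fst p) (snd p) x) = 0" by (intro exI[of _ "(l, u)"]) simp
  qed
  then obtain p where p: "!!k. abs (fst (p k))<=L" "!!k. snd (p k):W" "!!k. 1/2<=q (p k)" "!!k. q (p k)<=1"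
    "!!k. N (%x. snd (p k) x - c (p k) * K (1 / real (Suc k)) (fst (p k)) (snd (p k)) x) = 0" by blast
  have pc: "p k:carr" for k using p(2) by (simp add: carr_iff)
  have c\<beta>: "c (p k) = \<beta> (p k)" for k using small[OF pc p(4), of k] by (simp add: c_def clip_1)
  have bd: "N (snd (p k))<=M + 4" for k using small[OF pc p(4), of k] by simp
  have inv: "(%k. 1 / real (Suc k))---->0" by (rule recip_tendsto)
  have f0: "(%k. N (%x. snd (p k) x - c (p k) * K (1 / real (Suc k)) (fst (p k)) (snd (p k)) x))---->0" unfolding p(5) by (rule tendsto_const)
  obtain s l u cc where s: "strict_mono (s::nat=>nat)" "abs l<=L" "u:W" "0<=cc" "cc<=1" "(%k. fst (p (s k)))---->l"
    "(%k. N (%x. snd (p (s k)) x - u x))---->0" "(%k. c (p (s k)))---->cc" "N (%x. u x - cc * K 0 l u x) = 0"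
   using fixpoint_limit[of "%k. fst (p k)" L "%k. snd (p k)" "M + 4" "%k. c (p k)" "%k. 1 / real (Suc k)" 0, OF p(1) p(2) bd c01 _ inv f0]
   by auto
  define z where "z = (l, u)"
  have zc: "z:carr" using s by (simp add: z_def carr_iff)
  have d: "(%k. dE (p (s k)) z)---->0" using dE_limitI[OF s(6,7)] by (simp add: z_def)
  have qz: "1/2<=q z" "q z<=1"
   by (rule LIMSEQ_le_const[OF q_tend[OF pc zc d]], use p(3) in blast)
     (rule LIMSEQ_le_const2[OF q_tend[OF pc zc d]], use p(4) in blast)
  have az: "(%k. a (p (s k)))---->a z" by (rule a_tend[OF pc zc d])
  have Az: "a w<=0" if "w:A" for w using dA_le[OF Ac(1) that, of w] Ac(1) that pm.refl[of w] by (auto simp: a_def)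
  have zA: "z ~: A"
  proof
   assume "z:A"
   hence "a z / r<=0" using Az r by (simp add: divide_simps)
   thus False using qz unfolding q_def by linarith
  qed
  have tbz: "tb z > 0"
  proof (rule ccontr)
   assume "~ tb z > 0"
   hence "tb z / rho<=0" using rho by (simp add: divide_simps)
   thus False using qz unfolding q_def by linarith
  qed
  \<comment> \<open>Where \<open>c\<close> is eventually 1 these are genuine fixed points of
    \<open>K\<close>, and the trivial alternative of \<open>perturbed_limit\<close> would make
    \<open>tb z\<close> nonpositive.\<close>
  have eq1: "z:S" if ev: "eventually (%k. \<beta> (p (s k)) = 1) sequentially"
  proof -
   obtain k0 where k0: "!!k. k>=k0==>\<beta> (p (s k)) = 1" using ev by (auto simp: eventually_sequentially)
   define g where "g k = s (k + k0)" for k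
   have lim: "(%k. fst (p (g k)))---->l" "(%k. N (%x. snd (p (g k)) x - u x))---->0"
    unfolding g_def by (rule LIMSEQ_ignore_initial_segment[OF s(6)], rule LIMSEQ_ignore_initial_segment[OF s(7)])
   have t0: "(%k. 1 / real (Suc (g k)))---->0"
    unfolding g_def using LIMSEQ_ignore_initial_segment[OF LIMSEQ_subseq_LIMSEQ[OF inv s(1)], of k0] by (simp add: o_def)
   have "(l, u):S \<or> N u = 0&l<=l1"
   proof (rule perturbed_limit[OF _ t0 lim(1) _ s(3) lim(2)])
    fix k
    show "N (%x. snd (p (g k)) x - K (1 / real (Suc (g k))) (fst (p (g k))) (snd (p (g k))) x) = 0"
     using p(5)[of "g k"] c\<beta>[of "g k"] k0[of "k + k0"] by (simp add: g_def)
   qed (use p in auto)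
   thus ?thesis using tbz by (auto simp: z_def tb_def max_def split: if_splits)
  qed
  show False
  proof (cases "a z<=r")
   case True
   have "eventually (%k. a (p (s k)) < 2*r) sequentially" by (rule order_tendstoD[OF az]) (use True r in auto)
   hence "eventually (%k. \<beta> (p (s k)) = 1) sequentially"
   proof (rule eventually_mono)
    fix k assume "a (p (s k)) < 2*r"
    hence "a (p (s k)) / r<=2" using r by (simp add: divide_simps)
    hence "clip (3 - a (p (s k)) / r) = 1" by (intro clip_1) simp
    thus "\<beta> (p (s k)) = 1" using clip01 by (auto simp: \<beta>_def max_def intro: antisym)
   qed
   hence zS: "z:SP" using eq1 by (simp add: SP_def)
   have "a z < 2*r" using True r by linarith
   then obtain w where w: "w:A" "dE z w < 2*r" using dA_less[OF Ac(1,2) zc] a_def by blast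
   have "e<=dE w z" by (rule AB[OF w(1) zS zA])
   thus False using w r pm.sym[of z w] zc Ac(1) by auto
  next
   case False
   hence "a z / r > 1" using r by (simp add: divide_simps)
   hence "tb z / rho<=1" using qz unfolding q_def by linarith
   hence "tb z<=rho" using rho by (simp add: divide_simps)
   hence tb: "N u<=rho" "l<=l1 + rho" by (auto simp: tb_def z_def)
   show False
   proof (cases "l > l1/2")
    case True
    have "eventually (%k. fst (p (s k)) > l1/2) sequentially" by (rule order_tendstoD[OF s(6)]) (use True in auto)
    hence "eventually (%k. \<beta> (p (s k)) = 1) sequentially"
    proof (rule eventually_mono)
     fix k assume "fst (p (s k)) > l1/2"
     hence "1<=(fst (p (s k)) - l1/4) / (l1/4)" using l1_pos by (simp add: divide_simps)
     hence "clip ((fst (p (s k)) - l1/4) / (l1/4)) = 1" by (rule clip_1)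
     thus "\<beta> (p (s k)) = 1" using clip01 by (auto simp: \<beta>_def max_def intro: antisym)
    qed
    hence zS: "z:SP" using eq1 by (simp add: SP_def)
    have "s2<=N (snd z)" by (rule s2(2)[OF zS zA]) (use True l1_pos tb rho in \<open>auto simp: z_def\<close>)
    thus False using tb rho by (simp add: z_def)
   next
    case l: False
    have "a z>=3*r"
    proof (rule ccontr)
     assume "~ a z>=3*r"
     then obtain w where w: "w:A" "dE z w < 3*r" using dA_less[OF Ac(1,2) zc, of "3*r"] a_def by auto
     have "abs (l - fst w) < 3*r" "N (%x. u x - snd w x) < 3*r" using w(2) N_nonneg[of "%x. u x - snd w x"] by (auto simp: dE_def z_def)
     moreover have "N (snd w)<=N u + N (%x. u x - snd w x)"
      using N_le_diff[of "snd w" u] N_minus_commute[of "snd w" u] s w(1) Ac(1) by (auto simp: carr_iff)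
     ultimately show False using A2[OF w(1)] l r rho tb by linarith
    qed
    hence "a z / r>=3" using r by (simp add: divide_simps)
    hence "clip (3 - a z / r) = 0" by (intro clip_0) simp
    \<comment> \<open>Off the triple tube only the cutoff in the parameter is left. It vanishes up
      to \<open>l1/4\<close>, and from there to \<open>l1/2\<close> coercivity applies with
      \<open>cc\<close> as factor.\<close>
    hence \<beta>z: "\<beta> z = clip ((l - l1/4) / (l1/4))" using clip01 by (auto simp: \<beta>_def z_def max_def intro: antisym)
    have "(%k. \<beta> (p (s k)))---->\<beta> z" by (rule \<beta>_tend[OF pc zc d])
    hence cc: "cc = \<beta> z" using s(8) c\<beta> LIMSEQ_unique by auto
    have "N u = 0"
    proof (cases "l<=l1/4")
     case True
     hence "cc = 0" unfolding cc \<beta>z using l1_pos by (intro clip_0) (simp add: divide_simps)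
     thus ?thesis using s(9) by simp
    next
     case False
     show ?thesis by (rule coercive[OF _ _ s(4,5,3) _ s(9)]) (use False l tb rho in auto)
    qed
    hence "tb z<=0" using l l1_pos by (simp add: tb_def z_def)
    thus False using tbz by simp
   qed
  qed
 qed
 obtain t where t: "t > 0" "!!l u. abs l<=L==>u:W==>1/2<=q (l, u)==>q (l, u)<=1==>N (%x. u x - c (l, u) * K t l u x)~=0"
  using zone by blast
 have "EX l u. abs l<=L&u:W&ell (l, u) = l&N (%x. u x - c (l, u) * K t l u x) = 0"
 proof (rule exact_fixpoint[OF Lp _ _ c01])
  show "c (l, u) = 0" if "N u > M + 5" for l u using that by (simp add: c_def clip_0)
 qed (use t cont ell_le in auto)
 then obtain l u where lu: "abs l<=L" "u:W" "ell (l, u) = l" "N (%x. u x - c (l, u) * K t l u x) = 0" by blast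
 have zc: "(l, u):carr" using lu by (simp add: carr_iff)
 \<comment> \<open>At parameter \<open>L\<close> both terms of \<open>q\<close> are large; at
   \<open>-L\<close> the map is 0, so \<open>u\<close> is trivial and \<open>q\<close> is at most 0.
   With the transition zone excluded, no value of \<open>q\<close> is left.\<close>
 consider "q (l, u)<=1/2" | "1<=q (l, u)" | "1/2<=q (l, u)" "q (l, u)<=1" by linarith
 thus False
 proof cases
  case 1
  hence lL: "l = L" using lu(3) by (simp add: ell_def clip_0)
  hence "a (l, u)>=5" using afar[OF zc] Lp by simp
  hence "a (l, u) / r > 1/2" using r by (simp add: divide_simps)
  moreover have "tb (l, u)>=L - l1" by (simp add: tb_def lL)
  hence "tb (l, u) / rho > 1/2" using rho M l1_pos by (simp add: divide_simps L_def)
  ultimately show False using 1 unfolding q_def by linarith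
 next
  case 2
  hence lL: "l = -L" using lu(3) by (simp add: ell_def clip_1)
  hence "a (l, u)>=5" using afar[OF zc] Lp by simp
  hence "a (l, u) / r>=3" using r by (simp add: divide_simps)
  hence "clip (3 - a (l, u) / r) = 0" by (intro clip_0) simp
  moreover have "clip ((fst (l, u) - l1/4) / (l1/4)) = 0" by (rule clip_0) (use lL Lp l1_pos in \<open>simp add: divide_simps\<close>)
  ultimately have "\<beta> (l, u) = 0" by (simp add: \<beta>_def)
  hence "N u = 0" using lu(4) by (simp add: c_def)
  hence "tb (l, u) / rho<=0" using lL Lp l1_pos rho by (simp add: tb_def divide_simps)
  thus False using 2 unfolding q_def by linarith
 next
  case 3
  thus False using t(2)[OF lu(1,2)] lu(4) by blast
 qed
qed
qed

text \<open>The component of \<open>bp\<close> in \<open>SP\<close> contains every continuum found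
  by \<open>continuum_reaches\<close>, so if bounded it meets the trivial line again. Only then does
  \<open>bp\<close> turn out to lie in \<open>S\<close>: otherwise its class and \<open>S\<close>
  would be disjoint closed sets, the component would reduce to that class, and neither alternative
  could hold.\<close>

theorem global_bifurcation:
"EX C. C \<subseteq> S&closedin topE C&connectedin topE C&(l1, %_. 0):C &
  (ALL D. D \<subseteq> S&closedin topE D&connectedin topE D&C \<subseteq> D-->D = C) &
  ((ALL M. EX z:C. nE z > M) \<or> (EX l. (l, %_. 0):C&l~=l1))"
proof -
define C where "C = connected_component_of_set (subtopology topE SP) bp"
have SPcl: "closedin topE SP" by (rule closedin_topE[OF SP_sub SP_closed])
have C_SP: "C \<subseteq> SP" using connected_component_of_subset_topspace[of "subtopology topE SP" bp] by (auto simp: C_def)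
have Ccl: "closedin topE C"
 using closedin_connected_component_of[of "subtopology topE SP" bp] closedin_trans_full[OF _ SPcl] unfolding C_def by blast
have Cconn: "connectedin topE C"
 using connectedin_connected_component_of[of "subtopology topE SP" bp] by (simp add: C_def connectedin_subtopology)
have Csup: "D \<subseteq> C" if "D \<subseteq> SP" "connectedin topE D" "bp:D" for D
 unfolding C_def by (rule connected_component_of_maximal) (use that in \<open>auto simp: connectedin_subtopology\<close>)
have bpC: "bp:C" using Csup[of "{bp}"] bp_SP bp_carr by (simp add: connectedin_sing)
have alt: "(ALL M. EX z:C. nE z > M) \<or> (EX l. (l, %_. 0):C&l~=l1)"
proof (rule ccontr)
 assume n: "~ ?thesis"
 then obtain M where M: "!!z. z:C==>nE z<=M" using not_le by blast
 obtain D where D: "D \<subseteq> SP" "connectedin topE D" "bp:D" "(EX z:D. max (M + 1) (l1 + 1)<=nE z) \<or> (EX l<=l1/2. (l, %_. 0):D)"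
  using continuum_reaches[of "max (M + 1) (l1 + 1)"] by auto
 have DC: "D \<subseteq> C" by (rule Csup[OF D(1-3)])
 from D(4) show False
 proof
  assume "EX z:D. max (M + 1) (l1 + 1)<=nE z"
  then obtain z where z: "z:D" "max (M + 1) (l1 + 1)<=nE z" by blast
  have "nE z<=M" using M DC z(1) by blast
  thus False using z(2) by simp
 next
  assume "EX l<=l1/2. (l, %_. 0):D"
  then obtain l where "l<=l1/2" "(l, %_. 0):C" using DC by blast
  thus False using n l1_pos by force
 qed
qed
have bpS: "bp:S"
proof (rule ccontr)
 assume nb: "bp ~: S"
 define X0 where "X0 = {z:carr. dE bp z = 0}"
 have X0S: "X0 \<inter> S = {}"
 proof -
  have "bp:S" if "z:X0" "z:S" for z
   by (rule S_closed[of "%_. z"]) (use that bp_carr pm.sym[of bp z] in \<open>auto simp: X0_def\<close>)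
  thus ?thesis using nb by blast
 qed
 have Scl: "closedin topE S" by (rule closedin_topE[OF S_sub S_closed])
 have X0cl: "closedin topE X0"
 proof (rule closedin_topE)
  fix z :: "nat => _" and l assume z: "!!k. z k:X0" "l:carr" "(%k. dE (z k) l)---->0"
  have "dE bp l<=0"
  proof (rule LIMSEQ_le_const[OF z(3)], intro exI[of _ 0] allI impI)
   fix k
   have "dE bp l<=dE bp (z k) + dE (z k) l" by (rule pm.tri) (use z bp_carr in \<open>auto simp: X0_def\<close>)
   thus "dE bp l<=dE (z k) l" using z(1)[of k] by (simp add: X0_def)
  qed
  thus "l:X0" using z pm.nonneg[OF bp_carr z(2)] by (simp add: X0_def)
 qed (auto simp: X0_def)
 have "C \<inter> S = {}"
 proof (rule ccontr)
  assume "C \<inter> S~={}"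
  moreover have "C \<inter> X0~={}" using bpC bp_carr pm.refl[OF bp_carr] unfolding X0_def by blast
  moreover have "C \<subseteq> S \<union> X0" using C_SP by (auto simp: SP_def X0_def)
  ultimately show False using Cconn X0S Scl X0cl unfolding connectedin_closedin by blast
 qed
 hence CX: "C \<subseteq> X0" using C_SP by (auto simp: SP_def X0_def)
 have CX': "fst z = l1&N (snd z) = 0" if "z:C" for z
 proof -
  have "z:carr" "dE bp z = 0" using CX that by (auto simp: X0_def)
  thus ?thesis using dE_bp[of z] N_nonneg[of "snd z"] by linarith
 qed
 from alt show False
 proof
  assume "ALL M. EX z:C. nE z > M"
  then obtain z where "z:C" "nE z > l1" by blast
  thus False using CX'[of z] l1_pos by (simp add: nE_def)
 next
  assume "EX l. (l, %_. 0):C&l~=l1"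
  thus False using CX' by force
 qed
qed
have SPS: "SP = S"
proof -
 have "z:S" if "z:carr" "dE bp z = 0" for z by (rule S_closed[of "%_. bp"]) (use that bpS in auto)
 thus ?thesis by (auto simp: SP_def)
qed
have "D = C" if "D \<subseteq> S" "connectedin topE D" "C \<subseteq> D" for D
 using Csup[of D] that bpC SPS by blast
thus ?thesis using C_SP SPS Ccl Cconn bpC alt unfolding bp_def by (intro exI[of _ C]) auto
qed

end

section \<open>Inequalities for powers of norms\<close>

lemma powr_add_le:
fixes a b p :: real
assumes "p > 0" "a>=0" "b>=0"
shows "(a + b) powr p<=2 powr p * (a powr p + b powr p)"
proof -
have "(a + b) powr p<=(2 * max a b) powr p" using assms by (intro powr_mono2) auto
also have "... = 2 powr p * max a b powr p" using assms by (simp add: powr_mult)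
also have "...<=2 powr p * (a powr p + b powr p)" by (intro mult_left_mono) (auto simp: max_def)
finally show ?thesis .
qed

lemma norm_add_powr_le:
fixes a b :: "'b::real_normed_vector"
assumes "p > 0"
shows "norm (a + b) powr p<=2 powr p * (norm a powr p + norm b powr p)"
proof -
have "norm (a + b) powr p<=(norm a + norm b) powr p" using assms by (intro powr_mono2) (auto simp: norm_triangle_ineq)
thus ?thesis using powr_add_le[OF assms, of "norm a" "norm b"] by simp
qed

lemma norm_diff_powr_le:
fixes a b :: "'b::real_normed_vector"
assumes "p > 0"
shows "norm (a - b) powr p<=2 powr p * (norm a powr p + norm b powr p)"
using norm_add_powr_le[OF assms, of a "-b"] by simp

lemma young_eta:
fixes p q e :: real
assumes "p > 1" "q > 1" "1/p + 1/q = 1" "e > 0"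
obtains C where "C > 0" "!!a b. a>=0==>b>=0==>a * b<=e * a powr p + C * b powr q"
proof -
define t where "t = e powr (1/p)"
have t: "t > 0" using assms by (simp add: t_def)
have tp: "t powr p = e" using assms by (simp add: t_def powr_powr)
show thesis
proof (rule that[of "(1/t) powr q"])
 fix a b :: real assume ab: "a>=0" "b>=0"
 have "a * b = (t * a) * (b / t)" using t by simp
 also have "...<=(t * a) powr p / p + (b / t) powr q / q"
  using t ab assms by (intro Youngs_inequality) auto
 also have "...<=(t * a) powr p + (b / t) powr q"
  using assms by (intro add_mono) (auto simp: divide_simps mult_le_cancel_left1)
 also have "(t * a) powr p = e * a powr p" using t ab tp by (simp add: powr_mult)
 also have "(b / t) powr q = (1/t) powr q * b powr q" using t ab by (simp add: powr_mult[symmetric])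
 finally show "a * b<=e * a powr p + (1/t) powr q * b powr q" .
qed (use t in simp)
qed

text \<open>The derivative of the power is strictly increasing, so by the mean value theorem the
  increment over the left half of the interval is smaller than over the right half.\<close>

lemma powr_midpoint_strict:
fixes s t p :: real
assumes p: "p > 1" and s: "0<=s" and st: "s < t"
shows "((s + t)/2) powr p < (s powr p + t powr p) / 2"
proof -
define m where "m = (s + t)/2"
have m: "s < m" "m < t" "t - m = m - s" using st by (auto simp: m_def field_simps)
have ct: "continuous_on X (%x. x powr p)" if "X \<subseteq> {0..}" for X
 using that p by (intro continuous_on_powr' continuous_intros) auto
have df: "((%x. x powr p) has_real_derivative p * x powr (p - 1)) (at x)" if "x > 0" for x
 using that by (auto intro!: derivative_eq_intros)
have dfe: "(%x. x powr p) differentiable (at x)" if "x > 0" for x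
 unfolding real_differentiable_def using df[OF that] by blast
have "EX l z. s < z&z < m&((%x. x powr p) has_real_derivative l) (at z)&m powr p - s powr p = (m - s) * l"
 by (rule MVT[OF m(1)]) (use ct dfe s in auto)
then obtain l1 z1 where z1: "s < z1" "z1 < m" "((%x. x powr p) has_real_derivative l1) (at z1)" "m powr p - s powr p = (m - s) * l1" by blast
have "EX l z. m < z&z < t&((%x. x powr p) has_real_derivative l) (at z)&t powr p - m powr p = (t - m) * l"
 by (rule MVT[OF m(2)]) (use ct dfe s m in auto)
then obtain l2 z2 where z2: "m < z2" "z2 < t" "((%x. x powr p) has_real_derivative l2) (at z2)" "t powr p - m powr p = (t - m) * l2" by blast
have "l1 = p * z1 powr (p - 1)" "l2 = p * z2 powr (p - 1)"
 using DERIV_unique[OF z1(3) df] DERIV_unique[OF z2(3) df] z1 z2 m s by auto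
moreover have "z1 powr (p - 1) < z2 powr (p - 1)" using z1 z2 s p by (intro powr_less_mono2) auto
ultimately have "l1 < l2" using p by simp
hence "(m - s) * l1 < (m - s) * l2" using m by simp
hence "m powr p - s powr p < t powr p - m powr p" unfolding z1(4) z2(4) m(3) .
thus ?thesis unfolding m_def[symmetric] by (simp add: field_simps)
qed

section \<open>Convexity of the p-th power of the norm\<close>

definition Ap :: "real => 'b::euclidean_space => 'b" where "Ap p a = norm a powr (p - 2) *\<^sub>R a"

text \<open>The defect in midpoint convexity measures distance for all p at once: unlike the p-th
  power of the distance when p < 2, it is dominated by the monotonicity of \<open>Ap\<close>, and
  its integral by the excess of an energy over its infimum.\<close>

definition convexity_gap :: "real => 'b::euclidean_space => 'b => real" where
"convexity_gap p a b = (norm a powr p + norm b powr p) / 2 - norm ((1/2) *\<^sub>R (a + b)) powr p"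

lemma norm_Ap: "norm (Ap p a) = norm a powr (p - 1)"
proof (cases "a = 0")
case False
have "norm a powr (p - 2 + 1) = norm a powr (p - 2) * norm a powr 1" by (rule powr_add)
thus ?thesis by (simp add: Ap_def)
qed (simp add: Ap_def)

lemma Ap_inner_self: "Ap p a \<bullet> a = norm a powr p"
proof (cases "a = 0")
case False
have "norm a powr (p - 2 + 2) = norm a powr (p - 2) * norm a powr 2" by (rule powr_add)
thus ?thesis using False by (simp add: Ap_def dot_square_norm)
qed (simp add: Ap_def)

lemma young_powr:
fixes x y p :: real
assumes "p > 1" "x>=0" "y>=0"
shows "x powr (p - 1) * y<=(1 - 1/p) * x powr p + y powr p / p"
proof -
define q where "q = p / (p - 1)"
have q: "q > 1" "1/q + 1/p = 1" "(p - 1) * q = p" "1/q = 1 - 1/p" using assms by (auto simp: q_def field_simps)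
have "x powr (p - 1) * y<=(x powr (p - 1)) powr q / q + y powr p / p"
 using assms q by (intro Youngs_inequality) auto
also have "(x powr (p - 1)) powr q = x powr p" using q by (simp add: powr_powr)
also have "x powr p / q = (1 - 1/p) * x powr p" using q(4) by (metis divide_inverse_commute inverse_eq_divide)
finally show ?thesis .
qed

lemma Ap_inner_le:
fixes a b :: "'b::euclidean_space"
assumes "p > 1"
shows "abs (Ap p a \<bullet> b)<=(1 - 1/p) * norm a powr p + norm b powr p / p"
proof -
have "abs (Ap p a \<bullet> b)<=norm a powr (p - 1) * norm b" using Cauchy_Schwarz_ineq2[of "Ap p a" b] by (simp add: norm_Ap)
also have "...<=(1 - 1/p) * norm a powr p + norm b powr p / p" by (rule young_powr) (use assms in auto)
finally show ?thesis .
qed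

lemma Ap_inner_le':
fixes a b :: "'b::euclidean_space"
assumes "p > 1"
shows "abs (Ap p a \<bullet> b)<=norm a powr p + norm b powr p"
proof -
have "(1 - 1/p) * norm a powr p<=1 * norm a powr p" using assms by (intro mult_right_mono) auto
moreover have "norm b powr p / p<=norm b powr p" using assms by (simp add: divide_le_eq mult_le_cancel_left1)
ultimately show ?thesis using Ap_inner_le[OF assms, of a b] by linarith
qed

text \<open>Young's inequality read as a supporting hyperplane, the gradient of the p-th power of
  the norm being \<open>p\<close> times \<open>Ap\<close>. Jensen's and Minkowski's inequalities,
  the variational inequality and the derivative of \<open>abs s powr p\<close> are all drawn from
  it.\<close>

lemma convex_tangent:
fixes a b :: "'b::euclidean_space"
assumes p: "p > 1"
shows "norm a powr p + p * (Ap p a \<bullet> (b - a))<=norm b powr p"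
proof -
have "Ap p a \<bullet> b<=(1 - 1/p) * norm a powr p + norm b powr p / p" using Ap_inner_le[OF p, of a b] by linarith
hence "p * (Ap p a \<bullet> b)<=p * ((1 - 1/p) * norm a powr p + norm b powr p / p)" using p by simp
also have "... = (p - 1) * norm a powr p + norm b powr p" using p by (simp add: field_simps)
finally show ?thesis by (simp add: inner_diff_right Ap_inner_self algebra_simps)
qed

text \<open>Add the supporting inequalities at \<open>a\<close> and at \<open>b\<close>, both
  evaluated at the midpoint.\<close>

lemma convexity_gap_le:
fixes a b :: "'b::euclidean_space"
assumes p: "p > 1"
shows "4 / p * convexity_gap p a b<=(Ap p a - Ap p b) \<bullet> (a - b)"
proof -
define m where "m = (1/2) *\<^sub>R (a + b)"
have half: "(1/2) *\<^sub>R x + (1/2) *\<^sub>R x = x" for x :: 'b unfolding scaleR_left_distrib[symmetric] by simp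
have "m - ((1/2) *\<^sub>R a + (1/2) *\<^sub>R a) = (1/2) *\<^sub>R (b - a)" by (simp add: m_def algebra_simps)
hence ma: "m - a = (1/2) *\<^sub>R (b - a)" unfolding half .
have "m - ((1/2) *\<^sub>R b + (1/2) *\<^sub>R b) = (1/2) *\<^sub>R (a - b)" by (simp add: m_def algebra_simps)
hence mb: "m - b = (1/2) *\<^sub>R (a - b)" unfolding half .
have "norm a powr p + p * (Ap p a \<bullet> (m - a))<=norm m powr p" "norm b powr p + p * (Ap p b \<bullet> (m - b))<=norm m powr p"
 by (rule convex_tangent[OF p])+
hence "norm a powr p + norm b powr p - 2 * norm m powr p<=p/2 * ((Ap p a - Ap p b) \<bullet> (a - b))"
 unfolding ma mb by (simp add: inner_diff_left inner_diff_right algebra_simps)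
moreover have "2 * convexity_gap p a b = norm a powr p + norm b powr p - 2 * norm m powr p"
 unfolding convexity_gap_def m_def[symmetric] by simp
ultimately have "2 * convexity_gap p a b<=p/2 * ((Ap p a - Ap p b) \<bullet> (a - b))" by linarith
thus ?thesis using p by (simp add: field_simps)
qed

lemma convexity_gap_pos:
fixes a b :: "'b::euclidean_space"
assumes p: "p > 1" and ab: "a~=b"
shows "0 < convexity_gap p a b"
proof -
have n: "norm ((1/2) *\<^sub>R (a + b))<=(norm a + norm b)/2" using norm_triangle_ineq[of a b] by simp
show ?thesis
proof (cases "norm a = norm b")
 case False
 have "norm ((1/2) *\<^sub>R (a + b)) powr p<=((norm a + norm b)/2) powr p" using n p by (intro powr_mono2) auto
 moreover have "((norm a + norm b)/2) powr p < (norm a powr p + norm b powr p)/2"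
  using False powr_midpoint_strict[OF p, of "norm a" "norm b"] powr_midpoint_strict[OF p, of "norm b" "norm a"]
  by (cases "norm a" "norm b" rule: linorder_cases) (auto simp: add.commute)
 ultimately show ?thesis by (simp add: convexity_gap_def)
next
 \<comment> \<open>For equal norms the strictness comes from the parallelogram law.\<close>
 case True
 have "(norm (a + b))\<^sup>2 + (norm (a - b))\<^sup>2 = 2 * (norm a)\<^sup>2 + 2 * (norm b)\<^sup>2"
  by (simp add: power2_norm_eq_inner algebra_simps inner_commute)
 moreover have "(norm (a - b))\<^sup>2 > 0" using ab by simp
 ultimately have "(norm (a + b))\<^sup>2 < 2 * (norm a)\<^sup>2 + 2 * (norm b)\<^sup>2" by linarith
 also have "... = (2 * norm a)\<^sup>2" using True by (simp add: power2_eq_square)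
 finally have "(norm (a + b))\<^sup>2 < (2 * norm a)\<^sup>2" .
 hence "norm (a + b) < 2 * norm a" by (rule power_less_imp_less_base) simp
 hence "norm ((1/2) *\<^sub>R (a + b)) powr p < norm a powr p" using p by (intro powr_less_mono2) auto
 thus ?thesis using True by (simp add: convexity_gap_def)
qed
qed

lemma convexity_gap_nonneg:
fixes a b :: "'b::euclidean_space"
assumes "p > 1"
shows "0<=convexity_gap p a b"
proof (cases "a = b")
case True
have "(1/2) *\<^sub>R (a + a) = a" by (rule scaleR_half_double)
thus ?thesis using True by (simp add: convexity_gap_def del: scaleR_half_double)
next
case False thus ?thesis using convexity_gap_pos[OF assms False] by simp
qed

text \<open>Both sides are \<open>p\<close>-homogeneous, so it suffices to bound the convexity gap from below on the compact set of
normalised pairs with \<open>|a - b|^p \<ge> e\<close>; this treats all exponents \<open>p > 1\<close> at once.\<close>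
lemma diff_powr_le_gap:
fixes p e :: real
assumes p: "p > 1" and e: "e > 0"
obtains C where "C > 0" "!!a b :: 'b::euclidean_space. norm (a - b) powr p<=e * (norm a powr p + norm b powr p) + C * convexity_gap p a b"
proof -
define K where "K = {x :: 'b \<times> 'b. norm (fst x) powr p + norm (snd x) powr p = 1&e<=norm (fst x - snd x) powr p}"
define f where "f x = convexity_gap p (fst x) (snd x)" for x :: "'b \<times> 'b"
have cf: "continuous_on UNIV f" unfolding f_def convexity_gap_def
 using p by (intro continuous_intros continuous_on_powr') auto
have c1: "continuous_on UNIV (%x::'b\<times>'b. norm (fst x) powr p + norm (snd x) powr p)" "continuous_on UNIV (%x::'b\<times>'b. norm (fst x - snd x) powr p)"
 using p by (auto intro!: continuous_intros continuous_on_powr')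
have "closed K"
proof -
 have "K = {x. norm (fst x) powr p + norm (snd x) powr p = 1} \<inter> {x. e<=norm (fst x - snd x) powr p}"
  by (auto simp: K_def)
 thus ?thesis using closed_Collect_eq[OF c1(1) continuous_on_const] closed_Collect_le[OF continuous_on_const c1(2)] by (simp add: closed_Int)
qed
moreover have "bounded K"
proof -
 have le1: "t<=1" if "t powr p<=1" "0<=t" for t
 proof (rule ccontr)
  assume "~ t<=1"
  hence "1 powr p < t powr p" using p by (intro powr_less_mono2) auto
  thus False using that by simp
 qed
 have "K \<subseteq> cball 0 1 \<times> cball 0 1"
 proof
  fix x assume x: "x:K"
  have "norm (fst x) powr p<=1" "norm (snd x) powr p<=1" using x powr_ge_zero[of "norm (fst x)" p] powr_ge_zero[of "norm (snd x)" p]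
   unfolding K_def mem_Collect_eq by linarith+
  hence "norm (fst x)<=1" "norm (snd x)<=1" using le1 by auto
  thus "x:cball 0 1 \<times> cball 0 1" by (cases x) simp
 qed
 thus ?thesis using bounded_Times[OF bounded_cball bounded_cball] bounded_subset by blast
qed
ultimately have "compact K" by (simp add: compact_eq_bounded_closed)
have ex: "EX d>0. ALL x:K. d<=f x"
proof (cases "K = {}")
 case True thus ?thesis by (auto intro: exI[of _ 1])
next
 case False
 obtain x where x: "x:K" "!!y. y:K==>f x<=f y"
  using continuous_attains_inf[OF \<open>compact K\<close> False, of f] continuous_on_subset[OF cf] by blast
 have "fst x~=snd x" using x(1) e by (auto simp: K_def)
 hence "0 < f x" unfolding f_def by (rule convexity_gap_pos[OF p])
 thus ?thesis using x(2) by blast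
qed
then obtain d where d: "d > 0" "!!x. x:K==>d<=f x" by blast
show thesis
proof (rule that[of "2 powr p / d"])
 fix a b :: 'b
 define S where "S = norm a powr p + norm b powr p"
 have S0: "0<=S" by (simp add: S_def)
 show "norm (a - b) powr p<=e * (norm a powr p + norm b powr p) + 2 powr p / d * convexity_gap p a b"
 proof (cases "S = 0")
  case True
  hence "norm a powr p = 0" "norm b powr p = 0" unfolding S_def using powr_ge_zero[of "norm a" p] powr_ge_zero[of "norm b" p] by linarith+
  thus ?thesis using p by (simp add: convexity_gap_def)
 next
  case False
  hence S: "S > 0" using S0 by simp
  define c where "c = S powr (1/p)"
  have c: "c > 0" "c powr p = S" using S p by (auto simp: c_def powr_powr)
  define a' b' where "a' = (1/c) *\<^sub>R a" and "b' = (1/c) *\<^sub>R b"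
  have nn: "norm ((1/c) *\<^sub>R v) powr p = norm v powr p / S" for v :: 'b
   using c by (simp add: powr_divide)
  have diff: "a' - b' = (1/c) *\<^sub>R (a - b)" by (simp add: a'_def b'_def algebra_simps)
  have g: "convexity_gap p a' b' = convexity_gap p a b / S"
  proof -
   have "(1/2) *\<^sub>R (a' + b') = (1/c) *\<^sub>R ((1/2) *\<^sub>R (a + b))" by (simp add: a'_def b'_def algebra_simps)
   moreover have "(x/S + y/S)/2 - z/S = ((x + y)/2 - z)/S" for x y z :: real by (simp add: add_divide_distrib diff_divide_distrib)
   ultimately show ?thesis unfolding convexity_gap_def by (simp only: nn a'_def b'_def)
  qed
  have n1: "norm a' powr p + norm b' powr p = 1" unfolding a'_def b'_def nn using S by (simp add: S_def add_divide_distrib[symmetric])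
  show ?thesis
  proof (cases "e<=norm (a' - b') powr p")
   case True
   hence "(a', b'):K" using n1 by (simp add: K_def)
   hence "d<=convexity_gap p a' b'" using d(2) f_def by force
   hence dS: "d * S<=convexity_gap p a b" using S g by (simp add: field_simps)
   have "norm (a - b) powr p<=2 powr p * S" using norm_diff_powr_le[of p a b] p by (simp add: S_def)
   also have "... = 2 powr p / d * (d * S)" using d by simp
   also have "...<=2 powr p / d * convexity_gap p a b" using dS d by (intro mult_left_mono) auto
   finally show ?thesis using e S0 unfolding S_def[symmetric] by (smt (verit) mult_nonneg_nonneg)
  next
   case False
   hence "norm (a - b) powr p / S < e" unfolding diff nn by simp
   hence "norm (a - b) powr p<=e * S" using S by (simp add: field_simps)
   moreover have "0<=2 powr p / d * convexity_gap p a b" using d convexity_gap_nonneg[OF p] by (intro mult_nonneg_nonneg) auto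
   ultimately show ?thesis unfolding S_def by linarith
  qed
 qed
qed (use d in simp)
qed

lemma tendsto_subseqI:
fixes x :: "nat => 'b::metric_space"
assumes "!!s :: nat => nat. strict_mono s==>EX r. strict_mono (r::nat=>nat)&(%k. x (s (r k)))---->l"
shows "x---->l"
proof (rule ccontr)
assume "~ x---->l"
then obtain e where e: "e > 0" "\<exists>\<^sub>F n in sequentially. ~ dist (x n) l < e"
 unfolding tendsto_iff by (auto simp: frequently_def)
hence "infinite {n. ~ dist (x n) l < e}" by (simp add: cofinite_eq_sequentially[symmetric] INFM_iff_infinite)
then obtain s :: "nat => nat" where s: "strict_mono s" "!!n. s n:{n. ~ dist (x n) l < e}"
 using infinite_enumerate by blast
obtain r where r: "strict_mono (r::nat=>nat)" "(%k. x (s (r k)))---->l" using assms[OF s(1)] by blast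
have "eventually (%k. dist (x (s (r k))) l < e) sequentially" using r(2) e(1) by (rule tendstoD)
thus False using s(2) by (auto simp: eventually_sequentially)
qed

section \<open>Functions with integrable powers\<close>

text \<open>Dominated convergence with majorants that vary. In \<open>le\<close> the part of the
  difference controlled by the fixed majorant \<open>2 * H'\<close> is split off; what remains is
  \<open>H n - H'\<close>, whose integral tends to 0, and the negative part of that difference,
  which \<open>H'\<close> dominates.\<close>

lemma generalized_dct:
fixes g :: "nat => 'a => 'b::euclidean_space" and H :: "nat => 'a => real"
assumes gm: "!!n. g n:borel_measurable M" "g':borel_measurable M"
 and H: "!!n. integrable M (H n)" "integrable M H'"
 and lim: "AE x in M. (%n. g n x)---->g' x" "AE x in M. (%n. H n x)---->H' x"
 and bd: "!!n. AE x in M. norm (g n x)<=H n x"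
 and HI: "(%n. \<integral>x. H n x \<partial>M)---->(LINT x|M. H' x)"
shows "integrable M g'" "!!n. integrable M (g n)" "(%n. \<integral>x. norm (g n x - g' x) \<partial>M)---->0" "(%n. \<integral>x. g n x \<partial>M)---->(LINT x|M. g' x)"
proof -
note [measurable] = gm borel_measurable_integrable[OF H(1)] borel_measurable_integrable[OF H(2)]
show ig: "integrable M (g n)" for n
 by (rule Bintegrable_bound[OF H(1)[of n]]) (auto intro: eventually_mono[OF bd[of n]])
have bdall: "AE x in M. ALL n. norm (g n x)<=H n x" using bd by (simp add: AE_all_countable)
have bd': "AE x in M. norm (g' x)<=H' x" using bdall lim
proof eventually_elim
 case (elim x)
 show ?case by (rule LIMSEQ_le[OF tendsto_norm[OF elim(2)] elim(3)]) (use elim in auto)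
qed
show ig': "integrable M g'" by (rule Bintegrable_bound[OF H(2)]) (auto intro: eventually_mono[OF bd'])
have iD: "integrable M (%x. norm (g n x - g' x))" for n using ig ig' by auto
have 1: "(%n. \<integral>x. min (norm (g n x - g' x)) (2 * H' x) \<partial>M)---->(LINT x|M. 0)"
proof (rule integral_dominated_convergence)
 show "integrable M (%x. 2 * H' x)" using H by auto
 show "AE x in M. (%n. min (norm (g n x - g' x)) (2 * H' x))---->0" using lim(1) bd'
 proof eventually_elim
  case (elim x)
  have "0<=H' x" using elim(2) norm_ge_zero order_trans by blast
  have "(%n. norm (g n x - g' x))---->0" using tendsto_norm[OF LIM_zero[OF elim(1)]] by simp
  from tendsto_min[OF this tendsto_const[of "2 * H' x"]] show ?case using \<open>0 \<le> H' x\<close> by simp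
 qed
 show "AE x in M. norm (min (norm (g n x - g' x)) (2 * H' x))<=2 * H' x" for n using bd'
 proof eventually_elim
  case (elim x)
  have "0<=H' x" using elim norm_ge_zero order_trans by blast
  thus ?case by (auto simp: min_def)
 qed
qed auto
have 2: "(%n. \<integral>x. max 0 (H' x - H n x) \<partial>M)---->(LINT x|M. 0)"
proof (rule integral_dominated_convergence)
 show "integrable M H'" by (rule H)
 show "AE x in M. (%n. max 0 (H' x - H n x))---->0" using lim(2)
 proof eventually_elim
  case (elim x)
  have "(%n. H' x - H n x)---->H' x - H' x" by (intro tendsto_intros elim)
  from tendsto_max[OF tendsto_const[of 0] this] show ?case by simp
 qed
 show "AE x in M. norm (max 0 (H' x - H n x))<=H' x" for n using bdall bd'
 proof eventually_elim
  case (elim x)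
  have "0<=H' x" "0<=H n x" using elim norm_ge_zero order_trans by blast+
  thus ?case by auto
 qed
qed auto
have i2: "integrable M (%x. max 0 (H' x - H n x))" for n using H by auto
have i1: "integrable M (%x. min (norm (g n x - g' x)) (2 * H' x))" for n using iD H by auto
have le: "(LINT x|M. norm (g n x - g' x))<=(LINT x|M. min (norm (g n x - g' x)) (2 * H' x)) + ((LINT x|M. H n x) - (LINT x|M. H' x)) + 2 * (LINT x|M. max 0 (H' x - H n x))" for n
proof -
 have "(LINT x|M. norm (g n x - g' x))<=(LINT x|M. min (norm (g n x - g' x)) (2 * H' x) + (H n x - H' x) + 2 * max 0 (H' x - H n x))"
 proof (rule integral_mono_AE)
  show "integrable M (%x. min (norm (g n x - g' x)) (2 * H' x) + (H n x - H' x) + 2 * max 0 (H' x - H n x))"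
   using i1 i2 H by auto
  show "AE x in M. norm (g n x - g' x)<=min (norm (g n x - g' x)) (2 * H' x) + (H n x - H' x) + 2 * max 0 (H' x - H n x)"
   using bdall bd'
  proof eventually_elim
   case (elim x)
   have "norm (g n x - g' x)<=H n x + H' x" using elim norm_triangle_ineq4[of "g n x" "g' x"] by (meson add_mono order_trans)
   thus ?case by (auto simp: min_def max_def)
  qed
 qed (use iD in auto)
 also have "... = (LINT x|M. min (norm (g n x - g' x)) (2 * H' x)) + ((LINT x|M. H n x) - (LINT x|M. H' x)) + 2 * (LINT x|M. max 0 (H' x - H n x))"
  using i1 i2 H by simp
 finally show ?thesis .
qed
have "(%n. (LINT x|M. min (norm (g n x - g' x)) (2 * H' x)) + ((LINT x|M. H n x) - (LINT x|M. H' x)) + 2 * (LINT x|M. max 0 (H' x - H n x)))---->0 + ((LINT x|M. H' x) - (LINT x|M. H' x)) + 2 * 0"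
 using 1 2 by (intro tendsto_intros HI) auto
hence z: "(%n. (LINT x|M. min (norm (g n x - g' x)) (2 * H' x)) + ((LINT x|M. H n x) - (LINT x|M. H' x)) + 2 * (LINT x|M. max 0 (H' x - H n x)))---->0" by simp
show L1: "(%n. \<integral>x. norm (g n x - g' x) \<partial>M)---->0"
 by (rule Lim_null_comparison[OF _ z]) (use le in auto)
have "(%n. (LINT x|M. g n x) - (LINT x|M. g' x))---->0"
proof (rule Lim_null_comparison[OF _ L1], intro always_eventually allI)
 fix n
 have "(LINT x|M. g n x) - (LINT x|M. g' x) = (LINT x|M. g n x - g' x)" using ig ig' by simp
 thus "norm ((LINT x|M. g n x) - (LINT x|M. g' x))<=(LINT x|M. norm (g n x - g' x))" by (simp add: integral_norm_bound)
qed
thus "(%n. \<integral>x. g n x \<partial>M)---->(LINT x|M. g' x)" by (simp add: LIM_zero_iff)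
qed

definition Lp :: "'a measure => real => ('a => 'b::euclidean_space) => bool" where
"Lp M p f \<longleftrightarrow> f:borel_measurable M&integrable M (%x. norm (f x) powr p)"

definition Ip :: "'a measure => real => ('a => 'b::euclidean_space) => real" where
"Ip M p f = (LINT x|M. norm (f x) powr p)"

lemma Lp_meas: "Lp M p f==>f:borel_measurable M" by (simp add: Lp_def)
lemma Lp_int: "Lp M p f==>integrable M (%x. norm (f x) powr p)" by (simp add: Lp_def)
lemma Ip_nonneg: "0<=Ip M p f" unfolding Ip_def by (rule integral_nonneg_AE) simp

lemma Lp_bound:
assumes "f:borel_measurable M" "integrable M w" "AE x in M. norm (f x) powr p<=w x"
shows "Lp M p f"
unfolding Lp_def
proof (intro conjI)
note [measurable] = assms(1)
show "integrable M (%x. norm (f x) powr p)"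
 by (rule Bintegrable_bound[OF assms(2)]) (auto intro: eventually_mono[OF assms(3)])
qed (rule assms)

lemma Lp_zero [simp]: "Lp M p (%_. 0)" by (simp add: Lp_def)
lemma Ip_zero [simp]: "Ip M p (%_. 0) = 0" by (simp add: Ip_def)

lemma Lp_scale:
fixes f :: "'a => 'b::euclidean_space"
assumes "Lp M p f"
shows "Lp M p (%x. c *\<^sub>R f x)" "Ip M p (%x. c *\<^sub>R f x) = abs c powr p * Ip M p f"
using assms by (auto simp: Lp_def Ip_def powr_mult)

lemma Lp_scale_real:
fixes f :: "'a => real"
assumes "Lp M p f"
shows "Lp M p (%x. c * f x)" "Ip M p (%x. c * f x) = abs c powr p * Ip M p f"
using Lp_scale[OF assms, of c] by simp_all

lemma Lp_add:
assumes "p > 0" "Lp M p f" "Lp M p g"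
shows "Lp M p (%x. f x + g x)" "Ip M p (%x. f x + g x)<=2 powr p * (Ip M p f + Ip M p g)"
proof -
note [measurable] = Lp_meas[OF assms(2)] Lp_meas[OF assms(3)]
have i: "integrable M (%x. 2 powr p * (norm (f x) powr p + norm (g x) powr p))" using assms by (auto simp: Lp_def)
show l: "Lp M p (%x. f x + g x)"
 by (rule Lp_bound[OF _ i]) (auto simp: norm_add_powr_le assms)
have "Ip M p (%x. f x + g x)<=(LINT x|M. 2 powr p * (norm (f x) powr p + norm (g x) powr p))" unfolding Ip_def
 by (rule integral_mono[OF Lp_int[OF l] i]) (simp add: norm_add_powr_le assms)
also have "... = 2 powr p * (Ip M p f + Ip M p g)" using assms by (simp add: Ip_def Lp_def)
finally show "Ip M p (%x. f x + g x)<=2 powr p * (Ip M p f + Ip M p g)" .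
qed

lemma Lp_minus: "Lp M p f==>Lp M p (%x. - f x)" "Ip M p (%x. - f x) = Ip M p f"
by (auto simp: Lp_def Ip_def)

lemma Ip_minus_commute: "Ip M p (%x. f x - g x) = Ip M p (%x. g x - f x)"
by (simp add: Ip_def norm_minus_commute)

lemma Lp_diff:
assumes "p > 0" "Lp M p f" "Lp M p g"
shows "Lp M p (%x. f x - g x)" "Ip M p (%x. f x - g x)<=2 powr p * (Ip M p f + Ip M p g)"
using Lp_add[OF assms(1,2) Lp_minus(1)[OF assms(3)]] Lp_minus(2)[of M p g] by simp_all

lemma Ip_diff_tri:
assumes "p > 0" "Lp M p f" "Lp M p g" "Lp M p h"
shows "Ip M p (%x. f x - h x)<=2 powr p * (Ip M p (%x. f x - g x) + Ip M p (%x. g x - h x))"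
using Lp_add(2)[OF assms(1) Lp_diff(1)[OF assms(1-3)] Lp_diff(1)[OF assms(1,3,4)]] by simp

lemma Ip_lim_trans:
assumes p: "p > 0" and L: "!!k::nat. Lp M p (f k)" "!!k. Lp M p (g k)" "!!k. Lp M p (h k)"
 and lim: "(%k. Ip M p (%x. f k x - g k x))---->0" "(%k. Ip M p (%x. g k x - h k x))---->0"
shows "(%k. Ip M p (%x. f k x - h k x))---->0"
proof (rule Lim_null_comparison)
show "(%k. 2 powr p * (Ip M p (%x. f k x - g k x) + Ip M p (%x. g k x - h k x)))---->0"
 using tendsto_mult_left[OF tendsto_add[OF lim], of "2 powr p"] by simp
qed (use Ip_diff_tri[OF p L] in \<open>auto simp: Ip_nonneg\<close>)

lemma Ip_eq_0_iff:
assumes "p > 0" "Lp M p f"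
shows "Ip M p f = 0 \<longleftrightarrow> (AE x in M. f x = 0)"
unfolding Ip_def using integral_nonneg_eq_0_iff_AE[OF Lp_int[OF assms(2)]] by simp

lemma Lp_cong_AE:
assumes "AE x in M. f x = g x" "g:borel_measurable M" "Lp M p f"
shows "Lp M p g" "Ip M p g = Ip M p f"
proof -
note [measurable] = assms(2) Lp_meas[OF assms(3)]
have ae: "AE x in M. norm (f x) powr p = norm (g x) powr p" using assms(1) by eventually_elim simp
show "Lp M p g" unfolding Lp_def using integrable_cong_AE[OF _ _ ae] Lp_int[OF assms(3)] by auto
show "Ip M p g = Ip M p f" unfolding Ip_def by (rule integral_cong_AE) (use ae in auto)
qed

text \<open>Convexity of the power, applied to the functions divided by \<open>a\<close> and
  \<open>b\<close> with weights proportional to \<open>a\<close> and \<open>b\<close>. Upper bounds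
  in place of the norms keep the divisors positive; Minkowski's inequality follows by shrinking
  them.\<close>

lemma Ip_add_normalized:
assumes p: "p > 1" and f: "Lp M p f" "Ip M p f<=a powr p" and g: "Lp M p g" "Ip M p g<=b powr p" and ab: "a > 0" "b > 0"
shows "Ip M p (%x. f x + g x)<=(a + b) powr p"
proof -
let ?s = "a / (a + b)" and ?t = "b / (a + b)"
have st: "?s + ?t = 1" "0<=?s" "0<=?t" using ab by (auto simp: add_divide_distrib[symmetric])
have cv: "convex_on {0..} (%x::real. x powr p)"
proof -
 have "convex_on UNIV (%x::real. abs x powr p)"
 proof (rule convex_onI)
  fix t x y :: real assume t: "0 < t" "t < 1"
  let ?m = "(1 - t) * x + t * y"
  have "abs (?m) powr p + p * (Ap p ?m \<bullet> (x - ?m))<=abs x powr p" "abs (?m) powr p + p * (Ap p ?m \<bullet> (y - ?m))<=abs y powr p"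
   using convex_tangent[OF p, of ?m x] convex_tangent[OF p, of ?m y] by simp_all
  hence "(1 - t) * (abs (?m) powr p + p * (Ap p ?m \<bullet> (x - ?m))) + t * (abs (?m) powr p + p * (Ap p ?m \<bullet> (y - ?m)))<=(1 - t) * abs x powr p + t * abs y powr p"
   using t by (intro add_mono mult_left_mono) auto
  moreover have "(1 - t) * (abs (?m) powr p + p * (Ap p ?m \<bullet> (x - ?m))) + t * (abs (?m) powr p + p * (Ap p ?m \<bullet> (y - ?m))) = abs (?m) powr p"
   by (simp add: algebra_simps)
  ultimately show "abs ((1 - t) *\<^sub>R x + t *\<^sub>R y) powr p<=(1 - t) * abs x powr p + t * abs y powr p" by simp
 qed simp
 hence "convex_on {0..} (%x::real. abs x powr p)" by (rule convex_on_subset) auto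
 thus ?thesis by (simp add: convex_on_def)
qed
have pw: "norm (f x + g x) powr p<=(a + b) powr p * (?s * (norm (f x) powr p / a powr p) + ?t * (norm (g x) powr p / b powr p))" for x
proof -
 have "norm (f x + g x) powr p<=((a + b) * (?s * (norm (f x) / a) + ?t * (norm (g x) / b))) powr p"
 proof (rule powr_mono2)
  have "a + b~=0" using ab by simp
  hence "(a + b) * (?s * (norm (f x) / a)) = norm (f x)" "(a + b) * (?t * (norm (g x) / b)) = norm (g x)" using ab by simp_all
  hence "(a + b) * (?s * (norm (f x) / a) + ?t * (norm (g x) / b)) = norm (f x) + norm (g x)" by (simp only: distrib_left)
  thus "norm (f x + g x)<=(a + b) * (?s * (norm (f x) / a) + ?t * (norm (g x) / b))" by (simp add: norm_triangle_ineq)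
 qed (use p in auto)
 also have "... = (a + b) powr p * (?s * (norm (f x) / a) + ?t * (norm (g x) / b)) powr p"
  using ab st by (intro powr_mult)
 also have "...<=(a + b) powr p * (?s * (norm (f x) / a) powr p + ?t * (norm (g x) / b) powr p)"
 proof (rule mult_left_mono)
  have "1 - ?t = ?s" using st(1) by linarith
  thus "(?s * (norm (f x) / a) + ?t * (norm (g x) / b)) powr p<=?s * (norm (f x) / a) powr p + ?t * (norm (g x) / b) powr p"
   using convex_onD[OF cv, of ?t "norm (f x) / a" "norm (g x) / b"] st(2,3) ab by simp
 qed simp
 also have "(norm (f x) / a) powr p = norm (f x) powr p / a powr p" using ab by (simp add: powr_divide)
 also have "(norm (g x) / b) powr p = norm (g x) powr p / b powr p" using ab by (simp add: powr_divide)
 finally show ?thesis .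
qed
have pp: "p > 0" using p by simp
have "Ip M p (%x. f x + g x)<=(LINT x|M. (a + b) powr p * (?s * (norm (f x) powr p / a powr p) + ?t * (norm (g x) powr p / b powr p)))"
 unfolding Ip_def by (rule integral_mono[OF Lp_int[OF Lp_add(1)[OF pp f(1) g(1)]]]) (use pw Lp_int[OF f(1)] Lp_int[OF g(1)] in auto)
also have "... = (a + b) powr p * (?s * (Ip M p f / a powr p) + ?t * (Ip M p g / b powr p))"
 using Lp_int[OF f(1)] Lp_int[OF g(1)] by (simp add: Ip_def)
also have "...<=(a + b) powr p * (?s * 1 + ?t * 1)"
 using f g ab st by (intro mult_left_mono add_mono) (auto simp: divide_le_eq)
finally show ?thesis using st by simp
qed

lemma minkowski:
assumes p: "p > 1" and f: "Lp M p f" and g: "Lp M p g"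
shows "Ip M p (%x. f x + g x) powr (1/p)<=Ip M p f powr (1/p) + Ip M p g powr (1/p)"
proof (rule field_le_epsilon)
fix e :: real assume e: "e > 0"
define a where "a = Ip M p f powr (1/p) + e/2"
define b where "b = Ip M p g powr (1/p) + e/2"
have ab: "a > 0" "b > 0" using e by (auto simp: a_def b_def add_nonneg_pos)
have *: "Ip M p h<=(Ip M p h powr (1/p) + e/2) powr p" for h :: "'a => 'b"
proof -
 have "Ip M p h = (Ip M p h powr (1/p)) powr p" using p Ip_nonneg[of M p h] by (simp add: powr_powr)
 also have "...<=(Ip M p h powr (1/p) + e/2) powr p" using p e by (intro powr_mono2) auto
 finally show ?thesis .
qed
have "Ip M p (%x. f x + g x)<=(a + b) powr p"
 by (rule Ip_add_normalized[OF p f _ g _ ab]) (use * in \<open>auto simp: a_def b_def\<close>)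
hence "Ip M p (%x. f x + g x) powr (1/p)<=((a + b) powr p) powr (1/p)" using p Ip_nonneg by (intro powr_mono2) auto
also have "... = a + b" using p ab by (simp add: powr_powr)
finally show "Ip M p (%x. f x + g x) powr (1/p)<=Ip M p f powr (1/p) + Ip M p g powr (1/p) + e" by (simp add: a_def b_def)
qed

lemma Ip_tendsto:
assumes p: "p > 1" and f: "!!n. Lp M p (f n)" "Lp M p g" and lim: "(%n. Ip M p (%x. f n x - g x))---->0"
shows "(%n. Ip M p (f n))---->Ip M p g"
proof -
define N where "N h = Ip M p h powr (1/p)" for h :: "'a => 'b"
have pp: "p > 0" using p by simp
have d: "Lp M p (%x. f n x - g x)" for n by (rule Lp_diff[OF pp f])
have 1: "N (f n)<=N (%x. f n x - g x) + N g" for n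
 using minkowski[OF p d[of n] f(2)] by (simp add: N_def)
have 2: "N g<=N (f n) + N (%x. f n x - g x)" for n
 using minkowski[OF p f(1)[of n] Lp_minus(1)[OF d[of n]]] Lp_minus(2)[of M p "%x. f n x - g x"] by (simp add: N_def)
have "(%n. N (%x. f n x - g x))---->0 powr (1/p)" unfolding N_def
 by (rule tendsto_powr'[OF lim tendsto_const]) (use p in \<open>auto simp: Ip_nonneg\<close>)
hence z: "(%n. N (%x. f n x - g x))---->0" by simp
have "(%n. N (f n) - N g)---->0"
 by (rule Lim_null_comparison[OF _ z]) (use 1 2 in \<open>auto intro!: always_eventually simp: abs_le_iff algebra_simps\<close>)
hence "(%n. N (f n))---->N g" by (simp add: LIM_zero_iff)
hence "(%n. N (f n) powr p)---->N g powr p" by (rule tendsto_powr') (use p N_def in auto)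
moreover have "N h powr p = Ip M p h" for h using p Ip_nonneg[of M p h] by (simp add: N_def powr_powr)
ultimately show ?thesis by simp
qed

lemma Ip_AE_subseq:
fixes f :: "nat => 'a => 'b::euclidean_space"
assumes p: "p > 0" and f: "!!n. Lp M p (f n)" "Lp M p g" and lim: "(%n. Ip M p (%x. f n x - g x))---->0"
shows "EX r. strict_mono (r::nat=>nat)&(AE x in M. (%n. f (r n) x)---->g x)"
proof -
have "EX r::nat=>nat. strict_mono r&(AE x in M. (%n. norm (f (r n) x - g x) powr p)---->0)"
 by (rule tendsto_L1_AE_subseq) (use Lp_int[OF Lp_diff(1)[OF p f]] lim in \<open>auto simp: Ip_def\<close>)
then obtain r where r: "strict_mono (r::nat=>nat)" "AE x in M. (%n. norm (f (r n) x - g x) powr p)---->0" by blast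
have "AE x in M. (%n. f (r n) x)---->g x" using r(2)
proof eventually_elim
 case (elim x)
 have "(%n. (norm (f (r n) x - g x) powr p) powr (1/p))---->0 powr (1/p)"
  by (rule tendsto_powr'[OF elim tendsto_const]) (use p in auto)
 hence "(%n. norm (f (r n) x - g x))---->0" using p by (simp add: powr_powr)
 thus ?case by (simp add: tendsto_norm_zero_iff LIM_zero_iff)
qed
thus ?thesis using r(1) by blast
qed

lemma Lp_fatou:
fixes f :: "nat => 'a => 'b::euclidean_space"
assumes p: "p > 0" and f: "!!n. Lp M p (f n)" and g: "g:borel_measurable M" and lim: "AE x in M. (%n. f n x)---->g x"
 and B: "!!n. Ip M p (f n)<=B"
shows "Lp M p g" "Ip M p g<=B"
proof -
note [measurable] = Lp_meas[OF f] g
have B0: "0<=B" using B[of 0] Ip_nonneg[of M p "f 0"] by linarith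
have nn: "(\<integral>\<^sup>+x. ennreal (norm (f n x) powr p) \<partial>M)<=ennreal B" for n
 using nn_integral_eq_integral[OF Lp_int[OF f[of n]]] B[of n] by (simp add: Ip_def ennreal_leI)
have "(\<integral>\<^sup>+x. ennreal (norm (g x) powr p) \<partial>M) = (\<integral>\<^sup>+x. liminf (%n. ennreal (norm (f n x) powr p)) \<partial>M)"
proof (rule nn_integral_cong_AE, use lim in eventually_elim)
 case (elim x)
 have "(%n. norm (f n x) powr p)---->norm (g x) powr p"
  by (intro tendsto_powr' tendsto_norm elim tendsto_const) (use p in auto)
 hence "(%n. ennreal (norm (f n x) powr p))---->ennreal (norm (g x) powr p)" by (intro tendsto_ennrealI)
 from lim_imp_Liminf[OF _ this] show ?case by simp
qed
also have "...<=liminf (%n. \<integral>\<^sup>+x. ennreal (norm (f n x) powr p) \<partial>M)" by (rule nn_integral_liminf) simp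
also have "...<=liminf (%n. ennreal B)" by (intro Liminf_mono always_eventually allI nn)
also have "... = ennreal B" by (simp add: Liminf_const)
finally have le: "(\<integral>\<^sup>+x. ennreal (norm (g x) powr p) \<partial>M)<=ennreal B" .
have i: "integrable M (%x. norm (g x) powr p)"
proof (rule integrableI_bounded)
 show "(\<integral>\<^sup>+x. ennreal (norm (norm (g x) powr p)) \<partial>M) < \<infinity>" using le by (simp add: le_less_trans)
qed simp
thus "Lp M p g" using g by (simp add: Lp_def)
show "Ip M p g<=B" using le B0 nn_integral_eq_integral[OF i] by (simp add: Ip_def)
qed

text \<open>On a finite measure space a Cauchy sequence for the exponent p is Cauchy in the mean, by
  \<open>t <= d + d powr (1 - p) * t powr p\<close>. An almost everywhere convergent subsequence
  provides the limit, and Fatou's lemma transfers the Cauchy estimate to it.\<close>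

lemma Lp_complete:
fixes f :: "nat => 'a => 'b::euclidean_space"
assumes p: "p > 1" and M: "finite_measure M" and f: "!!n. Lp M p (f n)"
 and cau: "!!e. e > 0==>EX N. ALL m>=N. ALL n>=N. Ip M p (%x. f m x - f n x) < e"
shows "EX g. Lp M p g&(%n. Ip M p (%x. f n x - g x))---->0"
proof -
interpret finite_measure M by (rule M)
have pp: "p > 0" using p by simp
note [measurable] = Lp_meas[OF f]
have pw: "t<=d + d powr (1 - p) * t powr p" if "t>=0" "d > 0" for t d :: real
proof (cases "t<=d")
 case True thus ?thesis by (simp add: add_increasing2)
next
 case False
 have "t = t powr (1 - p) * t powr p" using False that by (simp add: powr_add[symmetric])
 also have "...<=d powr (1 - p) * t powr p" using False that p by (intro mult_right_mono powr_mono2') auto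
 finally show ?thesis using that by simp
qed
have i1: "integrable M (f n)" for n
proof (rule Bintegrable_bound)
 show "integrable M (%x. 1 + 1 powr (1-p) * norm (f n x) powr p)" using Lp_int[OF f[of n]] by auto
 show "AE x in M. norm (f n x)<=norm (1 + 1 powr (1-p) * norm (f n x) powr p)" using pw[of _ 1] by (auto intro: order_trans)
qed simp
have c1: "EX N. ALL i>=N. ALL j>=N. (LINT x|M. norm (f i x - f j x)) < e" if e: "e > 0" for e
proof -
 \<comment> \<open>\<open>d\<close> makes the constant part at most half of \<open>e\<close>, then
   \<open>e'\<close> makes the power part less than the other half.\<close>
 define d where "d = e / (2 * (measure M (space M) + 1))"
 have mp: "measure M (space M) + 1 > 0" by (simp add: add_nonneg_pos)
 have d: "d > 0" using e mp by (simp add: d_def)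
 have dm: "d * measure M (space M)<=e/2" using e mp by (simp add: d_def divide_simps)
 define e' where "e' = e / (2 * d powr (1 - p))"
 have e': "e' > 0" using e d by (simp add: e'_def)
 obtain N where N: "ALL i>=N. ALL j>=N. Ip M p (%x. f i x - f j x) < e'" using cau[OF e'] by blast
 have "(LINT x|M. norm (f i x - f j x)) < e" if "i>=N" "j>=N" for i j
 proof -
  have "(LINT x|M. norm (f i x - f j x))<=(LINT x|M. d + d powr (1-p) * norm (f i x - f j x) powr p)"
   by (rule integral_mono) (use i1 Lp_int[OF Lp_diff(1)[OF pp f f]] pw d in auto)
  also have "... = d * measure M (space M) + d powr (1-p) * Ip M p (%x. f i x - f j x)"
   using Lp_int[OF Lp_diff(1)[OF pp f f]] by (simp add: Ip_def mult.commute)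
  also have "d powr (1-p) * Ip M p (%x. f i x - f j x) < d powr (1-p) * e'" using N that d by simp
  also have "d powr (1-p) * e' = e/2" using d by (simp add: e'_def)
  finally show ?thesis using dm by linarith
 qed
 thus ?thesis by blast
qed
obtain r where r: "strict_mono r" "AE x in M. Cauchy (%i. f (r i) x)"
 using cauchy_L1_AE_cauchy_subseq[of M f, OF i1 c1] by blast
define g where "g x = lim (%i. f (r i) x)" for x
have gm [measurable]: "g:borel_measurable M" unfolding g_def by measurable
have lim: "AE x in M. (%i. f (r i) x)---->g x" using r(2)
 by eventually_elim (simp add: g_def Cauchy_convergent_iff convergent_LIMSEQ_iff)
have main: "Lp M p (%x. f n x - g x)&Ip M p (%x. f n x - g x)<=e" if n: "!!m. m>=N==>Ip M p (%x. f n x - f m x)<=e" for n N e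
proof -
 have l2: "AE x in M. (%i. f n x - f (r (i + N)) x)---->f n x - g x" using lim
  by eventually_elim (intro tendsto_intros LIMSEQ_ignore_initial_segment)
 have "r (i + N)>=N" for i using seq_suble[OF r(1), of "i + N"] by linarith
 hence "Ip M p (%x. f n x - f (r (i + N)) x)<=e" for i using n by blast
 from Lp_fatou[OF pp Lp_diff(1)[OF pp f f] _ l2 this] show ?thesis by simp
qed
obtain N1 where N1: "ALL m>=N1. ALL n>=N1. Ip M p (%x. f m x - f n x) < 1" using cau[of 1] by auto
hence "Lp M p (%x. f N1 x - g x)" using main[of N1 N1 1] by (meson less_imp_le order_refl)
from Lp_diff(1)[OF pp f[of N1] this] have g: "Lp M p g" by simp
have "(%n. Ip M p (%x. f n x - g x))---->0"
proof (rule LIMSEQ_I)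
 fix e :: real assume "e > 0"
 then obtain N where N: "ALL m>=N. ALL n>=N. Ip M p (%x. f m x - f n x) < e/2" using cau[of "e/2"] by auto
 have "norm (Ip M p (%x. f n x - g x) - 0) < e" if "n>=N" for n
 proof -
  have "Ip M p (%x. f n x - g x)<=e/2" using main[of N n "e/2"] N that by (meson less_imp_le)
  thus ?thesis using Ip_nonneg[of M p "%x. f n x - g x"] \<open>e > 0\<close> by simp
 qed
 thus "EX N. ALL n>=N. norm (Ip M p (%x. f n x - g x) - 0) < e" by blast
qed
thus ?thesis using g by blast
qed

lemma Ap_tendsto:
fixes f :: "nat => 'b::euclidean_space"
assumes p: "p > 1" and lim: "f---->a"
shows "(%n. Ap p (f n))---->Ap p a"
proof (cases "a = 0")
\<comment> \<open>At 0 the factor \<open>norm a powr (p - 2)\<close> may blow up when p < 2, so the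
  norm of the whole expression is used.\<close>
case True
have "(%n. norm (f n) powr (p - 1))---->norm a powr (p - 1)"
 by (intro tendsto_powr' tendsto_norm lim tendsto_const) (use p in auto)
hence "(%n. norm (Ap p (f n)))---->0" using True p by (simp add: norm_Ap)
hence "(%n. Ap p (f n))---->0" by (rule tendsto_norm_zero_cancel)
thus ?thesis using True by (simp add: Ap_def)
next
case False
show ?thesis unfolding Ap_def
 by (intro tendsto_scaleR tendsto_powr tendsto_norm lim tendsto_const) (use False in auto)
qed

lemma Ap_measurable [measurable]:
fixes f :: "'a => 'b::euclidean_space"
assumes [measurable]: "f:borel_measurable M"
shows "(%x. Ap p (f x)):borel_measurable M"
unfolding Ap_def by measurable

lemma integrable_Ap_inner:
assumes p: "p > 1" and f: "Lp M p f" "Lp M p g"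
shows "integrable M (%x. Ap p (f x) \<bullet> g x)"
proof (rule Bintegrable_bound)
note [measurable] = Lp_meas[OF f(1)] Lp_meas[OF f(2)]
show "integrable M (%x. norm (f x) powr p + norm (g x) powr p)" using f by (auto simp: Lp_def)
show "(%x. Ap p (f x) \<bullet> g x):borel_measurable M" by measurable
show "AE x in M. norm (Ap p (f x) \<bullet> g x)<=norm (norm (f x) powr p + norm (g x) powr p)" using Ap_inner_le'[OF p] by auto
qed

text \<open>Strong convergence of gradients carries over to the fluxes, tested with a fixed
  function. The majorants move with the index, which calls for \<open>generalized_dct\<close> along
  subsequences.\<close>

lemma Ap_inner_tendsto:
assumes p: "p > 1" and f: "!!n. Lp M p (f n)" "Lp M p f'" and lim: "(%n. Ip M p (%x. f n x - f' x))---->0"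
 and g: "Lp M p g"
shows "(%n. \<integral>x. Ap p (f n x) \<bullet> g x \<partial>M)---->(LINT x|M. Ap p (f' x) \<bullet> g x)"
proof (rule tendsto_subseqI)
fix s :: "nat => nat" assume s: "strict_mono s"
have pp: "p > 0" using p by simp
have lim1: "(%n. Ip M p (%x. f (s n) x - f' x))---->0" by (rule subseq_tendsto[OF lim s])
obtain r where r: "strict_mono (r::nat=>nat)" "AE x in M. (%n. f (s (r n)) x)---->f' x"
 using Ip_AE_subseq[OF pp f(1) f(2) lim1] by blast
have lim2: "(%n. Ip M p (%x. f (s (r n)) x - f' x))---->0" by (rule subseq_tendsto[OF lim1 r(1)])
note [measurable] = Lp_meas[OF f(1)] Lp_meas[OF f(2)] Lp_meas[OF g]
have "(%n. \<integral>x. Ap p (f (s (r n)) x) \<bullet> g x \<partial>M)---->(LINT x|M. Ap p (f' x) \<bullet> g x)"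
proof (rule generalized_dct(4))
 show "integrable M (%x. norm (f (s (r n)) x) powr p + norm (g x) powr p)" for n using f g by (auto simp: Lp_def)
 show "integrable M (%x. norm (f' x) powr p + norm (g x) powr p)" using f g by (auto simp: Lp_def)
 show "AE x in M. (%n. Ap p (f (s (r n)) x) \<bullet> g x)---->Ap p (f' x) \<bullet> g x"
  using r(2) by eventually_elim (intro tendsto_inner Ap_tendsto[OF p] tendsto_const)
 show "AE x in M. (%n. norm (f (s (r n)) x) powr p + norm (g x) powr p)---->norm (f' x) powr p + norm (g x) powr p"
  using r(2) by eventually_elim (intro tendsto_intros tendsto_powr' tendsto_norm, use p in auto)
 show "AE x in M. norm (Ap p (f (s (r n)) x) \<bullet> g x)<=norm (f (s (r n)) x) powr p + norm (g x) powr p" for n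
  using Ap_inner_le'[OF p] by auto
 have "(%n. Ip M p (f (s (r n))) + Ip M p g)---->Ip M p f' + Ip M p g"
  by (intro tendsto_intros Ip_tendsto[OF p f(1) f(2) lim2])
 thus "(%n. \<integral>x. norm (f (s (r n)) x) powr p + norm (g x) powr p \<partial>M)---->(LINT x|M. norm (f' x) powr p + norm (g x) powr p)"
  using Lp_int[OF f(1)] Lp_int[OF f(2)] Lp_int[OF g] by (simp add: Ip_def)
qed auto
thus "EX r. strict_mono (r::nat=>nat)&(%k. \<integral>x. Ap p (f (s (r k)) x) \<bullet> g x \<partial>M)---->(LINT x|M. Ap p (f' x) \<bullet> g x)"
 using r(1) by blast
qed

lemma Lp_mono_exp:
assumes M: "finite_measure M" and pq: "0 < p" "p<=q" and f: "Lp M q f"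
shows "Lp M p f" "Ip M p f<=measure M (space M) + Ip M q f"
proof -
interpret finite_measure M by (rule M)
have le: "t powr p<=1 + t powr q" if "t>=0" for t :: real
proof (cases "t<=1")
 case True
 hence "t powr p<=1 powr p" using that pq by (intro powr_mono2) auto
 thus ?thesis by (simp add: add_increasing2)
next
 case False hence "t powr p<=t powr q" using pq by (intro powr_mono) auto
 thus ?thesis by simp
qed
have i: "integrable M (%x. 1 + norm (f x) powr q)" using Lp_int[OF f] by auto
show l: "Lp M p f" by (rule Lp_bound[OF Lp_meas[OF f] i]) (use le in auto)
have "Ip M p f<=(LINT x|M. 1 + norm (f x) powr q)" unfolding Ip_def
 by (rule integral_mono[OF Lp_int[OF l] i]) (use le in auto)
thus "Ip M p f<=measure M (space M) + Ip M q f" using Lp_int[OF f] by (simp add: Ip_def)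
qed

section \<open>Test functions\<close>

text \<open>Integrate the supporting inequality at the mean value: its linear part vanishes.\<close>

lemma jensen_mean:
fixes f :: "'a => 'b::euclidean_space"
assumes p: "p > 1" and M: "finite_measure M" and m: "m = measure M (space M)" "m > 0" and f: "integrable M f" "Lp M p f"
shows "norm ((1/m) *\<^sub>R (LINT x|M. f x)) powr p<=(1/m) * Ip M p f"
proof -
interpret finite_measure M by (rule M)
define a where "a = (1/m) *\<^sub>R (LINT x|M. f x)"
have "(LINT x|M. norm a powr p + p * (Ap p a \<bullet> (f x - a)))<=(LINT x|M. norm (f x) powr p)"
 by (rule integral_mono) (use f Lp_int[OF f(2)] convex_tangent[OF p] in auto)
also have "(LINT x|M. norm a powr p + p * (Ap p a \<bullet> (f x - a))) = m * norm a powr p + p * (Ap p a \<bullet> ((LINT x|M. f x) - m *\<^sub>R a))"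
proof -
 have "(LINT x|M. Ap p a \<bullet> (f x - a)) = Ap p a \<bullet> (LINT x|M. f x - a)" using f by (intro integral_inner_right) auto
 also have "(LINT x|M. f x - a) = (LINT x|M. f x) - m *\<^sub>R a" using f m by (simp add: m(1)[symmetric])
 finally have "(LINT x|M. p * (Ap p a \<bullet> (f x - a))) = p * (Ap p a \<bullet> ((LINT x|M. f x) - m *\<^sub>R a))" by simp
 moreover have "(LINT x|M. norm a powr p) = m * norm a powr p" by (simp add: m(1))
 moreover have "integrable M (%x. p * (Ap p a \<bullet> (f x - a)))" using f by auto
 ultimately show ?thesis by (subst Bintegral_add) auto
qed
also have "(LINT x|M. f x) - m *\<^sub>R a = 0" using m(2) by (simp add: a_def)
finally have "m * norm a powr p<=Ip M p f" by (simp add: Ip_def)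
thus ?thesis unfolding a_def[symmetric] using m(2) by (simp add: field_simps)
qed

definition tsupp :: "('a::topological_space => real) => 'a set" where "tsupp ph = closure {x. ph x~=0}"

lemma test_pairD:
assumes "test_pair \<Omega> ph g"
shows "continuous_on UNIV g" "(ph has_derivative (%v. g x \<bullet> v)) (at x)" "compact (tsupp ph)" "tsupp ph \<subseteq> \<Omega>"
 "continuous_on UNIV ph"
using assms by (auto simp: test_pair_def tsupp_def intro!: continuous_at_imp_continuous_on has_derivative_continuous)

lemma gradient_unique:
assumes "(ph has_derivative (%v. a \<bullet> v)) (at x)" "(ph has_derivative (%v. b \<bullet> v)) (at x)"
shows "a = b"
proof -
have "(%v. a \<bullet> v) = (%v. b \<bullet> v)" by (rule has_derivative_unique[OF assms])
hence "!!v. a \<bullet> v = b \<bullet> v" by metis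
thus ?thesis by (metis vector_eq_rdot inner_commute)
qed

lemma test_pair_zero:
assumes t: "test_pair \<Omega> ph g" and x: "x ~: tsupp ph"
shows "ph x = 0" "g x = 0"
proof -
have z: "ph y = 0" if "y ~: tsupp ph" for y
proof (rule ccontr)
 assume "ph y~=0"
 hence "y:tsupp ph" unfolding tsupp_def by (intro subsetD[OF closure_subset]) simp
 with that show False by contradiction
qed
show "ph x = 0" by (rule z[OF x])
have o: "open (- tsupp ph)" by (auto simp: tsupp_def)
have "((%_. 0) has_derivative (%v. g x \<bullet> v)) (at x)"
 by (rule has_derivative_transform_within_open[OF test_pairD(2)[OF t] o]) (use x z in auto)
moreover have "((%_. 0::real) has_derivative (%v. 0 \<bullet> v)) (at x)" by simp
ultimately show "g x = 0" by (rule gradient_unique)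
qed

lemma test_pair_zero_out: "test_pair \<Omega> ph g==>x ~: \<Omega>==>ph x = 0&g x = 0"
using test_pair_zero[of \<Omega> ph g x] test_pairD(4)[of \<Omega> ph g] by blast

lemma test_pairI:
assumes "continuous_on UNIV g" "!!x. (ph has_derivative (%v. g x \<bullet> v)) (at x)" "compact K" "K \<subseteq> \<Omega>" "!!x. x ~: K==>ph x = 0"
shows "test_pair \<Omega> ph g"
proof -
have "closure {x. ph x~=0} \<subseteq> K" by (rule closure_minimal) (use assms compact_imp_closed in auto)
moreover from this have "compact (closure {x. ph x~=0})" using compact_Int_closed[OF assms(3), of "closure {x. ph x~=0}"] by (simp add: Int_absorb1)
ultimately show ?thesis using assms unfolding test_pair_def by blast
qed

lemma test_pair_add:
assumes "test_pair \<Omega> ph g" "test_pair \<Omega> ps h"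
shows "test_pair \<Omega> (%x. ph x + ps x) (%x. g x + h x)"
proof (rule test_pairI)
show "continuous_on UNIV (%x. g x + h x)" using assms by (auto intro!: continuous_intros dest: test_pairD(1))
show "((%x. ph x + ps x) has_derivative (%v. (g x + h x) \<bullet> v)) (at x)" for x
 using has_derivative_add[OF test_pairD(2)[OF assms(1)] test_pairD(2)[OF assms(2)]] by (simp add: inner_add_left)
show "compact (tsupp ph \<union> tsupp ps)" using assms test_pairD(3) by blast
show "tsupp ph \<union> tsupp ps \<subseteq> \<Omega>" using assms test_pairD(4) by blast
show "x ~: tsupp ph \<union> tsupp ps==>ph x + ps x = 0" for x
 using test_pair_zero(1)[OF assms(1), of x] test_pair_zero(1)[OF assms(2), of x] by simp
qed

lemma test_pair_scale:
assumes "test_pair \<Omega> ph g"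
shows "test_pair \<Omega> (%x. c * ph x) (%x. c *\<^sub>R g x)"
proof (rule test_pairI[OF _ _ test_pairD(3,4)[OF assms]])
show "continuous_on UNIV (%x. c *\<^sub>R g x)" using assms by (auto intro!: continuous_intros dest: test_pairD(1))
show "((%x. c * ph x) has_derivative (%v. (c *\<^sub>R g x) \<bullet> v)) (at x)" for x
 using has_derivative_mult_right[OF test_pairD(2)[OF assms], of c x] by simp
show "x ~: tsupp ph==>c * ph x = 0" for x using test_pair_zero[OF assms] by simp
qed

lemma test_pair_diff:
assumes "test_pair \<Omega> ph g" "test_pair \<Omega> ps h"
shows "test_pair \<Omega> (%x. ph x - ps x) (%x. g x - h x)"
using test_pair_add[OF assms(1) test_pair_scale[OF assms(2), of "-1"]] by simp

lemma test_pair_comp: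
assumes t: "test_pair \<Omega> ph g" and d: "!!s. (Th has_real_derivative Th' s) (at s)" and c: "continuous_on UNIV Th'" and z: "Th 0 = 0"
shows "test_pair \<Omega> (%x. Th (ph x)) (%x. Th' (ph x) *\<^sub>R g x)"
proof (rule test_pairI[OF _ _ test_pairD(3,4)[OF t]])
show "continuous_on UNIV (%x. Th' (ph x) *\<^sub>R g x)"
 by (intro continuous_intros continuous_on_compose2[OF c] test_pairD(1,5)[OF t]) auto
show "((%x. Th (ph x)) has_derivative (%v. (Th' (ph x) *\<^sub>R g x) \<bullet> v)) (at x)" for x
 using has_derivative_compose[OF test_pairD(2)[OF t] d[unfolded has_field_derivative_def]] by simp
show "x ~: tsupp ph==>Th (ph x) = 0" for x using test_pair_zero[OF t] z by simp
qed

lemma test_pair_mult: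
assumes t: "test_pair \<Omega> ph g" and d: "!!x. (a has_derivative (%v. b x \<bullet> v)) (at x)" and c: "continuous_on UNIV b"
shows "test_pair \<Omega> (%x. ph x * a x) (%x. ph x *\<^sub>R b x + a x *\<^sub>R g x)"
proof (rule test_pairI[OF _ _ test_pairD(3,4)[OF t]])
have ca: "continuous_on UNIV a" by (intro continuous_at_imp_continuous_on ballI has_derivative_continuous[OF d])
show "continuous_on UNIV (%x. ph x *\<^sub>R b x + a x *\<^sub>R g x)"
 by (intro continuous_intros c ca test_pairD(1,5)[OF t])
show "((%x. ph x * a x) has_derivative (%v. (ph x *\<^sub>R b x + a x *\<^sub>R g x) \<bullet> v)) (at x)" for x
 using has_derivative_mult[OF test_pairD(2)[OF t] d, of x] by (simp add: inner_add_left mult.commute)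
show "x ~: tsupp ph==>ph x * a x = 0" for x using test_pair_zero[OF t] by simp
qed

lemma compact_support_integrable:
fixes f :: "'a::euclidean_space => 'b::euclidean_space"
assumes "continuous_on UNIV f" "compact K" "!!x. x ~: K==>f x = 0"
shows "integrable lborel f"
proof -
have "integrable lborel (%x. indicator K x *\<^sub>R f x)"
 by (rule borel_integrable_compact[OF assms(2) continuous_on_subset[OF assms(1)]]) simp
moreover have "(%x. indicator K x *\<^sub>R f x) = f" using assms(3) by (auto simp: indicator_def)
ultimately show ?thesis by simp
qed

lemma compact_support_Lp:
fixes f :: "'a::euclidean_space => 'b::euclidean_space"
assumes f: "continuous_on UNIV f" "compact K" "!!x. x ~: K==>f x = 0" and p: "p > 0"
shows "Lp lborel p f"
unfolding Lp_def
proof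
show "f:borel_measurable lborel" using borel_measurable_continuous_onI[OF f(1)] by simp
show "integrable lborel (%x. norm (f x) powr p)"
 by (rule compact_support_integrable[OF _ f(2)]) (use f p in \<open>auto intro!: continuous_on_powr' continuous_on_norm continuous_on_const\<close>)
qed

lemma test_pair_bounded:
assumes t: "test_pair \<Omega> ph g"
shows "EX B>0. ALL x. abs (ph x)<=B&norm (g x)<=B"
proof -
let ?K = "tsupp ph"
have "compact (ph ` ?K)" "compact (g ` ?K)"
 by (rule compact_continuous_image[OF continuous_on_subset[OF test_pairD(5)[OF t]] test_pairD(3)[OF t]], simp)
   (rule compact_continuous_image[OF continuous_on_subset[OF test_pairD(1)[OF t]] test_pairD(3)[OF t]], simp)
hence "bounded (ph ` ?K)" "bounded (g ` ?K)" by (auto intro: compact_imp_bounded)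
then obtain B1 B2 where "ALL y:ph ` ?K. norm y<=B1" "ALL y:g ` ?K. norm y<=B2" unfolding bounded_iff by blast
hence B: "!!x. x:?K==>norm (ph x)<=B1" "!!x. x:?K==>norm (g x)<=B2" by blast+
have "abs (ph x)<=max 1 (max B1 B2)&norm (g x)<=max 1 (max B1 B2)" for x
 using B[of x] test_pair_zero[OF t, of x] by (cases "x:?K") auto
thus ?thesis by (intro exI[of _ "max 1 (max B1 B2)"]) auto
qed

lemma test_pair_Lp:
assumes t: "test_pair \<Omega> ph g" and p: "p > 0"
shows "Lp lborel p ph" "Lp lborel p g"
using test_pair_zero[OF t] by (auto intro!: compact_support_Lp[OF _ test_pairD(3)[OF t] _ p] test_pairD[OF t])

lemma test_pair_measurable [measurable_dest]:
assumes t: "test_pair \<Omega> ph g"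
shows "ph:borel_measurable borel" "g:borel_measurable borel"
using borel_measurable_continuous_onI test_pairD[OF t] by blast+

section \<open>Translation estimates and integration by parts\<close>

lemma nn_integral_shift:
fixes f :: "'a::euclidean_space => ennreal"
assumes [measurable]: "f:borel_measurable borel"
shows "(\<integral>\<^sup>+x. f (x + h) \<partial>lborel) = (\<integral>\<^sup>+x. f x \<partial>lborel)"
proof -
have "(\<integral>\<^sup>+x. f x \<partial>lborel) = (\<integral>\<^sup>+x. f x \<partial>distr lborel borel ((+) h))" by (simp add: lborel_distr_plus)
also have "... = (\<integral>\<^sup>+x. f (h + x) \<partial>lborel)" by (rule nn_integral_distr) auto
finally show ?thesis by (simp add: add.commute)
qed

lemma integral_shift:
fixes f :: "'a::euclidean_space => 'b::euclidean_space"
assumes [measurable]: "f:borel_measurable borel"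
shows "(LINT x|lborel. f (x + h)) = (LINT x|lborel. f x)"
proof -
have "(LINT x|lborel. f x) = (\<integral>x. f x \<partial>distr lborel borel ((+) h))" by (simp add: lborel_distr_plus)
also have "... = (LINT x|lborel. f (h + x))" by (rule integral_distr) auto
finally show ?thesis by (simp add: add.commute)
qed

lemma integrable_shift:
fixes f :: "'a::euclidean_space => 'b::euclidean_space"
assumes "integrable lborel f"
shows "integrable lborel (%x. f (x + h))"
proof -
have "integrable (distr lborel borel ((+) h)) f" using assms by (simp add: lborel_distr_plus)
from integrable_distr[OF _ this] show ?thesis by (simp add: add.commute)
qed

lemma nn_integral_powr_eq:
assumes "Lp M p f"
shows "(\<integral>\<^sup>+x. ennreal (norm (f x) powr p) \<partial>M) = ennreal (Ip M p f)"
unfolding Ip_def by (rule nn_integral_eq_integral[OF Lp_int[OF assms]]) simp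

abbreviation (input) dshift :: "real => ('a::euclidean_space => real) => 'a => 'a => ennreal"
where "dshift p ph h x \<equiv> ennreal (abs (ph (x + h) - ph x) powr p)"

text \<open>The increment is the integral of the directional derivative along the segment; Jensen's
  inequality, Tonelli's theorem and translation invariance bound it. Nonnegative integrals are used
  so that the order of integration can be exchanged without prior integrability.\<close>

lemma translation_estimate_nn:
fixes ph :: "'a::euclidean_space => real"
assumes p: "p > 1" and t: "test_pair \<Omega> ph g"
shows "(\<integral>\<^sup>+x. dshift p ph h x \<partial>lborel)<=ennreal (norm h powr p * Ip lborel p g)"
proof -
note [measurable] = test_pair_measurable[OF t]
define R where "R = restrict_space lborel {0..1::real}"
have R: "finite_measure R" "measure R (space R) = 1"
 unfolding R_def by (auto simp: finite_measure_restrict_space space_restrict_space measure_restrict_space intro!: finite_measureI)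
  (auto simp: emeasure_restrict_space)
interpret R: finite_measure R by (rule R)
interpret P: pair_sigma_finite R "lborel :: 'a measure" ..
have [measurable]: "(%t. t):borel_measurable R" unfolding R_def by (intro measurable_restrict_space1) simp
obtain B where B: "B > 0" "!!x. norm (g x)<=B" using test_pair_bounded[OF t] by blast
have pw: "dshift p ph h x<=(\<integral>\<^sup>+s. ennreal (norm h powr p * norm (g (x + s *\<^sub>R h)) powr p) \<partial>R)" for x
proof -
 define f where "f s = g (x + s *\<^sub>R h) \<bullet> h" for s
 have fm [measurable]: "f:borel_measurable R" unfolding f_def by measurable
 have fb: "norm (f s)<=B * norm h" for s
  unfolding f_def real_norm_def using Cauchy_Schwarz_ineq2[of "g (x + s *\<^sub>R h)" h] B(2)[of "x + s *\<^sub>R h"]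
  by (meson mult_right_mono norm_ge_zero order_trans)
 have fi: "integrable R f" by (rule R.integrable_const_bound[of _ "B * norm h"]) (use fb in auto)
 have fL: "Lp R p f"
 proof (rule Lp_bound[OF fm, where w = "%_. (B * norm h) powr p"])
  show "AE x in R. norm (f x) powr p<=(B * norm h) powr p" using fb p by (auto intro!: powr_mono2)
 qed simp
 have "(LINT s|R. f s) = (LINT s|lborel. indicator {0..1} s *\<^sub>R f s)" unfolding R_def by (rule integral_restrict_space) simp
 also have "... = ph (x + 1 *\<^sub>R h) - ph (x + 0 *\<^sub>R h)"
 proof (rule integral_FTC_Icc)
  have d: "((%s. ph (x + s *\<^sub>R h)) has_derivative (%v. g (x + s *\<^sub>R h) \<bullet> (v *\<^sub>R h))) (at s within {0..1})" for s
   by (rule has_derivative_compose[OF _ test_pairD(2)[OF t]]) (auto intro!: derivative_eq_intros)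
  show "((%s. ph (x + s *\<^sub>R h)) has_vector_derivative f s) (at s within {0..1})" for s
   using d[of s] by (simp add: has_vector_derivative_def f_def)
  show "continuous_on {0..1} f" unfolding f_def
   by (intro continuous_intros continuous_on_compose2[OF test_pairD(1)[OF t]]) auto
 qed auto
 finally have eq: "(LINT s|R. f s) = ph (x + h) - ph x" by simp
 have "dshift p ph h x<=ennreal (Ip R p f)"
  using jensen_mean[OF p R(1) R(2)[symmetric] zero_less_one fi fL] unfolding eq by (simp add: ennreal_leI)
 also have "... = (\<integral>\<^sup>+s. ennreal (norm (f s) powr p) \<partial>R)" by (rule nn_integral_powr_eq[OF fL, symmetric])
 also have "...<=(\<integral>\<^sup>+s. ennreal (norm h powr p * norm (g (x + s *\<^sub>R h)) powr p) \<partial>R)"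
 proof (rule nn_integral_mono, rule ennreal_leI)
  fix s
  have "norm (f s)<=norm h * norm (g (x + s *\<^sub>R h))" unfolding f_def real_norm_def using Cauchy_Schwarz_ineq2[of "g (x + s *\<^sub>R h)" h] by (simp add: mult.commute)
  hence "norm (f s) powr p<=(norm h * norm (g (x + s *\<^sub>R h))) powr p" using p by (intro powr_mono2) auto
  thus "norm (f s) powr p<=norm h powr p * norm (g (x + s *\<^sub>R h)) powr p" by (simp add: powr_mult)
 qed
 finally show ?thesis .
qed
have "(\<integral>\<^sup>+x. dshift p ph h x \<partial>lborel)<=(\<integral>\<^sup>+x. (\<integral>\<^sup>+s. ennreal (norm h powr p * norm (g (x + s *\<^sub>R h)) powr p) \<partial>R) \<partial>lborel)"
 by (rule nn_integral_mono[OF pw])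
also have "... = (\<integral>\<^sup>+s. (\<integral>\<^sup>+x. ennreal (norm h powr p * norm (g (x + s *\<^sub>R h)) powr p) \<partial>lborel) \<partial>R)"
 by (rule P.Fubini') measurable
also have "... = (\<integral>\<^sup>+s. ennreal (norm h powr p * Ip lborel p g) \<partial>R)"
proof (rule nn_integral_cong)
 fix s
 have "(\<integral>\<^sup>+x. ennreal (norm h powr p * norm (g (x + s *\<^sub>R h)) powr p) \<partial>lborel) = (\<integral>\<^sup>+x. ennreal (norm h powr p * norm (g x) powr p) \<partial>lborel)"
  by (rule nn_integral_shift[of "%x. ennreal (norm h powr p * norm (g x) powr p)"]) measurable
 also have "... = ennreal (norm h powr p * Ip lborel p g)"
  using nn_integral_powr_eq[OF test_pair_Lp(2)[OF t, of p]] p by (simp add: ennreal_mult nn_integral_cmult Ip_nonneg)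
 finally show "(\<integral>\<^sup>+x. ennreal (norm h powr p * norm (g (x + s *\<^sub>R h)) powr p) \<partial>lborel) = ennreal (norm h powr p * Ip lborel p g)" .
qed
also have "... = ennreal (norm h powr p * Ip lborel p g)" using R by (simp add: R.emeasure_eq_measure)
finally show ?thesis .
qed

text \<open>A shift by the diameter of the ball moves the support off itself, so the function is
  dominated by its own increment, and the translation estimate becomes Poincare's inequality with
  constant \<open>(2*R) powr p\<close>.\<close>

lemma poincare_test:
fixes ph :: "'a::euclidean_space => real"
assumes p: "p > 1" and t: "test_pair \<Omega> ph g" and b: "\<Omega> \<subseteq> ball 0 R"
shows "Ip lborel p ph<=(2*R) powr p * Ip lborel p g"
proof (cases "R > 0")
case False
hence "ball (0::'a) R = {}" by (intro ball_empty) simp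
hence "\<Omega> = {}" using b by blast
hence "ph x = 0" for x using test_pair_zero_out[OF t, of x] by simp
thus ?thesis by (simp add: Ip_def)
next
case True
note [measurable] = test_pair_measurable[OF t]
obtain e :: 'a where e: "norm e = 1" using vector_choose_size[of 1] by auto
define h where "h = (2*R) *\<^sub>R e"
have nh: "norm h = 2*R" using e True by (simp add: h_def)
have pp: "p > 0" using p by simp
have disj: "ph (x + h) = 0 \<or> ph x = 0" for x
proof (rule ccontr)
 assume "~ ?thesis"
 hence "x + h:\<Omega>" "x:\<Omega>" using test_pair_zero_out[OF t] by blast+
 hence "norm (x + h) < R" "norm x < R" using b by auto
 thus False using norm_triangle_ineq4[of "x + h" x] nh by simp
qed
have "ennreal (Ip lborel p ph) = (\<integral>\<^sup>+x. ennreal (abs (ph x) powr p) \<partial>lborel)"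
 using nn_integral_powr_eq[OF test_pair_Lp(1)[OF t pp]] by simp
also have "...<=(\<integral>\<^sup>+x. dshift p ph h x \<partial>lborel)"
proof -
 have "(\<integral>\<^sup>+x. ennreal (abs (ph x) powr p) \<partial>lborel)<=(\<integral>\<^sup>+x. dshift p ph h x \<partial>lborel)"
 proof (rule nn_integral_mono, rule ennreal_leI)
  fix x show "abs (ph x) powr p<=abs (ph (x + h) - ph x) powr p"
   using disj[of x] by (elim disjE) simp_all
 qed
 thus ?thesis .
qed
also have "...<=ennreal ((2*R) powr p * Ip lborel p g)" using translation_estimate_nn[OF p t, of h] by (simp add: nh)
finally show ?thesis by (subst (asm) ennreal_le_iff) (simp_all add: Ip_nonneg)
qed

text \<open>Difference quotients integrate to 0 by translation invariance, and they converge
  boundedly with supports in the compact unit neighbourhood \<open>K'\<close> of the support.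
  Integration by parts is this fact for a product.\<close>

lemma integral_grad_zero:
fixes ph :: "'a::euclidean_space => real"
assumes t: "test_pair \<Omega> ph g"
shows "(LINT x|lborel. g x) = 0"
proof -
note [measurable] = test_pair_measurable[OF t]
have gi: "integrable lborel g"
 by (rule compact_support_integrable[OF test_pairD(1,3)[OF t]]) (use test_pair_zero[OF t] in auto)
have phi: "integrable lborel ph"
 by (rule compact_support_integrable[OF test_pairD(5,3)[OF t]]) (use test_pair_zero[OF t] in auto)
obtain B where B: "B > 0" "!!x. norm (g x)<=B" using test_pair_bounded[OF t] by blast
let ?K = "tsupp ph"
have "(LINT x|lborel. g x \<bullet> v) = 0" if v: "norm v<=1" for v
proof -
 define q where "q n x = real (Suc n) * (ph (x + (1 / real (Suc n)) *\<^sub>R v) - ph x)" for n x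
 have int0: "(LINT x|lborel. q n x) = 0" for n
 proof -
  have "integrable lborel (%x. ph (x + (1 / real (Suc n)) *\<^sub>R v))"
   by (rule integrable_shift[OF phi])
  thus ?thesis using phi integral_shift[of ph "(1 / real (Suc n)) *\<^sub>R v"] by (simp add: q_def)
 qed
 have "(%n. \<integral>x. q n x \<partial>lborel)---->(LINT x|lborel. g x \<bullet> v)"
 proof (rule integral_dominated_convergence)
  define K' where "K' = (\<Union>x\<in>?K. \<Union>y\<in>cball 0 1. {x + y :: 'a})"
  have cK: "compact K'" unfolding K'_def by (rule compact_sums'[OF test_pairD(3)[OF t] compact_cball])
  show "integrable lborel (%x. B * indicator K' x)"
   using cK emeasure_compact_finite by (intro integrable_mult_right integrable_real_indicator) (auto simp: borel_compact)
  show "AE x in lborel. (%n. q n x)---->g x \<bullet> v"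
  proof (rule AE_I2)
   fix x
   have "((%s. ph (x + s *\<^sub>R v)) has_derivative (%s. g (x + 0 *\<^sub>R v) \<bullet> (s *\<^sub>R v))) (at 0)"
    by (rule has_derivative_compose[OF _ test_pairD(2)[OF t]]) (auto intro!: derivative_eq_intros)
   hence "((%s. ph (x + s *\<^sub>R v)) has_real_derivative (g x \<bullet> v)) (at 0)"
    by (simp add: has_field_derivative_def mult_commute_abs)
   hence "((%h. (ph (x + h *\<^sub>R v) - ph x) / h) \<longlongrightarrow> g x \<bullet> v) (at 0)" by (simp add: DERIV_def)
   moreover have "filterlim (%n. 1 / real (Suc n)) (at 0) sequentially"
    using LIMSEQ_inverse_real_of_nat by (intro filterlim_atI) (auto simp: inverse_eq_divide)
   ultimately have "(%n. (ph (x + (1 / real (Suc n)) *\<^sub>R v) - ph x) / (1 / real (Suc n)))---->g x \<bullet> v"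
    by (rule filterlim_compose)
   thus "(%n. q n x)---->g x \<bullet> v" by (simp add: q_def mult.commute)
  qed
  fix n
  show "AE x in lborel. norm (q n x)<=B * indicator K' x"
  proof (rule AE_I2)
   fix x
   define s where "s = 1 / real (Suc n)"
   have s: "0 < s" "s<=1" by (auto simp: s_def)
   show "norm (q n x)<=B * indicator K' x"
   proof (cases "x:K'")
    case True
    have "norm (ph (x + s *\<^sub>R v) - ph x)<=B * norm ((x + s *\<^sub>R v) - x)"
    proof (rule differentiable_bound[of UNIV])
     show "(ph has_derivative (%v. g y \<bullet> v)) (at y within UNIV)" for y using test_pairD(2)[OF t] by simp
     show "onorm (%v. g y \<bullet> v)<=B" for y using onorm_inner_right[OF bounded_linear_ident, of "g y"] B(2)[of y]
      by (smt (verit) onorm_le Cauchy_Schwarz_ineq2 mult_right_mono norm_ge_zero onorm_bound B(1) real_norm_def)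
    qed auto
    also have "...<=B * s" using v s B(1) by (simp add: mult_left_le)
    finally have "real (Suc n) * norm (ph (x + s *\<^sub>R v) - ph x)<=real (Suc n) * (B * s)" by (rule mult_left_mono) simp
    also have "... = B" by (simp add: s_def)
    finally show ?thesis using True by (simp add: q_def s_def abs_mult)
   next
    case False
    have "x ~: ?K"
    proof
     assume "x:?K"
     hence "x + 0:K'" unfolding K'_def by force
     thus False using False by simp
    qed
    moreover have "x + s *\<^sub>R v ~: ?K"
    proof
     assume "x + s *\<^sub>R v:?K"
     moreover have "- (s *\<^sub>R v):cball 0 1" using v s by (simp add: mult_le_one)
     ultimately have "(x + s *\<^sub>R v) + - (s *\<^sub>R v):K'" unfolding K'_def by blast
     thus False using False by simp
    qed
    ultimately show ?thesis using test_pair_zero[OF t] False by (simp add: q_def s_def)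
   qed
  qed
 qed (auto simp: q_def)
 hence "(%n. 0)---->(LINT x|lborel. g x \<bullet> v)" by (simp only: int0)
 thus ?thesis by (rule LIMSEQ_unique[OF _ tendsto_const])
qed
hence "(LINT x|lborel. g x) \<bullet> b = 0" if "b:Basis" for b
 using that integral_inner_left[of b lborel g] gi by simp
thus ?thesis by (simp add: euclidean_eq_iff[where 'a='a])
qed

lemma integration_by_parts_test:
fixes ph ps :: "'a::euclidean_space => real"
assumes t: "test_pair \<Omega> ph g" "test_pair \<Omega> ps h"
shows "(LINT x|lborel. ph x *\<^sub>R h x) = - (LINT x|lborel. ps x *\<^sub>R g x)"
proof -
have i1: "integrable lborel (%x. ph x *\<^sub>R h x)"
 by (rule compact_support_integrable[OF _ test_pairD(3)[OF t(1)]])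
   (use test_pair_zero[OF t(1)] test_pairD[OF t(1)] test_pairD[OF t(2)] in \<open>auto intro!: continuous_intros\<close>)
have i2: "integrable lborel (%x. ps x *\<^sub>R g x)"
 by (rule compact_support_integrable[OF _ test_pairD(3)[OF t(1)]])
   (use test_pair_zero[OF t(1)] test_pairD[OF t(1)] test_pairD[OF t(2)] in \<open>auto intro!: continuous_intros\<close>)
have "(LINT x|lborel. ph x *\<^sub>R h x + ps x *\<^sub>R g x) = 0"
 by (rule integral_grad_zero[OF test_pair_mult[OF t(1) test_pairD(2)[OF t(2)] test_pairD(1)[OF t(2)]]])
thus ?thesis using i1 i2 by (simp add: add_eq_0_iff)
qed

section \<open>The Sobolev inequality and Rellich's theorem for test functions\<close>

lemma DERIV_max_square: "((%y. (max 0 y)\<^sup>2) has_real_derivative 2 * max 0 y) (at y)"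
proof -
consider "y > 0" | "y < 0" | "y = 0" by linarith
thus ?thesis
proof cases
 case 1
 have "((%y. y\<^sup>2) has_real_derivative 2 * max 0 y) (at y)" using 1 by (auto intro!: derivative_eq_intros)
 thus ?thesis by (rule has_field_derivative_transform_within_open[of _ _ _ "{0<..}"]) (use 1 in auto)
next
 case 2
 have "((%y. 0) has_real_derivative 2 * max 0 y) (at y)" using 2 by (auto intro!: derivative_eq_intros)
 thus ?thesis by (rule has_field_derivative_transform_within_open[of _ _ _ "{..<0}"]) (use 2 in auto)
next
 case 3
 have "((%h. ((max 0 (0 + h))\<^sup>2 - (max 0 0)\<^sup>2) / h) \<longlongrightarrow> (0::real)) (at 0)"
 proof (rule Lim_null_comparison)
  show "\<forall>\<^sub>F h in at 0. norm (((max 0 (0 + h))\<^sup>2 - (max 0 0)\<^sup>2) / h)<=abs (h::real)"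
   by (rule always_eventually) (auto simp: max_def power2_eq_square)
  show "((%h. abs (h::real)) \<longlongrightarrow> 0) (at 0)" by (intro tendsto_rabs_zero tendsto_ident_at)
 qed
 thus ?thesis using 3 by (simp add: DERIV_def)
qed
qed

text \<open>A quadratic spline rising from 0 to 1 on the unit interval; \<open>ramp'\<close> is a
  tent of height 2. Continuous differentiability is what keeps compositions with it test
  functions.\<close>

definition ramp :: "real => real" where "ramp y = 2 * (max 0 y)\<^sup>2 - 4 * (max 0 (y - 1/2))\<^sup>2 + 2 * (max 0 (y - 1))\<^sup>2"
definition ramp' :: "real => real" where "ramp' y = 4 * max 0 y - 8 * max 0 (y - 1/2) + 4 * max 0 (y - 1)"

lemma DERIV_ramp: "(ramp has_real_derivative ramp' y) (at y)"
proof -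
have 1: "((%y. (max 0 (y - c))\<^sup>2) has_real_derivative 2 * max 0 (y - c)) (at y)" for c
 using DERIV_max_square[of "y - c"] DERIV_shift[of "%y. (max 0 y)\<^sup>2" "2 * max 0 (y - c)" y "- c"] by simp
show ?thesis unfolding ramp_def[abs_def] ramp'_def
 by (rule derivative_eq_intros DERIV_max_square 1 | simp)+
qed

lemma ramp_0: "y<=0==>ramp y = 0" "y<=0==>ramp' y = 0"
by (auto simp: ramp_def ramp'_def max_def)

lemma ramp_1: "1<=y==>ramp y = 1" "1<=y==>ramp' y = 0"
by (auto simp: ramp_def ramp'_def max_def power2_eq_square algebra_simps)

lemma ramp'_bound: "abs (ramp' y)<=2"
by (auto simp: ramp'_def max_def abs_if)

text \<open>A differentiable cutoff of the modulus, 0 up to level \<open>s\<close> and 1 from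
  \<open>2 * s\<close> on, so that its derivative lives on the shell in between.\<close>

definition lev :: "real => real => real" where "lev s t = ramp (t/s - 1) + ramp (-t/s - 1)"
definition lev' :: "real => real => real" where "lev' s t = (ramp' (t/s - 1) - ramp' (-t/s - 1)) / s"

lemma DERIV_lev:
assumes "s > 0"
shows "(lev s has_real_derivative lev' s t) (at t)"
proof -
have "((%t. ramp (t/s - 1)) has_real_derivative ramp' (t/s - 1) * (1/s)) (at t)"
 by (rule DERIV_chain2[OF DERIV_ramp]) (use assms in \<open>auto intro!: derivative_eq_intros\<close>)
moreover have "((%t. ramp (-t/s - 1)) has_real_derivative ramp' (-t/s - 1) * (-1/s)) (at t)"
 by (rule DERIV_chain2[OF DERIV_ramp]) (use assms in \<open>auto intro!: derivative_eq_intros\<close>)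
ultimately show ?thesis unfolding lev_def[abs_def] lev'_def
 by (auto intro!: derivative_eq_intros simp: diff_divide_distrib)
qed

lemma lev_facts:
assumes "s > 0"
shows "abs t<=s==>lev s t = 0" "2 * s<=abs t==>lev s t = 1" "abs (lev' s t)<=2 / s"
 "~ (s < abs t&abs t < 2 * s)==>lev' s t = 0"
proof -
have neg: "t>=0==>-t/s - 1<=0" "t<=0==>t/s - 1<=0" using assms by (auto simp: divide_simps)
have lo: "abs t<=s==>t/s - 1<=0" "abs t<=s==>-t/s - 1<=0" using assms by (auto simp: divide_simps)
have hi: "2 * s<=abs t==>t>=0==>1<=t/s - 1" "2 * s<=abs t==>t<=0==>1<=-t/s - 1" using assms by (auto simp: divide_simps)
show "abs t<=s==>lev s t = 0" using lo by (simp add: lev_def ramp_0)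
show "2 * s<=abs t==>lev s t = 1" using hi neg ramp_0(1) ramp_1(1) by (cases "t>=0") (auto simp: lev_def)
show "abs (lev' s t)<=2 / s"
proof (cases "t>=0")
 case True
 hence "lev' s t = ramp' (t/s - 1) / s" using neg ramp_0(2) by (simp add: lev'_def)
 thus ?thesis using ramp'_bound[of "t/s - 1"] assms by (simp add: divide_right_mono)
next
 case False
 hence "lev' s t = - ramp' (-t/s - 1) / s" using neg ramp_0(2) by (simp add: lev'_def)
 thus ?thesis using ramp'_bound[of "-t/s - 1"] assms by (simp add: divide_right_mono)
qed
assume n: "~ (s < abs t&abs t < 2 * s)"
then consider "abs t<=s" | "2 * s<=abs t" by linarith
thus "lev' s t = 0"
proof cases
 case 1 thus ?thesis using lo by (simp add: lev'_def ramp_0)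
next
 case 2 thus ?thesis using hi neg ramp_0(2) ramp_1(2) by (cases "t>=0") (auto simp: lev'_def)
qed
qed

lemma lev'_cont: "s > 0==>continuous_on UNIV (lev' s)"
unfolding lev'_def[abs_def] ramp'_def by (intro continuous_intros) auto

definition superlevel :: "('a::euclidean_space => real) => real => real" where
"superlevel ph s = measure lborel {x. s < abs (ph x)}"

definition shell_energy :: "real => ('a::euclidean_space => real) => ('a => 'a) => real => real" where
"shell_energy p ph g s = (LINT x|lborel. indicator {x. s < abs (ph x)&abs (ph x) < 2 * s} x * norm (g x) powr p)"

lemma superlevel_emeasure:
fixes ph :: "'a::euclidean_space => real"
assumes t: "test_pair \<Omega> ph g" and s: "s > 0"
shows "emeasure lborel {x. s < abs (ph x)} = ennreal (superlevel ph s)" "{x. s < abs (ph x)}:sets borel"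
proof -
note [measurable] = test_pair_measurable[OF t]
show m: "{x. s < abs (ph x)}:sets borel" by measurable
have "{x. s < abs (ph x)} \<subseteq> tsupp ph" using test_pair_zero(1)[OF t] s by force
hence "emeasure lborel {x. s < abs (ph x)}<=emeasure lborel (tsupp ph)" by (intro emeasure_mono) (auto simp: tsupp_def)
also have "... < \<infinity>" using emeasure_compact_finite[OF test_pairD(3)[OF t]] by simp
finally show "emeasure lborel {x. s < abs (ph x)} = ennreal (superlevel ph s)"
 unfolding superlevel_def by (intro emeasure_eq_ennreal_measure) auto
qed

lemma superlevel_nonneg: "0<=superlevel ph s" by (simp add: superlevel_def)

lemma shell_energy_facts:
fixes ph :: "'a::euclidean_space => real"
assumes t: "test_pair \<Omega> ph g" and p: "p > 1"
shows "0<=shell_energy p ph g s" "integrable lborel (%x. indicator {x. s < abs (ph x)&abs (ph x) < 2 * s} x * norm (g x) powr p)"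
proof -
note [measurable] = test_pair_measurable[OF t]
show "0<=shell_energy p ph g s" unfolding shell_energy_def by (intro integral_nonneg_AE) auto
have i: "integrable lborel (%x. norm (g x) powr p)" by (rule Lp_int[OF test_pair_Lp(2)[OF t]]) (use p in simp)
show "integrable lborel (%x. indicator {x. s < abs (ph x)&abs (ph x) < 2 * s} x * norm (g x) powr p)"
 by (rule Bintegrable_bound[OF i]) (auto simp: indicator_def)
qed

lemma average_translation:
fixes ph :: "'a::euclidean_space => real"
assumes p: "p > 1" and t: "test_pair \<Omega> ph g" and r: "r>=0"
shows "(\<integral>\<^sup>+x. (\<integral>\<^sup>+h. indicator (ball 0 r) h * dshift p ph h x \<partial>lborel) \<partial>lborel)
 <=ennreal (measure lborel (ball (0::'a) r) * (r powr p * Ip lborel p g))"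
proof -
note [measurable] = test_pair_measurable[OF t]
have "continuous_on UNIV (%z. ph (snd z + fst z) - ph (snd z))"
 by (intro continuous_intros continuous_on_compose2[OF test_pairD(5)[OF t]]) auto
from borel_measurable_continuous_onI[OF this]
have [measurable]: "(%z. ph (snd z + fst z) - ph (snd z)):borel_measurable (lborel \<Otimes>\<^sub>M lborel)"
 by (simp add: lborel_prod)
have [measurable]: "ball (0::'a) r:sets lborel" by simp
have "(\<integral>\<^sup>+x. (\<integral>\<^sup>+h. indicator (ball 0 r) h * dshift p ph h x \<partial>lborel) \<partial>lborel)
  = (\<integral>\<^sup>+h. (\<integral>\<^sup>+x. indicator (ball 0 r) h * dshift p ph h x \<partial>lborel) \<partial>lborel)"
 by (rule lborel_pair.Fubini') measurable
also have "...<=(\<integral>\<^sup>+h. indicator (ball (0::'a) r) h * ennreal (r powr p * Ip lborel p g) \<partial>lborel)"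
proof (rule nn_integral_mono)
 fix h :: 'a
 show "(\<integral>\<^sup>+x. indicator (ball 0 r) h * dshift p ph h x \<partial>lborel)<=indicator (ball 0 r) h * ennreal (r powr p * Ip lborel p g)"
 proof (cases "h:ball 0 r")
  case True
  have "(\<integral>\<^sup>+x. dshift p ph h x \<partial>lborel)<=ennreal (norm h powr p * Ip lborel p g)"
   by (rule translation_estimate_nn[OF p t])
  also have "...<=ennreal (r powr p * Ip lborel p g)"
   using True p by (intro ennreal_leI mult_right_mono powr_mono2 Ip_nonneg) auto
  finally show ?thesis using True by simp
 qed simp
qed
also have "... = emeasure lborel (ball (0::'a) r) * ennreal (r powr p * Ip lborel p g)"
 by (subst nn_integral_multc) auto
also have "... = ennreal (measure lborel (ball (0::'a) r) * (r powr p * Ip lborel p g))"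
 using emeasure_bounded_finite[OF bounded_ball, of "0::'a" r]
 by (subst emeasure_eq_ennreal_measure) (auto simp: ennreal_mult Ip_nonneg)
finally show ?thesis .
qed

text \<open>If a ball has twice the volume of \<open>{|ph| > s}\<close>, then from every point of \<open>{|ph| > 2s}\<close> at least half of the
translations by vectors of this ball leave \<open>{|ph| > s}\<close>, so the translation estimate applies to a truncation of \<open>ph\<close>.\<close>
lemma level_estimate:
fixes ph :: "'a::euclidean_space => real"
assumes p: "p > 1" and t: "test_pair \<Omega> ph g" and s: "s > 0"
shows "s powr p * superlevel ph (2 * s) <=
  (2 * 2 powr p * (2 / unit_ball_vol DIM('a)) powr (p / DIM('a))) * superlevel ph s powr (p / DIM('a)) * shell_energy p ph g s"
proof -
note [measurable] = test_pair_measurable[OF t]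
define n where "n = real DIM('a)"
define \<omega> where "\<omega> = unit_ball_vol n"
have n: "n > 0" by (simp add: n_def)
have \<omega>: "\<omega> > 0" unfolding \<omega>_def by (simp add: n_def)
define a where "a = superlevel ph s"
define b where "b = superlevel ph (2 * s)"
have ab: "0<=b" "b<=a"
proof -
 show "0<=b" by (simp add: b_def superlevel_nonneg)
 have "emeasure lborel {x. 2 * s < abs (ph x)}<=emeasure lborel {x. s < abs (ph x)}"
  by (rule emeasure_mono) (use s in auto)
 thus "b<=a" using superlevel_emeasure[OF t, of s] superlevel_emeasure[OF t, of "2 * s"] s
  by (simp add: a_def b_def ennreal_le_iff superlevel_nonneg)
qed
show ?thesis
proof (cases "a = 0")
 case True
 thus ?thesis using ab by (simp add: a_def b_def)
next
 case False
 hence a: "a > 0" using ab by simp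
 define r where "r = (2*a/\<omega>) powr (1/n)"
 have r: "r > 0" using a \<omega> by (simp add: r_def)
 have rn: "r ^ DIM('a) = 2*a/\<omega>"
 proof -
  have "r ^ DIM('a) = r powr n" using r by (simp add: n_def powr_realpow)
  also have "... = 2*a/\<omega>" using a \<omega> n by (simp add: r_def powr_powr)
  finally show ?thesis .
 qed
 have "emeasure lborel (ball (0::'a) r) = ennreal (\<omega> * r ^ DIM('a))" using r by (simp add: emeasure_ball \<omega>_def n_def)
 also have "\<omega> * r ^ DIM('a) = 2*a" unfolding rn using \<omega> by simp
 finally have eB: "emeasure lborel (ball (0::'a) r) = ennreal (2*a)" .
 hence mB: "measure lborel (ball (0::'a) r) = 2*a" using a by (simp add: measure_def)
 define ps where "ps x = lev s (ph x)" for x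
 define gp where "gp x = lev' s (ph x) *\<^sub>R g x" for x
 have tps: "test_pair \<Omega> ps gp" unfolding ps_def gp_def
  by (rule test_pair_comp[OF t DERIV_lev[OF s] lev'_cont[OF s]]) (use lev_facts(1)[OF s, of 0] s in simp)
 note [measurable] = test_pair_measurable[OF tps]
 have "ennreal (a * b) = (\<integral>\<^sup>+x. ennreal a * indicator {x. 2 * s < abs (ph x)} x \<partial>lborel)"
  using superlevel_emeasure[OF t, of "2 * s"] s a ab by (simp add: nn_integral_cmult b_def[symmetric] ennreal_mult)
 also have "...<=(\<integral>\<^sup>+x. (\<integral>\<^sup>+h. indicator (ball 0 r) h * ennreal (abs (ps (x + h) - ps x) powr p) \<partial>lborel) \<partial>lborel)"
 proof (rule nn_integral_mono)
  fix x
  show "ennreal a * indicator {x. 2 * s < abs (ph x)} x<=(\<integral>\<^sup>+h. indicator (ball 0 r) h * ennreal (abs (ps (x + h) - ps x) powr p) \<partial>lborel)"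
  proof (cases "2 * s < abs (ph x)")
   case True
   hence psx: "ps x = 1" using lev_facts(2)[OF s, of "ph x"] by (simp add: ps_def)
   define T where "T = {h. s < abs (ph (x + h))}"
   have Tm [measurable]: "T:sets borel" unfolding T_def by measurable
   have "emeasure lborel T = (\<integral>\<^sup>+h. indicator T h \<partial>lborel)" by simp
   also have "... = (\<integral>\<^sup>+h. indicator {x. s < abs (ph x)} (h + x) \<partial>lborel)"
    by (intro nn_integral_cong) (simp add: T_def indicator_def add.commute)
   also have "... = (\<integral>\<^sup>+h. indicator {x. s < abs (ph x)} h \<partial>lborel)" by (rule nn_integral_shift) measurable
   also have "... = ennreal a" using superlevel_emeasure[OF t s] by (simp add: a_def)
   finally have eT: "emeasure lborel T = ennreal a" .
   have "ennreal a = ennreal (2*a) - ennreal a" using a by (simp add: ennreal_minus)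
   also have "... = emeasure lborel (ball (0::'a) r) - emeasure lborel T" by (simp add: eB eT)
   also have "...<=emeasure lborel (ball 0 r - T)"
   proof -
    have "emeasure lborel (ball (0::'a) r)<=emeasure lborel ((ball 0 r - T) \<union> T)" by (rule emeasure_mono) auto
    also have "...<=emeasure lborel (ball 0 r - T) + emeasure lborel T" by (rule emeasure_subadditive) auto
    finally show ?thesis using eT by (simp add: ennreal_minus_le_iff add.commute)
   qed
   also have "... = (\<integral>\<^sup>+h. indicator (ball 0 r - T) h \<partial>lborel)" by simp
   also have "...<=(\<integral>\<^sup>+h. indicator (ball 0 r) h * ennreal (abs (ps (x + h) - ps x) powr p) \<partial>lborel)"
   proof (rule nn_integral_mono)
    fix h
    show "indicator (ball 0 r - T) h<=indicator (ball 0 r) h * ennreal (abs (ps (x + h) - ps x) powr p)"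
    proof (cases "h:ball 0 r - T")
     case True
     hence "ps (x + h) = 0" using lev_facts(1)[OF s, of "ph (x + h)"] by (simp add: ps_def T_def)
     thus ?thesis using True psx by (auto simp: indicator_def)
    qed simp
   qed
   finally show ?thesis using True by simp
  qed simp
 qed
 also have "...<=ennreal (2*a * (r powr p * Ip lborel p gp))"
  using average_translation[OF p tps, of r] r by (simp add: mB)
 finally have "a * b<=2*a * (r powr p * Ip lborel p gp)"
  using a by (subst (asm) ennreal_le_iff) (auto simp: Ip_nonneg)
 hence "b<=2 * (r powr p * Ip lborel p gp)" using a by simp
 \<comment> \<open>The gradient of the truncation is supported in the shell; this localisation makes
   the estimates summable over dyadic levels.\<close>
 moreover have "Ip lborel p gp<=(2/s) powr p * shell_energy p ph g s"
 proof -
  have "Ip lborel p gp<=(LINT x|lborel. (2/s) powr p * (indicator {x. s < abs (ph x)&abs (ph x) < 2 * s} x * norm (g x) powr p))"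
   unfolding Ip_def
  proof (rule integral_mono)
   show "integrable lborel (%x. norm (gp x) powr p)" by (rule Lp_int[OF test_pair_Lp(2)[OF tps]]) (use p in simp)
   show "integrable lborel (%x. (2/s) powr p * (indicator {x. s < abs (ph x)&abs (ph x) < 2 * s} x * norm (g x) powr p))"
    using shell_energy_facts(2)[OF t p] by simp
   fix x
   show "norm (gp x) powr p<=(2/s) powr p * (indicator {x. s < abs (ph x)&abs (ph x) < 2 * s} x * norm (g x) powr p)"
   proof (cases "s < abs (ph x)&abs (ph x) < 2 * s")
    case True
    have "norm (gp x)<=2/s * norm (g x)"
     unfolding gp_def norm_scaleR using mult_right_mono[OF lev_facts(3)[OF s, of "ph x"], of "norm (g x)"] by simp
    hence "norm (gp x) powr p<=(2/s * norm (g x)) powr p" using p by (intro powr_mono2) auto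
    also have "... = (2/s) powr p * norm (g x) powr p" by (rule powr_mult)
    finally show ?thesis using True by simp
   qed (use lev_facts(4)[OF s, of "ph x"] in \<open>simp add: gp_def\<close>)
  qed
  thus ?thesis by (simp add: shell_energy_def)
 qed
 ultimately have "b<=2 * (r powr p * ((2/s) powr p * shell_energy p ph g s))"
  by (meson mult_left_mono order_trans powr_ge_zero zero_le_numeral)
 hence "s powr p * b<=s powr p * (2 * (r powr p * ((2/s) powr p * shell_energy p ph g s)))" by (rule mult_left_mono) simp
 also have "... = 2 * (s powr p * (2/s) powr p) * r powr p * shell_energy p ph g s" by simp
 also have "s powr p * (2/s) powr p = 2 powr p" using s by (simp add: powr_mult[symmetric])
 also have "r powr p = (2/\<omega>) powr (p/n) * a powr (p/n)"
  using a \<omega> by (simp add: r_def powr_powr powr_mult[symmetric] mult.commute)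
 finally show ?thesis by (simp add: a_def b_def \<omega>_def n_def mult.assoc)
qed
qed

text \<open>Since \<open>th < 1\<close>, there is a \<open>K\<close> with
  \<open>C * K powr th <= K\<close>, and the recursion started below it stays below it. The step
  then becomes linear in \<open>e j\<close>, and the \<open>b j\<close> are summed along with the
  \<open>e j\<close>.\<close>

lemma iterated_level_bound:
fixes b e :: "nat => real"
assumes b0: "b 0<=1" and b: "!!j. 0<=b j" and e: "!!j. 0<=e j" "!!J. (\<Sum>j<J. e j)<=1"
 and step: "!!j. b (Suc j)<=C * b j powr th * e j" and C: "0<=C" and th: "0 < th" "th < 1"
shows "(\<Sum>j<J. b j)<=1 + (1 + C) powr (1 / (1 - th))"
proof -
define K where "K = (1 + C) powr (1 / (1 - th))"
have K1: "1<=K" unfolding K_def using C th by (intro ge_one_powr_ge_zero) auto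
have "K = K powr (1 - th) * K powr th" using K1 by (simp add: powr_add[symmetric])
also have "K powr (1 - th) = 1 + C" using C th by (simp add: K_def powr_powr)
finally have "K = K powr th + C * K powr th" by (simp add: distrib_right)
hence KC: "C * K powr th<=K" using powr_ge_zero[of K th] by linarith
have e1: "e j<=1" for j
proof -
 have "e j<=(\<Sum>j<Suc j. e j)" using e(1) by (simp add: sum_nonneg)
 thus ?thesis using e(2)[of "Suc j"] by linarith
qed
have step': "b (Suc j)<=K * e j" if "b j<=K" for j
proof -
 have "C * b j powr th * e j<=C * K powr th * e j" using that b C e th by (intro mult_right_mono mult_left_mono powr_mono2) auto
 also have "...<=K * e j" using KC e by (intro mult_right_mono) auto
 finally show ?thesis using step[of j] by linarith
qed
have bK: "b j<=K" for j
proof (induction j)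
 case 0 thus ?case using b0 K1 by simp
next
 case (Suc j)
 have "K * e j<=K * 1" using e1 K1 by (intro mult_left_mono) auto
 thus ?case using step'[OF Suc] by simp
qed
have "(\<Sum>j<J. b j)<=(\<Sum>j<Suc J. b j)" using b by simp
also have "... = b 0 + (\<Sum>j<J. b (Suc j))" by (rule sum.lessThan_Suc_shift)
also have "...<=1 + (\<Sum>j<J. K * e j)" using b0 step'[OF bK] by (intro add_mono sum_mono) auto
also have "... = 1 + K * (\<Sum>j<J. e j)" by (simp add: sum_distrib_left)
also have "...<=1 + K * 1" using e(2)[of J] K1 by (intro add_left_mono mult_left_mono) auto
finally show ?thesis by (simp add: K_def)
qed

text \<open>The leading 1 bounds the part below the lowest level. The bracket is the bound of
  \<open>iterated_level_bound\<close> for the constant of \<open>level_estimate\<close> times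
  \<open>2 powr q\<close>, and the outer \<open>2 powr q\<close> is the loss in passing from a level
  to its double.\<close>

definition sobolev_const :: "'a::euclidean_space itself => real => real => real" where
"sobolev_const _ p q = 1 + 2 powr q * (1 + (1 + 2 powr q * (2 * 2 powr p * (2 / unit_ball_vol DIM('a)) powr (p / DIM('a)))) powr (1 / (1 - p / DIM('a))))"

text \<open>Maz'ya's truncation argument: on dyadic levels \<open>level_estimate\<close> is a
  recursion for \<open>b j\<close>, in which the powers of the level cancel exactly because
  \<open>q = p + q * th\<close>. The shells are disjoint, so their energies add up to at most the
  full energy.\<close>

lemma sobolev_test:
fixes ph :: "'a::euclidean_space => real" and p q :: real
assumes p: "p > 1" and N: "p < DIM('a)" and q: "q = DIM('a) * p / (DIM('a) - p)"
 and t: "test_pair \<Omega> ph g" and e1: "Ip lborel p g<=1"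
shows "Ip lborel q ph<=sobolev_const TYPE('a) p q"
proof -
note [measurable] = test_pair_measurable[OF t]
define n where "n = real DIM('a)"
define th where "th = p / n"
have n: "n > p" "n > 0" using N p by (auto simp: n_def)
have th: "0 < th" "th < 1" using n p by (auto simp: th_def)
have q0: "q > 0" using n p by (simp add: q n_def[symmetric])
have qp: "q = p + q * th" using n p unfolding q n_def[symmetric] th_def by (simp add: field_simps)
define C where "C = 2 * 2 powr p * (2 / unit_ball_vol n) powr (p / n)"
have C0: "0<=C" by (simp add: C_def)
define m0 where "m0 = measure lborel (tsupp ph)"
have m0: "0<=m0" by (simp add: m0_def)
\<comment> \<open>The lowest level depends on the size of the support only to make the recursion
  start with \<open>b 0 <= 1\<close>; the final constant is independent of it.\<close>
define s where "s = (1 / (m0 + 1)) powr (1/q)"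
have s: "s > 0" using m0 by (simp add: s_def)
have sq: "s powr q * m0<=1" using m0 q0 by (simp add: s_def powr_powr divide_simps)
define b where "b j = (s * 2^j) powr q * superlevel ph (s * 2^j)" for j
define e where "e j = shell_energy p ph g (s * 2^j)" for j
have sj: "s * 2^j > 0" for j using s by simp
have tc: "compact (tsupp ph)" by (rule test_pairD(3)[OF t])
have sl: "superlevel ph \<sigma><=m0" if "\<sigma> > 0" for \<sigma>
proof -
 have "{x. \<sigma> < abs (ph x)} \<subseteq> tsupp ph" using test_pair_zero(1)[OF t] that by force
 hence "ennreal (superlevel ph \<sigma>)<=emeasure lborel (tsupp ph)" unfolding superlevel_emeasure(1)[OF t that, symmetric]
  by (intro emeasure_mono) (auto simp: tsupp_def)
 also have "... = ennreal m0" unfolding m0_def using emeasure_compact_finite[OF tc] by (intro emeasure_eq_ennreal_measure) auto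
 finally show ?thesis using m0 by (simp add: ennreal_le_iff)
qed
have sum_b: "(\<Sum>j<J. b j)<=1 + (1 + 2 powr q * C) powr (1 / (1 - th))" for J
proof (rule iterated_level_bound[where e = e])
 show "b 0<=1" using sl[OF s] sq mult_left_mono[OF sl[OF s], of "s powr q"] by (simp add: b_def)
 show "0<=b j" for j by (simp add: b_def superlevel_nonneg)
 show "0<=e j" for j unfolding e_def by (rule shell_energy_facts[OF t p])
 show "b (Suc j)<=2 powr q * C * b j powr th * e j" for j
 proof -
  define \<sigma> where "\<sigma> = s * 2^j"
  have \<sigma>: "\<sigma> > 0" using sj by (simp add: \<sigma>_def)
  have l: "\<sigma> powr p * superlevel ph (2*\<sigma>)<=C * superlevel ph \<sigma> powr th * e j"
   using level_estimate[OF p t \<sigma>] by (simp add: C_def n_def th_def e_def \<sigma>_def)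
  have "b (Suc j) = (2*\<sigma>) powr q * superlevel ph (2*\<sigma>)" by (simp add: b_def \<sigma>_def mult.commute mult.left_commute)
  also have "(2*\<sigma>) powr q = 2 powr q * (\<sigma> powr (q*th) * \<sigma> powr p)"
   using \<sigma> qp by (simp add: powr_mult powr_add[symmetric] add.commute)
  also have "... * superlevel ph (2*\<sigma>) = 2 powr q * \<sigma> powr (q*th) * (\<sigma> powr p * superlevel ph (2*\<sigma>))" by simp
  also have "...<=2 powr q * \<sigma> powr (q*th) * (C * superlevel ph \<sigma> powr th * e j)" by (rule mult_left_mono[OF l]) simp
  also have "... = 2 powr q * C * ((\<sigma> powr q) powr th * superlevel ph \<sigma> powr th) * e j" by (simp add: powr_powr)
  also have "(\<sigma> powr q) powr th * superlevel ph \<sigma> powr th = b j powr th" by (simp add: b_def \<sigma>_def powr_mult superlevel_nonneg)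
  finally show ?thesis .
 qed
 show "(\<Sum>j<J. e j)<=1" for J
 proof -
  define A where "A j = {x. s * 2^j < abs (ph x)&abs (ph x) < 2*(s * 2^j)}" for j
  have disj: "disjoint_family_on A {..<J}"
  proof -
   have "A i \<inter> A j = {}" if "i < j" for i j
   proof -
    have "(2::real)^Suc i<=2^j" using that by (intro power_increasing) auto
    hence "2*(s * 2^i)<=s * 2^j" using s by simp
    thus ?thesis by (auto simp: A_def)
   qed
   thus ?thesis unfolding disjoint_family_on_def by (metis inf_commute linorder_neqE_nat)
  qed
  have iA: "integrable lborel (%x. indicator (A j) x * norm (g x) powr p)" for j
   unfolding A_def by (rule shell_energy_facts(2)[OF t p])
  have "(\<Sum>j<J. e j) = (\<Sum>j<J. \<integral>x. indicator (A j) x * norm (g x) powr p \<partial>lborel)"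
   by (simp only: e_def shell_energy_def A_def)
  also have "... = (LINT x|lborel. (\<Sum>j<J. indicator (A j) x * norm (g x) powr p))"
   by (rule Bintegral_sum[symmetric]) (rule iA)
  also have "...<=(LINT x|lborel. norm (g x) powr p)"
  proof (rule integral_mono)
   show "integrable lborel (%x. \<Sum>j<J. indicator (A j) x * norm (g x) powr p)"
    by (rule Bintegrable_sum) (rule iA)
   show "integrable lborel (%x. norm (g x) powr p)" by (rule Lp_int[OF test_pair_Lp(2)[OF t]]) (use p in simp)
   fix x
   have "(\<Sum>j<J. indicator (A j) x) = (indicator (\<Union>j\<in>{..<J}. A j) x :: real)"
    by (rule indicator_UN_disjoint[OF _ disj, symmetric]) simp
   also have "...<=1" by (simp add: indicator_def)
   finally have "(\<Sum>j<J. indicator (A j) x) * norm (g x) powr p<=1 * norm (g x) powr p" by (rule mult_right_mono) simp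
   thus "(\<Sum>j<J. indicator (A j) x * norm (g x) powr p)<=norm (g x) powr p" by (simp add: sum_distrib_right)
  qed
  finally show ?thesis using e1 by (simp add: Ip_def)
 qed
qed (use C0 th in auto)
obtain B where B: "B > 0" "!!x. abs (ph x)<=B" using test_pair_bounded[OF t] by blast
obtain J where J: "B / s < 2 ^ J" using real_arch_pow[of 2 "B/s"] by auto
hence J: "B<=s * 2^J" using s by (simp add: divide_simps mult.commute)
\<comment> \<open>A step function over the levels that dominates the q-th power: the support term
  acts up to \<open>s\<close>, otherwise the term of the largest level exceeded. Test functions are
  bounded, so finitely many levels suffice.\<close>
define F where "F x = s powr q * indicator (tsupp ph) x + (\<Sum>j<J. (2 * (s*2^j)) powr q * indicator {x. s * 2^j < abs (ph x)} x)" for x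
have iA: "integrable lborel (indicator {x. s * 2^j < abs (ph x)} :: 'a => real)" for j
 using superlevel_emeasure[OF t sj[of j]] by (intro integrable_real_indicator) auto
have iT: "integrable lborel (indicator (tsupp ph) :: 'a => real)"
 using emeasure_compact_finite[OF tc] by (intro integrable_real_indicator) (auto simp: tsupp_def)
have iF: "integrable lborel F" unfolding F_def
 by (intro Bintegrable_add integrable_mult_right Bintegrable_sum iA iT)
have pw: "norm (ph x) powr q<=F x" for x
proof -
 have F2: "0<=(\<Sum>j<J. (2 * (s*2^j)) powr q * indicator {x. s * 2^j < abs (ph x)} x)" by (intro sum_nonneg) auto
 show ?thesis
 proof (cases "abs (ph x)<=s")
  case True
  have "norm (ph x) powr q<=s powr q * indicator (tsupp ph) x"
  proof (cases "x:tsupp ph")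
   case True thus ?thesis using \<open>\<bar>ph x\<bar> \<le> s\<close> q0 by (simp add: powr_mono2)
  next
   case False thus ?thesis using test_pair_zero(1)[OF t False] by simp
  qed
  thus ?thesis using F2 unfolding F_def by linarith
 next
  case False
  define k where "k = (LEAST k. abs (ph x)<=s * 2^k)"
  have ex: "abs (ph x)<=s * 2^J" using J B(2)[of x] by linarith
  have k: "abs (ph x)<=s * 2^k" unfolding k_def by (rule LeastI[of "%k. abs (ph x)<=s * 2^k", OF ex])
  have kJ: "k<=J" unfolding k_def by (rule Least_le[of "%k. abs (ph x)<=s * 2^k", OF ex])
  have "k~=0"
  proof
   assume "k = 0"
   thus False using k False by simp
  qed
  then obtain j where j: "k = Suc j" using not0_implies_Suc by blast
  have lt: "s * 2^j < abs (ph x)" using not_less_Least[of j "%k. abs (ph x)<=s * 2^k"] j unfolding k_def by simp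
  have "norm (ph x) powr q<=(2 * (s*2^j)) powr q * indicator {x. s * 2^j < abs (ph x)} x"
   using lt k j q0 by (simp add: powr_mono2)
  also have "...<=(\<Sum>j<J. (2 * (s*2^j)) powr q * indicator {x. s * 2^j < abs (ph x)} x)"
   by (rule member_le_sum) (use kJ j in auto)
  also have "...<=F x" unfolding F_def by simp
  finally show ?thesis .
 qed
qed
have "Ip lborel q ph<=(LINT x|lborel. F x)" unfolding Ip_def
 by (rule integral_mono[OF Lp_int[OF test_pair_Lp(1)[OF t q0]] iF pw])
also have "... = s powr q * m0 + (\<Sum>j<J. (2 * (s*2^j)) powr q * superlevel ph (s * 2^j))"
proof -
 have "(LINT x|lborel. F x) = (LINT x|lborel. s powr q * indicator (tsupp ph) x) + (LINT x|lborel. (\<Sum>j<J. (2 * (s*2^j)) powr q * indicator {x. s * 2 ^ j < abs (ph x)} x))"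
  unfolding F_def by (rule Bintegral_add) (intro integrable_mult_right Bintegrable_sum iA iT)+
 also have "(LINT x|lborel. (\<Sum>j<J. (2 * (s*2^j)) powr q * indicator {x. s * 2 ^ j < abs (ph x)} x))
   = (\<Sum>j<J. \<integral>x. (2 * (s*2^j)) powr q * indicator {x. s * 2 ^ j < abs (ph x)} x \<partial>lborel)"
  by (rule Bintegral_sum) (intro integrable_mult_right iA)
 finally show ?thesis by (simp add: m0_def superlevel_def)
qed
also have "(\<Sum>j<J. (2 * (s*2^j)) powr q * superlevel ph (s * 2^j)) = 2 powr q * (\<Sum>j<J. b j)"
 unfolding b_def sum_distrib_left using s by (intro sum.cong) (auto simp: powr_mult)
also have "s powr q * m0 + 2 powr q * (\<Sum>j<J. b j)<=1 + 2 powr q * (1 + (1 + 2 powr q * C) powr (1 / (1 - th)))"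
 using sq sum_b[of J] by (intro add_mono mult_left_mono) auto
finally show ?thesis by (simp add: sobolev_const_def C_def n_def th_def)
qed

section \<open>Rellich's theorem by averages over grid cells\<close>

definition cell :: "real => 'a::euclidean_space => 'a set" where
"cell d x = {y. ALL b:Basis. \<lfloor>y \<bullet> b / d\<rfloor> = \<lfloor>x \<bullet> b / d\<rfloor>}"

lemma cell_self: "x:cell d x" by (simp add: cell_def)
lemma cell_eq: "y:cell d x==>cell d y = cell d x" by (auto simp: cell_def)

lemma cell_measurable [measurable]: "cell d x:sets borel"
proof -
have "cell d x = (\<Inter>b\<in>Basis. {y. \<lfloor>y \<bullet> b / d\<rfloor> = \<lfloor>x \<bullet> b / d\<rfloor>})" by (auto simp: cell_def)
also have "...:sets borel"
 by (rule sets.countable_INT'') (auto simp: countable_finite intro!: borel_measurable_neq)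
finally show ?thesis .
qed

lemma cell_near:
fixes x :: "'a::euclidean_space"
assumes "d > 0" "y:cell d x"
shows "norm (y - x) < 2 * real DIM('a) * d"
proof -
have "abs ((y - x) \<bullet> b)<=d" if b: "b:Basis" for b
proof -
 have "\<lfloor>y \<bullet> b / d\<rfloor> = \<lfloor>x \<bullet> b / d\<rfloor>" using assms b by (simp add: cell_def)
 hence "abs (y \<bullet> b / d - x \<bullet> b / d) < 1" by linarith
 thus ?thesis using assms(1) by (simp add: diff_divide_distrib[symmetric] inner_diff_left abs_less_iff divide_simps split: if_splits) (simp add: abs_le_iff)
qed
hence "(\<Sum>b\<in>Basis. abs ((y - x) \<bullet> b))<=(\<Sum>b\<in>(Basis::'a set). d)" by (intro sum_mono)
hence "norm (y - x)<=real DIM('a) * d" using norm_le_l1[of "y - x"] by simp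
moreover have "real DIM('a) * d > 0" using assms by simp
ultimately show ?thesis by linarith
qed

lemma cell_measure:
fixes x :: "'a::euclidean_space"
assumes d: "d > 0"
shows "emeasure lborel (cell d x) < \<infinity>" "d ^ DIM('a)<=measure lborel (cell d x)"
proof -
have "cell d x \<subseteq> ball x (2 * real DIM('a) * d)" using cell_near[OF d] by (auto simp: dist_norm norm_minus_commute)
hence "bounded (cell d x)" using bounded_subset bounded_ball by blast
thus fin: "emeasure lborel (cell d x) < \<infinity>" by (rule emeasure_bounded_finite)
define l where "l = (\<Sum>b\<in>Basis. (d * \<lfloor>x \<bullet> b / d\<rfloor>) *\<^sub>R b :: 'a)"
define u where "u = (\<Sum>b\<in>Basis. (d * \<lfloor>x \<bullet> b / d\<rfloor> + d) *\<^sub>R b :: 'a)"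
have lu: "l \<bullet> b = d * \<lfloor>x \<bullet> b / d\<rfloor>" "u \<bullet> b = d * \<lfloor>x \<bullet> b / d\<rfloor> + d" if "b:Basis" for b
 using that by (simp_all add: l_def u_def)
have sub: "box l u \<subseteq> cell d x"
proof
 fix y assume y: "y:box l u"
 have "\<lfloor>y \<bullet> b / d\<rfloor> = \<lfloor>x \<bullet> b / d\<rfloor>" if b: "b:Basis" for b
 proof (rule floor_unique)
  have "d * \<lfloor>x \<bullet> b / d\<rfloor> < y \<bullet> b" "y \<bullet> b < d * \<lfloor>x \<bullet> b / d\<rfloor> + d" using y b lu by (auto simp: mem_box)
  thus "real_of_int \<lfloor>x \<bullet> b / d\<rfloor><=y \<bullet> b / d" "y \<bullet> b / d < real_of_int \<lfloor>x \<bullet> b / d\<rfloor> + 1"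
   using d by (simp_all add: field_simps)
 qed
 thus "y:cell d x" by (simp add: cell_def)
qed
have "emeasure lborel (box l u) = (\<Prod>b\<in>(Basis::'a set). (u - l) \<bullet> b)" by (rule emeasure_lborel_box) (use lu d in auto)
also have "(\<Prod>b\<in>(Basis::'a set). (u - l) \<bullet> b) = d ^ DIM('a)" using lu by (simp add: inner_diff_left)
finally have "ennreal (d ^ DIM('a))<=emeasure lborel (cell d x)" using emeasure_mono[OF sub, of lborel] by simp
also have "... = ennreal (measure lborel (cell d x))" using fin by (intro emeasure_eq_ennreal_measure) auto
finally show "d ^ DIM('a)<=measure lborel (cell d x)" using d by (subst (asm) ennreal_le_iff) auto
qed

lemma finite_cells:
assumes d: "d > 0"
shows "finite (cell d ` ball (0::'a::euclidean_space) R)"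
proof -
define k where "k = \<lceil>\<bar>R\<bar> / d\<rceil> + 1"
define G where "G f = {y::'a. ALL b:Basis. \<lfloor>y \<bullet> b / d\<rfloor> = f b}" for f :: "'a => int"
have "cell d ` ball (0::'a) R \<subseteq> G ` (PiE Basis (%_. {-k..k}))"
proof
 fix S assume "S:cell d ` ball (0::'a) R"
 then obtain x where x: "norm x < R" "S = cell d x" by auto
 define f where "f = restrict (%b. \<lfloor>x \<bullet> b / d\<rfloor>) Basis"
 have "\<lfloor>x \<bullet> b / d\<rfloor>:{-k..k}" if b: "b:Basis" for b
 proof -
  have "abs (x \<bullet> b)<=abs R" using Basis_le_norm[OF b, of x] x by linarith
  hence "abs (x \<bullet> b / d)<=abs R / d" using d by (simp add: divide_right_mono)
  moreover have "\<lfloor>t\<rfloor>:{-(\<lceil>c\<rceil> + 1)..\<lceil>c\<rceil> + 1}" if "abs t<=c" for t c :: real using that by simp linarith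
  ultimately show ?thesis unfolding k_def by blast
 qed
 hence "f:PiE Basis (%_. {-k..k})" by (auto simp: f_def)
 moreover have "S = G f" using x by (auto simp: G_def f_def cell_def)
 ultimately show "S:G ` (PiE Basis (%_. {-k..k}))" by blast
qed
moreover have "finite (G ` (PiE (Basis::'a set) (%_. {-k..k})))" by (intro finite_imageI finite_PiE) auto
ultimately show ?thesis by (rule finite_subset)
qed

text \<open>The deviation from the cell average is an average of increments over the cell. Moved to
  the origin, the cell lies in a ball of radius \<open>r\<close>, so that
  \<open>average_translation\<close> can take over; \<open>d ^ DIM('a)\<close> is a lower bound for
  the volume of the cell.\<close>

lemma cell_oscillation:
fixes ph :: "'a::euclidean_space => real"
assumes p: "p > 1" and t: "test_pair \<Omega> ph g" and d: "d > 0"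
defines "r \<equiv> 2 * real DIM('a) * d"
shows "ennreal (abs (ph x - (LINT y|lborel. indicator (cell d x) y * ph y) / measure lborel (cell d x)) powr p)
 <=ennreal (1 / d ^ DIM('a)) * (\<integral>\<^sup>+h. indicator (ball 0 r) h * dshift p ph h x \<partial>lborel)"
proof -
note [measurable] = test_pair_measurable[OF t]
define S where "S = cell d x"
define m where "m = measure lborel S"
have Sm [measurable]: "S:sets borel" by (simp add: S_def)
have [measurable]: "ball (0::'a) r:sets borel" by simp
define R where "R = restrict_space lborel S"
have spR: "space R = S" by (simp add: R_def space_restrict_space)
have m: "m = measure R (space R)" "m > 0" "d ^ DIM('a)<=m"
proof -
 show "m = measure R (space R)" unfolding spR unfolding R_def m_def by (subst measure_restrict_space) auto
 show "d ^ DIM('a)<=m" using cell_measure(2)[OF d, of x] by (simp add: m_def S_def)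
 thus "m > 0" using d by (meson less_le_trans zero_less_power)
qed
have fR: "finite_measure R"
 by (rule finite_measureI) (use cell_measure(1)[OF d, of x] in \<open>simp add: spR, simp add: R_def emeasure_restrict_space S_def\<close>)
interpret R: finite_measure R by (rule fR)
obtain B where B: "B > 0" "!!x. abs (ph x)<=B" using test_pair_bounded[OF t] by blast
define f where "f y = ph x - ph y" for y
have phm: "ph:borel_measurable R" unfolding R_def by (intro measurable_restrict_space1) simp
have fm: "f:borel_measurable R" unfolding f_def using phm by simp
have fb: "norm (f y)<=2 * B" for y using B(2)[of x] B(2)[of y] by (simp add: f_def)
have iph: "integrable R ph" by (rule R.integrable_const_bound[of _ B]) (use B phm in auto)
have fi: "integrable R f" unfolding f_def using iph by auto
have fL: "Lp R p f"
 by (rule Lp_bound[OF fm, where w = "%_. (2 * B) powr p"]) (use fb p in \<open>auto intro!: powr_mono2\<close>)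
have "(LINT y|R. ph y) = (LINT y|lborel. indicator S y * ph y)" unfolding R_def by (subst integral_restrict_space) auto
hence mean: "(1/m) *\<^sub>R (LINT y|R. f y) = ph x - (LINT y|lborel. indicator S y * ph y) / m"
 unfolding f_def using iph m by (simp add: right_diff_distrib)
have "ennreal (abs (ph x - (LINT y|lborel. indicator S y * ph y) / m) powr p)<=ennreal ((1/m) * Ip R p f)"
 using jensen_mean[OF p fR m(1,2) fi fL] unfolding mean by (simp add: ennreal_leI)
also have "... = ennreal (1/m) * (\<integral>\<^sup>+y. ennreal (norm (f y) powr p) \<partial>R)"
 unfolding nn_integral_powr_eq[OF fL] by (rule ennreal_mult) (use m(2) in \<open>auto simp: Ip_nonneg\<close>)
also have "...<=ennreal (1 / d ^ DIM('a)) * (\<integral>\<^sup>+h. indicator (ball 0 r) h * dshift p ph h x \<partial>lborel)"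
proof (rule mult_mono)
 show "ennreal (1/m)<=ennreal (1 / d ^ DIM('a))" using m d by (intro ennreal_leI divide_left_mono) auto
 have "(\<integral>\<^sup>+y. ennreal (norm (f y) powr p) \<partial>R) = (\<integral>\<^sup>+y. ennreal (norm (f y) powr p) * indicator S y \<partial>lborel)"
  unfolding R_def by (subst nn_integral_restrict_space) auto
 also have "...<=(\<integral>\<^sup>+y. indicator (ball 0 r) (y + - x) * ennreal (abs (ph (x + (y + - x)) - ph x) powr p) \<partial>lborel)"
 proof (rule nn_integral_mono)
  fix y
  show "ennreal (norm (f y) powr p) * indicator S y<=indicator (ball 0 r) (y + - x) * ennreal (abs (ph (x + (y + - x)) - ph x) powr p)"
   using cell_near[OF d, of y x] by (auto simp: S_def r_def f_def indicator_def abs_minus_commute)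
 qed
 also have "... = (\<integral>\<^sup>+h. indicator (ball 0 r) h * dshift p ph h x \<partial>lborel)"
  by (rule nn_integral_shift) measurable
 finally show "(\<integral>\<^sup>+y. ennreal (norm (f y) powr p) \<partial>R)<=(\<integral>\<^sup>+h. indicator (ball 0 r) h * dshift p ph h x \<partial>lborel)" .
qed auto
finally show ?thesis by (simp add: S_def m_def)
qed

text \<open>A function splits into its cell averages and the deviation from them. The deviation is
  small with the mesh size, uniformly for bounded gradients, and the averages are finitely many
  numbers.\<close>

lemma cell_estimate:
fixes ph :: "'a::euclidean_space => real"
assumes p: "p > 1" and t: "test_pair \<Omega> ph g" and b: "\<Omega> \<subseteq> ball 0 R" and d: "d > 0" and T: "T>=0"
 and c: "!!S. S:cell d ` ball 0 R==>abs (LINT y|lborel. indicator S y * ph y)<=T * d ^ DIM('a)"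
shows "Ip lborel p ph<=2 powr p * ((unit_ball_vol DIM('a) * (2 * real DIM('a)) ^ DIM('a) * (2 * real DIM('a)) powr p) * d powr p * Ip lborel p g
  + measure lborel (ball (0::'a) R) * T powr p)"
proof -
note [measurable] = test_pair_measurable[OF t]
have pp: "p > 0" using p by simp
define r where "r = 2 * real DIM('a) * d"
have r: "r > 0" using d by (simp add: r_def)
define C where "C = unit_ball_vol DIM('a) * (2 * real DIM('a)) ^ DIM('a) * (2 * real DIM('a)) powr p"
define J where "J x = (\<integral>\<^sup>+h. indicator (ball 0 r) h * dshift p ph h x \<partial>lborel)" for x
have "continuous_on UNIV (%z. ph (fst z + snd z) - ph (fst z))"
 by (intro continuous_intros continuous_on_compose2[OF test_pairD(5)[OF t]]) auto
from borel_measurable_continuous_onI[OF this]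
have [measurable]: "(%z. ph (fst z + snd z) - ph (fst z)):borel_measurable (lborel \<Otimes>\<^sub>M lborel)"
 by (simp add: lborel_prod)
have [measurable]: "ball (0::'a) r:sets lborel" by simp
have Jm [measurable]: "J:borel_measurable lborel" unfolding J_def
 by (rule lborel.borel_measurable_nn_integral) measurable
have pw: "ennreal (abs (ph x) powr p)<=ennreal (2 powr p) * (ennreal (1 / d ^ DIM('a)) * J x + indicator (ball 0 R) x * ennreal (T powr p))" for x
proof (cases "x:ball 0 R")
 case False
 hence "ph x = 0" using test_pair_zero_out[OF t] b by blast
 thus ?thesis by simp
next
 case True
 define av where "av = (LINT y|lborel. indicator (cell d x) y * ph y) / measure lborel (cell d x)"
 have mp: "measure lborel (cell d x) > 0" using cell_measure(2)[OF d, of x] d by (meson less_le_trans zero_less_power)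
 have "abs av<=T * d ^ DIM('a) / measure lborel (cell d x)" unfolding av_def abs_divide
  using c[of "cell d x"] True mp by (simp add: divide_right_mono)
 also have "...<=T" using cell_measure(2)[OF d, of x] mp T by (simp add: divide_le_eq mult_left_mono)
 finally have av: "abs av powr p<=T powr p" using pp by (intro powr_mono2) auto
 have "abs (ph x) powr p<=2 powr p * (abs (ph x - av) powr p + T powr p)"
  using norm_add_powr_le[OF pp, of "ph x - av" av] av by (smt (verit) mult_left_mono powr_ge_zero real_norm_def diff_add_cancel)
 hence "ennreal (abs (ph x) powr p)<=ennreal (2 powr p) * (ennreal (abs (ph x - av) powr p) + ennreal (T powr p))"
  using ennreal_leI[of "abs (ph x) powr p" "2 powr p * (abs (ph x - av) powr p + T powr p)"] by (simp add: ennreal_mult)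
 also have "...<=ennreal (2 powr p) * (ennreal (1 / d ^ DIM('a)) * J x + indicator (ball 0 R) x * ennreal (T powr p))"
  using cell_oscillation[OF p t d, of x] True unfolding av_def J_def r_def by (intro mult_left_mono add_mono) auto
 finally show ?thesis .
qed
have "ennreal (Ip lborel p ph) = (\<integral>\<^sup>+x. ennreal (abs (ph x) powr p) \<partial>lborel)"
 using nn_integral_powr_eq[OF test_pair_Lp(1)[OF t pp]] by simp
also have "...<=(\<integral>\<^sup>+x. ennreal (2 powr p) * (ennreal (1 / d ^ DIM('a)) * J x + indicator (ball 0 R) x * ennreal (T powr p)) \<partial>lborel)"
 by (rule nn_integral_mono[OF pw])
also have "... = ennreal (2 powr p) * (ennreal (1 / d ^ DIM('a)) * (\<integral>\<^sup>+x. J x \<partial>lborel) + emeasure lborel (ball (0::'a) R) * ennreal (T powr p))"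
proof -
 have [measurable]: "J:borel_measurable borel" using Jm by simp
 have [measurable]: "ball (0::'a) R:sets borel" by simp
 have "(\<integral>\<^sup>+x. ennreal (2 powr p) * (ennreal (1 / d ^ DIM('a)) * J x + indicator (ball 0 R) x * ennreal (T powr p)) \<partial>lborel)
  = ennreal (2 powr p) * (\<integral>\<^sup>+x. ennreal (1 / d ^ DIM('a)) * J x + indicator (ball 0 R) x * ennreal (T powr p) \<partial>lborel)"
  by (rule nn_integral_cmult) measurable
 also have "(\<integral>\<^sup>+x. ennreal (1 / d ^ DIM('a)) * J x + indicator (ball 0 R) x * ennreal (T powr p) \<partial>lborel)
  = (\<integral>\<^sup>+x. ennreal (1 / d ^ DIM('a)) * J x \<partial>lborel) + (\<integral>\<^sup>+x. indicator (ball (0::'a) R) x * ennreal (T powr p) \<partial>lborel)"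
  by (rule nn_integral_add) measurable
 also have "(\<integral>\<^sup>+x. ennreal (1 / d ^ DIM('a)) * J x \<partial>lborel) = ennreal (1 / d ^ DIM('a)) * (\<integral>\<^sup>+x. J x \<partial>lborel)"
  by (rule nn_integral_cmult) measurable
 also have "(\<integral>\<^sup>+x. indicator (ball (0::'a) R) x * ennreal (T powr p) \<partial>lborel) = (\<integral>\<^sup>+x. indicator (ball (0::'a) R) x \<partial>lborel) * ennreal (T powr p)"
  by (rule nn_integral_multc) measurable
 finally show ?thesis by simp
qed
also have "...<=ennreal (2 powr p) * (ennreal (1 / d ^ DIM('a)) * ennreal (measure lborel (ball (0::'a) r) * (r powr p * Ip lborel p g))
  + ennreal (measure lborel (ball (0::'a) R)) * ennreal (T powr p))"
proof (intro mult_left_mono add_mono mult_right_mono)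
 show "(\<integral>\<^sup>+x. J x \<partial>lborel)<=ennreal (measure lborel (ball (0::'a) r) * (r powr p * Ip lborel p g))"
  unfolding J_def using average_translation[OF p t, of r] r by simp
 show "emeasure lborel (ball (0::'a) R)<=ennreal (measure lborel (ball (0::'a) R))"
  using emeasure_bounded_finite[OF bounded_ball, of "0::'a" R] by (subst emeasure_eq_ennreal_measure) auto
qed auto
also have "... = ennreal (2 powr p * (1 / d ^ DIM('a) * (measure lborel (ball (0::'a) r) * (r powr p * Ip lborel p g)) + measure lborel (ball (0::'a) R) * T powr p))"
 using d by (simp add: ennreal_mult[symmetric] ennreal_plus[symmetric] Ip_nonneg del: ennreal_plus)
finally have "Ip lborel p ph<=2 powr p * (1 / d ^ DIM('a) * (measure lborel (ball (0::'a) r) * (r powr p * Ip lborel p g)) + measure lborel (ball (0::'a) R) * T powr p)"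
 using d by (subst (asm) ennreal_le_iff) (auto intro!: mult_nonneg_nonneg add_nonneg_nonneg simp: Ip_nonneg)
also have "1 / d ^ DIM('a) * (measure lborel (ball (0::'a) r) * (r powr p * Ip lborel p g)) = C * d powr p * Ip lborel p g"
proof -
 have "measure lborel (ball (0::'a) r) = unit_ball_vol DIM('a) * r ^ DIM('a)" using r by (simp add: content_ball)
 moreover have "r ^ DIM('a) = (2 * real DIM('a)) ^ DIM('a) * d ^ DIM('a)" by (simp add: r_def power_mult_distrib)
 moreover have "r powr p = (2 * real DIM('a)) powr p * d powr p" unfolding r_def by (rule powr_mult)
 ultimately show ?thesis using d by (simp add: C_def)
qed
finally show ?thesis by (simp add: C_def)
qed

lemma exists_pos_powr_less:
fixes p C e :: real
assumes "p > 0" "C>=0" "e > 0"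
shows "EX d>0. C * d powr p < e"
proof (intro exI conjI)
show "(e / (C + 1)) powr (1/p) > 0" using assms by simp
have "C * ((e / (C + 1)) powr (1/p)) powr p = C * (e / (C + 1))" using assms by (simp add: powr_powr)
also have "... < e" using assms by (simp add: divide_simps)
finally show "C * ((e / (C + 1)) powr (1/p)) powr p < e" .
qed

text \<open>For each tolerance a mesh size makes the oscillation term small, and then only finitely
  many cell averages have to converge; a diagonal sequence serves all tolerances. The result is a
  Cauchy property because the limit need not be a test function.\<close>

theorem rellich_test:
fixes ph :: "nat => 'a::euclidean_space => real"
assumes p: "p > 1" and t: "!!n. test_pair \<Omega> (ph n) (g n)" and b: "\<Omega> \<subseteq> ball 0 R" and B: "!!n. Ip lborel p (g n)<=B"
shows "EX r. strict_mono (r::nat=>nat)&(ALL e>0. EX N. ALL m>=N. ALL n>=N. Ip lborel p (%x. ph (r m) x - ph (r n) x) < e)"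
proof -
have pp: "p > 0" using p by simp
define C where "C = unit_ball_vol DIM('a) * (2 * real DIM('a)) ^ DIM('a) * (2 * real DIM('a)) powr p"
have C: "C>=0" by (simp add: C_def)
define e0 where "e0 = 2 powr p * (B + B)"
have B0: "0<=B" using B[of 0] Ip_nonneg[of lborel p "g 0"] by linarith
have e0: "e0>=0" using B0 by (simp add: e0_def)
define mR where "mR = measure lborel (ball (0::'a) R)"
define A where "A = mR + (2*R) powr p * B"
have td: "test_pair \<Omega> (%x. ph m x - ph n x) (%x. g m x - g n x)" for m n by (rule test_pair_diff[OF t t])
have ge: "Ip lborel p (%x. g m x - g n x)<=e0" for m n
proof -
 have "Ip lborel p (%x. g m x - g n x)<=2 powr p * (Ip lborel p (g m) + Ip lborel p (g n))"
  by (rule Lp_diff(2)[OF pp test_pair_Lp(2)[OF t pp] test_pair_Lp(2)[OF t pp]])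
 also have "...<=e0" unfolding e0_def using B[of m] B[of n] by (intro mult_left_mono) auto
 finally show ?thesis .
qed
have phi: "integrable lborel (ph n)" for n
 by (rule compact_support_integrable[OF test_pairD(5,3)[OF t]]) (rule test_pair_zero(1)[OF t])
have Si: "integrable lborel (%y. indicator S y * ph n y)" if "S:sets borel" for S n
 using integrable_mult_indicator[OF _ phi[of n], of S] that by simp
have ph1: "abs (LINT y|lborel. indicator S y * ph n y)<=A" if S: "S:sets borel" for S n
proof -
 have "abs (LINT y|lborel. indicator S y * ph n y)<=(LINT y|lborel. norm (indicator S y * ph n y))"
  using integral_norm_bound[of lborel "%y. indicator S y * ph n y"] by simp
 also have "...<=(LINT y|lborel. indicator (ball 0 R) y + norm (ph n y) powr p)"
 proof (rule integral_mono)
  show "integrable lborel (%y. norm (indicator S y * ph n y))" using Si[OF S] by auto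
  show "integrable lborel (%y. indicator (ball 0 R) y + norm (ph n y) powr p)"
   using Lp_int[OF test_pair_Lp(1)[OF t pp, of n]] emeasure_bounded_finite[OF bounded_ball, of "0::'a" R]
   by (intro Bintegrable_add integrable_real_indicator) auto
  fix y
  have "abs s<=1 + abs s powr p" for s :: real
  proof (cases "abs s<=1")
   case True thus ?thesis using powr_ge_zero[of "abs s" p] by linarith
  next
   case False
   hence "abs s powr 1<=abs s powr p" using p by (intro powr_mono) auto
   thus ?thesis using False by simp
  qed
  thus "norm (indicator S y * ph n y)<=indicator (ball 0 R) y + norm (ph n y) powr p"
  proof (cases "y:\<Omega>")
   case True
   hence "y:ball 0 R" using b by blast
   thus ?thesis using \<open>\<And>s. \<bar>s\<bar> \<le> 1 + \<bar>s\<bar> powr p\<close>[of "ph n y"] by (simp add: indicator_def)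
  next
   case False
   thus ?thesis using test_pair_zero_out[OF t, of y n] by simp
  qed
 qed
 also have "... = mR + Ip lborel p (ph n)"
  using Lp_int[OF test_pair_Lp(1)[OF t pp, of n]] emeasure_bounded_finite[OF bounded_ball, of "0::'a" R]
  by (subst Bintegral_add) (auto simp: Ip_def mR_def intro!: integrable_real_indicator)
 also have "...<=A" unfolding A_def using poincare_test[OF p t b, of n] B[of n]
  by (intro add_left_mono) (meson mult_left_mono order_trans powr_ge_zero)
 finally show ?thesis .
qed
define P where "P k s \<longleftrightarrow> (EX N. ALL m>=N. ALL n>=N. Ip lborel p (%x. ph (s m) x - ph (s n) x) < 1 / real (Suc k))" for k and s :: "nat => nat"
have ex: "EX r. strict_mono r&P k (s \<circ> r)" if s: "strict_mono s" for k and s :: "nat => nat"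
proof -
 define \<epsilon> where "\<epsilon> = 1 / real (Suc k)"
 have \<epsilon>: "\<epsilon> > 0" by (simp add: \<epsilon>_def)
 obtain d where d: "d > 0" "(2 powr p * C * e0) * d powr p < \<epsilon>/2"
  using exists_pos_powr_less[OF pp, of "2 powr p * C * e0" "\<epsilon>/2"] C e0 \<epsilon> by auto
 obtain T where T: "T > 0" "(2 powr p * mR) * T powr p < \<epsilon>/2"
  using exists_pos_powr_less[OF pp, of "2 powr p * mR" "\<epsilon>/2"] \<epsilon> by (auto simp: mR_def)
 define Z where "Z = cell d ` ball (0::'a) R"
 have Z: "finite Z" unfolding Z_def by (rule finite_cells[OF d(1)])
 have Zm: "S:sets borel" if "S:Z" for S :: "'a set" using that by (auto simp: Z_def)
 define w where "w n S = (LINT y|lborel. indicator S y * ph (s n) y)" for n S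
 obtain r where r: "strict_mono (r::nat=>nat)" "ALL S:Z. convergent (%n. w (r n) S)"
  using finite_coords_convergent_subseq[OF Z, of w A] ph1[OF Zm] unfolding w_def by blast
 have "ALL S:Z. EX N. ALL m>=N. ALL n>=N. abs (w (r m) S - w (r n) S)<=T * d ^ DIM('a)"
 proof
  fix S assume "S:Z"
  hence "Cauchy (%n. w (r n) S)" using r(2) by (simp add: convergent_Cauchy)
  moreover have "T * d ^ DIM('a) > 0" using T d by simp
  ultimately obtain N where "ALL m>=N. ALL n>=N. dist (w (r m) S) (w (r n) S) < T * d ^ DIM('a)" unfolding Cauchy_def by blast
  thus "EX N. ALL m>=N. ALL n>=N. abs (w (r m) S - w (r n) S)<=T * d ^ DIM('a)" unfolding dist_real_def by (meson less_imp_le)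
 qed
 then obtain NS where NS: "!!S m n. S:Z==>m>=NS S==>n>=NS S==>abs (w (r m) S - w (r n) S)<=T * d ^ DIM('a)" by metis
 define N where "N = Max (insert 0 (NS ` Z))"
 have Nge: "NS S<=N" if "S:Z" for S unfolding N_def using that Z by (intro Max_ge) auto
 have "Ip lborel p (%x. ph (s (r m)) x - ph (s (r n)) x) < \<epsilon>" if mn: "m>=N" "n>=N" for m n
 proof -
  have "Ip lborel p (%x. ph (s (r m)) x - ph (s (r n)) x)<=2 powr p * (C * d powr p * Ip lborel p (%x. g (s (r m)) x - g (s (r n)) x) + mR * T powr p)"
   unfolding C_def mR_def
  proof (rule cell_estimate[OF p td b d(1)])
   fix S :: "'a set" assume S: "S:cell d ` ball 0 R"
   hence SZ: "S:Z" by (simp add: Z_def)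
   have "(LINT y|lborel. indicator S y * (ph (s (r m)) y - ph (s (r n)) y)) = w (r m) S - w (r n) S"
    unfolding w_def right_diff_distrib by (rule Bintegral_diff[OF Si Si]) (rule Zm[OF SZ])+
   thus "abs (LINT y|lborel. indicator S y * (ph (s (r m)) y - ph (s (r n)) y))<=T * d ^ DIM('a)"
    using NS[OF SZ, of m n] Nge[OF SZ] mn by simp
  qed (use T in simp)
  also have "...<=2 powr p * (C * d powr p * e0 + mR * T powr p)"
   using ge C by (intro mult_left_mono add_right_mono) auto
  also have "... = (2 powr p * C * e0) * d powr p + (2 powr p * mR) * T powr p" by (simp add: algebra_simps)
  also have "... < \<epsilon>" using d(2) T(2) by linarith
  finally show ?thesis .
 qed
 hence "P k (s \<circ> r)" unfolding P_def \<epsilon>_def by auto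
 thus ?thesis using r(1) by blast
qed
\<comment> \<open>After its first \<open>Suc k\<close> terms the diagonal sequence is a subsequence
  of the one chosen for \<open>k\<close>; hence \<open>P k\<close> must be stable under
  subsequences.\<close>
interpret subseqs P by unfold_locales (rule ex)
have stable: "P k (s \<circ> r)" if sr: "strict_mono r" "P k s" for k and s r :: "nat => nat"
proof -
 obtain N where N: "ALL m>=N. ALL n>=N. Ip lborel p (%x. ph (s m) x - ph (s n) x) < 1 / real (Suc k)" using sr(2) by (auto simp: P_def)
 have "r m>=N" if "m>=N" for m using seq_suble[OF sr(1), of m] that by linarith
 thus ?thesis unfolding P_def using N by (intro exI[of _ N]) auto
qed
have hold: "P k (diagseq \<circ> ((+) (Suc k)))" for k by (rule diagseq_holds[OF stable])
have "EX N. ALL m>=N. ALL n>=N. Ip lborel p (%x. ph (diagseq m) x - ph (diagseq n) x) < e" if e: "e > 0" for e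
proof -
 obtain k where k: "1 / real (Suc k) < e" using nat_approx_posE[OF e] by auto
 obtain N where N: "ALL m>=N. ALL n>=N. Ip lborel p (%x. ph (diagseq (Suc k + m)) x - ph (diagseq (Suc k + n)) x) < 1 / real (Suc k)"
  using hold[of k] by (auto simp: P_def)
 have "Ip lborel p (%x. ph (diagseq m) x - ph (diagseq n) x) < e" if "m>=Suc k + N" "n>=Suc k + N" for m n
 proof -
  have "N<=m - Suc k" "N<=n - Suc k" using that by arith+
  thus ?thesis using N[rule_format, of "m - Suc k" "n - Suc k"] that k by auto
 qed
 thus ?thesis by blast
qed
thus ?thesis using subseq_diagseq by blast
qed

section \<open>The fundamental lemma of the calculus of variations\<close>

lemma AE_lebesgue_on_iff:
assumes "\<Omega>:sets lebesgue"
shows "(AE x in lebesgue_on \<Omega>. P x) \<longleftrightarrow> negligible {x:\<Omega>. ~ P x}"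
proof -
have "(AE x in lebesgue_on \<Omega>. P x) \<longleftrightarrow> (AE x in lebesgue. x:\<Omega>-->P x)" by (rule AE_restrict_space_iff) (use assms in simp)
also have "... \<longleftrightarrow> negligible {x:\<Omega>. ~ P x}"
proof
 assume "AE x in lebesgue. x:\<Omega>-->P x"
 then obtain N where N: "{x:space lebesgue. ~ (x:\<Omega>-->P x)} \<subseteq> N" "N:null_sets lebesgue"
  by (auto simp: eventually_ae_filter)
 have "negligible N" using N(2) by (simp add: negligible_iff_null_sets)
 thus "negligible {x:\<Omega>. ~ P x}" by (rule negligible_subset) (use N(1) in auto)
next
 assume "negligible {x:\<Omega>. ~ P x}"
 hence "{x:\<Omega>. ~ P x}:null_sets lebesgue" by (simp add: negligible_iff_null_sets)
 thus "AE x in lebesgue. x:\<Omega>-->P x" by (rule AE_I') auto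
qed
finally show ?thesis .
qed

text \<open>Squaring the truncated paraboloid makes it continuously differentiable across the
  sphere.\<close>

definition bump :: "'a::euclidean_space => real => 'a => real" where
"bump x0 r y = (max 0 (1 - (norm (y - x0))\<^sup>2 / r\<^sup>2))\<^sup>2"

lemma bump_bounds: "0<=bump x0 r y" "bump x0 r y<=1"
by (auto simp: bump_def power_le_one max_def)

lemma bump_pos: "r > 0==>y:ball x0 r==>0 < bump x0 r y"
proof -
assume r: "r > 0" and y: "y:ball x0 r"
hence "norm (y - x0) < r" by (simp add: dist_norm norm_minus_commute)
hence "(norm (y - x0))\<^sup>2 < r\<^sup>2" by (intro power_strict_mono) auto
hence "0 < 1 - (norm (y - x0))\<^sup>2 / r\<^sup>2" using r by (simp add: divide_less_eq)
hence "0 < max 0 (1 - (norm (y - x0))\<^sup>2 / r\<^sup>2)" by linarith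
thus ?thesis unfolding bump_def by (rule zero_less_power)
qed

lemma bump_zero: "r > 0==>y ~: cball x0 r==>bump x0 r y = 0"
proof -
assume r: "r > 0" and y: "y ~: cball x0 r"
hence "r<=norm (y - x0)" by (simp add: dist_norm norm_minus_commute)
hence "r\<^sup>2<=(norm (y - x0))\<^sup>2" using r by (intro power_mono) auto
hence "1 - (norm (y - x0))\<^sup>2 / r\<^sup>2<=0" using r by (simp add: le_divide_eq)
thus ?thesis unfolding bump_def by (simp add: max_absorb1)
qed

lemma bump_test_pair:
fixes x0 :: "'a::euclidean_space"
assumes r: "r > 0" and c: "cball x0 r \<subseteq> \<Omega>"
shows "test_pair \<Omega> (bump x0 r) (%y. (2 * max 0 (1 - (norm (y - x0))\<^sup>2 / r\<^sup>2) * (- 2 / r\<^sup>2)) *\<^sub>R (y - x0))"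
proof (rule test_pairI[OF _ _ compact_cball c])
show "continuous_on UNIV (%y. (2 * max 0 (1 - (norm (y - x0))\<^sup>2 / r\<^sup>2) * (- 2 / r\<^sup>2)) *\<^sub>R (y - x0))"
 using r by (intro continuous_intros) auto
show "bump x0 r x = 0" if "x ~: cball x0 r" for x using bump_zero[OF r that] .
fix x
define q where "q y = 1 - (y - x0) \<bullet> (y - x0) / r\<^sup>2" for y
have qd: "(q has_derivative (%v. (- 2 / r\<^sup>2) * ((x - x0) \<bullet> v))) (at x)" unfolding q_def
proof -
 have "((%y. (y - x0) \<bullet> (y - x0)) has_derivative (%v. (x - x0) \<bullet> v + v \<bullet> (x - x0))) (at x)"
  by (auto intro!: derivative_eq_intros)
 from has_derivative_diff[OF has_derivative_const has_derivative_mult_right[OF this, of "1 / r\<^sup>2"], of 1]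
 show "((%y. 1 - (y - x0) \<bullet> (y - x0) / r\<^sup>2) has_derivative (%v. (- 2 / r\<^sup>2) * ((x - x0) \<bullet> v))) (at x)"
  by (simp add: inner_commute)
qed
have "((%y. (max 0 (q y))\<^sup>2) has_derivative (%v. 2 * max 0 (q x) * ((- 2 / r\<^sup>2) * ((x - x0) \<bullet> v)))) (at x)"
 using has_derivative_compose[OF qd DERIV_max_square[of "q x", unfolded has_field_derivative_def]] by simp
thus "(bump x0 r has_derivative (%v. (2 * max 0 (1 - (norm (x - x0))\<^sup>2 / r\<^sup>2) * (- 2 / r\<^sup>2)) *\<^sub>R (x - x0) \<bullet> v)) (at x)"
 by (simp add: bump_def[abs_def] q_def power2_norm_eq_inner mult.assoc)
qed

lemma real_polynomial_gradient:
fixes f :: "'a::euclidean_space => real"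
assumes "real_polynomial_function f"
shows "EX g. continuous_on UNIV g&(ALL x. (f has_derivative (%v. g x \<bullet> v)) (at x))"
using assms
proof induction
case (linear f)
hence "(f has_derivative (%v. (\<Sum>b\<in>Basis. f b *\<^sub>R b) \<bullet> v)) (at x)" for x
proof -
 have "f v = (\<Sum>b\<in>Basis. f b *\<^sub>R b) \<bullet> v" for v
 proof -
  have "f v = f (\<Sum>b\<in>Basis. (v \<bullet> b) *\<^sub>R b)" by (simp add: euclidean_representation)
  also have "... = (\<Sum>b\<in>Basis. (v \<bullet> b) * f b)" using linear by (simp add: bounded_linear.linear linear_sum linear_scale)
  also have "... = (\<Sum>b\<in>Basis. f b *\<^sub>R b) \<bullet> v" unfolding inner_sum_left by (intro sum.cong) (simp_all add: inner_commute)
  finally show ?thesis .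
 qed
 hence "f = (%v. (\<Sum>b\<in>Basis. f b *\<^sub>R b) \<bullet> v)" by blast
 thus ?thesis using bounded_linear_imp_has_derivative[OF linear] by metis
qed
thus ?case by (intro exI[of _ "%_. \<Sum>b\<in>Basis. f b *\<^sub>R b"]) auto
next
case (const c)
show ?case by (intro exI[of _ "%_. 0"]) auto
next
case (add f g)
then obtain a b where "continuous_on UNIV a" "ALL x. (f has_derivative (%v. a x \<bullet> v)) (at x)" "continuous_on UNIV b" "ALL x. (g has_derivative (%v. b x \<bullet> v)) (at x)" by blast
thus ?case by (intro exI[of _ "%x. a x + b x"]) (auto intro!: continuous_intros derivative_eq_intros simp: inner_add_left)
next
case (mult f g)
then obtain a b where ab: "continuous_on UNIV a" "ALL x. (f has_derivative (%v. a x \<bullet> v)) (at x)" "continuous_on UNIV b" "ALL x. (g has_derivative (%v. b x \<bullet> v)) (at x)" by blast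
have cf: "continuous_on UNIV f" "continuous_on UNIV g"
 using ab by (auto intro!: continuous_at_imp_continuous_on has_derivative_continuous)
show ?case using ab cf by (intro exI[of _ "%x. f x *\<^sub>R b x + g x *\<^sub>R a x"]) (auto intro!: continuous_intros derivative_eq_intros simp: inner_add_left)
qed

text \<open>A bounded measurable \<open>s\<close> is an almost everywhere limit of continuous
  functions; these are clipped to the interval from -1 to 1 and replaced by polynomials on the ball,
  whose gradients are continuous. The bump supplies the compact support.\<close>

lemma bump_approx:
fixes s :: "'a::euclidean_space => real"
assumes s: "s:borel_measurable lebesgue" "!!x. abs (s x)<=1" and r: "r > 0" "cball x0 r \<subseteq> \<Omega>"
shows "EX ps g. (ALL n::nat. test_pair \<Omega> (ps n) (g n))&(ALL n x. abs (ps n x)<=2)&(ALL n x. x ~: cball x0 r-->ps n x = 0) &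
  negligible {x. ~ (%n. ps n x)---->bump x0 r x * s x}"
proof -
obtain N and f :: "nat => 'a => real" where f: "negligible N" "!!n. continuous_on UNIV (f n)" "!!x. x ~: N==>(%n::nat. f n x)---->s x"
 using lebesgue_measurable_imp_measurable_on[OF s(1), of UNIV] by (auto simp: measurable_on_def)
define h where "h n x = max (-1) (min 1 (f n x))" for n x
have hc: "continuous_on UNIV (h n)" for n unfolding h_def by (intro continuous_intros f)
have hl: "(%n. h n x)---->s x" if "x ~: N" for x
proof -
 have "(%n. h n x)---->max (-1) (min 1 (s x))" unfolding h_def by (intro tendsto_intros f(3)[OF that])
 thus ?thesis using s(2)[of x] by (simp add: max_def min_def abs_le_iff split: if_splits)
qed
have "EX q. real_polynomial_function q&(ALL x:cball x0 r. abs (h n x - q x) < 1 / real (Suc n))" for n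
 using Stone_Weierstrass_real_polynomial_function[of "cball x0 r" "h n" "1 / real (Suc n)"] continuous_on_subset[OF hc]
 by (metis compact_cball of_nat_0_less_iff subset_UNIV zero_less_Suc zero_less_divide_1_iff)
then obtain q where q: "!!n. real_polynomial_function (q n)" "!!n x. x:cball x0 r==>abs (h n x - q n x) < 1 / real (Suc n)" by metis
have "EX g. continuous_on UNIV g&(ALL x. (q n has_derivative (%v. g x \<bullet> v)) (at x))" for n
 by (rule real_polynomial_gradient[OF q(1)])
then obtain gq where gq: "!!n. continuous_on UNIV (gq n)" "!!n x. (q n has_derivative (%v. gq n x \<bullet> v)) (at x)" by metis
define ps where "ps n x = bump x0 r x * q n x" for n x
have 1: "EX g. test_pair \<Omega> (ps n) g" for n
 unfolding ps_def using test_pair_mult[OF bump_test_pair[OF r] gq(2) gq(1)] by blast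
have 2: "ps n x = 0" if "x ~: cball x0 r" for n x using bump_zero[OF r(1) that] by (simp add: ps_def)
have 3: "abs (ps n x)<=2" for n x
proof (cases "x:cball x0 r")
 case True
 have "abs (h n x)<=1" by (auto simp: h_def)
 moreover have "1 / real (Suc n)<=1" by simp
 ultimately have "abs (q n x)<=2" using q(2)[OF True, of n] by linarith
 hence "bump x0 r x * abs (q n x)<=1 * 2" using bump_bounds by (intro mult_mono) auto
 thus ?thesis using bump_bounds(1)[of x0 r x] by (simp add: ps_def abs_mult)
qed (simp add: 2)
have 4: "(%n. ps n x)---->bump x0 r x * s x" if x: "x ~: N" for x
proof (cases "x:cball x0 r")
 case True
 have "(%n. h n x - q n x)---->0"
  by (rule Lim_null_comparison[OF _ LIMSEQ_inverse_real_of_nat]) (use q(2)[OF True] in \<open>auto simp: inverse_eq_divide less_imp_le\<close>)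
 from tendsto_diff[OF hl[OF x] this] have "(%n. q n x)---->s x" by simp
 thus ?thesis unfolding ps_def by (intro tendsto_intros)
next
 case False
 thus ?thesis using 2 bump_zero[OF r(1) False] by simp
qed
have "negligible {x. ~ (%n. ps n x)---->bump x0 r x * s x}"
 by (rule negligible_subset[OF f(1)]) (use 4 in auto)
moreover obtain g where "!!n. test_pair \<Omega> (ps n) (g n)" using 1 by metis
ultimately show ?thesis using 2 3 by blast
qed

text \<open>A set that is null near each of its points is null, by a countable subcover.\<close>

lemma negligible_if_locally_null:
assumes "open \<Omega>" "!!x r. r > 0==>cball x r \<subseteq> \<Omega>==>negligible (S \<inter> ball x r)" "S \<subseteq> \<Omega>"
shows "negligible S"
proof -
have "EX U. openin (top_of_set S) U&x:U&negligible U" if x: "x:S" for x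
proof -
 obtain r where r: "r > 0" "cball x r \<subseteq> \<Omega>" using assms(1,3) x open_contains_cball by blast
 show ?thesis using assms(2)[OF r] x r(1) by (intro exI[of _ "S \<inter> ball x r"]) (auto simp: openin_open)
qed
thus ?thesis by (subst locally_negligible_alt) blast
qed

text \<open>Approximating a bump times the sign of \<open>f\<close> shows in the limit that the bump
  integrates to 0 against \<open>abs (f x)\<close>; so \<open>f\<close> vanishes almost everywhere
  on each ball in \<Omega>.\<close>

lemma fundamental_lemma:
fixes f :: "'a::euclidean_space => real"
assumes o: "open \<Omega>" and f: "f:borel_measurable (lebesgue_on \<Omega>)"
 and loc: "!!K. compact K==>K \<subseteq> \<Omega>==>integrable (lebesgue_on K) f"
 and z: "!!ps g. test_pair \<Omega> ps g==>(\<integral>x. ps x * f x \<partial>lebesgue_on \<Omega>) = 0"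
shows "AE x in lebesgue_on \<Omega>. f x = 0"
proof -
have \<Omega>: "\<Omega>:sets lebesgue" using o by auto
define s where "s x = (if x:\<Omega> then sgn (f x) else 0)" for x
have sm: "s:borel_measurable lebesgue"
proof -
 have "(%x. sgn (f x)):borel_measurable (lebesgue_on \<Omega>)" using f by measurable
 thus ?thesis unfolding s_def by (simp add: borel_measurable_if \<Omega>)
qed
have s1: "abs (s x)<=1" for x by (simp add: s_def sgn_if)
have "negligible {x:\<Omega>. f x~=0}"
proof (rule negligible_if_locally_null[OF o])
 fix x0 r assume r: "r > 0" "cball x0 r \<subseteq> \<Omega>"
 obtain ps g where ps: "!!n::nat. test_pair \<Omega> (ps n) (g n)" "!!n x. abs (ps n x)<=2" "!!n x. x ~: cball x0 r==>ps n x = 0"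
   "negligible {x. ~ (%n. ps n x)---->bump x0 r x * s x}"
  using bump_approx[OF sm s1 r] by blast
 have psm: "ps n:borel_measurable (lebesgue_on \<Omega>)" for n
  using test_pair_measurable(1)[OF ps(1)] by (intro measurable_restrict_space1 measurable_completion) simp
 have bm: "bump x0 r:borel_measurable (lebesgue_on \<Omega>)"
  using test_pair_measurable(1)[OF bump_test_pair[OF r]] by (intro measurable_restrict_space1 measurable_completion) simp
 have sm': "s:borel_measurable (lebesgue_on \<Omega>)" using sm by (rule measurable_restrict_space1)
 note [measurable] = psm bm sm' f
 have wi: "integrable (lebesgue_on \<Omega>) (%x. 2 * abs (indicator (cball x0 r) x * f x))"
 proof -
  have "integrable (lebesgue_on (cball x0 r)) f" by (rule loc) (use r in auto)
  hence "integrable lebesgue (%x. indicator (cball x0 r) x *\<^sub>R f x)" by (subst (asm) integrable_restrict_space) auto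
  hence "integrable lebesgue (%x. indicator \<Omega> x *\<^sub>R (indicator (cball x0 r) x * f x))"
   using r(2) by (simp add: mult.assoc[symmetric] indicator_inter_arith[symmetric] Int_absorb1)
  hence "integrable (lebesgue_on \<Omega>) (%x. indicator (cball x0 r) x * f x)" using \<Omega> by (subst integrable_restrict_space) auto
  thus ?thesis by auto
 qed
 have "(%n. \<integral>x. ps n x * f x \<partial>lebesgue_on \<Omega>)---->(\<integral>x. bump x0 r x * s x * f x \<partial>lebesgue_on \<Omega>)"
 proof (rule integral_dominated_convergence[OF _ _ wi])
  have "AE x in lebesgue_on \<Omega>. (%n. ps n x)---->bump x0 r x * s x"
   unfolding AE_lebesgue_on_iff[OF \<Omega>] by (rule negligible_subset[OF ps(4)]) auto
  thus "AE x in lebesgue_on \<Omega>. (%n. ps n x * f x)---->bump x0 r x * s x * f x"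
   by eventually_elim (intro tendsto_intros)
  show "AE x in lebesgue_on \<Omega>. norm (ps n x * f x)<=2 * abs (indicator (cball x0 r) x * f x)" for n
  proof (rule AE_I2)
   fix x show "norm (ps n x * f x)<=2 * abs (indicator (cball x0 r) x * f x)"
    using ps(2)[of n x] ps(3)[of x n] by (cases "x:cball x0 r") (auto simp: abs_mult mult_right_mono)
  qed
 qed measurable
 hence "(%n::nat. 0)---->(\<integral>x. bump x0 r x * s x * f x \<partial>lebesgue_on \<Omega>)" by (simp only: z[OF ps(1)])
 hence 0: "(\<integral>x. bump x0 r x * s x * f x \<partial>lebesgue_on \<Omega>) = 0" using LIMSEQ_unique tendsto_const by blast
 have sf: "s x * f x = abs (f x)" if "x:\<Omega>" for x using that by (simp add: s_def sgn_if)
 have nn: "AE x in lebesgue_on \<Omega>. 0<=bump x0 r x * s x * f x"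
  by (rule AE_I2) (auto simp: bump_bounds sf mult.assoc space_restrict_space)
 have ii: "integrable (lebesgue_on \<Omega>) (%x. bump x0 r x * s x * f x)"
 proof (rule Bintegrable_bound[OF wi])
  show "AE x in lebesgue_on \<Omega>. norm (bump x0 r x * s x * f x)<=norm (2 * abs (indicator (cball x0 r) x * f x))"
  proof (rule AE_I2)
   fix x assume "x:space (lebesgue_on \<Omega>)"
   hence x: "x:\<Omega>" by (simp add: space_restrict_space)
   show "norm (bump x0 r x * s x * f x)<=norm (2 * abs (indicator (cball x0 r) x * f x))"
    using bump_bounds[of x0 r x] bump_zero[OF r(1), of x x0] mult_right_mono[of "bump x0 r x" 2 "abs (f x)"]
    by (cases "x:cball x0 r") (auto simp: mult.assoc sf[OF x] abs_mult)
  qed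
 qed measurable
 have "AE x in lebesgue_on \<Omega>. bump x0 r x * s x * f x = 0" using integral_nonneg_eq_0_iff_AE[OF ii nn] 0 by blast
 hence "negligible {x:\<Omega>. ~ bump x0 r x * s x * f x = 0}" by (simp add: AE_lebesgue_on_iff[OF \<Omega>])
 thus "negligible ({x:\<Omega>. f x~=0} \<inter> ball x0 r)"
 proof (rule negligible_subset, intro subsetI)
  fix x assume x: "x:{x:\<Omega>. f x~=0} \<inter> ball x0 r"
  hence "bump x0 r x > 0" using bump_pos[OF r(1)] by blast
  thus "x:{x:\<Omega>. ~ bump x0 r x * s x * f x = 0}" using x by (auto simp: s_def sgn_if)
 qed
qed auto
thus ?thesis by (simp add: AE_lebesgue_on_iff[OF \<Omega>])
qed

text \<open>If the weighted integral were nonpositive for all test functions, approximating bumps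
  restricted to the set where \<open>V\<close> is positive would make that set null. The principal
  eigenvalue gets its competitors from here.\<close>

lemma exists_test_weight_pos:
fixes V :: "'a::euclidean_space => real"
assumes o: "open \<Omega>" and fin: "finite_measure (lebesgue_on \<Omega>)" and p: "p > 0" and V: "V:borel_measurable (lebesgue_on \<Omega>)" "AE x in lebesgue_on \<Omega>. abs (V x)<=B"
 and pos: "emeasure lebesgue {x:\<Omega>. V x > 0} > 0"
shows "EX ps g. test_pair \<Omega> ps g&(\<integral>x. V x * abs (ps x) powr p \<partial>lebesgue_on \<Omega>) > 0"
proof (rule ccontr)
assume n: "~ ?thesis"
interpret finite_measure "lebesgue_on \<Omega>" by (rule fin)
have le0: "(\<integral>x. V x * abs (ps x) powr p \<partial>lebesgue_on \<Omega>)<=0" if "test_pair \<Omega> ps g" for ps g using n that not_le by blast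
have \<Omega>: "\<Omega>:sets lebesgue" using o by auto
define s where "s x = (if x:\<Omega> then indicator {0<..} (V x) else 0 :: real)" for x
have sm: "s:borel_measurable lebesgue"
proof -
 have "(%x. indicator {0<..} (V x) :: real):borel_measurable (lebesgue_on \<Omega>)" using V by measurable
 thus ?thesis unfolding s_def by (simp add: borel_measurable_if \<Omega>)
qed
have s1: "abs (s x)<=1" for x by (simp add: s_def indicator_def)
have "negligible {x:\<Omega>. V x > 0}"
proof (rule negligible_if_locally_null[OF o])
 fix x0 r assume r: "r > 0" "cball x0 r \<subseteq> \<Omega>"
 obtain ps g where ps: "!!n::nat. test_pair \<Omega> (ps n) (g n)" "!!n x. abs (ps n x)<=2" "!!n x. x ~: cball x0 r==>ps n x = 0"
   "negligible {x. ~ (%n. ps n x)---->bump x0 r x * s x}"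
  using bump_approx[OF sm s1 r] by blast
 have psm: "ps n:borel_measurable (lebesgue_on \<Omega>)" for n
  using test_pair_measurable(1)[OF ps(1)] by (intro measurable_restrict_space1 measurable_completion) simp
 have bm: "bump x0 r:borel_measurable (lebesgue_on \<Omega>)"
  using test_pair_measurable(1)[OF bump_test_pair[OF r]] by (intro measurable_restrict_space1 measurable_completion) simp
 have sm': "s:borel_measurable (lebesgue_on \<Omega>)" using sm by (rule measurable_restrict_space1)
 note [measurable] = psm bm sm' V(1)
 have lim: "(%n. \<integral>x. V x * abs (ps n x) powr p \<partial>lebesgue_on \<Omega>)---->(\<integral>x. V x * abs (bump x0 r x * s x) powr p \<partial>lebesgue_on \<Omega>)"
 proof (rule integral_dominated_convergence)
  show "integrable (lebesgue_on \<Omega>) (%x. B * 2 powr p)" by simp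
  have "AE x in lebesgue_on \<Omega>. (%n. ps n x)---->bump x0 r x * s x"
   unfolding AE_lebesgue_on_iff[OF \<Omega>] by (rule negligible_subset[OF ps(4)]) auto
  thus "AE x in lebesgue_on \<Omega>. (%n. V x * abs (ps n x) powr p)---->V x * abs (bump x0 r x * s x) powr p"
   by eventually_elim (intro tendsto_intros tendsto_powr' tendsto_rabs, use p in auto)
  show "AE x in lebesgue_on \<Omega>. norm (V x * abs (ps n x) powr p)<=B * 2 powr p" for n using V(2)
  proof eventually_elim
   case (elim x)
   have "abs (V x) * abs (ps n x) powr p<=B * 2 powr p" using elim ps(2)[of n x] p by (intro mult_mono powr_mono2) auto
   thus ?case by (simp add: abs_mult)
  qed
 qed measurable
 have "(\<integral>x. V x * abs (bump x0 r x * s x) powr p \<partial>lebesgue_on \<Omega>)<=0"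
  by (rule LIMSEQ_le_const2[OF lim]) (use le0[OF ps(1)] in auto)
 have ii: "integrable (lebesgue_on \<Omega>) (%x. V x * abs (bump x0 r x * s x) powr p)"
 proof (rule integrable_const_bound[of _ "B * 2 powr p"])
  show "AE x in lebesgue_on \<Omega>. norm (V x * abs (bump x0 r x * s x) powr p)<=B * 2 powr p" using V(2)
  proof eventually_elim
   case (elim x)
   have "abs (bump x0 r x * s x)<=1 * 1" unfolding abs_mult using bump_bounds[of x0 r x] s1[of x] by (intro mult_mono) auto
   hence "abs (V x) * abs (bump x0 r x * s x) powr p<=B * 2 powr p" using elim p by (intro mult_mono powr_mono2) auto
   thus ?case by (simp add: abs_mult)
  qed
 qed measurable
 have nn: "AE x in lebesgue_on \<Omega>. 0<=V x * abs (bump x0 r x * s x) powr p"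
 proof (rule AE_I2)
  fix x show "0<=V x * abs (bump x0 r x * s x) powr p" by (cases "V x > 0") (auto simp: s_def indicator_def)
 qed
 have "(\<integral>x. V x * abs (bump x0 r x * s x) powr p \<partial>lebesgue_on \<Omega>) = 0"
  using \<open>_ \<le> 0\<close> integral_nonneg_AE[OF nn] by linarith
 hence "AE x in lebesgue_on \<Omega>. V x * abs (bump x0 r x * s x) powr p = 0" using integral_nonneg_eq_0_iff_AE[OF ii nn] by blast
 hence "negligible {x:\<Omega>. ~ V x * abs (bump x0 r x * s x) powr p = 0}" by (simp only: AE_lebesgue_on_iff[OF \<Omega>])
 thus "negligible ({x:\<Omega>. V x > 0} \<inter> ball x0 r)"
 proof (rule negligible_subset, intro subsetI)
  fix x assume x: "x:{x:\<Omega>. V x > 0} \<inter> ball x0 r"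
  hence "bump x0 r x > 0" using bump_pos[OF r(1)] by blast
  thus "x:{x:\<Omega>. ~ V x * abs (bump x0 r x * s x) powr p = 0}" using x by (auto simp: s_def)
 qed
qed auto
thus False using pos by (simp add: negligible_iff_null_sets null_setsD1)
qed

section \<open>The space \<open>W\<^sub>0\<^sup>1\<^sup>p\<close>\<close>

text \<open>For passing to the limit in both sides of the integration by parts formula;
  \<open>T x\<close> will be one of the two linear pairings with a bounded test function.\<close>

lemma tendsto_Ip_bounded_pairing:
fixes f :: "nat => 'a => 'b::euclidean_space" and T :: "'a => 'b => 'c::euclidean_space"
assumes p: "p > 1" and M: "finite_measure M" and f: "!!n. Lp M p (f n)" "Lp M p f'" "(%n. Ip M p (%x. f n x - f' x))---->0"
 and T: "!!x. continuous_on UNIV (T x)" "!!x y. norm (T x y)<=B * norm y" and B: "B>=0"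
 and m: "!!h. h:borel_measurable M==>(%x. T x (h x)):borel_measurable M"
shows "(%n. \<integral>x. T x (f n x) \<partial>M)---->(LINT x|M. T x (f' x))"
proof (rule tendsto_subseqI)
interpret finite_measure M by (rule M)
fix s :: "nat => nat" assume s: "strict_mono s"
have pp: "p > 0" using p by simp
have lim1: "(%n. Ip M p (%x. f (s n) x - f' x))---->0" by (rule subseq_tendsto[OF f(3) s])
obtain r where r: "strict_mono (r::nat=>nat)" "AE x in M. (%n. f (s (r n)) x)---->f' x"
 using Ip_AE_subseq[OF pp f(1) f(2) lim1] by blast
have lim2: "(%n. Ip M p (%x. f (s (r n)) x - f' x))---->0" by (rule subseq_tendsto[OF lim1 r(1)])
have le: "t<=1 + t powr p" if "t>=0" for t :: real
proof (cases "t<=1")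
 case True thus ?thesis using powr_ge_zero[of t p] by linarith
next
 case False hence "t powr 1<=t powr p" using p by (intro powr_mono) auto
 thus ?thesis using False by simp
qed
have "(%n. \<integral>x. T x (f (s (r n)) x) \<partial>M)---->(LINT x|M. T x (f' x))"
proof (rule generalized_dct(4))
 show "(%x. T x (f (s (r n)) x)):borel_measurable M" for n by (rule m[OF Lp_meas[OF f(1)]])
 show "(%x. T x (f' x)):borel_measurable M" by (rule m[OF Lp_meas[OF f(2)]])
 show "integrable M (%x. B * (1 + norm (f (s (r n)) x) powr p))" for n using Lp_int[OF f(1)] by auto
 show "integrable M (%x. B * (1 + norm (f' x) powr p))" using Lp_int[OF f(2)] by auto
 show "AE x in M. (%n. T x (f (s (r n)) x))---->T x (f' x)" using r(2)
 proof eventually_elim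
  case (elim x)
  thus ?case using T(1)[of x] by (metis continuous_on_tendsto_compose UNIV_I always_eventually)
 qed
 show "AE x in M. (%n. B * (1 + norm (f (s (r n)) x) powr p))---->B * (1 + norm (f' x) powr p)"
  using r(2) by eventually_elim (intro tendsto_intros tendsto_powr' tendsto_norm, use p in auto)
 show "AE x in M. norm (T x (f (s (r n)) x))<=B * (1 + norm (f (s (r n)) x) powr p)" for n
 proof (rule AE_I2)
  fix x
  have "B * norm (f (s (r n)) x)<=B * (1 + norm (f (s (r n)) x) powr p)" using le[of "norm (f (s (r n)) x)"] B by (intro mult_left_mono) auto
  thus "norm (T x (f (s (r n)) x))<=B * (1 + norm (f (s (r n)) x) powr p)" using T(2)[of x "f (s (r n)) x"] by linarith
 qed
 have "(%n. B * (measure M (space M) + Ip M p (f (s (r n)))))---->B * (measure M (space M) + Ip M p f')"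
  by (intro tendsto_intros Ip_tendsto[OF p f(1) f(2) lim2])
 thus "(%n. \<integral>x. B * (1 + norm (f (s (r n)) x) powr p) \<partial>M)---->(LINT x|M. B * (1 + norm (f' x) powr p))"
  using Lp_int[OF f(1)] Lp_int[OF f(2)] by (simp add: Ip_def)
qed
thus "EX r. strict_mono (r::nat=>nat)&(%k. \<integral>x. T x (f (s (r k)) x) \<partial>M)---->(LINT x|M. T x (f' x))" using r(1) by blast
qed

text \<open>The convergence step behind the chain and product rules: the composed functions grow at
  most linearly in a sequence that converges in the p-norm.\<close>

lemma Lp_dominated:
fixes f :: "nat => 'a => 'b::euclidean_space" and h :: "nat => 'a => 'c::euclidean_space" and w :: "'a => real"
assumes p: "p > 1" and fm: "!!n. f n:borel_measurable M" "f':borel_measurable M" and h: "!!n. Lp M p (h n)" "Lp M p h'" and w: "Lp M p w"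
 and lim: "AE x in M. (%n. f n x)---->f' x" "AE x in M. (%n. h n x)---->h' x" "(%n. Ip M p (%x. h n x - h' x))---->0"
 and K: "K>=0" and bd: "!!n. AE x in M. norm (f n x)<=K * norm (h n x) + abs (w x)"
shows "!!n. Lp M p (f n)" "Lp M p f'" "(%n. Ip M p (%x. f n x - f' x))---->0"
proof -
have pp: "p > 0" using p by simp
note [measurable] = fm Lp_meas[OF h(1)] Lp_meas[OF h(2)] Lp_meas[OF w]
define D where "D a x = 2 powr p * (K powr p * norm (a x) powr p + abs (w x) powr p)" for a :: "'a => 'c" and x
have Dint: "integrable M (D a)" if "Lp M p a" for a using Lp_int[OF that] Lp_int[OF w] unfolding D_def by auto
have DI: "(LINT x|M. D a x) = 2 powr p * (K powr p * Ip M p a + Ip M p w)" if "Lp M p a" for a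
 unfolding D_def Ip_def using Lp_int[OF that] Lp_int[OF w] by simp
have bdD: "norm y powr p<=D a x" if "norm y<=K * norm (a x) + abs (w x)" for y :: 'b and a x
proof -
 have "norm y powr p<=(K * norm (a x) + abs (w x)) powr p" using that pp by (intro powr_mono2) auto
 also have "...<=2 powr p * ((K * norm (a x)) powr p + abs (w x) powr p)" using K by (intro powr_add_le[OF pp]) auto
 finally show ?thesis by (simp add: D_def powr_mult)
qed
have bdall: "AE x in M. ALL n. norm (f n x)<=K * norm (h n x) + abs (w x)" using bd by (simp add: AE_all_countable)
have bd': "AE x in M. norm (f' x)<=K * norm (h' x) + abs (w x)" using bdall lim(1,2)
proof eventually_elim
 case (elim x)
 show ?case by (rule LIMSEQ_le[OF tendsto_norm[OF elim(2)], of "%n. K * norm (h n x) + abs (w x)"]) (use elim in \<open>auto intro!: tendsto_intros\<close>)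
qed
show fL: "Lp M p (f n)" for n
 by (rule Lp_bound[OF fm(1) Dint[OF h(1)[of n]]]) (use bd[of n] bdD in \<open>auto elim: eventually_mono\<close>)
show fL': "Lp M p f'"
 by (rule Lp_bound[OF fm(2) Dint[OF h(2)]]) (use bd' bdD in \<open>auto elim: eventually_mono\<close>)
have "(%n. \<integral>x. norm (f n x - f' x) powr p \<partial>M)---->(LINT x|M. 0)"
proof (rule generalized_dct(4))
 show "integrable M (%x. 2 powr p * (D (h n) x + D h' x))" for n using Dint[OF h(1)] Dint[OF h(2)] by auto
 show "integrable M (%x. 2 powr p * (D h' x + D h' x))" using Dint[OF h(2)] by auto
 show "AE x in M. (%n. norm (f n x - f' x) powr p)---->0" using lim(1)
 proof eventually_elim
  case (elim x)
  have "(%n. norm (f n x - f' x) powr p)---->norm (f' x - f' x) powr p"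
   by (intro tendsto_powr' tendsto_norm tendsto_diff elim tendsto_const) (use pp in auto)
  thus ?case using pp by simp
 qed
 show "AE x in M. (%n. 2 powr p * (D (h n) x + D h' x))---->2 powr p * (D h' x + D h' x)" using lim(2)
  unfolding D_def by eventually_elim (intro tendsto_intros tendsto_powr' tendsto_norm, use pp in auto)
 show "AE x in M. norm (norm (f n x - f' x) powr p)<=2 powr p * (D (h n) x + D h' x)" for n using bd[of n] bd'
 proof eventually_elim
  case (elim x)
  have "norm (f n x - f' x) powr p<=2 powr p * (norm (f n x) powr p + norm (f' x) powr p)" by (rule norm_diff_powr_le[OF pp])
  also have "...<=2 powr p * (D (h n) x + D h' x)" using bdD elim by (intro mult_left_mono add_mono) auto
  finally show ?case by simp
 qed
 have "(%n. 2 powr p * (2 powr p * (K powr p * Ip M p (h n) + Ip M p w) + 2 powr p * (K powr p * Ip M p h' + Ip M p w)))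
  ---->2 powr p * (2 powr p * (K powr p * Ip M p h' + Ip M p w) + 2 powr p * (K powr p * Ip M p h' + Ip M p w))"
  by (intro tendsto_intros Ip_tendsto[OF p h(1) h(2) lim(3)])
 thus "(%n. \<integral>x. 2 powr p * (D (h n) x + D h' x) \<partial>M)---->(LINT x|M. 2 powr p * (D h' x + D h' x))"
  using Dint[OF h(1)] Dint[OF h(2)] by (simp add: DI[OF h(1)] DI[OF h(2)])
qed auto
thus "(%n. Ip M p (%x. f n x - f' x))---->0" by (simp add: Ip_def)
qed

section \<open>The closure of the test functions\<close>

locale sobolev_domain =
fixes \<Omega> :: "'a::euclidean_space set" and p R :: real
assumes p1: "p > 1" and pN: "p < DIM('a)" and open_dom: "open \<Omega>" and dom_ball: "\<Omega> \<subseteq> ball 0 R"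
begin

abbreviation M where "M \<equiv> lebesgue_on \<Omega>"
definition q :: real where "q = DIM('a) * p / (DIM('a) - p)"

lemma p0: "p > 0" using p1 by simp
lemma q_gt: "q > p" "q > 1" "q > 0"
proof -
have "(DIM('a) - p) * p < DIM('a) * p" using p0 by (intro mult_strict_right_mono) auto
thus 1: "q > p" using pN by (simp add: q_def less_divide_eq mult.commute)
show "q > 1" "q > 0" using 1 p1 by linarith+
qed

lemma dom_sets: "\<Omega>:sets lebesgue" using open_dom by auto
lemma dom_lmeas: "\<Omega>:lmeasurable" using open_dom dom_ball bounded_subset[OF bounded_ball] by (intro lmeasurable_open) auto
lemma fin: "finite_measure M" by (rule finite_measure_lebesgue_on[OF dom_lmeas])
sublocale finite_measure M by (rule fin)

lemma borel_M: "f:borel_measurable borel==>f:borel_measurable M"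
by (intro measurable_restrict_space1 measurable_completion) simp

text \<open>Test functions are studied on the whole space with \<open>lborel\<close>, whereas the
  definitions use Lebesgue measure on \<Omega>; for functions vanishing outside \<Omega> the
  integrals agree.\<close>

lemma transfer_integral:
fixes f :: "'a => 'b::euclidean_space"
assumes f: "f:borel_measurable borel" "!!x. x ~: \<Omega>==>f x = 0"
shows "(LINT x|M. f x) = (LINT x|lborel. f x)" "integrable M f \<longleftrightarrow> integrable lborel f"
proof -
have eq: "(%x. indicator \<Omega> x *\<^sub>R f x) = f" using f(2) by (auto simp: indicator_def)
have fm: "f:borel_measurable lborel" using f(1) by simp
have "(LINT x|M. f x) = (LINT x|lebesgue. indicator \<Omega> x *\<^sub>R f x)" using dom_sets by (subst integral_restrict_space) auto
also have "... = (LINT x|lborel. f x)" unfolding eq by (rule integral_completion[OF fm])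
finally show "(LINT x|M. f x) = (LINT x|lborel. f x)" .
have "integrable M f \<longleftrightarrow> integrable lebesgue (%x. indicator \<Omega> x *\<^sub>R f x)" using dom_sets by (subst integrable_restrict_space) auto
thus "integrable M f \<longleftrightarrow> integrable lborel f" unfolding eq using integrable_completion[OF fm] by simp
qed

lemma transfer_Lp:
fixes f :: "'a => 'b::euclidean_space"
assumes f: "f:borel_measurable borel" "!!x. x ~: \<Omega>==>f x = 0"
shows "Lp M s f \<longleftrightarrow> Lp lborel s f" "Ip M s f = Ip lborel s f"
proof -
have m: "(%x. norm (f x) powr s):borel_measurable borel" using f(1) by measurable
show "Lp M s f \<longleftrightarrow> Lp lborel s f" unfolding Lp_def using transfer_integral(2)[OF m] f(2) f(1) borel_M[OF f(1)] by simp
show "Ip M s f = Ip lborel s f" unfolding Ip_def using transfer_integral(1)[OF m] f by simp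
qed

lemma test_transfer:
assumes t: "test_pair \<Omega> ph g"
shows "Ip M s ph = Ip lborel s ph" "Ip M s g = Ip lborel s g" "s > 0==>Lp M s ph" "s > 0==>Lp M s g"
using transfer_Lp[OF test_pair_measurable(1)[OF t]] transfer_Lp[OF test_pair_measurable(2)[OF t]] test_pair_zero_out[OF t] test_pair_Lp[OF t]
by auto

text \<open>Membership in \<open>W0\<close> with the gradient as explicit argument. Rules for sums,
  limits and compositions are proved for this relation and then read off for the chosen
  \<open>wgrad\<close>, which is determined almost everywhere.\<close>

definition apx :: "('a => real) => ('a => 'a) => bool" where
"apx u G \<longleftrightarrow> Lp M p u&Lp M p G&(EX ph g. (ALL k::nat. test_pair \<Omega> (ph k) (g k)) &
  (%k. Ip M p (%x. ph k x - u x))---->0&(%k. Ip M p (%x. g k x - G x))---->0)"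

lemma apxE:
assumes "apx u G"
shows "EX ph g. (ALL k::nat. test_pair \<Omega> (ph k) (g k))&(%k. Ip M p (%x. ph k x - u x))---->0&(%k. Ip M p (%x. g k x - G x))---->0"
using assms unfolding apx_def by blast

lemma apx_Lp: "apx u G==>Lp M p u" "apx u G==>Lp M p G" by (auto simp: apx_def)

lemma apxI:
assumes "!!k::nat. test_pair \<Omega> (ph k) (g k)" "Lp M p u" "Lp M p G" "(%k. Ip M p (%x. ph k x - u x))---->0" "(%k. Ip M p (%x. g k x - G x))---->0"
shows "apx u G"
using assms unfolding apx_def by blast

lemma apx_test: "test_pair \<Omega> ph g==>apx ph g"
by (rule apxI[of "%_. ph" "%_. g"]) (auto simp: test_transfer p0)

lemma apx_AE:
assumes "apx u G"
shows "EX ph g. (ALL k::nat. test_pair \<Omega> (ph k) (g k))&(%k. Ip M p (%x. ph k x - u x))---->0&(%k. Ip M p (%x. g k x - G x))---->0 &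
 (AE x in M. (%k. ph k x)---->u x)&(AE x in M. (%k. g k x)---->G x)"
proof -
obtain ph g where t: "!!k::nat. test_pair \<Omega> (ph k) (g k)" "(%k. Ip M p (%x. ph k x - u x))---->0" "(%k. Ip M p (%x. g k x - G x))---->0"
 using apxE[OF assms] by blast
obtain r where r: "strict_mono (r::nat=>nat)" "AE x in M. (%k. ph (r k) x)---->u x"
 using Ip_AE_subseq[OF p0 test_transfer(3)[OF t(1) p0] apx_Lp(1)[OF assms] t(2)] by blast
have 1: "(%k. Ip M p (%x. ph (r k) x - u x))---->0" "(%k. Ip M p (%x. g (r k) x - G x))---->0"
 using LIMSEQ_subseq_LIMSEQ[OF t(2) r(1)] LIMSEQ_subseq_LIMSEQ[OF t(3) r(1)] by (simp_all add: o_def)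
obtain s where s: "strict_mono (s::nat=>nat)" "AE x in M. (%k. g (r (s k)) x)---->G x"
 using Ip_AE_subseq[OF p0 test_transfer(4)[OF t(1) p0] apx_Lp(2)[OF assms] 1(2)] by blast
have 2: "(%k. Ip M p (%x. ph (r (s k)) x - u x))---->0" "(%k. Ip M p (%x. g (r (s k)) x - G x))---->0"
 using LIMSEQ_subseq_LIMSEQ[OF 1(1) s(1)] LIMSEQ_subseq_LIMSEQ[OF 1(2) s(1)] by (simp_all add: o_def)
have 3: "AE x in M. (%k. ph (r (s k)) x)---->u x" using r(2)
proof eventually_elim
 case (elim x)
 from LIMSEQ_subseq_LIMSEQ[OF elim s(1)] show ?case by (simp add: o_def)
qed
show ?thesis using t(1) 2 3 s(2) by (intro exI[of _ "%k. ph (r (s k))"] exI[of _ "%k. g (r (s k))"]) auto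
qed

lemma apx_weak_gradient:
assumes a: "apx u G"
shows "has_weak_gradient \<Omega> u G"
proof -
obtain ph g where t: "!!k::nat. test_pair \<Omega> (ph k) (g k)" "(%k. Ip M p (%x. ph k x - u x))---->0" "(%k. Ip M p (%x. g k x - G x))---->0"
 using apxE[OF a] by blast
note uG = apx_Lp[OF a]
note [measurable] = Lp_meas[OF uG(1)] Lp_meas[OF uG(2)]
have loc: "integrable (lebesgue_on K) f" if f: "Lp M p f" and K: "compact K" "K \<subseteq> \<Omega>" for K and f :: "'a => 'b::euclidean_space"
proof -
 have "Lp M 1 f" by (rule Lp_mono_exp(1)[OF fin _ _ f]) (use p1 in auto)
 hence "integrable M (%x. norm (f x))" by (simp add: Lp_def)
 hence "integrable M f" using Lp_meas[OF f] by (simp add: integrable_norm_iff)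
 hence i: "integrable lebesgue (%x. indicator \<Omega> x *\<^sub>R f x)" using dom_sets by (subst (asm) integrable_restrict_space) auto
 have Ks: "K:sets lebesgue" using K(1) by (simp add: lmeasurable_compact fmeasurableD)
 from integrable_mult_indicator[OF Ks i] have "integrable lebesgue (%x. indicator K x *\<^sub>R f x)"
 proof (rule Bintegrable_cong[THEN iffD1, rotated 2])
  show "indicator K x *\<^sub>R indicator \<Omega> x *\<^sub>R f x = indicator K x *\<^sub>R f x" for x using K(2) by (auto simp: indicator_def)
 qed simp
 thus ?thesis using Ks by (subst integrable_restrict_space) auto
qed
have parts: "(LINT x|M. u x *\<^sub>R h x) = - (LINT x|M. ps x *\<^sub>R G x)" if th: "test_pair \<Omega> ps h" for ps h
proof -
 obtain B where B: "B > 0" "!!x. abs (ps x)<=B" "!!x. norm (h x)<=B" using test_pair_bounded[OF th] by blast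
 note [measurable] = borel_M[OF test_pair_measurable(1)[OF th]] borel_M[OF test_pair_measurable(2)[OF th]]
 have 1: "(%k. \<integral>x. ph k x *\<^sub>R h x \<partial>M)---->(LINT x|M. u x *\<^sub>R h x)"
  by (rule tendsto_Ip_bounded_pairing[OF p1 fin test_transfer(3)[OF t(1) p0] uG(1) t(2), of "%x y. y *\<^sub>R h x" B])
    (use B in \<open>auto intro!: continuous_intros mult_right_mono simp: mult.commute[of B]  mult_left_mono\<close>)
 have 2: "(%k. \<integral>x. ps x *\<^sub>R g k x \<partial>M)---->(LINT x|M. ps x *\<^sub>R G x)"
  by (rule tendsto_Ip_bounded_pairing[OF p1 fin test_transfer(4)[OF t(1) p0] uG(2) t(3), of "%x y. ps x *\<^sub>R y" B])
    (use B in \<open>auto intro!: continuous_intros mult_right_mono\<close>)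
 have "(LINT x|M. ph k x *\<^sub>R h x) = - (LINT x|M. ps x *\<^sub>R g k x)" for k
 proof -
  note [measurable] = test_pair_measurable[OF th] test_pair_measurable[OF t(1)[of k]]
  have "(LINT x|M. ph k x *\<^sub>R h x) = (LINT x|lborel. ph k x *\<^sub>R h x)"
   by (rule transfer_integral(1)) (use test_pair_zero_out[OF th] in auto)
  also have "... = - (LINT x|lborel. ps x *\<^sub>R g k x)" by (rule integration_by_parts_test[OF t(1) th])
  also have "(LINT x|lborel. ps x *\<^sub>R g k x) = (LINT x|M. ps x *\<^sub>R g k x)"
   by (rule transfer_integral(1)[symmetric]) (use test_pair_zero_out[OF th] in auto)
  finally show ?thesis .
 qed
 with tendsto_minus[OF 2] have "(%k. \<integral>x. ph k x *\<^sub>R h x \<partial>M)---->- (LINT x|M. ps x *\<^sub>R G x)" by simp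
 thus ?thesis by (rule LIMSEQ_unique[OF 1])
qed
show ?thesis unfolding has_weak_gradient_def using loc[OF uG(1)] loc[OF uG(2)] parts by auto
qed

text \<open>The difference of two weak gradients is orthogonal to all test functions, component by
  component. This gives the choice in \<open>wgrad\<close> its meaning.\<close>

lemma weak_gradient_unique:
assumes w: "has_weak_gradient \<Omega> u G" "has_weak_gradient \<Omega> u H"
shows "AE x in M. G x = H x"
proof -
have m: "G:borel_measurable M" "H:borel_measurable M" using w by (auto simp: has_weak_gradient_def)
note [measurable] = m
have il: "integrable (lebesgue_on K) G" "integrable (lebesgue_on K) H" if "compact K" "K \<subseteq> \<Omega>" for K
 using w that by (auto simp: has_weak_gradient_def)
have "AE x in M. (G x - H x) \<bullet> b = 0" if b: "b:Basis" for b
proof (rule fundamental_lemma[OF open_dom])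
 show "integrable (lebesgue_on K) (%x. (G x - H x) \<bullet> b)" if "compact K" "K \<subseteq> \<Omega>" for K using il[OF that] by auto
 fix ps g assume t: "test_pair \<Omega> ps g"
 have ii: "integrable M (%x. ps x *\<^sub>R F x)" if F: "F:borel_measurable M" "!!K. compact K==>K \<subseteq> \<Omega>==>integrable (lebesgue_on K) F" for F :: "'a => 'a"
 proof -
  obtain B where B: "B > 0" "!!x. abs (ps x)<=B" using test_pair_bounded[OF t] by blast
  let ?K = "tsupp ps"
  have Ks: "?K:sets lebesgue" using test_pairD(3)[OF t] by (simp add: lmeasurable_compact fmeasurableD)
  have "integrable (lebesgue_on ?K) F" by (rule F(2)[OF test_pairD(3,4)[OF t]])
  hence "integrable lebesgue (%x. indicator ?K x *\<^sub>R F x)" using Ks by (subst (asm) integrable_restrict_space) auto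
  hence "integrable lebesgue (%x. indicator \<Omega> x *\<^sub>R (indicator ?K x *\<^sub>R F x))"
   by (rule integrable_mult_indicator[OF dom_sets])
  hence i2: "integrable M (%x. indicator ?K x *\<^sub>R F x)" using dom_sets by (subst integrable_restrict_space) auto
  note [measurable] = F(1) borel_M[OF test_pair_measurable(1)[OF t]]
  show ?thesis
  proof (rule Bintegrable_bound)
   show "integrable M (%x. B *\<^sub>R (indicat_real ?K x *\<^sub>R F x))" by (rule integrable_scaleR_right) (rule i2)
   show "AE x in M. norm (ps x *\<^sub>R F x)<=norm (B *\<^sub>R (indicator ?K x *\<^sub>R F x))"
    by (rule AE_I2) (use B test_pair_zero(1)[OF t] in \<open>auto simp: indicator_def intro!: mult_right_mono\<close>)
  qed measurable
 qed
 have e: "(LINT x|M. ps x *\<^sub>R G x) = (LINT x|M. ps x *\<^sub>R H x)"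
 proof -
  have wi: "(LINT x|M. u x *\<^sub>R g x) = - (LINT x|M. ps x *\<^sub>R F x)" if "has_weak_gradient \<Omega> u F" for F
   using that[unfolded has_weak_gradient_def, THEN conjunct2, THEN conjunct2, THEN conjunct2, rule_format, OF t] .
  show ?thesis using wi[OF w(1)] wi[OF w(2)] by (metis neg_equal_iff_equal)
 qed
 have iG: "integrable M (%x. ps x *\<^sub>R G x)" and iH: "integrable M (%x. ps x *\<^sub>R H x)"
  using ii[OF m(1) il(1)] ii[OF m(2) il(2)] by auto
 have "(LINT x|M. ps x * ((G x - H x) \<bullet> b)) = (LINT x|M. (ps x *\<^sub>R G x - ps x *\<^sub>R H x) \<bullet> b)"
  by (simp add: inner_diff_left right_diff_distrib)
 also have "... = ((LINT x|M. ps x *\<^sub>R G x) - (LINT x|M. ps x *\<^sub>R H x)) \<bullet> b"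
  using iG iH by (subst integral_inner_left) auto
 finally show "(LINT x|M. ps x * ((G x - H x) \<bullet> b)) = 0" using e by simp
qed measurable
hence "AE x in M. ALL b:Basis. (G x - H x) \<bullet> b = 0" by (intro AE_finite_allI) auto
thus ?thesis by eventually_elim (simp add: euclidean_eq_iff[where 'a='a] inner_diff_left)
qed

lemma apx_cong:
assumes a: "apx u G" and u: "AE x in M. u x = u' x" "u':borel_measurable M" and G: "AE x in M. G x = G' x" "G':borel_measurable M"
shows "apx u' G'"
proof -
obtain ph g where t: "!!k::nat. test_pair \<Omega> (ph k) (g k)" "(%k. Ip M p (%x. ph k x - u x))---->0" "(%k. Ip M p (%x. g k x - G x))---->0"
 using apxE[OF a] by blast
note uG = apx_Lp[OF a]
note [measurable] = Lp_meas[OF uG(1)] Lp_meas[OF uG(2)] u(2) G(2)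
note [measurable] = borel_M[OF test_pair_measurable(1)[OF t(1)]] borel_M[OF test_pair_measurable(2)[OF t(1)]]
have 1: "Ip M p (%x. ph k x - u' x) = Ip M p (%x. ph k x - u x)" for k
 by (rule Lp_cong_AE(2)[OF _ _ Lp_diff(1)[OF p0 test_transfer(3)[OF t(1) p0] uG(1)]]) (use u(1) in \<open>auto elim: eventually_mono\<close>)
have 2: "Ip M p (%x. g k x - G' x) = Ip M p (%x. g k x - G x)" for k
 by (rule Lp_cong_AE(2)[OF _ _ Lp_diff(1)[OF p0 test_transfer(4)[OF t(1) p0] uG(2)]]) (use G(1) in \<open>auto elim: eventually_mono\<close>)
show ?thesis
 by (rule apxI[of ph g, OF t(1) Lp_cong_AE(1)[OF u uG(1)] Lp_cong_AE(1)[OF G uG(2)]]) (simp_all add: 1 2 t)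
qed

lemma W0_iff: "u:W0 \<Omega> p \<longleftrightarrow> (EX G. apx u G)"
proof
assume "u:W0 \<Omega> p"
thus "EX G. apx u G" unfolding W0_def apx_def Ip_def Lp_on_def Lp_def by auto
next
assume "EX G. apx u G"
then obtain G where a: "apx u G" by blast
show "u:W0 \<Omega> p" unfolding W0_def mem_Collect_eq
 using apx_weak_gradient[OF a] a by (intro exI[of _ G]) (simp add: apx_def Ip_def Lp_on_def Lp_def)
qed

lemma apx_wgrad: "apx u G==>AE x in M. wgrad \<Omega> u x = G x"
proof -
assume a: "apx u G"
have "has_weak_gradient \<Omega> u (wgrad \<Omega> u)" unfolding wgrad_def by (rule someI[of "has_weak_gradient \<Omega> u", OF apx_weak_gradient[OF a]])
thus ?thesis by (rule weak_gradient_unique[OF _ apx_weak_gradient[OF a]])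
qed

lemma W0_apx: "u:W0 \<Omega> p==>apx u (wgrad \<Omega> u)"
proof -
assume "u:W0 \<Omega> p"
then obtain G where a: "apx u G" by (auto simp: W0_iff)
have "has_weak_gradient \<Omega> u (wgrad \<Omega> u)" unfolding wgrad_def by (rule someI[of "has_weak_gradient \<Omega> u", OF apx_weak_gradient[OF a]])
hence m: "wgrad \<Omega> u:borel_measurable M" by (simp add: has_weak_gradient_def)
have "AE x in M. G x = wgrad \<Omega> u x" using apx_wgrad[OF a] by eventually_elim simp
thus ?thesis by (intro apx_cong[OF a _ Lp_meas[OF apx_Lp(1)[OF a]] _ m]) auto
qed

lemma apx_W0: "apx u G==>u:W0 \<Omega> p" by (auto simp: W0_iff)

lemma apx_Ip_wgrad: "apx u G==>Ip M p (wgrad \<Omega> u) = Ip M p G"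
using Lp_cong_AE(2)[OF apx_wgrad _ apx_Lp(2)[OF W0_apx[OF apx_W0]]] Lp_meas[OF apx_Lp(2)] by metis

lemma Wnorm_eq: "Wnorm \<Omega> p u = Ip M p (wgrad \<Omega> u) powr (1/p)" by (simp add: Wnorm_def Ip_def)

lemma apx_Wnorm: "apx u G==>Wnorm \<Omega> p u = Ip M p G powr (1/p)" by (simp add: Wnorm_eq apx_Ip_wgrad)

text \<open>The k-th function is replaced by a test pair closer than
  \<open>1 / real (Suc k)\<close>, so that closedness and Rellich's theorem reduce to sequences of
  test functions.\<close>

lemma apx_choose:
assumes a: "!!k::nat. apx (u k) (G k)"
shows "EX ph g. (ALL k. test_pair \<Omega> (ph k) (g k)&Ip M p (%x. g k x - G k x)<=1) &
 (%k. Ip M p (%x. ph k x - u k x))---->0&(%k. Ip M p (%x. g k x - G k x))---->0"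
proof -
have "EX ph g. test_pair \<Omega> ph g&Ip M p (%x. ph x - u k x) < 1 / real (Suc k)&Ip M p (%x. g x - G k x) < 1 / real (Suc k)" for k
proof -
 obtain ph g where t: "!!j::nat. test_pair \<Omega> (ph j) (g j)" "(%j. Ip M p (%x. ph j x - u k x))---->0" "(%j. Ip M p (%x. g j x - G k x))---->0"
  using apxE[OF a[of k]] by blast
 have "1 / real (Suc k) > 0" by simp
 from eventually_conj[OF order_tendstoD(2)[OF t(2) this] order_tendstoD(2)[OF t(3) this]]
 show ?thesis using t(1) by (auto simp: eventually_sequentially)
qed
then obtain ph g where t: "!!k. test_pair \<Omega> (ph k) (g k)" "!!k. Ip M p (%x. ph k x - u k x) < 1 / real (Suc k)" "!!k. Ip M p (%x. g k x - G k x) < 1 / real (Suc k)"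
 by metis
have inv: "(%k. 1 / real (Suc k))---->0" by (rule recip_tendsto)
have n1: "(%k. Ip M p (%x. ph k x - u k x))---->0"
 by (rule Lim_null_comparison[OF _ inv]) (use less_imp_le[OF t(2)] in \<open>simp add: Ip_nonneg\<close>)
have n2: "(%k. Ip M p (%x. g k x - G k x))---->0"
 by (rule Lim_null_comparison[OF _ inv]) (use less_imp_le[OF t(3)] in \<open>simp add: Ip_nonneg\<close>)
have "1 / real (Suc k)<=1" for k by simp
hence "Ip M p (%x. g k x - G k x)<=1" for k using t(3)[of k] less_imp_le order_trans by blast
thus ?thesis using t(1) n1 n2 by blast
qed

lemma apx_closed:
assumes a: "!!k::nat. apx (u k) (G k)" and L: "Lp M p u'" "Lp M p G'" and lim: "(%k. Ip M p (%x. u k x - u' x))---->0" "(%k. Ip M p (%x. G k x - G' x))---->0"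
shows "apx u' G'"
proof -
obtain ph g where t: "!!k. test_pair \<Omega> (ph k) (g k)" "(%k. Ip M p (%x. ph k x - u k x))---->0" "(%k. Ip M p (%x. g k x - G k x))---->0"
 using apx_choose[of u G, OF a] by blast
show ?thesis
 by (rule apxI[OF t(1) L Ip_lim_trans[of p M ph u "%_. u'", OF p0 test_transfer(3)[OF t(1) p0] apx_Lp(1)[OF a] L(1) t(2) lim(1)]
  Ip_lim_trans[of p M g G "%_. G'", OF p0 test_transfer(4)[OF t(1) p0] apx_Lp(2)[OF a] L(2) t(3) lim(2)]])
qed

lemma apx_add:
assumes a: "apx u G" "apx v H"
shows "apx (%x. u x + v x) (%x. G x + H x)"
proof -
obtain ph g where t: "!!k::nat. test_pair \<Omega> (ph k) (g k)" "(%k. Ip M p (%x. ph k x - u x))---->0" "(%k. Ip M p (%x. g k x - G x))---->0"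
 using apxE[OF a(1)] by blast
obtain ps h where s: "!!k::nat. test_pair \<Omega> (ps k) (h k)" "(%k. Ip M p (%x. ps k x - v x))---->0" "(%k. Ip M p (%x. h k x - H x))---->0"
 using apxE[OF a(2)] by blast
have z: "(%k. 2 powr p * (x k + y k))---->0" if "x---->0" "y---->0" for x y :: "nat => real"
 using tendsto_mult_left[OF tendsto_add[OF that], of "2 powr p"] by simp
show ?thesis
proof (rule apxI[OF test_pair_add[OF t(1) s(1)] Lp_add(1)[OF p0 apx_Lp(1)[OF a(1)] apx_Lp(1)[OF a(2)]] Lp_add(1)[OF p0 apx_Lp(2)[OF a(1)] apx_Lp(2)[OF a(2)]]])
 show "(%k. Ip M p (%x. ph k x + ps k x - (u x + v x)))---->0"
 proof (rule Lim_null_comparison[OF _ z[OF t(2) s(2)]], intro always_eventually allI)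
  fix k show "norm (Ip M p (%x. ph k x + ps k x - (u x + v x)))<=2 powr p * (Ip M p (%x. ph k x - u x) + Ip M p (%x. ps k x - v x))"
   using Lp_add(2)[OF p0 Lp_diff(1)[OF p0 test_transfer(3)[OF t(1) p0] apx_Lp(1)[OF a(1)]] Lp_diff(1)[OF p0 test_transfer(3)[OF s(1) p0] apx_Lp(1)[OF a(2)]]]
   by (simp add: Ip_nonneg add_diff_add)
 qed
 show "(%k. Ip M p (%x. g k x + h k x - (G x + H x)))---->0"
 proof (rule Lim_null_comparison[OF _ z[OF t(3) s(3)]], intro always_eventually allI)
  fix k show "norm (Ip M p (%x. g k x + h k x - (G x + H x)))<=2 powr p * (Ip M p (%x. g k x - G x) + Ip M p (%x. h k x - H x))"
   using Lp_add(2)[OF p0 Lp_diff(1)[OF p0 test_transfer(4)[OF t(1) p0] apx_Lp(2)[OF a(1)]] Lp_diff(1)[OF p0 test_transfer(4)[OF s(1) p0] apx_Lp(2)[OF a(2)]]]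
   by (simp add: Ip_nonneg add_diff_add)
 qed
qed
qed

lemma apx_scale:
assumes a: "apx u G"
shows "apx (%x. c * u x) (%x. c *\<^sub>R G x)"
proof -
obtain ph g where t: "!!k::nat. test_pair \<Omega> (ph k) (g k)" "(%k. Ip M p (%x. ph k x - u x))---->0" "(%k. Ip M p (%x. g k x - G x))---->0"
 using apxE[OF a] by blast
show ?thesis
proof (rule apxI[OF test_pair_scale[OF t(1)] Lp_scale_real(1)[OF apx_Lp(1)[OF a]] Lp_scale(1)[OF apx_Lp(2)[OF a]]])
 have "Ip M p (%x. c * ph k x - c * u x) = abs c powr p * Ip M p (%x. ph k x - u x)" for k
  using Lp_scale_real(2)[OF Lp_diff(1)[OF p0 test_transfer(3)[OF t(1) p0] apx_Lp(1)[OF a]], of c] by (simp add: right_diff_distrib)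
 thus "(%k. Ip M p (%x. c * ph k x - c * u x))---->0" using tendsto_mult_left[OF t(2), of "abs c powr p"] by simp
 have "Ip M p (%x. c *\<^sub>R g k x - c *\<^sub>R G x) = abs c powr p * Ip M p (%x. g k x - G x)" for k
  using Lp_scale(2)[OF Lp_diff(1)[OF p0 test_transfer(4)[OF t(1) p0] apx_Lp(2)[OF a]], of c] by (simp add: scaleR_diff_right)
 thus "(%k. Ip M p (%x. c *\<^sub>R g k x - c *\<^sub>R G x))---->0" using tendsto_mult_left[OF t(3), of "abs c powr p"] by simp
qed
qed

lemma apx_diff: "apx u G==>apx v H==>apx (%x. u x - v x) (%x. G x - H x)"
using apx_add[of u G "%x. (-1) * v x" "%x. (-1) *\<^sub>R H x"] apx_scale[of v H "-1"] by simp

lemma apx_poincare: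
assumes a: "apx u G"
shows "Ip M p u<=(2*R) powr p * Ip M p G"
proof -
obtain ph g where t: "!!k::nat. test_pair \<Omega> (ph k) (g k)" "(%k. Ip M p (%x. ph k x - u x))---->0" "(%k. Ip M p (%x. g k x - G x))---->0"
 using apxE[OF a] by blast
have 1: "(%k. Ip M p (ph k))---->Ip M p u" by (rule Ip_tendsto[OF p1 test_transfer(3)[OF t(1) p0] apx_Lp(1)[OF a] t(2)])
have 2: "(%k. Ip M p (g k))---->Ip M p G" by (rule Ip_tendsto[OF p1 test_transfer(4)[OF t(1) p0] apx_Lp(2)[OF a] t(3)])
show ?thesis
 by (rule LIMSEQ_le[OF 1 tendsto_mult_left[OF 2]]) (use poincare_test[OF p1 t(1) dom_ball] test_transfer[OF t(1)] in auto)
qed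

definition Sq :: real where "Sq = sobolev_const TYPE('a) p q"

lemma sobolev_test_scaled:
assumes t: "test_pair \<Omega> ph g" and s: "s > 0" and e: "Ip M p g<=s powr p"
shows "Ip M q ph<=Sq * s powr q"
proof -
have ts: "test_pair \<Omega> (%x. (1/s) * ph x) (%x. (1/s) *\<^sub>R g x)" by (rule test_pair_scale[OF t])
have s1: "(1/s) powr r * s powr r = 1" for r using s by (simp add: powr_divide)
have "Ip lborel p (%x. (1/s) *\<^sub>R g x) = (1/s) powr p * Ip M p g"
 using Lp_scale(2)[OF test_pair_Lp(2)[OF t p0], of "1/s"] s test_transfer(2)[OF t] by simp
also have "...<=(1/s) powr p * s powr p" by (intro mult_left_mono e) simp
finally have "Ip lborel p (%x. (1/s) *\<^sub>R g x)<=1" unfolding s1 .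
from sobolev_test[OF p1 pN q_def ts this] have "Ip lborel q (%x. (1/s) * ph x)<=Sq" by (simp add: Sq_def)
moreover have "Ip lborel q (%x. (1/s) * ph x) = (1/s) powr q * Ip M q ph"
 using Lp_scale_real(2)[OF test_pair_Lp(1)[OF t q_gt(3)], of "1/s"] s test_transfer(1)[OF t] by simp
ultimately have "(1/s) powr q * Ip M q ph * s powr q<=Sq * s powr q" by (intro mult_right_mono) auto
moreover have "(1/s) powr q * Ip M q ph * s powr q = ((1/s) powr q * s powr q) * Ip M q ph" by simp
ultimately show ?thesis unfolding s1 by simp
qed

lemma apx_sobolev:
assumes a: "apx u G"
shows "Lp M q u" "Ip M q u<=Sq * (Ip M p G powr (1/p)) powr q"
proof -
obtain ph g where t: "!!k::nat. test_pair \<Omega> (ph k) (g k)" "(%k. Ip M p (%x. ph k x - u x))---->0" "(%k. Ip M p (%x. g k x - G x))---->0"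
  "AE x in M. (%k. ph k x)---->u x" "AE x in M. (%k. g k x)---->G x"
 using apx_AE[OF a] by blast
define n where "n = Ip M p G powr (1/p)"
have n0: "n>=0" by (simp add: n_def)
have np: "n powr p = Ip M p G" using p0 by (simp add: n_def powr_powr Ip_nonneg)
have lim: "(%k. Ip M p (g k))---->Ip M p G" by (rule Ip_tendsto[OF p1 test_transfer(4)[OF t(1) p0] apx_Lp(2)[OF a] t(3)])
\<comment> \<open>With \<open>s\<close> strictly above the norm of \<open>G\<close>, late
  approximants satisfy the scaled inequality, and Fatou's lemma passes to \<open>u\<close>.
  Strictness also covers a vanishing gradient, by whose norm one could not divide.\<close>
have *: "Lp M q u&Ip M q u<=Sq * s powr q" if s: "s > n" for s
proof -
 have "n powr p < s powr p" using s n0 p0 by (intro powr_less_mono2) auto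
 hence "eventually (%k. Ip M p (g k) < s powr p) sequentially" using order_tendstoD(2)[OF lim] np by simp
 then obtain k0 where k0: "!!k. k>=k0==>Ip M p (g k) < s powr p" by (auto simp: eventually_sequentially)
 have le: "Ip M q (ph (k + k0))<=Sq * s powr q" for k
  by (rule sobolev_test_scaled[OF t(1)]) (use s n0 k0[of "k + k0"] in auto)
 have ae: "AE x in M. (%k. ph (k + k0) x)---->u x" using t(4) by eventually_elim (rule LIMSEQ_ignore_initial_segment)
 show ?thesis using Lp_fatou[OF q_gt(3) test_transfer(3)[OF t(1) q_gt(3)] Lp_meas[OF apx_Lp(1)[OF a]] ae le] by blast
qed
show "Lp M q u" using *[of "n + 1"] by simp
have l: "(%k. Sq * (n + 1 / real (Suc k)) powr q)---->Sq * (n + 0) powr q"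
 using LIMSEQ_inverse_real_of_nat n0 q_gt by (intro tendsto_intros tendsto_powr') (auto simp: inverse_eq_divide)
have "Ip M q u<=Sq * (n + 0) powr q"
 by (rule LIMSEQ_le_const[OF l]) (use *[of "n + 1 / real (Suc _)"] in auto)
thus "Ip M q u<=Sq * (Ip M p G powr (1/p)) powr q" by (simp add: n_def)
qed

lemma apx_rellich:
assumes a: "!!k::nat. apx (u k) (G k)" and B: "!!k. Ip M p (G k)<=B"
shows "EX r v. strict_mono (r::nat=>nat)&Lp M p v&(%k. Ip M p (%x. u (r k) x - v x))---->0&(AE x in M. (%k. u (r k) x)---->v x)"
proof -
obtain ph g where t: "!!k. test_pair \<Omega> (ph k) (g k)" "!!k. Ip M p (%x. g k x - G k x)<=1" "(%k. Ip M p (%x. ph k x - u k x))---->0"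
 using apx_choose[of u G, OF a] by blast
have gB: "Ip lborel p (g k)<=2 powr p * (1 + B)" for k
proof -
 have "Ip M p (%x. (g k x - G k x) + G k x)<=2 powr p * (Ip M p (%x. g k x - G k x) + Ip M p (G k))"
  by (rule Lp_add(2)[OF p0 Lp_diff(1)[OF p0 test_transfer(4)[OF t(1) p0] apx_Lp(2)[OF a]] apx_Lp(2)[OF a]])
 also have "...<=2 powr p * (1 + B)" by (intro mult_left_mono add_mono B t) simp
 finally show ?thesis using test_transfer(2)[OF t(1)] by simp
qed
obtain r where r: "strict_mono (r::nat=>nat)" "!!e. e > 0==>EX N. ALL m>=N. ALL n>=N. Ip lborel p (%x. ph (r m) x - ph (r n) x) < e"
 using rellich_test[of p \<Omega> ph g, OF p1 t(1) dom_ball gB] by metis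
have "EX N. ALL m>=N. ALL n>=N. Ip M p (%x. ph (r m) x - ph (r n) x) < e" if "e > 0" for e
 using r(2)[OF that] test_transfer(1)[OF test_pair_diff[OF t(1) t(1)]] by simp
from Lp_complete[OF p1 fin, of "%n. ph (r n)", OF test_transfer(3)[OF t(1) p0] this]
obtain v where v: "Lp M p v" "(%n. Ip M p (%x. ph (r n) x - v x))---->0" by blast
have "(%k. Ip M p (%x. ph (r k) x - u (r k) x))---->0" by (rule subseq_tendsto[OF t(3) r(1)])
hence tr: "(%k. Ip M p (%x. u (r k) x - ph (r k) x))---->0" by (simp only: Ip_minus_commute[of M p "u (r _)" "ph (r _)"])
have uv: "(%k. Ip M p (%x. u (r k) x - v x))---->0"
 by (rule Ip_lim_trans[of p M "%k. u (r k)" "%k. ph (r k)" "%_. v", OF p0 apx_Lp(1)[OF a] test_transfer(3)[OF t(1) p0] v(1) tr v(2)])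
obtain s where s: "strict_mono (s::nat=>nat)" "AE x in M. (%k. u (r (s k)) x)---->v x"
 using Ip_AE_subseq[OF p0 apx_Lp(1)[OF a] v(1) uv] by blast
have "(%k. Ip M p (%x. u ((r \<circ> s) k) x - v x))---->0" using LIMSEQ_subseq_LIMSEQ[OF uv s(1)] by (simp add: o_def)
thus ?thesis using strict_mono_o[OF r(1) s(1)] v(1) s(2) by (intro exI[of _ "r \<circ> s"] exI[of _ v]) auto
qed

text \<open>The rule for test pairs is an assumption because its two uses differ: with
  \<open>\<alpha>\<close> equal to 1, compact support requires \<open>Th 0 = 0\<close>; with a test
  function \<open>\<alpha>\<close> it is automatic, and \<open>Th\<close> need not vanish at 0, as
  for \<open>picone_fun\<close>.\<close>

lemma apx_mult_comp:
assumes a: "apx u G" and tt: "!!ph g. test_pair \<Omega> ph g==>test_pair \<Omega> (%x. \<alpha> x * Th (ph x)) (%x. \<alpha> x *\<^sub>R (Th' (ph x) *\<^sub>R g x) + Th (ph x) *\<^sub>R b x)"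
 and \<alpha>b [measurable]: "\<alpha>:borel_measurable M" "b:borel_measurable M" and B: "!!x. abs (\<alpha> x)<=B" "!!x. norm (b x)<=B"
 and d: "!!s. (Th has_real_derivative Th' s) (at s)" and c: "continuous_on UNIV Th'" and K: "!!s. abs (Th' s)<=K" "!!s. abs (Th s)<=K"
shows "apx (%x. \<alpha> x * Th (u x)) (%x. \<alpha> x *\<^sub>R (Th' (u x) *\<^sub>R G x) + Th (u x) *\<^sub>R b x)"
proof -
obtain ph g where t: "!!k::nat. test_pair \<Omega> (ph k) (g k)" "(%k. Ip M p (%x. ph k x - u x))---->0" "(%k. Ip M p (%x. g k x - G x))---->0"
  "AE x in M. (%k. ph k x)---->u x" "AE x in M. (%k. g k x)---->G x"
 using apx_AE[OF a] by blast
have B0: "B>=0" using B(2) norm_ge_zero order_trans by blast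
have K0: "K>=0" using K(1)[of 0] by linarith
have cT: "continuous_on UNIV Th" using d by (meson DERIV_isCont continuous_at_imp_continuous_on)
note uG = apx_Lp[OF a]
note [measurable] = Lp_meas[OF uG(1)] Lp_meas[OF uG(2)] borel_measurable_continuous_onI[OF cT] borel_measurable_continuous_onI[OF c]
note [measurable] = borel_M[OF test_pair_measurable(1)[OF t(1)]] borel_M[OF test_pair_measurable(2)[OF t(1)]]
have aeT: "AE x in M. (%k. Th (ph k x))---->Th (u x)&(%k. Th' (ph k x))---->Th' (u x)" using t(4)
proof eventually_elim
 case (elim x)
 show ?case using continuous_on_tendsto_compose[OF cT elim] continuous_on_tendsto_compose[OF c elim] by auto
qed
have 1: "Lp M p (%x. \<alpha> x * Th (u x))" "(%k. Ip M p (%x. \<alpha> x * Th (ph k x) - \<alpha> x * Th (u x)))---->0"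
proof -
 have ae: "AE x in M. (%k. \<alpha> x * Th (ph k x))---->\<alpha> x * Th (u x)" using aeT by eventually_elim (auto intro!: tendsto_intros)
 have bd: "AE x in M. norm (\<alpha> x * Th (ph n x))<=0 * norm (ph n x) + abs (B * K)" for n
  using mult_mono[OF B(1) K(2)] B0 K0 by (simp add: abs_mult)
 have w: "Lp M p (%x. B * K)" by (simp add: Lp_def)
 note L = Lp_dominated[OF p1 _ _ test_transfer(3)[OF t(1) p0] uG(1) w ae t(4) t(2) _ bd]
 show "Lp M p (%x. \<alpha> x * Th (u x))" by (rule L(2)) auto
 show "(%k. Ip M p (%x. \<alpha> x * Th (ph k x) - \<alpha> x * Th (u x)))---->0" by (rule L(3)) auto
qed
have 2: "Lp M p (%x. \<alpha> x *\<^sub>R (Th' (u x) *\<^sub>R G x) + Th (u x) *\<^sub>R b x)"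
  "(%k. Ip M p (%x. (\<alpha> x *\<^sub>R (Th' (ph k x) *\<^sub>R g k x) + Th (ph k x) *\<^sub>R b x) - (\<alpha> x *\<^sub>R (Th' (u x) *\<^sub>R G x) + Th (u x) *\<^sub>R b x)))---->0"
proof -
 have ae: "AE x in M. (%k. \<alpha> x *\<^sub>R (Th' (ph k x) *\<^sub>R g k x) + Th (ph k x) *\<^sub>R b x)---->\<alpha> x *\<^sub>R (Th' (u x) *\<^sub>R G x) + Th (u x) *\<^sub>R b x"
  using aeT t(5) by eventually_elim (auto intro!: tendsto_intros)
 have bd: "AE x in M. norm (\<alpha> x *\<^sub>R (Th' (ph n x) *\<^sub>R g n x) + Th (ph n x) *\<^sub>R b x)<=(B * K) * norm (g n x) + abs (B * K)" for n
 proof (rule AE_I2)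
  fix x
  have "abs (\<alpha> x) * (abs (Th' (ph n x)) * norm (g n x))<=B * (K * norm (g n x))" using B K B0 K0 by (intro mult_mono) (auto intro: mult_nonneg_nonneg)
  moreover have "abs (Th (ph n x)) * norm (b x)<=K * B" using K B K0 by (intro mult_mono) auto
  ultimately show "norm (\<alpha> x *\<^sub>R (Th' (ph n x) *\<^sub>R g n x) + Th (ph n x) *\<^sub>R b x)<=(B * K) * norm (g n x) + abs (B * K)"
   using norm_triangle_ineq[of "\<alpha> x *\<^sub>R (Th' (ph n x) *\<^sub>R g n x)" "Th (ph n x) *\<^sub>R b x"] B0 K0 by (simp add: mult.assoc abs_mult mult.commute[of K B])
 qed
 have w: "Lp M p (%x. B * K)" by (simp add: Lp_def)
 note L = Lp_dominated[OF p1 _ _ test_transfer(4)[OF t(1) p0] uG(2) w ae t(5) t(3) _ bd]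
 show "Lp M p (%x. \<alpha> x *\<^sub>R (Th' (u x) *\<^sub>R G x) + Th (u x) *\<^sub>R b x)" by (rule L(2)) (use B0 K0 in auto)
 show "(%k. Ip M p (%x. (\<alpha> x *\<^sub>R (Th' (ph k x) *\<^sub>R g k x) + Th (ph k x) *\<^sub>R b x) - (\<alpha> x *\<^sub>R (Th' (u x) *\<^sub>R G x) + Th (u x) *\<^sub>R b x)))---->0" by (rule L(3)) (use B0 K0 in auto)
qed
show ?thesis by (rule apxI[OF tt[OF t(1)] 1(1) 2(1) 1(2) 2(2)])
qed

lemma apx_comp:
assumes a: "apx u G" and d: "!!s. (Th has_real_derivative Th' s) (at s)" and c: "continuous_on UNIV Th'" and z: "Th 0 = 0"
 and K: "!!s. abs (Th' s)<=K" "!!s. abs (Th s)<=K"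
shows "apx (%x. Th (u x)) (%x. Th' (u x) *\<^sub>R G x)"
using apx_mult_comp[of u G "%_. 1" Th Th' "%_. 0" 1 K, OF a _ _ _ _ _ d c K] by (simp add: test_pair_comp[OF _ d c z])

lemma apx_test_mult_comp:
assumes a: "apx u G" and tb: "test_pair \<Omega> \<alpha> b" and d: "!!s. (Th has_real_derivative Th' s) (at s)" and c: "continuous_on UNIV Th'"
 and K: "!!s. abs (Th' s)<=K" "!!s. abs (Th s)<=K"
shows "apx (%x. \<alpha> x * Th (u x)) (%x. \<alpha> x *\<^sub>R (Th' (u x) *\<^sub>R G x) + Th (u x) *\<^sub>R b x)"
proof -
obtain B where B: "!!x. abs (\<alpha> x)<=B" "!!x. norm (b x)<=B" using test_pair_bounded[OF tb] by blast
show ?thesis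
proof (rule apx_mult_comp[OF a _ borel_M[OF test_pair_measurable(1)[OF tb]] borel_M[OF test_pair_measurable(2)[OF tb]] B d c K])
 fix ph g assume t: "test_pair \<Omega> ph g"
 show "test_pair \<Omega> (%x. \<alpha> x * Th (ph x)) (%x. \<alpha> x *\<^sub>R (Th' (ph x) *\<^sub>R g x) + Th (ph x) *\<^sub>R b x)"
 proof (rule test_pair_mult[OF tb])
  show "((%x. Th (ph x)) has_derivative (%v. (Th' (ph x) *\<^sub>R g x) \<bullet> v)) (at x)" for x
   using has_derivative_compose[OF test_pairD(2)[OF t] d[unfolded has_field_derivative_def]] by simp
  show "continuous_on UNIV (%x. Th' (ph x) *\<^sub>R g x)"
   by (intro continuous_intros continuous_on_compose2[OF c] test_pairD(1,5)[OF t]) auto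
 qed
qed
qed

end

section \<open>Integrated convexity gaps and the seminormed space\<close>

definition gap_int :: "'a measure => real => ('a => 'b::euclidean_space) => ('a => 'b) => real" where
"gap_int M p F G = (Ip M p F + Ip M p G) / 2 - Ip M p (%x. (1/2) *\<^sub>R (F x + G x))"

lemma gap_int_eq:
fixes F G :: "'a => 'b::euclidean_space"
assumes p: "p > 1" and L: "Lp M p F" "Lp M p G"
shows "integrable M (%x. convexity_gap p (F x) (G x))" "(LINT x|M. convexity_gap p (F x) (G x)) = gap_int M p F G"
proof -
have p0: "p > 0" using p by simp
have h: "Lp M p (%x. (1/2) *\<^sub>R (F x + G x))" by (rule Lp_scale(1)[OF Lp_add(1)[OF p0 L]])
note i = Lp_int[OF L(1)] Lp_int[OF L(2)] Lp_int[OF h]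
have i12: "integrable M (%x. (norm (F x) powr p + norm (G x) powr p) / 2)" using i by auto
show "integrable M (%x. convexity_gap p (F x) (G x))" unfolding convexity_gap_def by (rule Bintegrable_diff[OF i12 i(3)])
have "(LINT x|M. convexity_gap p (F x) (G x)) = (LINT x|M. (norm (F x) powr p + norm (G x) powr p) / 2) - Ip M p (%x. (1/2) *\<^sub>R (F x + G x))"
 unfolding convexity_gap_def Ip_def by (rule Bintegral_diff[OF i12 i(3)])
also have "(LINT x|M. (norm (F x) powr p + norm (G x) powr p) / 2) = (Ip M p F + Ip M p G) / 2"
 using i(1,2) by (simp add: Ip_def)
finally show "(LINT x|M. convexity_gap p (F x) (G x)) = gap_int M p F G" by (simp add: gap_int_def)
qed

text \<open>A small gap means a small distance: on bounded sets of functions the term with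
  \<open>e\<close> can be made harmless first, and \<open>C\<close> is fixed afterwards.\<close>

lemma Ip_diff_le_gap:
fixes p e :: real
assumes p: "p > 1" and e: "e > 0"
shows "EX C>0. ALL F G :: 'a => 'b::euclidean_space. Lp M p F-->Lp M p G -->
  Ip M p (%x. F x - G x)<=e * (Ip M p F + Ip M p G) + C * gap_int M p F G"
proof -
obtain C where C: "C > 0" "!!a b :: 'b. norm (a - b) powr p<=e * (norm a powr p + norm b powr p) + C * convexity_gap p a b"
 using diff_powr_le_gap[OF p e] by metis
have "Ip M p (%x. F x - G x)<=e * (Ip M p F + Ip M p G) + C * gap_int M p F G" if L: "Lp M p F" "Lp M p G" for F G :: "'a => 'b"
proof -
 have p0: "p > 0" using p by simp
 note i = Lp_int[OF L(1)] Lp_int[OF L(2)] gap_int_eq(1)[OF p L]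
 have j: "integrable M (%x. e * (norm (F x) powr p + norm (G x) powr p))" "integrable M (%x. C * convexity_gap p (F x) (G x))" using i by auto
 have "Ip M p (%x. F x - G x)<=(LINT x|M. e * (norm (F x) powr p + norm (G x) powr p) + C * convexity_gap p (F x) (G x))"
  unfolding Ip_def by (intro integral_mono Lp_int[OF Lp_diff(1)[OF p0 L]] Bintegrable_add j C(2))
 also have "... = e * (Ip M p F + Ip M p G) + C * gap_int M p F G"
  using Bintegral_add[OF j] i by (simp add: gap_int_eq(2)[OF p L] Ip_def)
 finally show ?thesis .
qed
thus ?thesis using C(1) by blast
qed

lemma gap_int_le_Ap:
fixes F G :: "'a => 'b::euclidean_space"
assumes p: "p > 1" and L: "Lp M p F" "Lp M p G"
shows "4 / p * gap_int M p F G <=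
  ((LINT x|M. Ap p (F x) \<bullet> F x) - (LINT x|M. Ap p (F x) \<bullet> G x)) - ((LINT x|M. Ap p (G x) \<bullet> F x) - (LINT x|M. Ap p (G x) \<bullet> G x))"
proof -
note i = integrable_Ap_inner[OF p L(1) L(1)] integrable_Ap_inner[OF p L(1) L(2)] integrable_Ap_inner[OF p L(2) L(1)] integrable_Ap_inner[OF p L(2) L(2)]
have "4 / p * gap_int M p F G = (LINT x|M. 4 / p * convexity_gap p (F x) (G x))" using gap_int_eq(2)[OF p L] by simp
also have "...<=(LINT x|M. (Ap p (F x) \<bullet> F x - Ap p (F x) \<bullet> G x) - (Ap p (G x) \<bullet> F x - Ap p (G x) \<bullet> G x))"
proof (intro integral_mono)
 show "integrable M (%x. 4 / p * convexity_gap p (F x) (G x))" using gap_int_eq(1)[OF p L] by (rule integrable_mult_right)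
 show "integrable M (%x. (Ap p (F x) \<bullet> F x - Ap p (F x) \<bullet> G x) - (Ap p (G x) \<bullet> F x - Ap p (G x) \<bullet> G x))" using i by auto
 show "4 / p * convexity_gap p (F x) (G x)<=(Ap p (F x) \<bullet> F x - Ap p (F x) \<bullet> G x) - (Ap p (G x) \<bullet> F x - Ap p (G x) \<bullet> G x)" for x
  using convexity_gap_le[OF p, of "F x" "G x"] by (simp add: inner_diff_left inner_diff_right)
qed
also have "... = ((LINT x|M. Ap p (F x) \<bullet> F x) - (LINT x|M. Ap p (F x) \<bullet> G x)) - ((LINT x|M. Ap p (G x) \<bullet> F x) - (LINT x|M. Ap p (G x) \<bullet> G x))"
 using i by simp
finally show ?thesis .
qed

context sobolev_domain
begin

abbreviation W where "W \<equiv> W0 \<Omega> p"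
abbreviation N where "N \<equiv> Wnorm \<Omega> p"
abbreviation D where "D \<equiv> wgrad \<Omega>"

lemma W_Lp: "u:W==>Lp M p u" "u:W==>Lp M p (D u)" "u:W==>Lp M q u"
using apx_Lp[OF W0_apx] apx_sobolev(1)[OF W0_apx] by auto

lemma N_powr: "N u powr p = Ip M p (D u)" using p0 by (simp add: Wnorm_eq powr_powr Ip_nonneg)

lemma wgrad_scale: "u:W==>AE x in M. D (%x. c * u x) x = c *\<^sub>R D u x"
using apx_wgrad[OF apx_scale[OF W0_apx]] .

sublocale seminormed W N
proof
show "(%_. 0):W"
proof (rule apx_W0)
 show "apx (%_. 0) (%_. 0)" by (rule apx_test) (auto intro!: test_pairI[of _ _ "{}"] continuous_intros)
qed
show "(%x. u x + v x):W" if "u:W" "v:W" for u v using apx_W0[OF apx_add[OF W0_apx W0_apx]] that by blast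
show "(%x. c * u x):W" if "u:W" for c u using apx_W0[OF apx_scale[OF W0_apx]] that by blast
show "0<=N u" for u by (simp add: Wnorm_eq)
show "N (%x. c * u x) = abs c * N u" if u: "u:W" for c u
proof -
 have "N (%x. c * u x) = (abs c powr p * Ip M p (D u)) powr (1/p)"
  using apx_Wnorm[OF apx_scale[OF W0_apx[OF u]]] Lp_scale(2)[OF W_Lp(2)[OF u]] by simp
 also have "... = abs c * N u" using p0 by (simp add: Wnorm_eq powr_mult powr_powr Ip_nonneg)
 finally show ?thesis .
qed
show "N (%x. u x + v x)<=N u + N v" if u: "u:W" "v:W" for u v
 using apx_Wnorm[OF apx_add[OF W0_apx[OF u(1)] W0_apx[OF u(2)]]] minkowski[OF p1 W_Lp(2)[OF u(1)] W_Lp(2)[OF u(2)]] by (simp add: Wnorm_eq)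
qed

lemma N_diff_powr: "u:W==>v:W==>N (%x. u x - v x) powr p = Ip M p (%x. D u x - D v x)"
using apx_Ip_wgrad[OF apx_diff[OF W0_apx W0_apx]] by (simp add: N_powr)

lemma N_lim_iff:
assumes "!!k::nat. u k:W" "v:W"
shows "(%k. N (%x. u k x - v x))---->0 \<longleftrightarrow> (%k. Ip M p (%x. D (u k) x - D v x))---->0"
proof
assume l: "(%k. N (%x. u k x - v x))---->0"
have "(%k. N (%x. u k x - v x) powr p)---->0 powr p" by (intro tendsto_powr' l tendsto_const) (use p0 N_nonneg in auto)
thus "(%k. Ip M p (%x. D (u k) x - D v x))---->0" using p0 assms by (simp add: N_diff_powr)
next
assume l: "(%k. Ip M p (%x. D (u k) x - D v x))---->0"
have "(%k. Ip M p (%x. D (u k) x - D v x) powr (1/p))---->0 powr (1/p)"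
 by (intro tendsto_powr' l tendsto_const) (use p0 in \<open>auto simp: Ip_nonneg\<close>)
moreover have "Ip M p (%x. D (u k) x - D v x) powr (1/p) = N (%x. u k x - v x)" for k
 using N_diff_powr[OF assms(1)[of k] assms(2)] p0 N_nonneg by (simp flip: N_diff_powr[OF assms(1)[of k] assms(2)] add: powr_powr)
ultimately show "(%k. N (%x. u k x - v x))---->0" using p0 by simp
qed

lemma W0_cong:
assumes "u:W" "AE x in M. u x = v x" "v:borel_measurable M"
shows "v:W" "AE x in M. D v x = D u x"
using apx_W0[OF apx_cong[OF W0_apx[OF assms(1)] assms(2,3), of "D u"]] apx_wgrad[OF apx_cong[OF W0_apx[OF assms(1)] assms(2,3), of "D u"]]
 Lp_meas[OF W_Lp(2)[OF assms(1)]] by auto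

lemma sobolev_W: "u:W==>Ip M q u<=Sq * N u powr q" using apx_sobolev(2)[OF W0_apx] by (simp add: Wnorm_eq)
lemma poincare_W: "u:W==>Ip M p u<=(2*R) powr p * N u powr p" using apx_poincare[OF W0_apx] by (simp add: N_powr)

lemma N_eq_0_iff:
assumes u: "u:W"
shows "N u = 0 \<longleftrightarrow> (AE x in M. u x = 0)"
proof
assume "N u = 0"
hence "Ip M p u<=0" using poincare_W[OF u] by simp
hence "Ip M p u = 0" using Ip_nonneg[of M p u] by linarith
thus "AE x in M. u x = 0" using Ip_eq_0_iff[OF p0 W_Lp(1)[OF u]] by simp
next
assume z: "AE x in M. u x = 0"
have "apx u (%_. 0)"
proof (rule apx_cong)
 show "apx (%_. 0) (%_. 0)" by (rule apx_test) (auto intro!: test_pairI[of _ _ "{}"] continuous_intros)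
 show "AE x in M. 0 = u x" using z by eventually_elim simp
qed (use Lp_meas[OF W_Lp(1)[OF u]] in auto)
thus "N u = 0" using p0 by (simp add: apx_Wnorm)
qed

lemma Sq_nonneg: "Sq>=0"
proof -
have t: "test_pair \<Omega> (%_. 0) (%_. 0)" by (auto intro!: test_pairI[of _ _ "{}"] continuous_intros)
show ?thesis using sobolev_test_scaled[OF t, of 1] by simp
qed

lemma N_lim_Lp:
assumes u: "!!k::nat. u k:W" "v:W" and l: "(%k. N (%x. u k x - v x))---->0"
shows "(%k. Ip M p (%x. u k x - v x))---->0"
proof -
have "(%k. (2*R) powr p * N (%x. u k x - v x) powr p)---->(2*R) powr p * 0 powr p"
 by (intro tendsto_intros tendsto_powr' l) (use p0 N_nonneg in auto)
hence z: "(%k. (2*R) powr p * N (%x. u k x - v x) powr p)---->0" using p0 by simp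
show ?thesis by (rule Lim_null_comparison[OF _ z]) (use poincare_W[OF diff[OF u]] in \<open>auto simp: Ip_nonneg\<close>)
qed

lemma W_complete:
assumes u: "!!k::nat. u k:W" and cau: "!!e. e > 0==>EX n. ALL j>=n. ALL k>=n. Ip M p (%x. D (u j) x - D (u k) x) < e"
shows "EX v:W. (%k. N (%x. u k x - v x))---->0"
proof -
obtain G where G: "Lp M p G" "(%k. Ip M p (%x. D (u k) x - G x))---->0"
 using Lp_complete[of p M "%k. D (u k)", OF p1 fin W_Lp(2)[OF u] cau] by blast
have "EX n. ALL j>=n. ALL k>=n. Ip M p (%x. u j x - u k x) < e" if e: "e > 0" for e
proof -
 define C where "C = (2*R) powr p + 1"
 have C: "C > 0" using powr_ge_zero[of "2*R" p] by (simp add: C_def add_nonneg_pos)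
 obtain n where n: "!!j k. j>=n==>k>=n==>Ip M p (%x. D (u j) x - D (u k) x) < e / C" using cau[of "e / C"] e C by auto
 have "Ip M p (%x. u j x - u k x) < e" if jk: "j>=n" "k>=n" for j k
 proof -
  have "Ip M p (%x. u j x - u k x)<=(2*R) powr p * Ip M p (%x. D (u j) x - D (u k) x)"
   using poincare_W[OF diff[OF u u]] N_diff_powr[OF u u] by simp
  also have "...<=C * Ip M p (%x. D (u j) x - D (u k) x)" by (intro mult_right_mono) (auto simp: C_def Ip_nonneg)
  also have "... < C * (e / C)" using n[OF jk] C by (intro mult_strict_left_mono) auto
  finally show ?thesis using C by simp
 qed
 thus ?thesis by blast
qed
then obtain v where v: "Lp M p v" "(%k. Ip M p (%x. u k x - v x))---->0"
 using Lp_complete[of p M u, OF p1 fin W_Lp(1)[OF u]] by blast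
have a: "apx v G" by (rule apx_closed[of u "%k. D (u k)", OF W0_apx[OF u] v(1) G(1) v(2) G(2)])
have vW: "v:W" by (rule apx_W0[OF a])
have "Ip M p (%x. D (u k) x - D v x) = Ip M p (%x. D (u k) x - G x)" for k
 by (rule Lp_cong_AE(2)[OF _ _ Lp_diff(1)[OF p0 W_Lp(2)[OF u] G(1)]])
   (use apx_wgrad[OF a] Lp_meas[OF W_Lp(2)[OF u[of k]]] Lp_meas[OF W_Lp(2)[OF vW]] in \<open>auto elim: eventually_mono\<close>)
hence "(%k. Ip M p (%x. D (u k) x - D v x))---->0" using G(2) by simp
thus ?thesis using vW N_lim_iff[of u, OF u vW] by blast
qed

section \<open>Solvability and stability for the p-Laplacian\<close>

definition q' :: real where "q' = q / (q - 1)"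

lemma q'_gt: "q' > 1" "q' > 0" "1/q' = 1 - 1/q"
using q_gt by (auto simp: q'_def field_simps)

lemma young_q: "a>=0==>b>=0==>a * b<=a powr q' + b powr q"
proof -
assume ab: "a>=0" "b>=0"
have e: "(a powr (1/(q-1))) powr (q - 1) = a" "(a powr (1/(q-1))) powr q = a powr q'"
 using ab q_gt(2) by (auto simp: powr_powr q'_def)
have "a * b<=(1 - 1/q) * a powr q' + b powr q / q"
 using young_powr[of q "a powr (1/(q-1))" b] q_gt(2) ab unfolding e by simp
also have "...<=1 * a powr q' + b powr q / 1" using q_gt(2) by (intro add_mono mult_right_mono divide_left_mono) auto
finally show ?thesis by simp
qed

lemma pairing_integrable:
assumes f: "Lp M q' f" and u: "Lp M q (u :: 'a => real)"
shows "integrable M (%x. f x * u x)" "abs (LINT x|M. f x * u x)<=Ip M q' f + Ip M q u"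
proof -
note [measurable] = Lp_meas[OF f] Lp_meas[OF u]
have i: "integrable M (%x. norm (f x) powr q' + norm (u x) powr q)" using Lp_int[OF f] Lp_int[OF u] by auto
have bd: "abs (f x * u x)<=norm (f x) powr q' + norm (u x) powr q" for x using young_q[of "abs (f x)" "abs (u x)"] by (simp add: abs_mult)
show 1: "integrable M (%x. f x * u x)" by (rule Bintegrable_bound[OF i]) (use bd in auto)
have "abs (LINT x|M. f x * u x)<=(LINT x|M. abs (f x * u x))" by (rule integral_abs_bound)
also have "...<=(LINT x|M. norm (f x) powr q' + norm (u x) powr q)" by (intro integral_mono i bd) (use 1 in auto)
also have "... = Ip M q' f + Ip M q u" using Lp_int[OF f] Lp_int[OF u] by (simp add: Ip_def)
finally show "abs (LINT x|M. f x * u x)<=Ip M q' f + Ip M q u" .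
qed

text \<open>An upper bound for the dual norm by the inequalities of Hoelder and Sobolev. The factor
  \<open>1 + Sq\<close> arises because the two summands of Young's inequality are balanced and
  added.\<close>

definition dn :: "('a => real) => real" where "dn f = (1 + Sq) * Ip M q' f powr (1/q')"

lemma dn_nonneg: "dn f>=0" using Sq_nonneg by (simp add: dn_def)

lemma dual_bound:
assumes f: "Lp M q' f" and u: "u:W"
shows "abs (LINT x|M. f x * u x)<=dn f * N u"
proof (cases "N u = 0 \<or> Ip M q' f = 0")
case True
hence "AE x in M. f x * u x = 0" using N_eq_0_iff[OF u] Ip_eq_0_iff[OF q'_gt(2) f] by (auto elim: eventually_mono)
hence "(LINT x|M. f x * u x) = 0" by (rule integral_eq_zero_AE)
thus ?thesis using dn_nonneg N_nonneg[of u] by simp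
next
case False
hence N0: "N u > 0" and I0: "Ip M q' f > 0" using N_nonneg[of u] Ip_nonneg[of M q' f] by auto
\<comment> \<open>The scale at which \<open>(1/t) powr q' * Ip M q' f\<close> and
  \<open>t powr q\<close> are equal.\<close>
define t where "t = Ip M q' f powr (1/(q*q'))"
have t: "t > 0" using I0 by (simp add: t_def)
have f': "Lp M q' (%x. (1/t) * f x)" by (rule Lp_scale_real(1)[OF f])
have u': "(%x. (t / N u) * u x):W" by (rule scale[OF u])
have Nu': "N (%x. (t / N u) * u x) = t" using N_scale[OF u, of "t / N u"] t N0 by simp
have tq: "t powr q = Ip M q' f powr (1/q')" using q_gt by (simp add: t_def powr_powr)
have "(1/t) powr q' * Ip M q' f = Ip M q' f powr 1 / Ip M q' f powr (1/q)"
 using I0 q'_gt by (simp add: t_def powr_divide powr_powr)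
also have "... = Ip M q' f powr (1/q')" by (simp add: q'_gt(3) powr_diff)
finally have tq': "(1/t) powr q' * Ip M q' f = Ip M q' f powr (1/q')" .
have "abs (LINT x|M. ((1/t) * f x) * ((t / N u) * u x))<=Ip M q' (%x. (1/t) * f x) + Ip M q (%x. (t / N u) * u x)"
 by (rule pairing_integrable(2)[OF f' W_Lp(3)[OF u']])
also have "...<=abs (1/t) powr q' * Ip M q' f + Sq * t powr q" using Lp_scale_real(2)[OF f, of "1/t"] sobolev_W[OF u'] Nu' by simp
also have "... = dn f" using t by (simp add: tq tq' dn_def distrib_right del: abs_divide)
finally have *: "abs (LINT x|M. ((1/t) * f x) * ((t / N u) * u x))<=dn f" .
have e: "((1/t) * f x) * ((t / N u) * u x) = (1 / N u) * (f x * u x)" for x using t by simp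
have "abs ((1 / N u) * (LINT x|M. f x * u x))<=dn f" using * unfolding e by simp
hence "abs (LINT x|M. f x * u x) / N u<=dn f" using N0 by (simp add: abs_mult)
thus ?thesis using N0 by (simp add: divide_le_eq)
qed

lemma dn_tendsto:
assumes "(%k. Ip M q' (f k))---->0"
shows "(%k. dn (f k))---->0"
proof -
have "(%k. (1 + Sq) * Ip M q' (f k) powr (1/q'))---->(1 + Sq) * 0 powr (1/q')"
 by (intro tendsto_intros tendsto_powr' assms) (use q'_gt(2) in \<open>auto simp: Ip_nonneg\<close>)
thus ?thesis using q'_gt(2) by (simp add: dn_def)
qed

definition sol :: "('a => real) => ('a => real) => bool" where
"sol f w \<longleftrightarrow> w:W&(ALL ps:W. (LINT x|M. Ap p (D w x) \<bullet> D ps x) = (LINT x|M. f x * ps x))"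

lemma solD: "sol f w==>w:W" "sol f w==>ps:W==>(LINT x|M. Ap p (D w x) \<bullet> D ps x) = (LINT x|M. f x * ps x)"
by (auto simp: sol_def)

lemma Ap_inner_self_int: "(LINT x|M. Ap p (D w x) \<bullet> D w x) = N w powr p"
by (simp add: N_powr Ip_def Ap_inner_self)

lemma sol_energy: "sol f w==>N w powr p = (LINT x|M. f x * w x)"
using solD(2)[of f w w] solD(1)[of f w] Ap_inner_self_int by simp

lemma sol_bound:
assumes s: "sol f w" and f: "Lp M q' f"
shows "N w powr (p - 1)<=dn f"
proof (cases "N w = 0")
case True thus ?thesis using dn_nonneg by simp
next
case False
hence n: "N w > 0" using N_nonneg[of w] by linarith
have "N w powr (p - 1) * N w = N w powr (p - 1) * N w powr 1" using n by (simp only: powr_one)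
also have "... = N w powr p" unfolding powr_add[symmetric] by simp
also have "...<=dn f * N w" using sol_energy[OF s] dual_bound[OF f solD(1)[OF s]] by linarith
finally show ?thesis using n by simp
qed

text \<open>Test the difference of the two equations with \<open>w - v\<close>; monotonicity of the
  flux dominates the gap of the gradients.\<close>

lemma sol_gap:
assumes s: "sol f w" "sol g v" and f: "Lp M q' f" "Lp M q' g"
shows "4 / p * gap_int M p (D w) (D v)<=dn (%x. f x - g x) * N (%x. w x - v x)"
proof -
note W = solD(1)[OF s(1)] solD(1)[OF s(2)]
have fg: "Lp M q' (%x. f x - g x)" by (rule Lp_diff(1)[OF q'_gt(2) f])
note i = pairing_integrable(1)[OF f(1) W_Lp(3)[OF W(1)]] pairing_integrable(1)[OF f(1) W_Lp(3)[OF W(2)]]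
 pairing_integrable(1)[OF f(2) W_Lp(3)[OF W(1)]] pairing_integrable(1)[OF f(2) W_Lp(3)[OF W(2)]]
have "(LINT x|M. (f x - g x) * (w x - v x)) = (LINT x|M. (f x * w x - f x * v x) - (g x * w x - g x * v x))"
 by (simp add: algebra_simps)
also have "... = ((LINT x|M. f x * w x) - (LINT x|M. f x * v x)) - ((LINT x|M. g x * w x) - (LINT x|M. g x * v x))"
 using i by simp
finally have e: "(LINT x|M. (f x - g x) * (w x - v x)) = ..." .
have "4 / p * gap_int M p (D w) (D v)<=(LINT x|M. (f x - g x) * (w x - v x))"
 using gap_int_le_Ap[OF p1 W_Lp(2)[OF W(1)] W_Lp(2)[OF W(2)]] unfolding e
 using solD(2)[OF s(1) W(1)] solD(2)[OF s(1) W(2)] solD(2)[OF s(2) W(1)] solD(2)[OF s(2) W(2)] by simp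
also have "...<=dn (%x. f x - g x) * N (%x. w x - v x)" using dual_bound[OF fg diff[OF W]] by linarith
finally show ?thesis .
qed

lemma gap_int_nonneg:
assumes "u:W" "v:W"
shows "gap_int M p (D u) (D v)>=0"
unfolding gap_int_eq(2)[OF p1 W_Lp(2)[OF assms(1)] W_Lp(2)[OF assms(2)], symmetric]
by (rule integral_nonneg_AE) (simp add: convexity_gap_nonneg[OF p1])

lemma gap_tendsto:
assumes u: "!!k::nat. u k:W" "v:W" and B: "!!k. N (u k) powr p<=B" and g: "(%k. gap_int M p (D (u k)) (D v))---->0"
shows "(%k. N (%x. u k x - v x))---->0"
unfolding N_lim_iff[OF u]
proof (rule LIMSEQ_I)
fix e :: real assume e: "e > 0"
define B' where "B' = abs B + N v powr p + 1"
have B': "B' > 0" unfolding B'_def by (intro add_nonneg_pos) auto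
have "e / (2 * B') > 0" using e B' by simp
from Ip_diff_le_gap[OF p1 this, where M=M and 'b='a]
obtain C where C: "C > 0" "!!F G :: 'a => 'a. Lp M p F==>Lp M p G ==>
  Ip M p (%x. F x - G x)<=e / (2 * B') * (Ip M p F + Ip M p G) + C * gap_int M p F G" by blast
have "e / (2 * C) > 0" using e C(1) by simp
from order_tendstoD(2)[OF g this] obtain n where n: "!!k. k>=n==>gap_int M p (D (u k)) (D v) < e / (2 * C)"
 by (auto simp: eventually_sequentially)
have "norm (Ip M p (%x. D (u k) x - D v x) - 0) < e" if k: "k>=n" for k
proof -
 have "Ip M p (D (u k)) + Ip M p (D v)<=B'" using B[of k] unfolding N_powr B'_def by simp
 hence "e / (2 * B') * (Ip M p (D (u k)) + Ip M p (D v))<=e / (2 * B') * B'" using e B' by (intro mult_left_mono) auto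
 moreover have "e / (2 * B') * B' = e / 2" using B' by simp
 moreover have "C * gap_int M p (D (u k)) (D v) < C * (e / (2 * C))" using n[OF k] C(1) by (intro mult_strict_left_mono) auto
 moreover have "C * (e / (2 * C)) = e / 2" using C(1) by simp
 ultimately have "Ip M p (%x. D (u k) x - D v x) < e" using C(2)[OF W_Lp(2)[OF u(1)[of k]] W_Lp(2)[OF u(2)]] by linarith
 thus ?thesis by (simp add: Ip_nonneg)
qed
thus "EX n. ALL k>=n. norm (Ip M p (%x. D (u k) x - D v x) - 0) < e" by blast
qed

lemma powr_bound_inv: "x>=0==>x powr (p - 1)<=c==>x<=c powr (1/(p-1))"
using powr_mono2[of "1/(p-1)" "x powr (p-1)" c] p1 by (simp add: powr_powr)

text \<open>The norms stay bounded by \<open>sol_bound\<close>, so the gap to \<open>v\<close> tends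
  to 0 with the data, and with it the distance. Uniqueness is the case of a constant
  sequence.\<close>

lemma sol_stable:
assumes s: "!!k::nat. sol (f k) (w k)" "sol g v" and f: "!!k. Lp M q' (f k)" "Lp M q' g" and l: "(%k. Ip M q' (%x. f k x - g x))---->0"
shows "(%k. N (%x. w k x - v x))---->0"
proof -
note W = solD(1)[OF s(1)] solD(1)[OF s(2)]
have "(%k. Ip M q' (f k))---->Ip M q' g" by (rule Ip_tendsto[OF q'_gt(1) f l])
hence "Bseq (%k. Ip M q' (f k))" by (intro convergent_imp_Bseq convergentI)
then obtain B where B: "!!k. norm (Ip M q' (f k))<=B" by (auto simp: Bseq_def)
define b where "b = ((1 + Sq) * B powr (1/q')) powr (1/(p-1))"
have Nb: "N (w k)<=b" for k
proof -
 have "dn (f k)<=(1 + Sq) * B powr (1/q')" unfolding dn_def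
  using B[of k] q'_gt(2) Sq_nonneg by (intro mult_left_mono powr_mono2) (auto simp: Ip_nonneg)
 thus ?thesis unfolding b_def by (intro powr_bound_inv N_nonneg order_trans[OF sol_bound[OF s(1) f(1)]])
qed
have z: "(%k. p / 4 * (dn (%x. f k x - g x) * (b + N v)))---->0"
 using tendsto_mult_right[OF dn_tendsto[OF l], of "p / 4 * (b + N v)"] by (simp add: mult_ac)
have g0: "(%k. gap_int M p (D (w k)) (D v))---->0"
proof (rule Lim_null_comparison[OF _ z], intro always_eventually allI)
 fix k
 have "N (%x. w k x - v x)<=b + N v" using N_tri[OF W(1)[of k] scale[OF W(2), of "-1"]] N_scale[OF W(2), of "-1"] Nb[of k] by simp
 hence "dn (%x. f k x - g x) * N (%x. w k x - v x)<=dn (%x. f k x - g x) * (b + N v)" by (intro mult_left_mono dn_nonneg)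
 hence "4 / p * gap_int M p (D (w k)) (D v)<=dn (%x. f k x - g x) * (b + N v)" using sol_gap[OF s f] by (rule order_trans[rotated])
 hence "gap_int M p (D (w k)) (D v)<=p / 4 * (dn (%x. f k x - g x) * (b + N v))" using p0 by (simp add: field_simps)
 thus "norm (gap_int M p (D (w k)) (D v))<=p / 4 * (dn (%x. f k x - g x) * (b + N v))" using gap_int_nonneg[OF W] by simp
qed
show ?thesis
 by (rule gap_tendsto[OF W _ g0, of "b powr p"]) (use Nb N_nonneg p0 in \<open>auto intro!: powr_mono2\<close>)
qed

lemma sol_unique:
assumes "sol f w" "sol f v" "Lp M q' f"
shows "N (%x. w x - v x) = 0"
using sol_stable[of "%_. f" "%_. w" f v] assms q'_gt by (simp add: LIMSEQ_const_iff)

text \<open>Minimisation of the energy without weak topologies: the gap of two members of a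
  minimising sequence is controlled by their excess over the infimum, so the sequence is Cauchy in
  norm.\<close>

lemma sol_exists:
assumes f: "Lp M q' f"
shows "EX w. sol f w"
proof -
define J where "J v = N v powr p / p - (LINT x|M. f x * v x)" for v
\<comment> \<open>The coefficient \<open>1/(2*p)\<close> leaves half of the energy, which makes the
  functional bounded below and minimising sequences bounded.\<close>
obtain C where C: "C > 0" "!!a b. a>=0==>b>=0==>a * b<=1/(2*p) * a powr p + C * b powr (p/(p-1))"
 using young_eta[of p "p/(p-1)" "1/(2*p)"] p1 by (auto simp: field_simps)
define c where "c = C * dn f powr (p/(p-1))"
have low: "N v powr p / (2*p)<=J v + c" if "v:W" for v
proof -
 have "(LINT x|M. f x * v x)<=N v * dn f" using dual_bound[OF f that] by (simp add: mult.commute)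
 also have "...<=1/(2*p) * N v powr p + c" unfolding c_def by (rule C(2)[OF N_nonneg dn_nonneg])
 finally show ?thesis using p0 by (simp add: J_def field_simps)
qed
define m where "m = (INF v\<in>W. J v)"
have bdd: "bdd_below (J ` W)"
proof (rule bdd_belowI2)
 show "- c<=J v" if "v:W" for v using low[OF that] p0 divide_nonneg_nonneg[of "N v powr p" "2*p"] powr_ge_zero[of "N v" p] by linarith
qed
have mle: "m<=J v" if "v:W" for v unfolding m_def by (rule cINF_lower[OF bdd that])
have "EX v:W. J v < m + 1 / real (Suc k)" for k
 using cINF_less_iff[OF _ bdd, of "m + 1 / real (Suc k)"] zero unfolding m_def by auto
then obtain v where v: "!!k. v k:W" "!!k. J (v k) < m + 1 / real (Suc k)" by metis
define B where "B = 2 * p * (m + 1 + c)"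
have vB: "N (v k) powr p<=B" for k
proof -
 have "1 / real (Suc k)<=1" by simp
 hence "N (v k) powr p / (2*p)<=m + 1 + c" using low[OF v(1)[of k]] v(2)[of k] by linarith
 thus ?thesis using p0 by (simp add: B_def field_simps)
qed
\<comment> \<open>Compare with the midpoint, whose energy is at least \<open>m\<close>.\<close>
have gap: "gap_int M p (D (v j)) (D (v k))<=p * (1 / real (Suc j) + 1 / real (Suc k))" for j k
proof -
 have mid: "(%x. (1/2) * (v j x + v k x)):W" by (intro scale add v)
 have a: "apx (%x. (1/2) * (v j x + v k x)) (%x. (1/2) *\<^sub>R (D (v j) x + D (v k) x))" by (intro apx_scale apx_add W0_apx v)
 have "N (%x. (1/2) * (v j x + v k x)) powr p = Ip M p (%x. (1/2) *\<^sub>R (D (v j) x + D (v k) x))"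
  using apx_Ip_wgrad[OF a] by (simp add: N_powr)
 moreover have "(LINT x|M. f x * ((1/2) * (v j x + v k x))) = (1/2) * (LINT x|M. f x * v j x) + (1/2) * (LINT x|M. f x * v k x)"
 proof -
  have "(LINT x|M. f x * ((1/2) * (v j x + v k x))) = (LINT x|M. (1/2) * (f x * v j x) + (1/2) * (f x * v k x))" by (simp add: algebra_simps)
  also have "... = (LINT x|M. (1/2) * (f x * v j x)) + (LINT x|M. (1/2) * (f x * v k x))"
   by (intro Bintegral_add integrable_mult_right pairing_integrable(1)[OF f] W_Lp(3) v)
  finally show ?thesis by simp
 qed
 ultimately have "(J (v j) + J (v k)) / 2 - J (%x. (1/2) * (v j x + v k x)) = gap_int M p (D (v j)) (D (v k)) / p"
  using p0 by (simp add: J_def gap_int_def N_powr field_simps)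
 moreover have "0 < 1 / real (Suc j)" "0 < 1 / real (Suc k)" by simp_all
 ultimately have "gap_int M p (D (v j)) (D (v k)) / p<=1 / real (Suc j) + 1 / real (Suc k)"
  using v(2)[of j] v(2)[of k] mle[OF mid] by argo
 thus ?thesis using p0 by (simp add: divide_le_eq mult.commute)
qed
have B1: "B + 1 > 0" using order_trans[OF powr_ge_zero vB] by (simp add: add_nonneg_pos)
have "EX n. ALL j>=n. ALL k>=n. Ip M p (%x. D (v j) x - D (v k) x) < e" if e: "e > 0" for e
proof -
 have "e / (4 * (B + 1)) > 0" using e B1 by simp
 from Ip_diff_le_gap[OF p1 this, where M=M and 'b='a]
 obtain C where C: "C > 0" "!!F G :: 'a => 'a. Lp M p F==>Lp M p G ==>
  Ip M p (%x. F x - G x)<=e / (4 * (B + 1)) * (Ip M p F + Ip M p G) + C * gap_int M p F G" by blast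
 have "e / (4 * C * p) > 0" using e C p0 by simp
 then obtain n where n: "1 / real (Suc n) < e / (4 * C * p)" using reals_Archimedean by (auto simp: inverse_eq_divide)
 have "Ip M p (%x. D (v j) x - D (v k) x) < e" if jk: "j>=n" "k>=n" for j k
 proof -
  have "Ip M p (D (v j)) + Ip M p (D (v k))<=2 * (B + 1)" using vB[of j] vB[of k] unfolding N_powr by simp
  hence "e / (4 * (B + 1)) * (Ip M p (D (v j)) + Ip M p (D (v k)))<=e / (4 * (B + 1)) * (2 * (B + 1))" using e B1 by (intro mult_left_mono) auto
  moreover have "e / (4 * (B + 1)) * (2 * (B + 1)) = e / 2" using B1 by (simp add: field_simps)
  moreover have "1 / real (Suc j)<=1 / real (Suc n)" "1 / real (Suc k)<=1 / real (Suc n)" using jk by (auto intro!: divide_left_mono)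
  hence "1 / real (Suc j) + 1 / real (Suc k) < 2 * (e / (4 * C * p))" using n by linarith
  hence "p * (1 / real (Suc j) + 1 / real (Suc k)) < p * (2 * (e / (4 * C * p)))" using p0 by (intro mult_strict_left_mono) auto
  hence "gap_int M p (D (v j)) (D (v k)) < p * (2 * (e / (4 * C * p)))" using gap[of j k] by linarith
  hence "C * gap_int M p (D (v j)) (D (v k)) < C * (p * (2 * (e / (4 * C * p))))" using C(1) by (intro mult_strict_left_mono) auto
  moreover have "C * (p * (2 * (e / (4 * C * p)))) = e / 2" using C(1) p0 by simp
  ultimately show ?thesis using C(2)[OF W_Lp(2)[OF v(1)[of j]] W_Lp(2)[OF v(1)[of k]]] by linarith
 qed
 thus ?thesis by blast
qed
then obtain w where w: "w:W" "(%k. N (%x. v k x - w x))---->0" using W_complete[of v, OF v(1)] by blast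
have Jw: "J w<=m"
proof -
 have l1: "(%k. N (v k) powr p)---->N w powr p" by (intro tendsto_powr' N_tendsto[OF v(1) w] tendsto_const) (use p0 N_nonneg in auto)
 have z: "(%k. dn f * N (%x. v k x - w x))---->0" using tendsto_mult_left[OF w(2), of "dn f"] by simp
 have "(%k. (LINT x|M. f x * v k x) - (LINT x|M. f x * w x))---->0"
 proof (rule Lim_null_comparison[OF _ z], intro always_eventually allI)
  fix k
  have "(LINT x|M. f x * v k x) - (LINT x|M. f x * w x) = (LINT x|M. f x * v k x - f x * w x)"
   by (rule Bintegral_diff[OF pairing_integrable(1)[OF f W_Lp(3)[OF v(1)[of k]]] pairing_integrable(1)[OF f W_Lp(3)[OF w(1)]], symmetric])
  also have "... = (LINT x|M. f x * (v k x - w x))" by (simp only: right_diff_distrib)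
  finally have "(LINT x|M. f x * v k x) - (LINT x|M. f x * w x) = ..." .
  thus "norm ((LINT x|M. f x * v k x) - (LINT x|M. f x * w x))<=dn f * N (%x. v k x - w x)"
   using dual_bound[OF f diff[OF v(1)[of k] w(1)]] by simp
 qed
 hence l2: "(%k. \<integral>x. f x * v k x \<partial>M)---->(LINT x|M. f x * w x)" by (simp add: LIM_zero_iff)
 have l3: "(%k. J (v k))---->J w" unfolding J_def by (intro tendsto_intros l1 l2) (use p0 in auto)
 have "(%k. m + 1 / real (Suc k))---->m + 0" by (intro tendsto_intros) (use LIMSEQ_inverse_real_of_nat in \<open>simp add: inverse_eq_divide\<close>)
 hence l4: "(%k. m + 1 / real (Suc k))---->m" by simp
 show ?thesis by (rule LIMSEQ_le[OF l3 l4]) (use v(2) less_imp_le in blast)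
qed
\<comment> \<open>The tangent is taken at the perturbed gradient \<open>F k\<close>, not at
  \<open>D w\<close>. It bounds the energy difference from above by a flux without differentiating
  the functional, and the flux converges as the perturbation tends to 0.\<close>
have le: "(LINT x|M. f x * ps x)<=(LINT x|M. Ap p (D w x) \<bullet> D ps x)" if ps: "ps:W" for ps
proof -
 define F where "F k x = D w x + (1 / real (Suc k)) *\<^sub>R D ps x" for k x
 have a: "apx (%x. w x + (1 / real (Suc k)) * ps x) (F k)" for k unfolding F_def by (intro apx_scale apx_add W0_apx w ps)
 have FL: "Lp M p (F k)" for k by (rule apx_Lp(2)[OF a])
 have step: "(LINT x|M. f x * ps x)<=(LINT x|M. Ap p (F k x) \<bullet> D ps x)" for k
 proof -
  define t where "t = 1 / real (Suc k)"
  have t: "t > 0" by (simp add: t_def)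
  have "J w<=J (%x. w x + t * ps x)" using Jw mle[OF add[OF w(1) scale[OF ps, of t]]] by simp
  moreover have "N (%x. w x + t * ps x) powr p = Ip M p (F k)" using apx_Ip_wgrad[OF a[of k]] by (simp add: N_powr t_def)
  moreover have "(LINT x|M. f x * (w x + t * ps x)) = (LINT x|M. f x * w x) + t * (LINT x|M. f x * ps x)"
  proof -
   have "(LINT x|M. f x * (w x + t * ps x)) = (LINT x|M. f x * w x + t * (f x * ps x))" by (simp add: algebra_simps)
   also have "... = (LINT x|M. f x * w x) + (LINT x|M. t * (f x * ps x))"
    by (intro Bintegral_add integrable_mult_right pairing_integrable(1)[OF f] W_Lp(3) w ps)
   finally show ?thesis by simp
  qed
  ultimately have 1: "t * (LINT x|M. f x * ps x)<=(Ip M p (F k) - Ip M p (D w)) / p"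
   by (simp add: J_def N_powr diff_divide_distrib)
  have i: "integrable M (%x. norm (F k x) powr p)" "integrable M (%x. p * t * (Ap p (F k x) \<bullet> D ps x))" "integrable M (%x. norm (D w x) powr p)"
   using Lp_int[OF FL] integrable_Ap_inner[OF p1 FL W_Lp(2)[OF ps]] Lp_int[OF W_Lp(2)[OF w(1)]] by auto
  have "Ip M p (F k) - p * t * (LINT x|M. Ap p (F k x) \<bullet> D ps x) = (LINT x|M. norm (F k x) powr p - p * t * (Ap p (F k x) \<bullet> D ps x))"
   using i by (simp add: Ip_def)
  also have "...<=Ip M p (D w)" unfolding Ip_def
  proof (intro integral_mono Bintegrable_diff i)
   fix x
   show "norm (F k x) powr p - p * t * (Ap p (F k x) \<bullet> D ps x)<=norm (D w x) powr p"
    using convex_tangent[OF p1, of "F k x" "D w x"] by (simp add: F_def t_def)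
  qed
  finally have "(Ip M p (F k) - Ip M p (D w)) / p<=t * (LINT x|M. Ap p (F k x) \<bullet> D ps x)" using p0 by (simp add: field_simps)
  hence "t * (LINT x|M. f x * ps x)<=t * (LINT x|M. Ap p (F k x) \<bullet> D ps x)" using 1 by linarith
  thus ?thesis using t by simp
 qed
 have "(%k. Ip M p (%x. F k x - D w x))---->0"
 proof -
  have "Ip M p (%x. F k x - D w x) = (1 / real (Suc k)) powr p * Ip M p (D ps)" for k
   using Lp_scale(2)[OF W_Lp(2)[OF ps], of "1 / real (Suc k)"] by (simp add: F_def)
  moreover have "(%k. (1 / real (Suc k)) powr p * Ip M p (D ps))---->0 powr p * Ip M p (D ps)"
   by (intro tendsto_intros tendsto_powr') (use LIMSEQ_inverse_real_of_nat p0 in \<open>auto simp: inverse_eq_divide\<close>)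
  ultimately show ?thesis using p0 by simp
 qed
 from Ap_inner_tendsto[OF p1 FL W_Lp(2)[OF w(1)] this W_Lp(2)[OF ps]]
 show ?thesis by (rule LIMSEQ_le_const) (use step in auto)
qed
have "sol f w" unfolding sol_def
proof (intro conjI w(1) ballI antisym)
 fix ps assume ps: "ps:W"
 show "(LINT x|M. f x * ps x)<=(LINT x|M. Ap p (D w x) \<bullet> D ps x)" by (rule le[OF ps])
 \<comment> \<open>The inequality for the negative of \<open>ps\<close> gives the reverse one; its
   chosen gradient is the negative only almost everywhere.\<close>
 have "(LINT x|M. Ap p (D w x) \<bullet> D (%x. (-1) * ps x) x) = (LINT x|M. - (Ap p (D w x) \<bullet> D ps x))"
 proof (rule integral_cong_AE)
  show "AE x in M. Ap p (D w x) \<bullet> D (%x. (-1) * ps x) x = - (Ap p (D w x) \<bullet> D ps x)"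
   using wgrad_scale[OF ps, of "-1"] by eventually_elim simp
 qed (use Lp_meas[OF W_Lp(2)[OF w(1)]] Lp_meas[OF W_Lp(2)[OF ps]] Lp_meas[OF W_Lp(2)[OF scale[OF ps, of "-1"]]] in measurable)
 thus "(LINT x|M. Ap p (D w x) \<bullet> D ps x)<=(LINT x|M. f x * ps x)" using le[OF scale[OF ps, of "-1"]] by simp
qed
thus ?thesis by blast
qed

end

section \<open>The nonlinearity as a compact map\<close>

text \<open>Composition with a simple function is measurable piece by piece. Simple approximations
  of \<open>u\<close> and continuity in the second variable give the limit almost everywhere, which
  suffices since Lebesgue measure is complete.\<close>

lemma caratheodory_comp_measurable:
fixes n :: "'a::euclidean_space => real => real"
assumes S: "S:sets lebesgue" and n: "!!s. (%x. n x s):borel_measurable (lebesgue_on S)"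
 and c: "AE x in lebesgue_on S. continuous_on UNIV (n x)" and u: "u:borel_measurable (lebesgue_on S)"
shows "(%x. n x (u x)):borel_measurable (lebesgue_on S)"
proof -
obtain F where F: "!!i. simple_function (lebesgue_on S) (F i)" "!!x. x:space (lebesgue_on S)==>(%i. F i x)---->u x"
 using borel_measurable_implies_sequence_metric[OF u, of 0] by blast
have m: "(%x. n x (F i x)):borel_measurable (lebesgue_on S)" for i
proof (rule measurable_compose_countable'[where f="%s x. n x s" and g="F i" and I="F i ` space (lebesgue_on S)"])
 have fin: "finite (F i ` space (lebesgue_on S))" using F(1)[of i] by (simp add: simple_function_def)
 thus "countable (F i ` space (lebesgue_on S))" by (rule countable_finite)
 show "F i:measurable (lebesgue_on S) (count_space (F i ` space (lebesgue_on S)))"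
  using F(1)[of i] unfolding measurable_count_space_eq2[OF fin] by (auto simp: simple_function_def)
qed (rule n)
define L where "L x = lim (%i. n x (F i x))" for x
have Lm: "L:borel_measurable (lebesgue_on S)" unfolding L_def by (rule borel_measurable_lim_metric[OF m])
have "AE x in lebesgue_on S. x:S-->L x = n x (u x)" using c AE_space
proof eventually_elim
 case (elim x)
 have "(%i. n x (F i x))---->n x (u x)" by (rule continuous_on_tendsto_compose[OF elim(1) F(2)[OF elim(2)]]) auto
 thus ?case by (simp add: L_def limI)
qed
hence "AE x in lebesgue. x:S-->L x = n x (u x)" using AE_restrict_space_iff[of S lebesgue] S by simp
hence ae: "AE x in lebesgue. (if x:S then L x else 0) = (if x:S then n x (u x) else 0)" by eventually_elim auto
have "(%x. if x:S then n x (u x) else 0):borel_measurable lebesgue"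
 by (rule borel_measurable_AE[OF borel_measurable_if_I[OF Lm S] ae])
thus ?thesis by (rule borel_measurable_if_D)
qed

context sobolev_domain
begin

lemma powr_q':
assumes "y<=eta * t powr (q - 1) + C" "y>=0" "eta>=0" "C>=0"
shows "y powr q'<=2 powr q' * (eta powr q' * t powr q + C powr q')"
proof -
have "y powr q'<=(eta * t powr (q - 1) + C) powr q'" using assms q'_gt by (intro powr_mono2) auto
also have "...<=2 powr q' * ((eta * t powr (q - 1)) powr q' + C powr q')" using assms q'_gt(2) by (intro powr_add_le) auto
also have "(eta * t powr (q - 1)) powr q' = eta powr q' * t powr q" using q_gt(2) by (simp add: powr_mult powr_powr q'_def)
finally show ?thesis .
qed

text \<open>Vitali's convergence theorem for Nemytskii operators: the part of \<open>f\<^sub>k - f'\<close> above \<open>eta (|u\<^sub>k|\<^sup>q\<^sup>-\<^sup>1 + |v|\<^sup>q\<^sup>-\<^sup>1)\<close> is bounded.\<close>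
lemma nemytskii_limit:
fixes f :: "nat => 'a => real" and u :: "nat => 'a => real"
assumes fm: "!!k. f k:borel_measurable M" "f':borel_measurable M" and u: "!!k. Lp M q (u k)" "Lp M q v" and B: "!!k. Ip M q (u k)<=B"
 and lim: "AE x in M. (%k. f k x)---->f' x" "AE x in M. (%k. u k x)---->v x"
 and gr: "!!eta. eta > 0==>EX C. ALL k. AE x in M. abs (f k x)<=eta * abs (u k x) powr (q - 1) + C"
shows "!!k. Lp M q' (f k)" "Lp M q' f'" "(%k. Ip M q' (%x. f k x - f' x))---->0"
proof -
note [measurable] = fm Lp_meas[OF u(1)] Lp_meas[OF u(2)]
have gr': "EX C>=0. (ALL k. AE x in M. abs (f k x)<=eta * abs (u k x) powr (q - 1) + C)&(AE x in M. abs (f' x)<=eta * abs (v x) powr (q - 1) + C)" if eta: "eta > 0" for eta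
proof -
 obtain C where C: "!!k. AE x in M. abs (f k x)<=eta * abs (u k x) powr (q - 1) + C" using gr[OF eta] by blast
 have C': "AE x in M. abs (f k x)<=eta * abs (u k x) powr (q - 1) + abs C" for k using C[of k] by eventually_elim auto
 have "AE x in M. ALL k. abs (f k x)<=eta * abs (u k x) powr (q - 1) + abs C" using C' by (simp add: AE_all_countable)
 hence "AE x in M. abs (f' x)<=eta * abs (v x) powr (q - 1) + abs C" using lim
 proof eventually_elim
  case (elim x)
  have "(%k. eta * abs (u k x) powr (q - 1) + abs C)---->eta * abs (v x) powr (q - 1) + abs C"
   by (intro tendsto_intros tendsto_powr' elim) (use q_gt in auto)
  from LIMSEQ_le[OF tendsto_rabs[OF elim(2)] this] elim(1) show ?case by blast
 qed
 thus ?thesis using C' by (intro exI[of _ "abs C"]) auto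
qed
obtain C1 where C1: "C1>=0" "!!k. AE x in M. abs (f k x)<=1 * abs (u k x) powr (q - 1) + C1" "AE x in M. abs (f' x)<=1 * abs (v x) powr (q - 1) + C1"
 using gr'[of 1] by auto
show fL: "Lp M q' (f k)" for k
proof (rule Lp_bound[OF fm(1)])
 show "AE x in M. norm (f k x) powr q'<=2 powr q' * (1 powr q' * norm (u k x) powr q + C1 powr q')" using C1(2)[of k]
 proof eventually_elim
  case (elim x) show ?case using powr_q'[OF elim] C1(1) by simp
 qed
qed (use Lp_int[OF u(1)] in auto)
show fL': "Lp M q' f'"
proof (rule Lp_bound[OF fm(2)])
 show "AE x in M. norm (f' x) powr q'<=2 powr q' * (1 powr q' * norm (v x) powr q + C1 powr q')" using C1(3)
 proof eventually_elim
  case (elim x) show ?case using powr_q'[OF elim] C1(1) by simp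
 qed
qed (use Lp_int[OF u(2)] in auto)
show "(%k. Ip M q' (%x. f k x - f' x))---->0"
proof (rule LIMSEQ_I)
 fix e :: real assume e: "e > 0"
 define b where "b = abs B + Ip M q v + 1"
 have b: "b > 0" using Ip_nonneg[of M q v] by (simp add: b_def add_nonneg_pos)
 \<comment> \<open>Chosen so that the growth part contributes exactly \<open>e / 2\<close> after two
   uses of \<open>powr_add_le\<close>; \<open>b\<close> bounds the sum of the q-th powers
   involved.\<close>
 define eta where "eta = (e / (2 * (2 powr q' * 2 powr q' * b))) powr (1/q')"
 have eta: "eta > 0" using e b by (simp add: eta_def)
 have etaq: "2 powr q' * (eta powr q' * (2 powr q' * b)) = e / 2"
  using e b q'_gt(2) by (simp add: eta_def powr_powr)
 obtain C where C: "C>=0" "!!k. AE x in M. abs (f k x)<=eta * abs (u k x) powr (q - 1) + C" "AE x in M. abs (f' x)<=eta * abs (v x) powr (q - 1) + C"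
  using gr'[OF eta] by auto
 define T where "T k x = abs (u k x) powr (q - 1) + abs (v x) powr (q - 1)" for k x
 define h where "h k x = max 0 (abs (f k x - f' x) - eta * T k x)" for k x
 have T0: "T k x>=0" for k x by (simp add: T_def)
 have hm[measurable]: "h k:borel_measurable M" for k unfolding h_def T_def by measurable
 have hb: "AE x in M. h k x powr q'<=(2 * C) powr q'" for k using C(2)[of k] C(3)
 proof eventually_elim
  case (elim x)
  have "h k x<=2 * C" using elim C(1) by (simp add: h_def T_def distrib_left)
  thus ?case using q'_gt(2) by (intro powr_mono2) (auto simp: h_def)
 qed
 have h0: "(%k. \<integral>x. h k x powr q' \<partial>M)---->(LINT x|M. 0)"
 proof (rule integral_dominated_convergence[where w="%_. (2 * C) powr q'"])
  show "AE x in M. (%k. h k x powr q')---->0" using lim(1)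
  proof eventually_elim
   case (elim x)
   have z: "(%k. abs (f k x - f' x))---->0" using elim by (simp add: LIM_zero tendsto_rabs_zero)
   have "(%k. h k x)---->0"
    by (rule Lim_null_comparison[OF _ z]) (use T0 eta in \<open>auto simp: h_def\<close>)
   hence "(%k. h k x powr q')---->0 powr q'" by (intro tendsto_powr' tendsto_const) (use q'_gt(2) in \<open>auto simp: h_def\<close>)
   thus ?case using q'_gt(2) by simp
  qed
  show "AE x in M. norm (h k x powr q')<=(2 * C) powr q'" for k using hb[of k] by simp
 qed auto
 have hi: "integrable M (%x. h k x powr q')" for k
  by (rule Bintegrable_bound[of M "%_. (2 * C) powr q'"]) (use hb[of k] in auto)
 have "e / 2 / 2 powr q' > 0" using e by simp
 with h0 obtain n where n: "!!k. k>=n==>(LINT x|M. h k x powr q') < e / 2 / 2 powr q'"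
  using order_tendstoD(2)[OF h0, of "e / 2 / 2 powr q'"] by (auto simp: eventually_sequentially)
 have "norm (Ip M q' (%x. f k x - f' x) - 0) < e" if k: "k>=n" for k
 proof -
  have pw: "norm (f k x - f' x) powr q'<=2 powr q' * (h k x powr q' + eta powr q' * (2 powr q' * (norm (u k x) powr q + norm (v x) powr q)))" for x
  proof -
   have "norm (f k x - f' x)<=h k x + eta * T k x" by (simp add: h_def)
   hence "norm (f k x - f' x) powr q'<=(h k x + eta * T k x) powr q'" using q'_gt(2) by (intro powr_mono2) auto
   also have "...<=2 powr q' * (h k x powr q' + (eta * T k x) powr q')" using eta T0 q'_gt(2) by (intro powr_add_le) (auto simp: h_def)
   also have "...<=2 powr q' * (h k x powr q' + eta powr q' * (2 powr q' * (norm (u k x) powr q + norm (v x) powr q)))"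
   proof -
    have "T k x powr q'<=2 powr q' * (norm (u k x) powr q + norm (v x) powr q)"
     using powr_q'[of "T k x" 1 "u k x" "abs (v x) powr (q - 1)"] T0 q_gt(2) powr_add_le[OF q'_gt(2), of "abs (u k x) powr (q - 1)" "abs (v x) powr (q - 1)"]
     by (simp add: T_def powr_powr q'_def)
    thus ?thesis by (simp add: powr_mult mult_left_mono)
   qed
   finally show ?thesis .
  qed
  have i: "integrable M (%x. eta powr q' * (2 powr q' * (norm (u k x) powr q + norm (v x) powr q)))" using Lp_int[OF u(1)] Lp_int[OF u(2)] by auto
  have "Ip M q' (%x. f k x - f' x)<=(LINT x|M. 2 powr q' * (h k x powr q' + eta powr q' * (2 powr q' * (norm (u k x) powr q + norm (v x) powr q))))"
   unfolding Ip_def by (intro integral_mono Lp_int[OF Lp_diff(1)[OF q'_gt(2) fL fL']] integrable_mult_right Bintegrable_add hi i pw)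
  also have "... = 2 powr q' * ((LINT x|M. h k x powr q') + eta powr q' * (2 powr q' * (Ip M q (u k) + Ip M q v)))"
   using Bintegral_add[OF hi[of k] i] Lp_int[OF u(1)] Lp_int[OF u(2)] by (simp add: Ip_def)
  also have "...<=2 powr q' * ((LINT x|M. h k x powr q') + eta powr q' * (2 powr q' * b))"
   using B[of k] by (intro mult_left_mono add_left_mono) (auto simp: b_def)
  also have "... = 2 powr q' * (LINT x|M. h k x powr q') + e / 2" by (simp only: distrib_left etaq)
  also have "... < 2 powr q' * (e / 2 / 2 powr q') + e / 2" using n[OF k] by (intro add_strict_right_mono mult_strict_left_mono) auto
  finally show ?thesis by (simp add: Ip_nonneg)
 qed
 thus "EX n. ALL k>=n. norm (Ip M q' (%x. f k x - f' x) - 0) < e" by blast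
qed
qed

lemma sol_cong:
assumes s: "sol f w" and f: "AE x in M. f x = f' x" "f:borel_measurable M" "f':borel_measurable M" and w: "AE x in M. w x = w' x" "w':W"
shows "sol f' w'"
unfolding sol_def
proof (intro conjI ballI w(2))
fix ps assume ps: "ps:W"
note [measurable] = Lp_meas[OF W_Lp(1)[OF ps]] Lp_meas[OF W_Lp(2)[OF ps]] Lp_meas[OF W_Lp(2)[OF w(2)]] Lp_meas[OF W_Lp(2)[OF solD(1)[OF s]]] f(2,3)
have "(LINT x|M. Ap p (D w' x) \<bullet> D ps x) = (LINT x|M. Ap p (D w x) \<bullet> D ps x)"
 using W0_cong(2)[OF solD(1)[OF s] w(1) Lp_meas[OF W_Lp(1)[OF w(2)]]] by (intro integral_cong_AE) (auto elim: eventually_mono)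
also have "... = (LINT x|M. f x * ps x)" by (rule solD(2)[OF s ps])
also have "... = (LINT x|M. f' x * ps x)" using f(1) by (intro integral_cong_AE) (auto elim: eventually_mono)
finally show "(LINT x|M. Ap p (D w' x) \<bullet> D ps x) = (LINT x|M. f' x * ps x)" .
qed

lemma N_diff_0_AE: "u:W==>v:W==>N (%x. u x - v x) = 0==>AE x in M. u x = v x"
using N_eq_0_iff[OF diff[of u v]] by auto

lemma W_compact:
assumes u: "!!k::nat. u k:W" and B: "!!k. N (u k)<=B"
shows "EX r v. strict_mono (r::nat=>nat)&Lp M q v&Lp M p v&(AE x in M. (%k. u (r k) x)---->v x)&(%k. Ip M p (%x. u (r k) x - v x))---->0"
proof -
have "Ip M p (D (u k))<=B powr p" for k unfolding N_powr[symmetric] using B N_nonneg p0 by (intro powr_mono2) auto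
from apx_rellich[of u "%k. D (u k)", OF W0_apx[OF u] this]
obtain r v where r: "strict_mono (r::nat=>nat)" "Lp M p v" "(%k. Ip M p (%x. u (r k) x - v x))---->0" "AE x in M. (%k. u (r k) x)---->v x"
 by blast
have "Ip M q (u (r k))<=Sq * B powr q" for k
 using sobolev_W[OF u[of "r k"]] by (rule order_trans) (use B N_nonneg q_gt Sq_nonneg in \<open>auto intro!: mult_left_mono powr_mono2\<close>)
from Lp_fatou(1)[OF q_gt(3) W_Lp(3)[OF u] Lp_meas[OF r(2)] r(4) this] show ?thesis using r by blast
qed

lemma Ip_q_bound: "u:W==>N u<=B==>Ip M q u<=Sq * B powr q"
using sobolev_W[of u] by (rule order_trans) (use N_nonneg q_gt Sq_nonneg in \<open>auto intro!: mult_left_mono powr_mono2\<close>)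

text \<open>\<open>T\<close> is where \<open>t powr (p - 1)\<close> and
  \<open>eta * t powr (q - 1)\<close> cross; up to it the constant suffices.\<close>

lemma powr_subcritical:
assumes eta: "eta > 0"
shows "EX C>=0. ALL t>=0. t powr (p - 1)<=eta * t powr (q - 1) + C"
proof -
define T where "T = eta powr (- 1 / (q - p))"
have T: "T > 0" using eta by (simp add: T_def)
have "- 1 / (q - p) * (- (q - p)) = 1" using q_gt(1) by (simp add: field_simps)
hence Tp: "T powr (- (q - p)) = eta" using eta unfolding T_def powr_powr by simp
have "t powr (p - 1)<=eta * t powr (q - 1) + T powr (p - 1)" if t: "t>=0" for t
proof (cases "t<=T")
 case True
 hence "t powr (p - 1)<=T powr (p - 1)" using t p1 by (intro powr_mono2) auto
 thus ?thesis using eta by (simp add: add_increasing)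
next
 case False
 hence "t powr (- (q - p))<=T powr (- (q - p))" using T q_gt(1) by (intro powr_mono2') auto
 hence "t powr (q - 1) * t powr (- (q - p))<=t powr (q - 1) * eta" unfolding Tp by (intro mult_left_mono) auto
 moreover have "t powr (q - 1) * t powr (- (q - p)) = t powr (p - 1)" by (simp flip: powr_add)
 moreover have "T powr (p - 1)>=0" by simp
 ultimately show ?thesis unfolding mult.commute[of "t powr (q - 1)" eta] by linarith
qed
thus ?thesis by (intro exI[of _ "T powr (p - 1)"]) auto
qed

text \<open>The first bound rests on subcritical growth at infinity and gives compactness of the
  right-hand side. The second also uses the behaviour at 0: it shows \<open>g\<close> to be of
  higher order there, as coercivity, rescaling and Picone's inequality require.\<close>

lemma majorant_bounds:
assumes f: "good_majorant p q f" and eta: "eta > 0"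
shows "EX C>=0. ALL t>=0. f t<=eta * t powr (q - 1) + C" "EX C>=0. ALL t>=0. f t<=eta * t powr (p - 1) + C * t powr (q - 1)"
proof -
have f0: "f 0 = 0" and fn: "!!s. s>=0==>f s>=0" and sm: "strict_mono_on {0..} f" and l1: "((%s. f s / s powr (q - 1)) \<longlongrightarrow> 0) at_top"
 and l2: "((%s. f s / s powr (p - 1)) \<longlongrightarrow> 0) (at_right 0)"
 using f by (auto simp: good_majorant_def)
have mono: "f s<=f t" if "0<=s" "s<=t" for s t
 using sm that by (cases "s = t") (auto simp: strict_mono_on_def less_imp_le)
from order_tendstoD(2)[OF l1 eta] obtain T0 where T0: "!!s. s>=T0==>f s / s powr (q - 1) < eta" by (auto simp: eventually_at_top_linorder)
define T where "T = max T0 1"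
have T: "T>=1" "!!s. s>=T==>f s<=eta * s powr (q - 1)"
proof -
 show "T>=1" by (simp add: T_def)
 fix s assume s: "s>=T"
 hence "s powr (q - 1) > 0" "f s / s powr (q - 1) < eta" using T0[of s] by (auto simp: T_def)
 thus "f s<=eta * s powr (q - 1)" by (simp add: divide_less_eq)
qed
from order_tendstoD(2)[OF l2 eta] obtain d where d: "d > 0" "!!s. 0 < s==>s < d==>f s / s powr (p - 1) < eta" by (auto simp: eventually_at_right_field)
have fT: "f T>=0" using fn T(1) by simp
have "f t<=eta * t powr (q - 1) + f T" if "t>=0" for t
proof (cases "t<=T")
 case True
 have "eta * t powr (q - 1)>=0" using eta by simp
 thus ?thesis using mono[OF that True] by linarith
next
 case False thus ?thesis using T(2)[of t] fT by simp
qed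
thus "EX C>=0. ALL t>=0. f t<=eta * t powr (q - 1) + C" using fT by blast
\<comment> \<open>On the middle range from \<open>d\<close> to \<open>T\<close> monotonicity gives
  \<open>f t <= f T\<close>, and the second summand makes \<open>C * t powr (q - 1)\<close> at least
  that.\<close>
define C where "C = eta + f T / d powr (q - 1)"
have C: "C>=0" using eta fT by (simp add: C_def)
have "f t<=eta * t powr (p - 1) + C * t powr (q - 1)" if t: "t>=0" for t
proof -
 have n: "eta * t powr (p - 1)>=0" "eta * t powr (q - 1)>=0" "f T / d powr (q - 1) * t powr (q - 1)>=0" using eta fT by auto
 consider "t = 0" | "0 < t" "t < d" | "d<=t" "t<=T" | "t>=T" using t by linarith
 thus ?thesis
 proof cases
  case 1 thus ?thesis using f0 by simp
 next
  case 2
  hence "t powr (p - 1) > 0" by simp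
  hence "f t<=eta * t powr (p - 1)" using d(2)[OF 2] by (simp add: divide_less_eq)
  thus ?thesis using C by (simp add: add_increasing2)
 next
  case 3
  hence "d powr (q - 1)<=t powr (q - 1)" using d(1) q_gt(2) by (intro powr_mono2) auto
  hence "f T * d powr (q - 1)<=f T * t powr (q - 1)" using fT by (intro mult_left_mono)
  hence "f T<=f T / d powr (q - 1) * t powr (q - 1)" using d(1) by (simp add: le_divide_eq)
  thus ?thesis using mono[OF t 3(2)] n by (simp add: C_def distrib_right)
 next
  case 4
  thus ?thesis using T(2)[OF 4] n by (simp add: C_def distrib_right)
 qed
qed
thus "EX C>=0. ALL t>=0. f t<=eta * t powr (p - 1) + C * t powr (q - 1)" using C by blast
qed

text \<open>The natural test function is the negative part of \<open>w\<close>. It is replaced by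
  \<open>Th\<close>, which vanishes exactly for nonnegative arguments and is bounded with bounded
  continuous derivative, so that the chain rule \<open>apx_comp\<close> applies. The tested equation
  forces the gradient of the composition to vanish, hence the composition itself.\<close>

lemma nonneg_of_rhs:
assumes s: "sol f w" and f: "Lp M q' f" "AE x in M. w x < 0-->f x>=0"
shows "AE x in M. w x>=0"
proof -
define Q where "Q s = (max 0 (- s))\<^sup>2" for s :: real
define Th where "Th s = - Q s / (1 + Q s)" for s
define Th' where "Th' s = 2 * max 0 (- s) / (1 + Q s)\<^sup>2" for s
have Q0: "Q s>=0" "1 + Q s > 0" for s by (auto simp: Q_def add_pos_nonneg)
have dQ: "(Q has_real_derivative - 2 * max 0 (- s)) (at s)" for s
proof -
 have "((%s. (max 0 (- s))\<^sup>2) has_real_derivative (2 * max 0 (- s)) * (- 1)) (at s)"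
  by (rule DERIV_chain2[OF DERIV_max_square]) (auto intro!: derivative_eq_intros)
 thus ?thesis by (simp add: Q_def[abs_def])
qed
have d: "(Th has_real_derivative Th' s) (at s)" for s
proof -
 have "((%s. - Q s / (1 + Q s)) has_real_derivative ((- (- 2 * max 0 (- s))) * (1 + Q s) - (- Q s) * (- 2 * max 0 (- s))) / ((1 + Q s) * (1 + Q s))) (at s)"
  by (rule DERIV_divide DERIV_minus dQ)+ (use Q0(2)[of s] in \<open>auto intro!: derivative_eq_intros dQ\<close>)
 moreover have "((- (- 2 * max 0 (- s))) * (1 + Q s) - (- Q s) * (- 2 * max 0 (- s))) / ((1 + Q s) * (1 + Q s)) = Th' s"
  by (simp add: Th'_def power2_eq_square algebra_simps)
 ultimately show ?thesis by (simp add: Th_def[abs_def])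
qed
have c: "continuous_on UNIV Th'" unfolding Th'_def[abs_def] Q_def[abs_def]
 by (intro continuous_intros) (metis Q0(2) Q_def less_irrefl power_zero_numeral zero_eq_power2)
have K: "abs (Th' s)<=1" for s
proof -
 define m where "m = max 0 (- s)"
 have m: "m>=0" by (simp add: m_def)
 have "2 * m<=1 + m\<^sup>2" using sum_squares_bound[of m 1] by simp
 also have "... * 1<=(1 + m\<^sup>2) * (1 + m\<^sup>2)" by (intro mult_left_mono) auto
 finally have "2 * m / (1 + m\<^sup>2)\<^sup>2<=1" using add_pos_nonneg[of 1 "m\<^sup>2"] by (simp add: power2_eq_square)
 thus ?thesis using m by (simp add: Th'_def Q_def m_def)
qed
have K2: "abs (Th s)<=1" for s using Q0[of s] by (simp add: Th_def divide_le_eq)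
have z: "Th 0 = 0" by (simp add: Th_def Q_def)
have w: "w:W" by (rule solD(1)[OF s])
have a: "apx (%x. Th (w x)) (%x. Th' (w x) *\<^sub>R D w x)" by (rule apx_comp[OF W0_apx[OF w] d c z K K2])
have tW: "(%x. Th (w x)):W" by (rule apx_W0[OF a])
have Th'0: "Th' s>=0" for s by (simp add: Th'_def)
have Thneg: "Th s < 0 \<longleftrightarrow> s < 0" "Th s<=0" for s
proof -
 have "Q s > 0 \<longleftrightarrow> s < 0" by (auto simp: Q_def max_def)
 thus "Th s < 0 \<longleftrightarrow> s < 0" "Th s<=0" using Q0[of s] zero_less_divide_iff[of "Q s" "1 + Q s"] by (auto simp: Th_def)
qed
note [measurable] = Lp_meas[OF W_Lp(2)[OF w]] Lp_meas[OF W_Lp(2)[OF tW]] Lp_meas[OF W_Lp(1)[OF w]] Lp_meas[OF f(1)] Lp_meas[OF apx_Lp(2)[OF a]] Lp_meas[OF apx_Lp(1)[OF a]]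
have "(LINT x|M. Th' (w x) * norm (D w x) powr p) = (LINT x|M. Ap p (D w x) \<bullet> D (%x. Th (w x)) x)"
proof (rule integral_cong_AE)
 show "AE x in M. Th' (w x) * norm (D w x) powr p = Ap p (D w x) \<bullet> D (%x. Th (w x)) x"
  using apx_wgrad[OF a] by eventually_elim (simp add: Ap_inner_self)
 show "(%x. Th' (w x) * norm (D w x) powr p):borel_measurable M"
  using borel_measurable_continuous_onI[OF c] by measurable
qed measurable
also have "... = (LINT x|M. f x * Th (w x))" by (rule solD(2)[OF s tW])
also have "...<=0"
proof -
 have "AE x in M. 0<=- (f x * Th (w x))" using f(2)
 proof eventually_elim
  case (elim x)
  show ?case
  proof (cases "w x < 0")
   case True thus ?thesis using Thneg(2)[of "w x"] elim by (simp add: mult_nonneg_nonpos)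
  next
   case False hence "Th (w x) = 0" using Thneg[of "w x"] by linarith
   thus ?thesis by simp
  qed
 qed
 from integral_nonneg_AE[OF this] show ?thesis by simp
qed
finally have le: "(LINT x|M. Th' (w x) * norm (D w x) powr p)<=0" .
have i: "integrable M (%x. Th' (w x) * norm (D w x) powr p)"
proof (rule Bintegrable_bound[OF Lp_int[OF W_Lp(2)[OF w]]])
 show "(%x. Th' (w x) * norm (D w x) powr p):borel_measurable M" using borel_measurable_continuous_onI[OF c] by measurable
 show "AE x in M. norm (Th' (w x) * norm (D w x) powr p)<=norm (norm (D w x) powr p)"
  using K by (intro AE_I2) (simp add: abs_mult mult_left_le_one_le)
qed
have "(LINT x|M. Th' (w x) * norm (D w x) powr p) = 0"
proof (rule antisym[OF le integral_nonneg_AE])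
 show "AE x in M. 0<=Th' (w x) * norm (D w x) powr p" using Th'0 by simp
qed
hence "AE x in M. Th' (w x) * norm (D w x) powr p = 0"
 using integral_nonneg_eq_0_iff_AE[OF i] Th'0 by simp
hence "AE x in M. Th' (w x) *\<^sub>R D w x = 0" by eventually_elim auto
hence "Ip M p (%x. Th' (w x) *\<^sub>R D w x) = 0" using Ip_eq_0_iff[OF p0 apx_Lp(2)[OF a]] by simp
hence "N (%x. Th (w x)) = 0" using apx_Wnorm[OF a] p0 by simp
hence "AE x in M. Th (w x) = 0" using N_eq_0_iff[OF tW] by simp
thus ?thesis by eventually_elim (use Thneg(1) in \<open>metis less_irrefl not_le\<close>)
qed

end

section \<open>The weighted problem and its solution map\<close>

locale weighted_problem = sobolev_domain \<Omega> p R for \<Omega> :: "'a::euclidean_space set" and p R +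
fixes V :: "'a => real" and g :: "real => 'a => real => real" and Vb :: real
assumes V_meas: "V:borel_measurable (lebesgue_on \<Omega>)" and V_bd: "AE x in lebesgue_on \<Omega>. abs (V x)<=Vb"
 and V_pos: "emeasure lebesgue {x:\<Omega>. V x > 0} > 0"
 and g_meas: "!!l s. (%x. g l x s):borel_measurable (lebesgue_on \<Omega>)"
 and g_cont: "AE x in lebesgue_on \<Omega>. continuous_on UNIV (%(l, s). g l x s)"
 and g_grow: "!!L. EX f. good_majorant p (DIM('a) * p / (DIM('a) - p)) f &
   (AE x in lebesgue_on \<Omega>. ALL l:{-L..L}. ALL s. abs (g l x s)<=f (abs s))"
begin

lemma g_bound:
assumes "!!f. good_majorant p q f==>EX C>=0. ALL t>=0. f t<=b C t"
shows "EX C>=0. AE x in M. ALL l s. abs l<=L-->abs (g l x s)<=b C (abs s)"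
proof -
obtain f where f: "good_majorant p q f" "AE x in M. ALL l:{-L..L}. ALL s. abs (g l x s)<=f (abs s)" using g_grow[of L] by (auto simp: q_def)
obtain C where C: "C>=0" "!!t. t>=0==>f t<=b C t" using assms[OF f(1)] by blast
have "AE x in M. ALL l s. abs l<=L-->abs (g l x s)<=b C (abs s)" using f(2)
 by eventually_elim (metis C(2) abs_ge_zero abs_le_iff atLeastAtMost_iff minus_le_iff order_trans)
thus ?thesis using C(1) by blast
qed

lemma g_bound1: "eta > 0==>EX C>=0. AE x in M. ALL l s. abs l<=L-->abs (g l x s)<=eta * abs s powr (q - 1) + C"
by (rule g_bound[OF majorant_bounds(1)])

abbreviation "g_le L eta C \<equiv> AE x in M. ALL l s. abs l<=L-->abs (g l x s)<=eta * abs s powr (p - 1) + C * abs s powr (q - 1)"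

lemma g_bound2: "eta > 0==>EX C>=0. g_le L eta C"
by (rule g_bound[OF majorant_bounds(2)])

lemma g_zero: "AE x in M. g l x 0 = 0"
proof -
obtain C where "AE x in M. ALL k s. abs k<=abs l-->abs (g k x s)<=1 * abs s powr (p - 1) + C * abs s powr (q - 1)" using g_bound2[of 1 "abs l"] by auto
thus ?thesis
proof eventually_elim
 case (elim x)
 from elim[rule_format, of l 0] show ?case by simp
qed
qed

definition H :: "real => real => ('a => real) => 'a => real" where
"H t l u x = l * V x * Ap p (u x) + g l x (u x) + t"

lemma weak_solution_iff: "weak_solution \<Omega> p V g l u \<longleftrightarrow> sol (H 0 l u) u"
unfolding weak_solution_def sol_def H_def Ap_def by (simp add: mult.assoc)

lemma g_meas_comp:
assumes u: "u:borel_measurable M"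
shows "(%x. g l x (u x)):borel_measurable M"
proof (rule caratheodory_comp_measurable[OF dom_sets g_meas _ u])
show "AE x in M. continuous_on UNIV (g l x)" using g_cont
proof eventually_elim
 case (elim x)
 have "continuous_on UNIV (%s. (l, s :: real))" by (intro continuous_intros)
 from continuous_on_compose2[OF elim this] show ?case by simp
qed
qed

lemma H_meas: "u:borel_measurable M==>H t l u:borel_measurable M"
unfolding H_def using V_meas g_meas_comp[of u l] by (intro borel_measurable_add borel_measurable_times Ap_measurable) auto

lemma g_tendsto:
assumes "continuous_on UNIV (%(l, s). g l x s)" "lk---->l" "sk---->s"
shows "(%k. g (lk k) x (sk k))---->g l x s"
using continuous_on_tendsto_compose[OF assms(1) tendsto_Pair[OF assms(2,3)]] by simp

lemma Vb_nonneg: "Vb>=0"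
proof (rule ccontr)
assume "~ Vb>=0"
hence "AE x in M. ~ V x > 0" using V_bd by (auto elim: eventually_mono)
hence "negligible {x:\<Omega>. V x > 0}" unfolding AE_lebesgue_on_iff[OF dom_sets] by simp
thus False using V_pos by (simp add: negligible_iff_null_sets null_sets_def)
qed

lemma H_growth:
assumes eta: "eta > 0"
shows "EX C. ALL t l. abs t<=L-->abs l<=L-->(ALL u. AE x in M. abs (H t l u x)<=eta * abs (u x) powr (q - 1) + C)"
proof -
define c where "c = abs L * Vb + 1"
have c: "c > 0" using Vb_nonneg by (simp add: c_def add_nonneg_pos)
have "eta / 2 > 0" "eta / (2 * c) > 0" using eta c by auto
obtain C1 where C1: "C1>=0" "AE x in M. ALL l s. abs l<=L-->abs (g l x s)<=eta / 2 * abs s powr (q - 1) + C1"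
 using g_bound1[OF \<open>eta / 2 > 0\<close>] by blast
obtain C2 where C2: "C2>=0" "!!t. t>=0==>t powr (p - 1)<=eta / (2 * c) * t powr (q - 1) + C2"
 using powr_subcritical[OF \<open>eta / (2 * c) > 0\<close>] by blast
have "AE x in M. abs (H t l u x)<=eta * abs (u x) powr (q - 1) + (C1 + c * C2 + abs L)" if tl: "abs t<=L" "abs l<=L" for t l u
 using C1(2) V_bd
proof eventually_elim
 case (elim x)
 have "abs (l * V x * Ap p (u x)) = abs l * abs (V x) * abs (u x) powr (p - 1)" using norm_Ap[of p "u x"] by (simp add: abs_mult)
 also have "...<=c * abs (u x) powr (p - 1)"
 proof (intro mult_right_mono)
  have "abs l * abs (V x)<=abs L * Vb" using elim(2) tl(2) by (intro mult_mono) auto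
  thus "abs l * abs (V x)<=c" by (simp add: c_def)
 qed simp
 also have "...<=c * (eta / (2 * c) * abs (u x) powr (q - 1) + C2)" using C2(2)[of "abs (u x)"] c by (intro mult_left_mono) auto
 also have "... = eta / 2 * abs (u x) powr (q - 1) + c * C2" using c by (simp add: distrib_left)
 finally have 1: "abs (l * V x * Ap p (u x))<=eta / 2 * abs (u x) powr (q - 1) + c * C2" .
 have 2: "abs (g l x (u x))<=eta / 2 * abs (u x) powr (q - 1) + C1" using elim(1) tl(2) by blast
 have "abs (H t l u x)<=abs (l * V x * Ap p (u x)) + abs (g l x (u x)) + abs t" unfolding H_def by (intro order_trans[OF abs_triangle_ineq] add_mono abs_triangle_ineq) auto
 also have "...<=eta * abs (u x) powr (q - 1) + (C1 + c * C2 + abs L)" using 1 2 tl(1) by (simp add: field_simps)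
 finally show ?case .
qed
thus ?thesis by blast
qed

text \<open>The embedding with the critical exponent \<open>q\<close> is not compact; convergence
  still holds because the leading factor in \<open>H_growth\<close> can be made arbitrarily
  small.\<close>

lemma H_lim:
assumes tl: "tk---->t" "lk---->l" and u: "!!k::nat. Lp M q (u k)" "Lp M q v" "!!k. Ip M q (u k)<=B" "AE x in M. (%k. u k x)---->v x"
shows "!!k. Lp M q' (H (tk k) (lk k) (u k))" "Lp M q' (H t l v)" "(%k. Ip M q' (%x. H (tk k) (lk k) (u k) x - H t l v x))---->0"
proof -
have "Bseq tk" "Bseq lk" using tl by (auto intro: convergent_imp_Bseq convergentI)
then obtain L1 L2 where L: "!!k. abs (tk k)<=L1" "!!k. abs (lk k)<=L2" by (auto simp: Bseq_def)
have lim: "AE x in M. (%k. H (tk k) (lk k) (u k) x)---->H t l v x" using u(4) g_cont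
proof eventually_elim
 case (elim x)
 show ?case unfolding H_def by (intro tendsto_intros tl Ap_tendsto[OF p1] g_tendsto elim)
qed
have gr: "EX C. ALL k. AE x in M. abs (H (tk k) (lk k) (u k) x)<=eta * abs (u k x) powr (q - 1) + C" if "eta > 0" for eta
proof -
 have "abs (tk k)<=max L1 L2" "abs (lk k)<=max L1 L2" for k using L[of k] by (simp_all add: le_max_iff_disj)
 thus ?thesis using H_growth[OF that, of "max L1 L2"] by meson
qed
note * = nemytskii_limit[of "%k. H (tk k) (lk k) (u k)" "H t l v" u v B, OF H_meas[OF Lp_meas[OF u(1)]] H_meas[OF Lp_meas[OF u(2)]] u(1,2,3) lim u(4) gr]
show "Lp M q' (H (tk k) (lk k) (u k))" for k by (rule *(1))
show "Lp M q' (H t l v)" by (rule *(2))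
show "(%k. Ip M q' (%x. H (tk k) (lk k) (u k) x - H t l v x))---->0" by (rule *(3))
qed

lemma H_Lp: "Lp M q u==>Lp M q' (H t l u)"
using H_lim(2)[of "%_. t" t "%_. l" l "%_. u" u "Ip M q u"] by simp

lemma H_cong: "AE x in M. u x = v x==>AE x in M. H t l u x = H t l v x"
by (auto simp: H_def elim: eventually_mono)

lemma Lp_contraction:
assumes u: "Lp M s u" and P: "continuous_on UNIV P" "!!y. abs (P y)<=abs y" and s: "s > 0"
shows "Lp M s (%x. P (u x :: real) :: real)" "Ip M s (%x. P (u x))<=Ip M s u"
proof -
note [measurable] = Lp_meas[OF u] borel_measurable_continuous_onI[OF P(1)]
have le: "norm (P (u x)) powr s<=norm (u x) powr s" for x using P(2) s by (intro powr_mono2) auto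
show 1: "Lp M s (%x. P (u x))" by (rule Lp_bound[OF _ Lp_int[OF u]]) (use le in auto)
show "Ip M s (%x. P (u x))<=Ip M s u" unfolding Ip_def by (intro integral_mono Lp_int[OF 1] Lp_int[OF u] le)
qed

lemma Lp_lim_unique:
assumes f: "!!k::nat. Lp M p (f k)" "Lp M p a" "Lp M p b" and l: "(%k. Ip M p (%x. f k x - a x))---->0" "(%k. Ip M p (%x. f k x - b x))---->0"
shows "AE x in M. a x = (b x :: real)"
proof -
have z: "(%k. 2 powr p * (Ip M p (%x. f k x - a x) + Ip M p (%x. f k x - b x)))---->0"
 using tendsto_mult_left[OF tendsto_add[OF l], of "2 powr p"] by simp
have "Ip M p (%x. a x - b x)<=0"
 by (rule LIMSEQ_le_const[OF z]) (use Ip_diff_tri[OF p0 f(2) f(1) f(3)] Ip_minus_commute[of M p a] in auto)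
hence "Ip M p (%x. a x - b x) = 0" using Ip_nonneg[of M p "%x. a x - b x"] by linarith
thus ?thesis using Ip_eq_0_iff[OF p0 Lp_diff(1)[OF p0 f(2,3)]] by auto
qed

text \<open>Covers both right-hand sides in use: \<open>P\<close> is the identity for the original
  problem and the positive part for \<open>K\<close>. The limit of the arguments is found only in
  Lebesgue spaces, while the solutions converge in norm.\<close>

lemma solution_compact:
assumes P: "continuous_on UNIV P" "!!y. abs (P y)<=abs y" and tl: "tk---->t" "lk---->l" and u: "!!k::nat. u k:W" "!!k. N (u k)<=B"
 and s: "!!k. sol (H (tk k) (lk k) (%x. P (u k x))) (w k)"
shows "EX r v w'. strict_mono (r::nat=>nat)&Lp M p v&Lp M q v&(%k. Ip M p (%x. u (r k) x - v x))---->0 &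
 sol (H t l (%x. P (v x))) w'&(%k. N (%x. w (r k) x - w' x))---->0"
proof -
obtain r v where r: "strict_mono (r::nat=>nat)" "Lp M q v" "Lp M p v" "AE x in M. (%k. u (r k) x)---->v x" "(%k. Ip M p (%x. u (r k) x - v x))---->0"
 using W_compact[of u, OF u] by blast
have tl': "(%k. tk (r k))---->t" "(%k. lk (r k))---->l" using LIMSEQ_subseq_LIMSEQ[OF tl(1) r(1)] LIMSEQ_subseq_LIMSEQ[OF tl(2) r(1)] by (simp_all add: o_def)
have B: "Ip M q (%x. P (u (r k) x))<=Sq * B powr q" for k
 using Lp_contraction(2)[OF W_Lp(3)[OF u(1)] P q_gt(3)] Ip_q_bound[OF u] by (rule order_trans)
have ae: "AE x in M. (%k. P (u (r k) x))---->P (v x)" using r(4) by eventually_elim (rule continuous_on_tendsto_compose[OF P(1)], auto)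
note h = H_lim[of "%k. tk (r k)" t "%k. lk (r k)" l "%k x. P (u (r k) x)" "%x. P (v x)", OF tl' Lp_contraction(1)[OF W_Lp(3)[OF u(1)] P q_gt(3)] Lp_contraction(1)[OF r(2) P q_gt(3)] B ae]
obtain w' where w': "sol (H t l (%x. P (v x))) w'" using sol_exists[OF h(2)] by blast
have "(%k. N (%x. w (r k) x - w' x))---->0"
 by (rule sol_stable[of "%k. H (tk (r k)) (lk (r k)) (%x. P (u (r k) x))" "%k. w (r k)", OF s w' h])
thus ?thesis using r w' by blast
qed

lemma sol_limit:
assumes tl: "tk---->t" "lk---->l" and s: "!!k::nat. sol (H (tk k) (lk k) (u k)) (u k)" and v: "v:W" "(%k. N (%x. u k x - v x))---->0"
shows "sol (H t l v) v"
proof -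
have u: "u k:W" for k by (rule solD(1)[OF s])
have "Bseq (%k. N (u k))" by (rule convergent_imp_Bseq[OF convergentI[OF N_tendsto[of u v, OF u v]]])
then obtain B where B: "!!k. N (u k)<=B" by (auto simp: Bseq_def N_nonneg)
obtain r v' w where r: "strict_mono (r::nat=>nat)" "Lp M p v'" "Lp M q v'" "(%k. Ip M p (%x. u (r k) x - v' x))---->0"
 "sol (H t l v') w" "(%k. N (%x. u (r k) x - w x))---->0"
 using solution_compact[of "%y. y" tk t lk l u B u, OF continuous_on_id order_refl tl u B s] by blast
have w: "w:W" by (rule solD(1)[OF r(5)])
have l1: "(%k. N (%x. u (r k) x - v x))---->0" by (rule subseq_tendsto[OF v(2) r(1)])
note lv = N_lim_Lp[of "%k. u (r k)" v, OF u v(1) l1] and lw = N_lim_Lp[of "%k. u (r k)" w, OF u w r(6)]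
have a: "AE x in M. v' x = v x" by (rule Lp_lim_unique[of "%k. u (r k)", OF W_Lp(1)[OF u] r(2) W_Lp(1)[OF v(1)] r(4) lv])
have b: "AE x in M. w x = v x" by (rule Lp_lim_unique[of "%k. u (r k)", OF W_Lp(1)[OF u] W_Lp(1)[OF w] W_Lp(1)[OF v(1)] lw lv])
show ?thesis
 by (rule sol_cong[OF r(5) H_cong[OF a] H_meas[OF Lp_meas[OF r(2)]] H_meas[OF Lp_meas[OF W_Lp(1)[OF v(1)]]] b v(1)])
qed

definition nts :: "(real \<times> ('a => real)) set" where
"nts = {z. nontrivial_on \<Omega> (snd z)&sol (H 0 (fst z) (snd z)) (snd z)}"

abbreviation S where "S \<equiv> sol_closure \<Omega> p V g"

lemma Etop_eq: "Etop \<Omega> p = topE"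
by (simp add: Etop_def topE_def Ecarrier_def carr_def Edist_def[abs_def] dE_def[abs_def])

lemma S_eq: "S = topE closure_of nts"
unfolding sol_closure_def Etop_eq nts_def weak_solution_iff by (simp add: case_prod_unfold)

lemma nts_carr: "nts \<subseteq> carr" by (auto simp: nts_def carr_iff dest: solD(1))

lemma S_sub: "S \<subseteq> carr" using closure_of_subset_topspace[of topE nts] by (simp add: S_eq)

lemma S_seq:
assumes z: "z:S"
shows "EX y. (ALL k::nat. y k:nts)&(%k. dE (y k) z)---->0"
proof -
have zc: "z:carr" using S_sub z by blast
have "EX y. y:nts&dE z y < 1 / real (Suc k)" for k
proof -
 have "{w:carr. dE z w < 1 / real (Suc k)}:{{w:carr. dE y w < r} | y r. y:carr&r > 0}"
  using zc by (intro CollectI exI[of _ z] exI[of _ "1 / real (Suc k)"]) auto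
 hence "openin topE {w:carr. dE z w < 1 / real (Suc k)}"
  unfolding topE_def openin_topology_generated_by_iff by (rule generate_topology_on.Basis)
 moreover have "z:{w:carr. dE z w < 1 / real (Suc k)}" using zc by (simp add: pm.refl)
 moreover have "ALL T. z:T&openin topE T-->(EX y. y:nts&y:T)" using z unfolding S_eq in_closure_of by (rule conjunct2)
 ultimately have "EX y. y:nts&y:{w:carr. dE z w < 1 / real (Suc k)}" by (elim allE impE) (rule conjI)
 thus ?thesis by (elim exE conjE CollectE) (intro exI conjI)
qed
then obtain y where y: "!!k. y k:nts" "!!k. dE z (y k) < 1 / real (Suc k)" by metis
have inv: "(%k. 1 / real (Suc k))---->0" by (rule recip_tendsto)
have "(%k. dE (y k) z)---->0"
proof (rule Lim_null_comparison[OF _ inv], intro always_eventually allI)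
 fix k
 have "y k:carr" using y(1) nts_carr by blast
 thus "norm (dE (y k) z)<=1 / real (Suc k)" using y(2)[of k] pm.sym[OF _ zc, of "y k"] N_nonneg by (simp add: dE_def)
qed
thus ?thesis using y(1) by blast
qed

lemma dE_tendsto:
assumes "(%k::nat. dE (y k) z)---->0"
shows "(%k. fst (y k))---->fst z" "(%k. N (%x. snd (y k) x - snd z x))---->0"
proof -
have "(%k. fst (y k) - fst z)---->0"
 by (rule Lim_null_comparison[OF _ assms]) (auto simp: dE_def N_nonneg)
thus "(%k. fst (y k))---->fst z" by (simp add: LIM_zero_iff)
show "(%k. N (%x. snd (y k) x - snd z x))---->0"
 by (rule Lim_null_comparison[OF _ assms]) (auto simp: dE_def N_nonneg)
qed

lemma S_closed: "closedin topE S" by (simp add: S_eq)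

lemma S_sol:
assumes "z:S"
shows "sol (H 0 (fst z) (snd z)) (snd z)"
proof -
obtain y where y: "!!k::nat. y k:nts" "(%k. dE (y k) z)---->0" using S_seq[OF assms] by blast
have s: "sol (H 0 (fst (y k)) (snd (y k))) (snd (y k))" for k using y(1)[of k] by (simp add: nts_def)
have "snd z:W" using S_sub assms by (auto simp: carr_iff)
from sol_limit[of "%_. 0" 0 "%k. fst (y k)" "fst z" "%k. snd (y k)" "snd z", OF tendsto_const dE_tendsto(1)[OF y(2)] s this dE_tendsto(2)[OF y(2)]]
show ?thesis .
qed

lemma nts_S: "nts \<subseteq> S" unfolding S_eq using nts_carr by (intro closure_of_subset) simp

lemma S_compact:
assumes z: "!!k::nat. z k:S" "!!k. abs (fst (z k)) + N (snd (z k))<=B"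
shows "EX r l. strict_mono (r::nat=>nat)&l:S&(%k. dE (z (r k)) l)---->0"
proof -
have b: "abs (fst (z k))<=B" "N (snd (z k))<=B" for k using z(2)[of k] N_nonneg[of "snd (z k)"] by linarith+
have "bounded (range (%k. fst (z k)))" using b(1) by (auto intro!: boundedI)
then obtain l r where r: "strict_mono (r::nat=>nat)" "(%k. fst (z (r k)))---->l"
 using bounded_imp_convergent_subsequence[of "%k. fst (z k)"] by (auto simp: o_def)
obtain s v w where s: "strict_mono (s::nat=>nat)" "sol (H 0 l v) w" "(%k. N (%x. snd (z (r (s k))) x - w x))---->0"
 using solution_compact[of "%y. y" "%_. 0" 0 "%k. fst (z (r k))" l "%k. snd (z (r k))" B "%k. snd (z (r k))",
   OF continuous_on_id order_refl tendsto_const r(2) solD(1)[OF S_sol[OF z(1)]] b(2) S_sol[OF z(1)]] by blast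
have l: "(%k. dE (z (r (s k))) (l, w))---->0"
proof -
 have "(%k. fst (z (r (s k))))---->l" by (rule subseq_tendsto[OF r(2) s(1)])
 hence "(%k. abs (fst (z (r (s k))) - l))---->0" by (simp add: LIM_zero tendsto_rabs_zero)
 from tendsto_add[OF this s(3)] show ?thesis by (simp add: dE_def)
qed
have "(l, w):S"
 by (rule closedin_topE_limit[OF S_closed z(1) _ l]) (use solD(1)[OF s(2)] in \<open>simp add: carr_iff\<close>)
thus ?thesis using l strict_mono_o[OF r(1) s(1)] by (intro exI[of _ "r \<circ> s"] exI[of _ "(l, w)"]) auto
qed

text \<open>A choice among solutions that differ only on null sets.\<close>

definition K :: "real => real => ('a => real) => 'a => real" where
"K t l u = (SOME w. sol (H t l (%x. max 0 (u x))) w)"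

lemma pos_part: "continuous_on UNIV (%y::real. max 0 y)" "abs (max 0 y)<=abs (y::real)"
by (auto intro!: continuous_intros)

lemma K_sol: "u:W==>sol (H t l (%x. max 0 (u x))) (K t l u)"
unfolding K_def using sol_exists[OF H_Lp[OF Lp_contraction(1)[OF W_Lp(3) pos_part q_gt(3)]]] by (rule someI_ex)

lemma K_compact:
assumes tl: "tk---->t" "lk---->l" and u: "!!k::nat. u k:W" "!!k. N (u k)<=B"
shows "EX r w. strict_mono (r::nat=>nat)&w:W&(%k. N (%x. K (tk (r k)) (lk (r k)) (u (r k)) x - w x))---->0 &
    (ALL v:W. (%k. N (%x. u k x - v x))---->0-->N (%x. w x - K t l v x) = 0)"
proof -
obtain r v w where r: "strict_mono (r::nat=>nat)" "Lp M p v" "Lp M q v" "(%k. Ip M p (%x. u (r k) x - v x))---->0"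
 "sol (H t l (%x. max 0 (v x))) w" "(%k. N (%x. K (tk (r k)) (lk (r k)) (u (r k)) x - w x))---->0"
 using solution_compact[of "%y. max 0 y" tk t lk l u B "%k. K (tk k) (lk k) (u k)", OF pos_part tl u K_sol[OF u(1)]] by blast
have "N (%x. w x - K t l v' x) = 0" if v': "v':W" "(%k. N (%x. u k x - v' x))---->0" for v'
proof -
 have l1: "(%k. N (%x. u (r k) x - v' x))---->0" by (rule subseq_tendsto[OF v'(2) r(1)])
 have a: "AE x in M. v x = v' x"
  by (rule Lp_lim_unique[of "%k. u (r k)", OF W_Lp(1)[OF u(1)] r(2) W_Lp(1)[OF v'(1)] r(4) N_lim_Lp[of "%k. u (r k)" v', OF u(1) v'(1) l1]])
 have m: "(%x. max 0 (v x)):borel_measurable M" "(%x. max 0 (v' x)):borel_measurable M" using Lp_meas[OF r(2)] Lp_meas[OF W_Lp(1)[OF v'(1)]] by auto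
 have "AE x in M. max 0 (v x) = max 0 (v' x)" using a by eventually_elim simp
 from sol_cong[OF r(5) H_cong[OF this] H_meas[OF m(1)] H_meas[OF m(2)] _ solD(1)[OF r(5)]]
 have "sol (H t l (%x. max 0 (v' x))) w" by simp
 thus ?thesis by (rule sol_unique[OF _ K_sol[OF v'(1)] H_Lp[OF Lp_contraction(1)[OF W_Lp(3)[OF v'(1)] pos_part q_gt(3)]]])
qed
thus ?thesis using r solD(1)[OF r(5)] by blast
qed

end

section \<open>The principal eigenvalue\<close>

context weighted_problem
begin

definition wV :: "('a => real) => real" where "wV u = (LINT x|M. V x * abs (u x) powr p)"

lemma wV_integrable:
assumes u: "Lp M p u"
shows "integrable M (%x. V x * abs (u x) powr p)" "abs (wV u)<=Vb * Ip M p u"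
proof -
note [measurable] = V_meas Lp_meas[OF u]
have i: "integrable M (%x. Vb * norm (u x) powr p)" using Lp_int[OF u] by auto
have bd: "AE x in M. abs (V x * abs (u x) powr p)<=Vb * norm (u x) powr p" using V_bd
 by eventually_elim (auto simp: abs_mult intro!: mult_right_mono)
show 1: "integrable M (%x. V x * abs (u x) powr p)"
 by (rule Bintegrable_bound[OF i]) (use bd Vb_nonneg in \<open>auto simp: abs_mult elim: eventually_mono\<close>)
have "abs (wV u)<=(LINT x|M. abs (V x * abs (u x) powr p))" unfolding wV_def by (rule integral_abs_bound)
also have "...<=(LINT x|M. Vb * norm (u x) powr p)" by (rule integral_mono_AE[OF integrable_abs[OF 1] i bd])
finally show "abs (wV u)<=Vb * Ip M p u" by (simp add: Ip_def)
qed

lemma wV_scale: "wV (%x. c * u x) = abs c powr p * wV u"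
proof -
have e: "V x * abs (c * u x) powr p = abs c powr p * (V x * abs (u x) powr p)" for x by (simp add: abs_mult powr_mult)
show ?thesis unfolding wV_def e by simp
qed

definition l1 :: real where "l1 = lambda1 \<Omega> p V"

lemma l1_eq: "l1 = Inf ((%u. N u powr p) ` {u:W. wV u = 1})"
unfolding l1_def lambda1_def wV_def N_powr Ip_def by (rule arg_cong[of _ _ Inf]) auto

lemma normalize:
assumes u: "u:W" and pos: "wV u > 0"
shows "EX v:W. wV v = 1&N v powr p = N u powr p / wV u"
proof (intro bexI conjI)
let ?c = "wV u powr (- 1 / p)"
have "abs (?c) powr p = wV u powr (-1 / p * p)" by (simp only: abs_of_nonneg[OF powr_ge_zero] powr_powr)
also have "-1 / p * p = -1" using p0 by simp
finally have c: "abs (?c) powr p = 1 / wV u" using pos by (simp add: powr_minus_divide)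
show "(%x. ?c * u x):W" by (rule scale[OF u])
show "wV (%x. ?c * u x) = 1" using pos by (simp only: wV_scale c) simp
have "N (%x. ?c * u x) powr p = abs (?c) powr p * N u powr p" by (simp add: N_scale[OF u] powr_mult)
thus "N (%x. ?c * u x) powr p = N u powr p / wV u" by (simp only: c) simp
qed

text \<open>Keeps \<open>l1\<close> from being the unspecified infimum of the empty set.\<close>

lemma constraint_nonempty: "{u:W. wV u = 1}~={}"
proof -
obtain ps h where ps: "test_pair \<Omega> ps h" "wV ps > 0"
 using exists_test_weight_pos[OF open_dom fin p0 V_meas V_bd V_pos] unfolding wV_def by blast
show ?thesis using normalize[OF apx_W0[OF apx_test[OF ps(1)]] ps(2)] by blast
qed

lemma l1_pos: "l1 > 0"
proof -
define c where "c = Vb * (2*R) powr p + 1"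
have c: "c > 0" using Vb_nonneg by (simp add: c_def add_nonneg_pos)
have "1 / c<=N u powr p" if u: "u:W" "wV u = 1" for u
proof -
 have "1<=Vb * Ip M p u" using wV_integrable(2)[OF W_Lp(1)[OF u(1)]] u(2) by simp
 also have "...<=Vb * ((2*R) powr p * N u powr p)" by (intro mult_left_mono poincare_W[OF u(1)] Vb_nonneg)
 also have "...<=c * N u powr p" by (simp add: c_def distrib_right)
 finally show ?thesis using c by (simp add: divide_le_eq mult.commute)
qed
hence "1 / c<=l1" unfolding l1_eq using constraint_nonempty by (intro cInf_greatest) auto
thus ?thesis using c by (smt (verit) divide_pos_pos)
qed

lemma l1_le:
assumes u: "u:W"
shows "l1 * wV u<=N u powr p"
proof (cases "wV u > 0")
case False
hence "l1 * wV u<=0" using l1_pos by (simp add: mult_nonneg_nonpos)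
thus ?thesis using powr_ge_zero[of "N u" p] by linarith
next
case True
obtain v where v: "v:W" "wV v = 1" "N v powr p = N u powr p / wV u" using normalize[OF u True] by blast
have "l1<=N v powr p" unfolding l1_eq by (rule cInf_lower[OF imageI]) (use v(1,2) in \<open>auto intro!: bdd_belowI[of _ 0]\<close>)
thus ?thesis using True v(3) by (simp add: le_divide_eq)
qed

lemma near_minimizer: "l > l1==>EX u:W. wV u = 1&N u powr p < l"
unfolding l1_eq using cInf_lessD[of "(%u. N u powr p) ` {u:W. wV u = 1}" l] constraint_nonempty by auto

lemma H_pairing:
assumes u: "u:W"
shows "integrable M (%x. g l x (u x) * u x)" "(LINT x|M. H 0 l u x * u x) = l * wV u + (LINT x|M. g l x (u x) * u x)"
proof -
have e: "H 0 l u x * u x = l * (V x * abs (u x) powr p) + g l x (u x) * u x" for x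
 using Ap_inner_self[of p "u x"] by (simp add: H_def distrib_right mult.assoc)
have i: "integrable M (%x. H 0 l u x * u x)" by (rule pairing_integrable(1)[OF H_Lp[OF W_Lp(3)[OF u]] W_Lp(3)[OF u]])
have j: "integrable M (%x. l * (V x * abs (u x) powr p))" using wV_integrable(1)[OF W_Lp(1)[OF u]] by (rule integrable_mult_right)
have "integrable M (%x. H 0 l u x * u x - l * (V x * abs (u x) powr p))" by (rule Bintegrable_diff[OF i j])
thus 1: "integrable M (%x. g l x (u x) * u x)" by (simp add: e)
show "(LINT x|M. H 0 l u x * u x) = l * wV u + (LINT x|M. g l x (u x) * u x)"
 unfolding e Bintegral_add[OF j 1] by (simp add: wV_def)
qed

lemma g_pairing_le:
assumes eta: "eta > 0"
shows "EX C>=0. ALL l u. abs l<=L-->u:W-->(LINT x|M. g l x (u x) * u x)<=eta * Ip M p u + C * Ip M q u"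
proof -
obtain C where C: "C>=0" "g_le L eta C"
 using g_bound2[OF eta] by blast
have "(LINT x|M. g l x (u x) * u x)<=eta * Ip M p u + C * Ip M q u" if l: "abs l<=L" and u: "u:W" for l u
proof -
 have i: "integrable M (%x. eta * norm (u x) powr p)" "integrable M (%x. C * norm (u x) powr q)" using Lp_int[OF W_Lp(1)[OF u]] Lp_int[OF W_Lp(3)[OF u]] by auto
 have "(LINT x|M. g l x (u x) * u x)<=(LINT x|M. eta * norm (u x) powr p + C * norm (u x) powr q)"
 proof (rule integral_mono_AE[OF H_pairing(1)[OF u] Bintegrable_add[OF i]])
  show "AE x in M. g l x (u x) * u x<=eta * norm (u x) powr p + C * norm (u x) powr q" using C(2)
  proof eventually_elim
   case (elim x)
   have pw: "abs (u x) powr (s - 1) * abs (u x) = abs (u x) powr s" for s using powr_mult_base[of "abs (u x)" "s - 1"] by (simp add: mult.commute)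
   have "g l x (u x) * u x<=abs (g l x (u x)) * abs (u x)" by (metis abs_ge_self abs_mult)
   also have "...<=(eta * abs (u x) powr (p - 1) + C * abs (u x) powr (q - 1)) * abs (u x)" using elim l by (intro mult_right_mono) auto
   also have "... = eta * (abs (u x) powr (p - 1) * abs (u x)) + C * (abs (u x) powr (q - 1) * abs (u x))" by (simp add: distrib_right mult.assoc)
   finally show ?case by (simp add: pw)
  qed
 qed
 also have "... = eta * Ip M p u + C * Ip M q u" using Bintegral_add[OF i] by (simp add: Ip_def)
 finally show ?thesis .
qed
thus ?thesis using C(1) by blast
qed

text \<open>Up to a parameter \<open>L\<close> below \<open>l1\<close> the weight term consumes at
  most the fraction \<open>L / l1\<close> of the energy, and of the reserve \<open>th\<close> the
  nonlinearity takes at most half once the norm is small. This excludes bifurcation below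
  \<open>l1\<close> and small fixed points of multiples of \<open>K\<close>.\<close>

lemma small_coercive:
assumes L: "L < l1" "0<=L"
shows "EX rho>0. ALL l u. 0<=l-->l<=L-->u:W-->N u<=rho-->N u powr p<=(LINT x|M. H 0 l u x * u x)-->N u = 0"
proof -
define th where "th = 1 - L / l1"
have th: "th > 0" using L l1_pos by (simp add: th_def)
define P where "P = (2*R) powr p + 1"
have P: "P > 0" by (simp add: P_def add_nonneg_pos)
\<comment> \<open>One quarter of the reserve goes to the p-part of \<open>g\<close>, after
  Poincare's inequality; \<open>rho\<close> is the norm at which the q-part, after Sobolev's
  inequality, takes another quarter.\<close>
have "th / (4 * P) > 0" using th P by simp
then obtain C where C: "C>=0" "!!l u. abs l<=L==>u:W==>(LINT x|M. g l x (u x) * u x)<=th / (4 * P) * Ip M p u + C * Ip M q u"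
 using g_pairing_le by blast
define c where "c = C * Sq + 1"
have c: "c > 0" using C(1) Sq_nonneg by (simp add: c_def add_nonneg_pos)
define rho where "rho = (th / (4 * c)) powr (1 / (q - p))"
have rho: "rho > 0" using th c by (simp add: rho_def)
have rhoq: "rho powr (q - p) = th / (4 * c)" using th c q_gt(1) by (simp add: rho_def powr_powr)
have "N u = 0" if h: "0<=l" "l<=L" "u:W" "N u<=rho" "N u powr p<=(LINT x|M. H 0 l u x * u x)" for l u
proof (rule ccontr)
 assume "N u~=0"
 hence n: "N u > 0" using N_nonneg[of u] by linarith
 have al: "abs l<=L" using h by simp
 define X where "X = N u powr p"
 have X: "X > 0" using n by (simp add: X_def)
 have 1: "l * wV u<=L / l1 * X"
 proof -
  have "wV u<=X / l1" using l1_le[OF h(3)] l1_pos by (simp add: X_def le_divide_eq mult.commute)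
  hence "l * wV u<=l * (X / l1)" using h(1) by (rule mult_left_mono)
  also have "...<=L * (X / l1)" using h(2) X l1_pos by (intro mult_right_mono) auto
  finally show ?thesis by simp
 qed
 have 2: "th / (4 * P) * Ip M p u<=th / 4 * X"
 proof -
  have "Ip M p u<=(2*R) powr p * X" unfolding X_def by (rule poincare_W[OF h(3)])
  also have "...<=P * X" using X by (intro mult_right_mono) (auto simp: P_def)
  finally have "th / (4 * P) * Ip M p u<=th / (4 * P) * (P * X)" using th P by (intro mult_left_mono) auto
  thus ?thesis using P by simp
 qed
 have 3: "C * Ip M q u<=th / 4 * X"
 proof -
  have "C * Ip M q u<=C * (Sq * N u powr q)" by (intro mult_left_mono sobolev_W[OF h(3)] C(1))
  also have "...<=c * N u powr q" by (simp add: c_def distrib_right)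
  also have "N u powr q = N u powr (q - p) * X" using powr_add[of "N u" "q - p" p] by (simp add: X_def)
  also have "c * (N u powr (q - p) * X)<=c * (th / (4 * c) * X)"
   unfolding rhoq[symmetric] using c X h(4) n q_gt(1) by (intro mult_left_mono mult_right_mono powr_mono2) auto
  finally show ?thesis using c by simp
 qed
 have "X<=L / l1 * X + th / 4 * X + th / 4 * X"
  using h(5) C(2)[OF al h(3)] H_pairing(2)[OF h(3), of l] 1 2 3 unfolding X_def by linarith
 also have "L / l1 * X = X - th * X" by (simp add: th_def left_diff_distrib)
 finally have "th / 2 * X<=0" by (simp add: mult.commute)
 thus False using th X by (simp add: mult_le_0_iff)
qed
thus ?thesis using rho by blast
qed

lemma no_bif_below:
assumes l: "0 < l" "l < l1"
shows "(l, %_. 0) ~: S"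
proof
assume "(l, %_. 0):S"
from S_seq[OF this] obtain y where y: "!!k::nat. y k:nts" "(%k. dE (y k) (l, %_. 0))---->0" by blast
define L where "L = (l + l1) / 2"
have L: "L < l1" "0<=L" "l < L" using l by (auto simp: L_def)
obtain rho where rho: "rho > 0" "!!l u. 0<=l==>l<=L==>u:W==>N u<=rho==>N u powr p<=(LINT x|M. H 0 l u x * u x)==>N u = 0"
 using small_coercive[OF L(1,2)] by blast
note lim = dE_tendsto[OF y(2)]
have "eventually (%k. 0 < fst (y k)) sequentially" "eventually (%k. fst (y k) < L) sequentially" "eventually (%k. N (snd (y k)) < rho) sequentially"
 using order_tendstoD[OF lim(1)] order_tendstoD(2)[OF lim(2)] l L rho(1) by auto
hence "eventually (%k. 0 < fst (y k)&fst (y k) < L&N (snd (y k)) < rho) sequentially" by (intro eventually_conj)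
then obtain k where k: "0 < fst (y k)" "fst (y k) < L" "N (snd (y k)) < rho" by (auto simp: eventually_sequentially)
have s: "sol (H 0 (fst (y k)) (snd (y k))) (snd (y k))" "nontrivial_on \<Omega> (snd (y k))" using y(1)[of k] by (auto simp: nts_def)
have "N (snd (y k)) = 0"
 by (rule rho(2)[of "fst (y k)"]) (use k solD(1)[OF s(1)] sol_energy[OF s(1)] in auto)
thus False using s(2) N_eq_0_iff[OF solD(1)[OF s(1)]] by (simp add: nontrivial_on_def)
qed

text \<open>On the set where \<open>w < 0\<close> the truncated right-hand side reduces to \<open>t \<ge> 0\<close>.\<close>
lemma truncated_nonneg:
assumes s: "sol (H t l (%x. max 0 (u x))) w" and t: "t>=0" and u: "u:W" and neg: "AE x in M. w x < 0-->u x<=0"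
shows "AE x in M. w x>=0"
proof (rule nonneg_of_rhs[OF s])
show "Lp M q' (H t l (%x. max 0 (u x)))" by (rule H_Lp[OF Lp_contraction(1)[OF W_Lp(3)[OF u] pos_part q_gt(3)]])
show "AE x in M. w x < 0-->0<=H t l (%x. max 0 (u x)) x" using neg g_zero[of l]
 by eventually_elim (use t in \<open>auto simp: H_def Ap_def max_def\<close>)
qed

text \<open>Nonnegativity removes the truncation. The energy of the fixed point is
  \<open>b powr p\<close> times that of the solution, while the right-hand side tested with it gives
  \<open>b\<close> times that energy; as \<open>b <= 1 < p\<close>, the inequality required by
  \<open>rho\<close> survives the factor.\<close>

lemma coercive:
assumes rho: "!!l u. 0<=l==>l<=L==>u:W==>N u<=rho==>N u powr p<=(LINT x|M. H 0 l u x * u x)==>N u = 0"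
 and l: "0<=l" "l<=L" and b: "0<=b" "b<=1" and u: "u:W" "N u<=rho" "N (%x. u x - b * K 0 l u x) = 0"
shows "N u = 0"
proof -
note k = K_sol[OF u(1), of 0 l]
have kW: "K 0 l u:W" by (rule solD(1)[OF k])
have ae: "AE x in M. u x = b * K 0 l u x" by (rule N_diff_0_AE[OF u(1) scale[OF kW] u(3)])
have k0: "AE x in M. K 0 l u x>=0"
 by (rule truncated_nonneg[OF k _ u(1)]) (use ae b in \<open>auto elim!: eventually_mono simp: mult_nonneg_nonpos\<close>)
have up: "AE x in M. max 0 (u x) = u x" using ae k0 by eventually_elim (use b in auto)
have m: "(%x. max 0 (u x)):borel_measurable M" "u:borel_measurable M" using Lp_meas[OF W_Lp(1)[OF u(1)]] by auto
have k': "sol (H 0 l u) (K 0 l u)" by (rule sol_cong[OF k H_cong[OF up] H_meas[OF m(1)] H_meas[OF m(2)] _ kW]) simp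
have Nu: "N u = b * N (K 0 l u)"
 using N_abs_diff[OF u(1) scale[OF kW, of b]] u(3) N_scale[OF kW, of b] b by simp
show ?thesis
proof (cases "b = 0")
 case True thus ?thesis using Nu by simp
next
 case False
 hence b0: "b > 0" using b by simp
 define E where "E = (LINT x|M. H 0 l u x * u x)"
 have "E = (LINT x|M. b * (H 0 l u x * K 0 l u x))" unfolding E_def
 proof (rule integral_cong_AE)
  show "AE x in M. H 0 l u x * u x = b * (H 0 l u x * K 0 l u x)" using ae by eventually_elim simp
 qed (use m(2) H_meas[OF m(2)] Lp_meas[OF W_Lp(1)[OF kW]] in measurable)
 also have "... = b * N (K 0 l u) powr p" using sol_energy[OF k'] by simp
 finally have E: "E = b * N (K 0 l u) powr p" .
 have "N u powr p = b powr p * N (K 0 l u) powr p" using Nu b N_nonneg by (simp add: powr_mult)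
 also have "...<=b powr 1 * N (K 0 l u) powr p" using b b0 p1 by (intro mult_right_mono powr_mono') auto
 finally have "N u powr p<=E" using E b0 by simp
 thus ?thesis using rho[OF l u(1,2)] by (simp add: E_def)
qed
qed

section \<open>Rescaling of small solutions\<close>

lemma Ap_scale: "c > 0==>Ap p (c *\<^sub>R a) = (c powr (p - 1)) *\<^sub>R Ap p a"
using powr_mult_base[of c "p - 2"] by (simp add: Ap_def powr_mult mult_ac)

lemma sol_scale:
assumes s: "sol f w" and c: "c > 0"
shows "sol (%x. c powr (p - 1) * f x) (%x. c * w x)"
unfolding sol_def
proof (intro conjI ballI scale solD(1)[OF s])
fix ps assume ps: "ps:W"
note w = solD(1)[OF s]
note [measurable] = Lp_meas[OF W_Lp(2)[OF w]] Lp_meas[OF W_Lp(2)[OF ps]] Lp_meas[OF W_Lp(2)[OF scale[OF w, of c]]]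
have "(LINT x|M. Ap p (D (%x. c * w x) x) \<bullet> D ps x) = (LINT x|M. c powr (p - 1) * (Ap p (D w x) \<bullet> D ps x))"
 using wgrad_scale[OF w, of c] by (intro integral_cong_AE) (auto elim!: eventually_mono simp: Ap_scale[OF c])
also have "... = c powr (p - 1) * (LINT x|M. f x * ps x)" using solD(2)[OF s ps] by simp
also have "... = (LINT x|M. c powr (p - 1) * f x * ps x)" by (simp add: mult.assoc)
finally show "(LINT x|M. Ap p (D (%x. c * w x) x) \<bullet> D ps x) = (LINT x|M. c powr (p - 1) * f x * ps x)" .
qed

text \<open>Under the rescaling the part of order p - 1 in the bound on \<open>g\<close> is
  invariant but carries the arbitrary factor \<open>eta\<close>; the part of order q - 1 gains
  \<open>c k powr (q - p)\<close>, which tends to 0.\<close>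

lemma g_rescaled_tendsto:
fixes v :: "nat => 'a => real"
assumes c: "!!k::nat. c k > 0" "c---->0" and v: "!!k. v k:W" "!!k. N (v k)<=1" and l: "!!k. abs (lk k)<=L"
 and gk: "!!k. gk k = (%x. (1 / c k) powr (p - 1) * g (lk k) x (c k * v k x))"
shows "!!k. Lp M q' (gk k)" "(%k. Ip M q' (gk k))---->0"
proof -
have vm: "(%x. c k * v k x):borel_measurable M" for k using Lp_meas[OF W_Lp(1)[OF v(1)]] by measurable
have gm: "gk k:borel_measurable M" for k unfolding gk using g_meas_comp[OF vm] by (rule borel_measurable_times[OF borel_measurable_const])
have vq: "Ip M q (v k)<=Sq" for k using Ip_q_bound[OF v(1) v(2)] by simp
have bd: "EX C>=0. ALL k. Lp M q' (gk k)&Ip M q' (gk k)<=2 powr q' * ((eta + C * c k powr (q - p)) powr q' * Sq + eta powr q' * measure M (space M))" if eta: "eta > 0" for eta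
proof -
 obtain C where C: "C>=0" "g_le L eta C"
  using g_bound2[OF eta] by blast
 have "Lp M q' (gk k)&Ip M q' (gk k)<=2 powr q' * ((eta + C * c k powr (q - p)) powr q' * Sq + eta powr q' * measure M (space M))" for k
 proof -
  let ?d = "eta + C * c k powr (q - p)"
  have d: "?d>=0" using eta C(1) by simp
  have pw: "AE x in M. norm (gk k x) powr q'<=2 powr q' * (?d powr q' * norm (v k x) powr q + eta powr q')" using C(2)
  proof eventually_elim
   case (elim x)
   define t where "t = abs (v k x)"
   have t: "t>=0" by (simp add: t_def)
   have e1: "(1 / c k) powr (p - 1) * (c k * t) powr (p - 1) = t powr (p - 1)" using c(1)[of k] by (simp add: powr_mult powr_divide)
   have e2: "(1 / c k) powr (p - 1) * (c k * t) powr (q - 1) = c k powr (q - p) * t powr (q - 1)"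
   proof -
    have "(1 / c k) powr (p - 1) * (c k * t) powr (q - 1) = c k powr (q - 1) / c k powr (p - 1) * t powr (q - 1)" using c(1)[of k] by (simp add: powr_mult powr_divide)
    also have "c k powr (q - 1) / c k powr (p - 1) = c k powr (q - p)" by (simp flip: powr_diff)
    finally show ?thesis .
   qed
   have "abs (g (lk k) x (c k * v k x))<=eta * abs (c k * v k x) powr (p - 1) + C * abs (c k * v k x) powr (q - 1)" using elim l[of k] by blast
   hence "abs (gk k x)<=(1 / c k) powr (p - 1) * (eta * (c k * t) powr (p - 1) + C * (c k * t) powr (q - 1))"
    using c(1)[of k] unfolding gk t_def by (simp add: abs_mult mult_left_mono)
   also have "... = eta * ((1 / c k) powr (p - 1) * (c k * t) powr (p - 1)) + C * ((1 / c k) powr (p - 1) * (c k * t) powr (q - 1))"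
    by (simp only: distrib_left mult.left_commute)
   also have "... = eta * t powr (p - 1) + C * (c k powr (q - p) * t powr (q - 1))" unfolding e1 e2 ..
   also have "...<=eta * (t powr (q - 1) + 1) + C * (c k powr (q - p) * t powr (q - 1))"
   proof -
    have "t powr (p - 1)<=t powr (q - 1) + 1"
    proof (cases "t<=1")
     case True thus ?thesis using powr_le1[of "p - 1" t] p1 t by (simp add: add_increasing)
    next
     case False thus ?thesis using powr_mono[of "p - 1" "q - 1" t] q_gt(1) by (simp add: add_increasing2)
    qed
    thus ?thesis using eta by (intro add_right_mono mult_left_mono) auto
   qed
   also have "... = ?d * t powr (q - 1) + eta" by (simp add: algebra_simps)
   finally show ?case using powr_q'[of "abs (gk k x)" ?d t eta] d eta by (simp add: t_def)
  qed
  have i: "integrable M (%x. 2 powr q' * (?d powr q' * norm (v k x) powr q + eta powr q'))" using Lp_int[OF W_Lp(3)[OF v(1)]] by auto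
  have L1: "Lp M q' (gk k)" by (rule Lp_bound[OF gm i pw])
  have "Ip M q' (gk k)<=(LINT x|M. 2 powr q' * (?d powr q' * norm (v k x) powr q + eta powr q'))"
   unfolding Ip_def by (rule integral_mono_AE[OF Lp_int[OF L1] i pw])
  also have "... = 2 powr q' * (?d powr q' * Ip M q (v k) + eta powr q' * measure M (space M))"
   using Lp_int[OF W_Lp(3)[OF v(1)[of k]]] by (simp add: Ip_def)
  also have "...<=2 powr q' * (?d powr q' * Sq + eta powr q' * measure M (space M))" using vq[of k] by (intro mult_left_mono add_right_mono) auto
  finally show ?thesis using L1 by blast
 qed
 thus ?thesis using C(1) by blast
qed
show "Lp M q' (gk k)" for k using bd[of 1] by auto
show "(%k. Ip M q' (gk k))---->0"
proof (rule LIMSEQ_I)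
 fix e :: real assume e: "e > 0"
 define b where "b = 2 powr q' * (2 powr q' * Sq + measure M (space M)) + 1"
 have b: "b > 0" using Sq_nonneg by (simp add: b_def add_nonneg_pos)
 define eta where "eta = (e / (2 * b)) powr (1 / q')"
 have eta: "eta > 0" using e b by (simp add: eta_def)
 have etaq: "eta powr q' = e / (2 * b)" using e b q'_gt(2) by (simp add: eta_def powr_powr)
 obtain C where C: "C>=0" "!!k. Ip M q' (gk k)<=2 powr q' * ((eta + C * c k powr (q - p)) powr q' * Sq + eta powr q' * measure M (space M))"
  using bd[OF eta] by blast
 have "(%k. C * c k powr (q - p))---->C * 0 powr (q - p)" by (intro tendsto_intros tendsto_powr' c) (use q_gt(1) less_imp_le[OF c(1)] in auto)
 hence "(%k. C * c k powr (q - p))---->0" using q_gt(1) by simp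
 from order_tendstoD(2)[OF this eta] obtain n where n: "!!k. k>=n==>C * c k powr (q - p) < eta" by (auto simp: eventually_sequentially)
 have "norm (Ip M q' (gk k) - 0) < e" if k: "k>=n" for k
 proof -
  have "(eta + C * c k powr (q - p)) powr q'<=(2 * eta) powr q'" using n[OF k] eta C(1) q'_gt(2) by (intro powr_mono2) auto
  hence "Ip M q' (gk k)<=2 powr q' * ((2 * eta) powr q' * Sq + eta powr q' * measure M (space M))"
   by (intro order_trans[OF C(2)] mult_left_mono add_right_mono mult_right_mono Sq_nonneg) auto
  also have "... = eta powr q' * (2 powr q' * (2 powr q' * Sq + measure M (space M)))" by (simp add: powr_mult algebra_simps)
  also have "...<=eta powr q' * b" by (intro mult_left_mono) (auto simp: b_def)
  also have "... = e / 2" using b by (simp add: etaq)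
  also have "... < e" using e by simp
  finally show ?thesis by (simp add: Ip_nonneg)
 qed
 thus "EX n. ALL k>=n. norm (Ip M q' (gk k) - 0) < e" by blast
qed
qed

text \<open>Normalised solutions satisfy the rescaled equation, whose right-hand side converges; by
  stability they converge in norm, so the limit has norm 1 and is nontrivial. The interpretation
  \<open>Z\<close> with zero nonlinearity makes the same tools available for the limit
  equation.\<close>

lemma eigenvalue_limit:
assumes z: "(l, %_. 0):S"
shows "is_eigenvalue \<Omega> p V l"
proof -
interpret Z: weighted_problem \<Omega> p R V "%_ _ _. 0" Vb
proof unfold_locales
 show "EX f. good_majorant p (DIM('a) * p / (DIM('a) - p)) f&(AE x in M. ALL l:{- L..L}. ALL s. abs 0<=f (abs s))" for L :: real
 proof -
  obtain f where "good_majorant p (DIM('a) * p / (DIM('a) - p)) f" using g_grow[of 0] by blast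
  thus ?thesis by (intro exI[of _ f]) (simp add: good_majorant_def)
 qed
qed (use V_meas V_bd V_pos in \<open>auto simp: case_prod_unfold\<close>)
from S_seq[OF z] obtain y where y: "!!k::nat. y k:nts" "(%k. dE (y k) (l, %_. 0))---->0" by blast
define lk where "lk k = fst (y k)" for k
define u where "u k = snd (y k)" for k
have lim: "lk---->l" "(%k. N (u k))---->0" using dE_tendsto[OF y(2)] by (simp_all add: lk_def[abs_def] u_def)
have s: "sol (H 0 (lk k) (u k)) (u k)" "nontrivial_on \<Omega> (u k)" for k using y(1)[of k] by (auto simp: nts_def lk_def u_def)
have uW: "u k:W" for k by (rule solD(1)[OF s(1)])
define c where "c k = N (u k)" for k
have c: "c k > 0" for k using s(2)[of k] N_eq_0_iff[OF uW[of k]] N_nonneg[of "u k"] by (auto simp: nontrivial_on_def c_def)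
have c0: "c---->0" using lim(2) by (simp add: c_def[abs_def])
define v where "v k = (%x. (1 / c k) * u k x)" for k
have vW: "v k:W" for k unfolding v_def by (rule scale[OF uW])
have vN: "N (v k) = 1" for k using N_scale[OF uW, of "1 / c k" k] c[of k] by (simp add: v_def c_def)
have "Bseq lk" using lim(1) by (auto intro: convergent_imp_Bseq convergentI)
then obtain L where L: "!!k. abs (lk k)<=L" by (auto simp: Bseq_def)
define gk where "gk k = (%x. (1 / c k) powr (p - 1) * g (lk k) x (c k * v k x))" for k
have cv: "c k * v k x = u k x" for k x using c[of k] by (simp add: v_def)
note gl = g_rescaled_tendsto[of c v lk L gk, OF c c0 vW eq_refl[OF vN] L gk_def]
obtain r v' where r: "strict_mono (r::nat=>nat)" "Lp M q v'" "Lp M p v'" "AE x in M. (%k. v (r k) x)---->v' x" "(%k. Ip M p (%x. v (r k) x - v' x))---->0"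
 using W_compact[of v 1, OF vW eq_refl[OF vN]] by blast
have lr: "(%k. lk (r k))---->l" by (rule subseq_tendsto[OF lim(1) r(1)])
note zl = Z.H_lim[of "%_. 0" 0 "%k. lk (r k)" l "%k. v (r k)" v' "Sq * 1 powr q", OF tendsto_const lr W_Lp(3)[OF vW] r(2) Ip_q_bound[OF vW eq_refl[OF vN]] r(4)]
define F where "F k x = Z.H 0 (lk (r k)) (v (r k)) x + gk (r k) x" for k x
have sF: "sol (F k) (v (r k))" for k
proof -
 have "(%x. (1 / c (r k)) powr (p - 1) * H 0 (lk (r k)) (u (r k)) x) = F k"
 proof
  fix x
  have "(1 / c (r k)) powr (p - 1) * Ap p (u (r k) x) = Ap p (v (r k) x)"
   using Ap_scale[of "1 / c (r k)" "u (r k) x"] c[of "r k"] by (simp add: v_def)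
  thus "(1 / c (r k)) powr (p - 1) * H 0 (lk (r k)) (u (r k)) x = F k x"
   unfolding F_def H_def Z.H_def gk_def cv by (simp add: distrib_left mult.left_commute)
 qed
 thus ?thesis using sol_scale[OF s(1)[of "r k"], of "1 / c (r k)"] c[of "r k"] by (simp add: v_def)
qed
have FL: "Lp M q' (F k)" for k unfolding F_def by (rule Lp_add(1)[OF q'_gt(2) zl(1) gl(1)])
have Fl: "(%k. Ip M q' (%x. F k x - Z.H 0 l v' x))---->0"
proof -
 have gr: "(%k. Ip M q' (gk (r k)))---->0" by (rule subseq_tendsto[OF gl(2) r(1)])
 have z0: "(%k. 2 powr q' * (Ip M q' (%x. Z.H 0 (lk (r k)) (v (r k)) x - Z.H 0 l v' x) + Ip M q' (gk (r k))))---->0"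
  using tendsto_mult_left[OF tendsto_add[OF zl(3) gr], of "2 powr q'"] by simp
 show ?thesis
 proof (rule Lim_null_comparison[OF _ z0], intro always_eventually allI)
  fix k
  have "Ip M q' (%x. (Z.H 0 (lk (r k)) (v (r k)) x - Z.H 0 l v' x) + gk (r k) x)<=2 powr q' * (Ip M q' (%x. Z.H 0 (lk (r k)) (v (r k)) x - Z.H 0 l v' x) + Ip M q' (gk (r k)))"
   by (rule Lp_add(2)[OF q'_gt(2) Lp_diff(1)[OF q'_gt(2) zl(1) zl(2)] gl(1)])
  thus "norm (Ip M q' (%x. F k x - Z.H 0 l v' x))<=2 powr q' * (Ip M q' (%x. Z.H 0 (lk (r k)) (v (r k)) x - Z.H 0 l v' x) + Ip M q' (gk (r k)))"
   by (simp add: Ip_nonneg F_def algebra_simps)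
 qed
qed
obtain w where w: "sol (Z.H 0 l v') w" using sol_exists[OF zl(2)] by blast
have wW: "w:W" by (rule solD(1)[OF w])
have vw: "(%k. N (%x. v (r k) x - w x))---->0" by (rule sol_stable[of F "%k. v (r k)", OF sF w FL zl(2) Fl])
have "AE x in M. v' x = w x"
 by (rule Lp_lim_unique[of "%k. v (r k)", OF W_Lp(1)[OF vW] r(3) W_Lp(1)[OF wW] r(5) N_lim_Lp[of "%k. v (r k)" w, OF vW wW vw]])
from sol_cong[OF w Z.H_cong[OF this] Z.H_meas[OF Lp_meas[OF r(2)]] Z.H_meas[OF Lp_meas[OF W_Lp(1)[OF wW]]] _ wW]
have "sol (Z.H 0 l w) w" by simp
moreover have "N w = 1"
 using N_tendsto[of "%k. v (r k)" w, OF vW wW vw] vN by (simp add: LIMSEQ_const_iff)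
ultimately show ?thesis unfolding is_eigenvalue_def Z.weak_solution_iff nontrivial_on_def
 using N_eq_0_iff[OF wW] by (intro exI[of _ w]) auto
qed

end

section \<open>Absence of small positive solutions beyond the principal eigenvalue\<close>

lemma DERIV_split:
fixes f1 f2 :: "real => real"
assumes d: "(f1 has_real_derivative d) (at a)" "(f2 has_real_derivative d) (at a)" and e: "f1 a = f2 a"
shows "((%s. if s>=a then f1 s else f2 s) has_real_derivative d) (at a)"
unfolding has_field_derivative_iff filterlim_at_split
proof
have 1: "((%y. (f1 y - f1 a) / (y - a)) \<longlongrightarrow> d) (at_right a)" and 2: "((%y. (f2 y - f2 a) / (y - a)) \<longlongrightarrow> d) (at_left a)"
 using d unfolding has_field_derivative_iff filterlim_at_split by auto
show "((%y. ((if y>=a then f1 y else f2 y) - (if a>=a then f1 a else f2 a)) / (y - a)) \<longlongrightarrow> d) (at_left a)"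
 by (rule Lim_transform_eventually[OF 2]) (auto simp: eventually_at_filter e)
show "((%y. ((if y>=a then f1 y else f2 y) - (if a>=a then f1 a else f2 a)) / (y - a)) \<longlongrightarrow> d) (at_right a)"
 by (rule Lim_transform_eventually[OF 1]) (auto simp: eventually_at_filter)
qed

lemma isCont_Ap:
assumes "p > 1"
shows "isCont (Ap p :: real => real) a"
unfolding continuous_at_sequentially o_def using Ap_tendsto[OF assms] by blast

text \<open>The supporting inequalities at both points enclose the difference quotient, with no case
  distinction at 0.\<close>

lemma DERIV_abs_powr:
assumes p: "p > 1"
shows "((%s. abs s powr p) has_real_derivative p * Ap p a) (at a)"
unfolding has_field_derivative_iff
proof -
have z: "((%y. p * abs (Ap p y - Ap p a)) \<longlongrightarrow> 0) (at a)"
proof -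
 have "((%y. p * abs (Ap p y - Ap p a)) \<longlongrightarrow> p * abs (Ap p a - Ap p a)) (at a)"
  by (intro tendsto_intros isCont_Ap[OF p, unfolded isCont_def])
 thus ?thesis by simp
qed
have "((%y. (abs y powr p - abs a powr p) / (y - a) - p * Ap p a) \<longlongrightarrow> 0) (at a)"
proof (rule Lim_null_comparison[OF _ z])
 have "norm ((abs y powr p - abs a powr p) / (y - a) - p * Ap p a)<=p * abs (Ap p y - Ap p a)" if y: "y~=a" for y
 proof -
  define X where "X = abs y powr p - abs a powr p - p * Ap p a * (y - a)"
  have "0<=X" using convex_tangent[OF p, of a y] by (simp add: X_def)
  moreover have "X<=p * (Ap p y - Ap p a) * (y - a)" using convex_tangent[OF p, of y a] by (simp add: X_def algebra_simps)
  ultimately have "abs X<=abs (p * (Ap p y - Ap p a) * (y - a))" by simp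
  also have "... = p * abs (Ap p y - Ap p a) * abs (y - a)" using p by (simp add: abs_mult)
  finally have "abs X / abs (y - a)<=p * abs (Ap p y - Ap p a)" using y by (simp add: divide_le_eq)
  moreover have "(abs y powr p - abs a powr p) / (y - a) - p * Ap p a = X / (y - a)" using y by (simp add: X_def diff_divide_distrib)
  ultimately show ?thesis by simp
 qed
 thus "eventually (%y. norm ((abs y powr p - abs a powr p) / (y - a) - p * Ap p a)<=p * abs (Ap p y - Ap p a)) (at a)"
  by (auto simp: eventually_at_filter)
qed
thus "((%y. (abs y powr p - abs a powr p) / (y - a)) \<longlongrightarrow> p * Ap p a) (at a)" by (simp add: LIM_zero_iff)
qed

text \<open>The function \<open>(s + e)\<^sup>1\<^sup>-\<^sup>p\<close> of Picone's test function, continued to negative arguments by reflection in a point.\<close>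
definition picone_fun :: "real => real => real => real" where
"picone_fun p e s = (if s>=0 then (e + s) powr (1 - p) else 2 * e powr (1 - p) - (e - s) powr (1 - p))"

lemma picone_fun:
assumes p: "p > 1" and e: "e > 0"
shows "(picone_fun p e has_real_derivative (1 - p) * (e + abs s) powr (- p)) (at s)"
 and "abs (picone_fun p e s)<=2 * e powr (1 - p)" and "abs ((1 - p) * (e + abs s) powr (- p))<=(p - 1) * e powr (- p)"
 and "continuous_on UNIV (%s. (1 - p) * (e + abs s) powr (- p))"
proof -
have d1: "((%s. (e + s) powr (1 - p)) has_real_derivative (1 - p) * (e + s) powr (- p)) (at s)" if "s>=0" for s
 using that e by (auto intro!: derivative_eq_intros)
have d2: "((%s. 2 * e powr (1 - p) - (e - s) powr (1 - p)) has_real_derivative (1 - p) * (e - s) powr (- p)) (at s)" if "s<=0" for s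
 using that e by (auto intro!: derivative_eq_intros)
show "(picone_fun p e has_real_derivative (1 - p) * (e + abs s) powr (- p)) (at s)"
proof -
 consider "s > 0" | "s < 0" | "s = 0" by linarith
 thus ?thesis
 proof cases
  case 1
  show ?thesis
   by (rule has_field_derivative_transform_within_open[of "%s. (e + s) powr (1 - p)" _ _ "{0<..}"])
     (use 1 d1[of s] in \<open>auto simp: picone_fun_def\<close>)
 next
  case 2
  show ?thesis
   by (rule has_field_derivative_transform_within_open[of "%s. 2 * e powr (1 - p) - (e - s) powr (1 - p)" _ _ "{..<0}"])
     (use 2 d2[of s] in \<open>auto simp: picone_fun_def\<close>)
 next
  case 3
  have "((%s. if s>=0 then (e + s) powr (1 - p) else 2 * e powr (1 - p) - (e - s) powr (1 - p)) has_real_derivative (1 - p) * e powr (- p)) (at 0)"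
   by (rule DERIV_split) (use d1[of 0] d2[of 0] in auto)
  thus ?thesis using 3 by (simp add: picone_fun_def[abs_def])
 qed
qed
show "abs (picone_fun p e s)<=2 * e powr (1 - p)"
proof (cases "s>=0")
 case True
 have "(e + s) powr (1 - p)<=e powr (1 - p)" using True e p by (intro powr_mono2') auto
 hence "(e + s) powr (1 - p)<=2 * e powr (1 - p)" using powr_ge_zero[of e "1 - p"] by linarith
 thus ?thesis using True by (simp add: picone_fun_def)
next
 case False
 have "(e - s) powr (1 - p)<=e powr (1 - p)" using False e p by (intro powr_mono2') auto
 hence "abs (2 * e powr (1 - p) - (e - s) powr (1 - p))<=2 * e powr (1 - p)"
  using powr_ge_zero[of e "1 - p"] powr_ge_zero[of "e - s" "1 - p"] by linarith
 thus ?thesis using False by (simp add: picone_fun_def)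
qed
have "(e + abs s) powr (- p)<=e powr (- p)" using e p by (intro powr_mono2') auto
thus "abs ((1 - p) * (e + abs s) powr (- p))<=(p - 1) * e powr (- p)" using p by (simp add: abs_mult mult_left_mono)
show "continuous_on UNIV (%s. (1 - p) * (e + abs s) powr (- p))"
 by (intro continuous_intros) (use e in \<open>auto simp: add_pos_nonneg\<close>)
qed

text \<open>The flux with gradient \<open>a\<close> is paired with the gradient of
  \<open>abs f powr p * v powr (1 - p)\<close>. Young's inequality for
  \<open>x = abs f * norm a / v\<close> produces a multiple of \<open>x powr p\<close> that cancels
  against the first term.\<close>

lemma picone_pointwise:
fixes a b :: "'b::euclidean_space"
assumes p: "p > 1" and v: "v > 0"
shows "Ap p a \<bullet> (abs f powr p *\<^sub>R (((1 - p) * v powr (- p)) *\<^sub>R a) + v powr (1 - p) *\<^sub>R ((p * Ap p f) *\<^sub>R b))<=norm b powr p"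
proof -
define x where "x = abs f * norm a / v"
have x0: "x>=0" using v by (simp add: x_def)
have xp: "x powr p = abs f powr p * (v powr (- p) * norm a powr p)" using v by (simp add: x_def powr_mult powr_divide powr_minus_divide)
have xp1: "x powr (p - 1) = v powr (1 - p) * (abs f powr (p - 1) * norm a powr (p - 1))"
 using v powr_minus_divide[of v "p - 1"] by (simp add: x_def powr_mult powr_divide)
have "abs (Ap p f * (Ap p a \<bullet> b))<=abs f powr (p - 1) * (norm a powr (p - 1) * norm b)"
 using norm_Ap[of p f] Cauchy_Schwarz_ineq2[of "Ap p a" b] by (simp add: abs_mult norm_Ap mult_left_mono)
hence "v powr (1 - p) * (Ap p f * (Ap p a \<bullet> b))<=v powr (1 - p) * (abs f powr (p - 1) * (norm a powr (p - 1) * norm b))"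
 by (intro mult_left_mono) auto
also have "... = x powr (p - 1) * norm b" by (simp add: xp1)
also have "...<=(1 - 1/p) * x powr p + norm b powr p / p" by (rule young_powr[OF p x0]) simp
finally have "p * (v powr (1 - p) * (Ap p f * (Ap p a \<bullet> b)))<=p * ((1 - 1/p) * x powr p + norm b powr p / p)"
 using p by (intro mult_left_mono) auto
also have "... = (p - 1) * x powr p + norm b powr p" using p by (simp add: field_simps)
finally have "p * (v powr (1 - p) * (Ap p f * (Ap p a \<bullet> b))) + (1 - p) * x powr p<=norm b powr p" by (simp add: algebra_simps)
thus ?thesis by (simp add: inner_add_right Ap_inner_self xp mult_ac)
qed

context weighted_problem
begin

text \<open>The shift by \<open>e\<close> keeps the power bounded where \<open>u\<close> vanishes,
  which makes the product an admissible test function.\<close>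

lemma picone_test:
assumes s: "sol f u" and u0: "AE x in M. u x>=0" and t: "test_pair \<Omega> ph b" and e: "e > 0" and f: "Lp M q' f"
shows "integrable M (%x. f x * (abs (ph x) powr p * picone_fun p e (u x)))" "(LINT x|M. f x * (abs (ph x) powr p * picone_fun p e (u x)))<=Ip M p b"
proof -
have t': "test_pair \<Omega> (%x. abs (ph x) powr p) (%x. (p * Ap p (ph x)) *\<^sub>R b x)"
proof (rule test_pair_comp[OF t DERIV_abs_powr[OF p1]])
 show "continuous_on UNIV (%s. p * Ap p s)" by (intro continuous_intros continuous_at_imp_continuous_on ballI isCont_Ap[OF p1])
 show "abs 0 powr p = 0" using p0 by simp
qed
note w = solD(1)[OF s]
define k where "k = max (2 * e powr (1 - p)) ((p - 1) * e powr (- p))"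
have k: "abs ((1 - p) * (e + abs s) powr (- p))<=k" "abs (picone_fun p e s)<=k" for s
 using picone_fun(2,3)[OF p1 e, of s] unfolding k_def by (simp_all add: le_max_iff_disj)
have a: "apx (%x. abs (ph x) powr p * picone_fun p e (u x))
  (%x. abs (ph x) powr p *\<^sub>R (((1 - p) * (e + abs (u x)) powr (- p)) *\<^sub>R D u x) + picone_fun p e (u x) *\<^sub>R ((p * Ap p (ph x)) *\<^sub>R b x))"
 by (rule apx_test_mult_comp[OF W0_apx[OF w] t' picone_fun(1)[OF p1 e] picone_fun(4)[OF p1 e] k])
have psW: "(%x. abs (ph x) powr p * picone_fun p e (u x)):W" by (rule apx_W0[OF a])
show "integrable M (%x. f x * (abs (ph x) powr p * picone_fun p e (u x)))" by (rule pairing_integrable(1)[OF f W_Lp(3)[OF psW]])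
have "(LINT x|M. f x * (abs (ph x) powr p * picone_fun p e (u x))) = (LINT x|M. Ap p (D u x) \<bullet> D (%x. abs (ph x) powr p * picone_fun p e (u x)) x)"
 by (rule solD(2)[OF s psW, symmetric])
also have "...<=(LINT x|M. norm (b x) powr p)"
proof (rule integral_mono_AE[OF integrable_Ap_inner[OF p1 W_Lp(2)[OF w] W_Lp(2)[OF psW]] Lp_int[OF test_transfer(4)[OF t p0]]])
 show "AE x in M. Ap p (D u x) \<bullet> D (%x. abs (ph x) powr p * picone_fun p e (u x)) x<=norm (b x) powr p"
  using apx_wgrad[OF a] u0
 proof eventually_elim
  case (elim x)
  have "e + u x > 0" using elim(2) e by simp
  from picone_pointwise[OF p1 this, of "D u x" "ph x" "b x"] show ?case using elim by (simp add: picone_fun_def)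
 qed
qed
finally show "(LINT x|M. f x * (abs (ph x) powr p * picone_fun p e (u x)))<=Ip M p b" by (simp add: Ip_def)
qed

text \<open>Splits the potential so that only the part of order q, which Sobolev's inequality
  controls, carries a large constant.\<close>

lemma powr_le_eps:
assumes s: "s > 0" and y: "y>=0"
shows "y powr (q - p)<=s + s powr (- p / (q - p)) * y powr q"
proof (cases "y powr (q - p)<=s")
case True thus ?thesis using s by (simp add: add_increasing2)
next
case False
hence "s powr (1 / (q - p))<=(y powr (q - p)) powr (1 / (q - p))" using s q_gt(1) by (intro powr_mono2) auto
also have "... = y" using y q_gt(1) by (simp add: powr_powr)
finally have "y powr (- p)<=(s powr (1 / (q - p))) powr (- p)" using s p0 by (intro powr_mono2') auto
hence "y powr (- p)<=s powr (- p / (q - p))" by (simp add: powr_powr)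
hence "y powr (- p) * y powr q<=s powr (- p / (q - p)) * y powr q" by (intro mult_right_mono) auto
moreover have "y powr (- p) * y powr q = y powr (q - p)" by (simp flip: powr_add)
ultimately show ?thesis using s by simp
qed

lemma weight_integrable:
assumes t: "test_pair \<Omega> ph b" and u: "Lp M q u"
shows "integrable M (%x. (eta + C * abs (u x) powr (q - p)) * abs (ph x) powr p)"
proof -
obtain B where B: "B > 0" "!!x. abs (ph x)<=B" using test_pair_bounded[OF t] by blast
note [measurable] = Lp_meas[OF u] borel_M[OF test_pair_measurable(1)[OF t]]
have i: "integrable M (%x. (abs eta + abs C * (1 + 1 * norm (u x) powr q)) * B powr p)" using Lp_int[OF u] by auto
show ?thesis
proof (rule Bintegrable_bound[OF i])
 show "AE x in M. norm ((eta + C * abs (u x) powr (q - p)) * abs (ph x) powr p)<=norm ((abs eta + abs C * (1 + 1 * norm (u x) powr q)) * B powr p)"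
 proof (rule AE_I2)
  fix x
  have "abs (eta + C * abs (u x) powr (q - p))<=abs eta + abs C * abs (u x) powr (q - p)" by (rule order_trans[OF abs_triangle_ineq]) (simp add: abs_mult)
  also have "...<=abs eta + abs C * (1 + 1 * norm (u x) powr q)" using powr_le_eps[of 1 "abs (u x)"] by (intro add_left_mono mult_left_mono) auto
  finally have "abs (eta + C * abs (u x) powr (q - p)) * abs (ph x) powr p<=(abs eta + abs C * (1 + 1 * norm (u x) powr q)) * B powr p"
   using B p0 by (intro mult_mono powr_mono2) auto
  thus "norm ((eta + C * abs (u x) powr (q - p)) * abs (ph x) powr p)<=norm ((abs eta + abs C * (1 + 1 * norm (u x) powr q)) * B powr p)"
   by (simp add: abs_mult)
 qed
qed measurable
qed

text \<open>The term \<open>t > 0\<close> compensates for the set \<open>{u = 0}\<close>, where the potential term does not contribute.\<close>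
lemma picone_inequality:
assumes s: "sol (H t l u) u" and u0: "AE x in M. u x>=0" and t: "t > 0" and ph: "test_pair \<Omega> ph b" and l: "0<=l" "l<=L"
 and g: "g_le L eta C" and eta: "eta>=0" "C>=0"
shows "l * wV ph<=Ip M p b + (LINT x|M. (eta + C * abs (u x) powr (q - p)) * abs (ph x) powr p)"
proof -
have w: "u:W" by (rule solD(1)[OF s])
note [measurable] = Lp_meas[OF W_Lp(1)[OF w]] borel_M[OF test_pair_measurable(1)[OF ph]] V_meas
define e where "e k = 1 / real (Suc k)" for k
have e: "e k > 0" for k by (simp add: e_def)
have e0: "e---->0" using LIMSEQ_inverse_real_of_nat by (simp add: e_def[abs_def] inverse_eq_divide)
\<comment> \<open>The factor by which the shift \<open>e k\<close> diminishes the weight term. The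
  value 1 where \<open>u\<close> vanishes makes the limit the full \<open>wV ph\<close>.\<close>
define r where "r k x = (if u x = 0 then 1 else (abs (u x) / (abs (u x) + e k)) powr (p - 1))" for k x
define Q where "Q x = (eta + C * abs (u x) powr (q - p)) * abs (ph x) powr p" for x
have r1: "0<=r k x" "r k x<=1" for k x
proof -
 show "0<=r k x" by (simp add: r_def)
 have "(abs (u x) / (abs (u x) + e k)) powr (p - 1)<=1" using e[of k] p1 by (intro powr_le1) (auto simp: divide_le_eq)
 thus "r k x<=1" by (simp add: r_def)
qed
have rm[measurable]: "r k:borel_measurable M" for k unfolding r_def by measurable
have Qi: "integrable M Q" unfolding Q_def by (rule weight_integrable[OF ph W_Lp(3)[OF w]])
have phL: "Lp M p ph" by (rule test_transfer(3)[OF ph p0])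
note Vi = wV_integrable(1)[OF phL]
have bd: "norm (V x * abs (ph x) powr p * r k x)<=abs (V x * abs (ph x) powr p)" for k x
 using r1[of k x] by (simp add: abs_mult mult_left_le)
have ri: "integrable M (%x. V x * abs (ph x) powr p * r k x)" for k
 by (rule Bintegrable_bound[OF integrable_abs[OF Vi]]) (use bd in auto)
have "(%k. \<integral>x. V x * abs (ph x) powr p * r k x \<partial>M)---->(LINT x|M. V x * abs (ph x) powr p)"
proof (rule integral_dominated_convergence[OF _ _ integrable_abs[OF Vi]])
 show "AE x in M. norm (V x * abs (ph x) powr p * r k x)<=abs (V x * abs (ph x) powr p)" for k using bd by simp
 show "AE x in M. (%k. V x * abs (ph x) powr p * r k x)---->V x * abs (ph x) powr p"
 proof (rule AE_I2)
  fix x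
  have "(%k. r k x)---->1"
  proof (cases "u x = 0")
   case True thus ?thesis by (simp add: r_def)
  next
   case False
   have "(%k. (abs (u x) / (abs (u x) + e k)) powr (p - 1))---->(abs (u x) / (abs (u x) + 0)) powr (p - 1)"
    by (intro tendsto_powr' tendsto_divide tendsto_add tendsto_const e0) (use False p1 in auto)
   thus ?thesis using False by (simp add: r_def)
  qed
  from tendsto_mult_left[OF this, of "V x * abs (ph x) powr p"] show "(%k. V x * abs (ph x) powr p * r k x)---->V x * abs (ph x) powr p" by simp
 qed
qed measurable
hence lim: "(%k. l * (LINT x|M. V x * abs (ph x) powr p * r k x))---->l * wV ph" unfolding wV_def by (rule tendsto_mult_left)
\<comment> \<open>As \<open>1 - p < 0\<close>, the contribution of t where \<open>u\<close> vanishes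
  eventually outweighs the weight term that was added there.\<close>
have ev: "eventually (%k. l * Vb<=t * e k powr (1 - p)) sequentially"
proof -
 have "(%k. l * Vb * e k powr (p - 1))---->l * Vb * 0 powr (p - 1)" by (intro tendsto_intros tendsto_powr' e0) (use p1 less_imp_le[OF e] in auto)
 hence "(%k. l * Vb * e k powr (p - 1))---->0" using p1 by simp
 from order_tendstoD(2)[OF this t] show ?thesis
 proof eventually_elim
  case (elim k)
  have "l * Vb * e k powr (p - 1) * e k powr (1 - p)<=t * e k powr (1 - p)" using elim by (intro mult_right_mono) auto
  moreover have "e k powr (p - 1) * e k powr (1 - p) = 1" using e[of k] by (simp flip: powr_add)
  ultimately show ?case by (simp add: mult.assoc)
 qed
qed
have "eventually (%k. l * (LINT x|M. V x * abs (ph x) powr p * r k x)<=Ip M p b + (LINT x|M. Q x)) sequentially" using ev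
proof eventually_elim
 case (elim k)
 note P = picone_test[OF s u0 ph e[of k] H_Lp[OF W_Lp(3)[OF w]]]
 have i: "integrable M (%x. l * (V x * abs (ph x) powr p * r k x) - Q x)" by (intro Bintegrable_diff integrable_mult_right ri Qi)
 have "l * (LINT x|M. V x * abs (ph x) powr p * r k x) - (LINT x|M. Q x) = (LINT x|M. l * (V x * abs (ph x) powr p * r k x) - Q x)"
  using ri[of k] Qi by simp
 also have "...<=(LINT x|M. H t l u x * (abs (ph x) powr p * picone_fun p (e k) (u x)))"
 proof (rule integral_mono_AE[OF i P(1)])
  show "AE x in M. l * (V x * abs (ph x) powr p * r k x) - Q x<=H t l u x * (abs (ph x) powr p * picone_fun p (e k) (u x))"
   using u0 g V_bd
  proof eventually_elim
   case (elim x)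
   define F where "F = abs (ph x) powr p"
   have F: "F>=0" by (simp add: F_def)
   show ?case
   proof (cases "u x = 0")
    case True
    have "abs (g l x 0)<=0" using elim(2)[rule_format, of l 0] l by simp
    hence h: "H t l u x = t" using True by (simp add: H_def Ap_def)
    have "l * V x<=l * Vb" using elim(3) l(1) by (intro mult_left_mono) auto
    hence "l * V x<=t * e k powr (1 - p)" using \<open>l * Vb \<le> t * e k powr (1 - p)\<close> by linarith
    hence "l * V x * F<=t * e k powr (1 - p) * F" using F by (rule mult_right_mono)
    moreover have "Q x>=0" using eta by (simp add: Q_def)
    ultimately show ?thesis using True unfolding h by (simp add: picone_fun_def r_def F_def mult_ac)
   next
    case False
    hence up: "u x > 0" using elim(1) by simp
    define v where "v = e k + u x"
    have v: "v > 0" "u x<=v" using up e[of k] by (auto simp: v_def)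
    have rr: "r k x = u x powr (p - 1) * v powr (1 - p)"
     using up v powr_minus_divide[of v "p - 1"] by (simp add: r_def v_def powr_divide add.commute)
    have uq: "u x powr (q - 1) * v powr (1 - p)<=u x powr (q - p)"
    proof -
     have "u x powr (q - 1) = u x powr (q - p) * u x powr (p - 1)" by (simp flip: powr_add)
     hence "u x powr (q - 1) * v powr (1 - p) = u x powr (q - p) * r k x" by (simp add: rr)
     also have "...<=u x powr (q - p) * 1" by (intro mult_left_mono r1) auto
     finally show ?thesis by simp
    qed
    have "- (eta * u x powr (p - 1) + C * u x powr (q - 1))<=g l x (u x)" using elim(2)[rule_format, of l "u x"] l up by simp
    hence "- (eta * u x powr (p - 1) + C * u x powr (q - 1)) * v powr (1 - p)<=g l x (u x) * v powr (1 - p)" by (rule mult_right_mono) simp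
    moreover have "(eta * u x powr (p - 1) + C * u x powr (q - 1)) * v powr (1 - p)<=eta * 1 + C * u x powr (q - p)"
    proof -
     have "(eta * u x powr (p - 1) + C * u x powr (q - 1)) * v powr (1 - p) = eta * r k x + C * (u x powr (q - 1) * v powr (1 - p))"
      by (simp add: rr distrib_right mult.assoc)
     also have "...<=eta * 1 + C * u x powr (q - p)" using eta r1 uq by (intro add_mono mult_left_mono) auto
     finally show ?thesis .
    qed
    moreover have "t * v powr (1 - p)>=0" using t by simp
    moreover have "H t l u x * v powr (1 - p) = l * V x * r k x + g l x (u x) * v powr (1 - p) + t * v powr (1 - p)"
    proof -
     have "Ap p (u x) = u x powr (p - 1)" using up powr_mult_base[of "u x" "p - 2"] by (simp add: Ap_def mult.commute)
     thus ?thesis unfolding H_def rr by (simp add: distrib_right mult.assoc)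
    qed
    ultimately have "l * V x * r k x - (eta + C * u x powr (q - p))<=H t l u x * v powr (1 - p)" unfolding mult_minus_left by linarith
    hence "(l * V x * r k x - (eta + C * u x powr (q - p))) * F<=H t l u x * v powr (1 - p) * F" using F by (rule mult_right_mono)
    thus ?thesis using up by (simp add: picone_fun_def Q_def F_def v_def algebra_simps)
   qed
  qed
 qed
 also have "...<=Ip M p b" by (rule P(2))
 finally show ?case by simp
qed
from tendsto_upperbound[OF lim this] show ?thesis by (simp add: Q_def)
qed

text \<open>Picone's inequality is applied with test functions, so a near minimiser is approximated
  by them; energy and weight converge, and the strict inequality persists.\<close>

lemma near_minimizing_test:
assumes l: "l > l1"
shows "EX ph b. test_pair \<Omega> ph b&Ip M p b < l * wV ph"
proof -
obtain u where u: "u:W" "wV u = 1" "N u powr p < l" using near_minimizer[OF l] by blast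
obtain ph b where t: "!!k::nat. test_pair \<Omega> (ph k) (b k)" "(%k. Ip M p (%x. ph k x - u x))---->0" "(%k. Ip M p (%x. b k x - D u x))---->0"
  "AE x in M. (%k. ph k x)---->u x"
 using apx_AE[OF W0_apx[OF u(1)]] by blast
have L: "Lp M p (ph k)" for k by (rule test_transfer(3)[OF t(1) p0])
have 1: "(%k. Ip M p (b k))---->N u powr p" unfolding N_powr by (rule Ip_tendsto[OF p1 test_transfer(4)[OF t(1) p0] W_Lp(2)[OF u(1)] t(3)])
have 2: "(%k. wV (ph k))---->wV u" unfolding wV_def
proof (rule generalized_dct(4))
 show "integrable M (%x. Vb * norm (ph k x) powr p)" for k using Lp_int[OF L] by auto
 show "integrable M (%x. Vb * norm (u x) powr p)" using Lp_int[OF W_Lp(1)[OF u(1)]] by auto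
 show "AE x in M. (%k. V x * abs (ph k x) powr p)---->V x * abs (u x) powr p"
  using t(4) by eventually_elim (intro tendsto_intros tendsto_powr', use p0 in auto)
 show "AE x in M. (%k. Vb * norm (ph k x) powr p)---->Vb * norm (u x) powr p"
  using t(4) by eventually_elim (intro tendsto_intros tendsto_powr' tendsto_norm, use p0 in auto)
 show "AE x in M. norm (V x * abs (ph k x) powr p)<=Vb * norm (ph k x) powr p" for k
  using V_bd by eventually_elim (auto simp: abs_mult intro!: mult_right_mono)
 show "(%k. \<integral>x. Vb * norm (ph k x) powr p \<partial>M)---->(LINT x|M. Vb * norm (u x) powr p)"
  using tendsto_mult_left[OF Ip_tendsto[OF p1 L W_Lp(1)[OF u(1)] t(2)], of Vb] by (simp add: Ip_def)
qed (use wV_integrable(1)[OF L] wV_integrable(1)[OF W_Lp(1)[OF u(1)]] in auto)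
have "(%k. Ip M p (b k) - l * wV (ph k))---->N u powr p - l * wV u" by (intro tendsto_intros 1 2)
hence "eventually (%k. Ip M p (b k) - l * wV (ph k) < 0) sequentially" by (rule order_tendstoD) (use u in simp)
then obtain k where "Ip M p (b k) - l * wV (ph k) < 0" by (auto simp: eventually_sequentially)
thus ?thesis using t(1)[of k] by (intro exI[of _ "ph k"] exI[of _ "b k"]) auto
qed

text \<open>For a test function whose quotient of energy and weight is below some
  \<open>l' < l\<close>, Picone's inequality would have to make up a fixed deficit \<open>d\<close>.
  Its error term cannot, since it becomes less than \<open>d\<close> as the solutions
  shrink.\<close>

lemma no_small_solutions:
assumes l: "lk---->l" "l > l1" and t: "!!k::nat. tk k > 0" and s: "!!k. sol (H (tk k) (lk k) (u k)) (u k)" and u0: "!!k. AE x in M. u k x>=0"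
 and lim: "(%k. N (u k))---->0"
shows False
proof -
define l' where "l' = (l + l1) / 2"
have l': "l1 < l'" "l' < l" using l(2) by (auto simp: l'_def)
obtain ph b where ph: "test_pair \<Omega> ph b" "Ip M p b < l' * wV ph" using near_minimizing_test[OF l'(1)] by blast
have u: "u k:W" for k by (rule solD(1)[OF s])
have I: "wV ph > 0" using ph(2) Ip_nonneg[of M p b] l' l1_pos by (smt (verit) mult_nonneg_nonpos)
define d where "d = l' * wV ph - Ip M p b"
have d: "d > 0" using ph(2) by (simp add: d_def)
obtain B where B: "B > 0" "!!x. abs (ph x)<=B" using test_pair_bounded[OF ph(1)] by blast
have phL: "Lp M p ph" by (rule test_transfer(3)[OF ph(1) p0])
define F where "F = Ip M p ph + 1"
have F: "F > 0" using Ip_nonneg[of M p ph] by (simp add: F_def)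
have "Bseq lk" using l(1) by (auto intro: convergent_imp_Bseq convergentI)
then obtain L where L: "!!k. abs (lk k)<=L" by (auto simp: Bseq_def)
\<comment> \<open>\<open>eta\<close> and \<open>e\<close> each claim at most a quarter of the
  deficit; the term with the large constant \<open>A\<close> tends to 0 with
  \<open>N (u k)\<close>.\<close>
define eta where "eta = d / (4 * F)"
have eta: "eta > 0" using d F by (simp add: eta_def)
obtain C where C: "C>=0" "g_le L eta C"
 using g_bound2[OF eta] by blast
define e where "e = d / (4 * (C + 1) * F)"
have e: "e > 0" using d F C(1) by (simp add: e_def)
define A where "A = e powr (- p / (q - p))"
have bound: "(LINT x|M. (eta + C * abs (u k x) powr (q - p)) * abs (ph x) powr p)<=(eta + C * e) * Ip M p ph + C * A * B powr p * Ip M q (u k)" for k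
proof -
 have i: "integrable M (%x. (eta + C * e) * norm (ph x) powr p)" "integrable M (%x. C * A * B powr p * norm (u k x) powr q)"
  using Lp_int[OF phL] Lp_int[OF W_Lp(3)[OF u[of k]]] by auto
 have "(LINT x|M. (eta + C * abs (u k x) powr (q - p)) * abs (ph x) powr p)<=(LINT x|M. (eta + C * e) * norm (ph x) powr p + C * A * B powr p * norm (u k x) powr q)"
 proof (rule integral_mono[OF weight_integrable[OF ph(1) W_Lp(3)[OF u]] Bintegrable_add[OF i]])
  fix x
  have "abs (u k x) powr (q - p)<=e + A * abs (u k x) powr q" unfolding A_def by (rule powr_le_eps[OF e]) simp
  hence "(eta + C * abs (u k x) powr (q - p)) * abs (ph x) powr p<=(eta + C * (e + A * abs (u k x) powr q)) * abs (ph x) powr p"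
   using C(1) by (intro mult_right_mono add_left_mono mult_left_mono) auto
  also have "... = (eta + C * e) * abs (ph x) powr p + C * A * abs (u k x) powr q * abs (ph x) powr p" by (simp add: algebra_simps)
  also have "...<=(eta + C * e) * abs (ph x) powr p + C * A * abs (u k x) powr q * B powr p"
   using B p0 C(1) by (intro add_left_mono mult_left_mono powr_mono2) (auto simp: A_def)
  finally show "(eta + C * abs (u k x) powr (q - p)) * abs (ph x) powr p<=(eta + C * e) * norm (ph x) powr p + C * A * B powr p * norm (u k x) powr q"
   by (simp add: mult_ac)
 qed
 also have "... = (eta + C * e) * Ip M p ph + C * A * B powr p * Ip M q (u k)" using Bintegral_add[OF i] by (simp add: Ip_def)
 finally show ?thesis .
qed
have small: "(eta + C * e) * Ip M p ph<=d / 2"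
proof -
 have "C * e<=(C + 1) * e" using e by (intro mult_right_mono) auto
 also have "... = d / (4 * F)" using C(1) F by (simp add: e_def divide_simps)
 finally have "(eta + C * e) * Ip M p ph<=(d / (4 * F) + d / (4 * F)) * F" unfolding eta_def using d F
  by (intro mult_mono add_left_mono) (auto simp: F_def Ip_nonneg)
 thus ?thesis using F by (simp add: field_simps)
qed
have "(%k. C * A * B powr p * (Sq * N (u k) powr q))---->C * A * B powr p * (Sq * 0 powr q)"
 by (intro tendsto_intros tendsto_powr' lim) (use q_gt(3) N_nonneg in auto)
hence z: "(%k. C * A * B powr p * (Sq * N (u k) powr q))---->0" using q_gt(3) by simp
have "d / 2 > 0" using d by simp
from eventually_conj[OF order_tendstoD(2)[OF z this] order_tendstoD(1)[OF l(1) l'(2)]]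
obtain k where k: "C * A * B powr p * (Sq * N (u k) powr q) < d / 2" "l' < lk k" by (auto simp: eventually_sequentially)
have "lk k * wV ph<=Ip M p b + (LINT x|M. (eta + C * abs (u k x) powr (q - p)) * abs (ph x) powr p)"
 by (rule picone_inequality[OF s u0 t ph(1) _ _ C(2)]) (use k(2) l' l1_pos L[of k] eta C(1) in auto)
moreover have "C * A * B powr p * Ip M q (u k)<=C * A * B powr p * (Sq * N (u k) powr q)" using C(1) by (intro mult_left_mono sobolev_W[OF u]) (auto simp: A_def)
moreover have "l' * wV ph<=lk k * wV ph" using k(2) I by (intro mult_right_mono) auto
ultimately show False using bound[of k] small k(1) d_def by linarith
qed

text \<open>Fixed points for t > 0 are nonnegative and so solve the untruncated perturbed equation;
  their limit solves the original one. If it is trivial, \<open>no_small_solutions\<close> confines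
  the parameter.\<close>

lemma perturbed_limit:
assumes t: "!!k::nat. 0 < tk k" "tk---->0" and l: "lk---->l" and u: "!!k. uk k:W" and v: "v:W" "(%k. N (%x. uk k x - v x))---->0"
 and f: "!!k. N (%x. uk k x - K (tk k) (lk k) (uk k) x) = 0"
shows "(l, v):S \<or> N v = 0&l<=l1"
proof -
have *: "(AE x in M. uk k x>=0)&sol (H (tk k) (lk k) (uk k)) (uk k)" for k
proof -
 note s = K_sol[OF u[of k], of "tk k" "lk k"]
 have kW: "K (tk k) (lk k) (uk k):W" by (rule solD(1)[OF s])
 have ae: "AE x in M. uk k x = K (tk k) (lk k) (uk k) x" by (rule N_diff_0_AE[OF u kW f])
 have "AE x in M. K (tk k) (lk k) (uk k) x>=0"
  by (rule truncated_nonneg[OF s less_imp_le[OF t(1)] u]) (use ae in \<open>auto elim!: eventually_mono\<close>)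
 hence p: "AE x in M. uk k x>=0" using ae by eventually_elim simp
 hence "AE x in M. max 0 (uk k x) = uk k x" by eventually_elim simp
 moreover have "(%x. max 0 (uk k x)):borel_measurable M" "uk k:borel_measurable M" using Lp_meas[OF W_Lp(1)[OF u]] by auto
 moreover have "AE x in M. K (tk k) (lk k) (uk k) x = uk k x" using ae by eventually_elim simp
 ultimately have "sol (H (tk k) (lk k) (uk k)) (uk k)" by (intro sol_cong[OF s H_cong H_meas H_meas _ u])
 thus ?thesis using p by blast
qed
have sv: "sol (H 0 l v) v" by (rule sol_limit[OF t(2) l _ v]) (use * in blast)
show ?thesis
proof (cases "N v = 0")
 case False
 hence "(l, v):nts" using sv N_eq_0_iff[OF v(1)] by (simp add: nts_def nontrivial_on_def)
 thus ?thesis using nts_S by blast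
next
 case True
 have "(%k. N (uk k))---->0" using N_tendsto[of uk v, OF u v] True by simp
 hence "~ l > l1" using no_small_solutions[of lk l tk uk, OF l _ t(1)] * by blast
 thus ?thesis using True by simp
qed
qed

theorem bifurcation_from_l1:
"EX C. C \<subseteq> S&closedin (Etop \<Omega> p) C&connectedin (Etop \<Omega> p) C&(l1, (%_. 0)):C &
  (ALL D. D \<subseteq> S&closedin (Etop \<Omega> p) D&connectedin (Etop \<Omega> p) D&C \<subseteq> D-->D = C) &
  ((ALL m. EX z:C. Edist \<Omega> p (0, (%_. 0)) z > m) \<or> (EX l'. (l', (%_. 0)):C&l'~=l1&is_eigenvalue \<Omega> p V l'))"
proof -
obtain rho where rho: "rho > 0" "!!l u. 0<=l==>l<=l1 / 2==>u:W==>N u<=rho==>N u powr p<=(LINT x|M. H 0 l u x * u x)==>N u = 0"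
 using small_coercive[of "l1 / 2"] l1_pos by auto
interpret B: bifurcation W N K S l1 rho
proof unfold_locales
 show "K t l u:W" if "u:W" for t l u using K_sol[OF that] by (rule solD(1))
 show "(l, %_. 0) ~: S" if "l1 / 4<=l" "l < l1" for l using no_bif_below[of l] that l1_pos by simp
 show "N u = 0" if "l1 / 4<=l" "l<=l1 / 2" "0<=b" "b<=1" "u:W" "N u<=rho" "N (%x. u x - b * K 0 l u x) = 0" for l b u
  by (rule coercive[of "l1 / 2" rho, OF rho(2)]) (use that l1_pos in auto)
 show "EX r w. strict_mono r&w:W&(%k. N (%x. K (tk (r k)) (lk (r k)) (uk (r k)) x - w x))---->0 &
   (ALL u:W. (%k. N (%x. uk k x - u x))---->0-->N (%x. w x - K t l u x) = 0)"
  if "tk---->t" "lk---->l" "!!k::nat. uk k:W" "!!k. N (uk k)<=B" for tk t lk l uk B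
  by (rule K_compact[OF that])
 show "l:S" if "!!k::nat. z k:S" "l:carr" "(%k. dE (z k) l)---->0" for z l
  by (rule closedin_topE_limit[OF S_closed that])
 show "EX r l. strict_mono r&l:S&(%k. dE (z (r k)) l)---->0" if "!!k::nat. z k:S" "!!k. abs (fst (z k)) + N (snd (z k))<=B" for z B
  by (rule S_compact[OF that])
 show "(l, v):S \<or> N v = 0&l<=l1"
  if "!!k::nat. 0 < tk k" "tk---->0" "lk---->l" "!!k. uk k:W" "v:W" "(%k. N (%x. uk k x - v x))---->0"
   "!!k. N (%x. uk k x - K (tk k) (lk k) (uk k) x) = 0" for tk lk uk l v
  by (rule perturbed_limit[OF that])
qed (use l1_pos rho(1) S_sub in auto)
obtain C where C: "C \<subseteq> S" "closedin topE C" "connectedin topE C" "(l1, %_. 0):C"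
 "ALL D. D \<subseteq> S&closedin topE D&connectedin topE D&C \<subseteq> D-->D = C" "(ALL m. EX z:C. B.nE z > m) \<or> (EX l. (l, %_. 0):C&l~=l1)"
 using B.global_bifurcation by blast
have nE: "B.nE z = Edist \<Omega> p (0, (%_. 0)) z" if "z:C" for z
proof -
 have "snd z:W" using that C(1) S_sub by (auto simp: carr_iff)
 thus ?thesis using N_scale[of "snd z" "-1"] by (simp add: Edist_def B.nE_def)
qed
show ?thesis
proof (intro exI[of _ C] conjI)
 show "C \<subseteq> S" "closedin (Etop \<Omega> p) C" "connectedin (Etop \<Omega> p) C" "(l1, %_. 0):C"
  "ALL D. D \<subseteq> S&closedin (Etop \<Omega> p) D&connectedin (Etop \<Omega> p) D&C \<subseteq> D-->D = C"
  using C unfolding Etop_eq by auto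
 show "(ALL m. EX z:C. Edist \<Omega> p (0, (%_. 0)) z > m) \<or> (EX l'. (l', (%_. 0)):C&l'~=l1&is_eigenvalue \<Omega> p V l')"
  using C(6)
 proof
  assume "ALL m. EX z:C. B.nE z > m"
  thus ?thesis using nE by metis
 next
  assume "EX l. (l, %_. 0):C&l~=l1"
  thus ?thesis using eigenvalue_limit C(1) by blast
 qed
qed
qed

end

section \<open>Reflection of the parameter\<close>

text \<open>Changing the signs of \<open>lambda\<close> and \<open>V\<close> together leaves the
  weight term unchanged. This isometry therefore carries solution sets to solution sets and
  exchanges the two principal eigenvalues up to sign.\<close>

definition reflect :: "real \<times> 'b => real \<times> 'b" where "reflect z = (- fst z, snd z)"

lemma reflect_simps [simp]: "reflect (reflect z) = z" "fst (reflect z) = - fst z" "snd (reflect z) = snd z" "reflect (l, u) = (- l, u)"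
by (simp_all add: reflect_def)

lemma reflect_mem: "z:reflect ` A \<longleftrightarrow> reflect z:A"
by (metis image_iff reflect_simps(1))

lemma reflect_image_image [simp]: "reflect ` reflect ` A = A"
by (simp add: image_image)

lemma (in seminormed) homeomorphic_map_reflect: "homeomorphic_map topE topE reflect"
proof -
have c: "continuous_map topE topE reflect" unfolding continuous_map_def
proof (intro conjI allI impI)
 show "reflect:topspace topE \<rightarrow> topspace topE" by (auto simp: carr_iff)
 fix U assume U: "openin topE U"
 show "openin topE {x:topspace topE. reflect x:U}" unfolding openin_topE
 proof (intro conjI ballI)
  fix z assume z: "z:{x:topspace topE. reflect x:U}"
  then obtain r where r: "r > 0" "!!w. w:carr==>dE (reflect z) w < r==>w:U" using U unfolding openin_topE by blast
  have "w:{x:topspace topE. reflect x:U}" if w: "w:carr" "dE z w < r" for w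
  proof -
   have "reflect w:carr" using w(1) by (simp add: carr_iff)
   moreover have "dE (reflect z) (reflect w) = dE z w" by (simp add: dE_def)
   ultimately show ?thesis using r(2)[of "reflect w"] w by simp
  qed
  thus "EX r>0. ALL w:carr. dE z w < r-->w:{x:topspace topE. reflect x:U}" using r(1) by blast
 qed auto
qed
have "homeomorphic_maps topE topE reflect reflect" unfolding homeomorphic_maps_def using c by simp
thus ?thesis by (rule homeomorphic_maps_map[THEN iffD1, THEN conjunct1])
qed

lemma weak_solution_reflect:
"weak_solution \<Omega> p (%x. - V x) (%l. g (- l)) l u \<longleftrightarrow> weak_solution \<Omega> p V g (- l) u"
unfolding weak_solution_def by simp

lemma is_eigenvalue_reflect: "is_eigenvalue \<Omega> p (%x. - V x) l \<longleftrightarrow> is_eigenvalue \<Omega> p V (- l)"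
unfolding is_eigenvalue_def using weak_solution_reflect[of \<Omega> p V "%_ _ _. 0"] by simp

lemma lambda_neg1_reflect: "lambda_neg1 \<Omega> p V = - lambda1 \<Omega> p (%x. - V x)"
unfolding lambda_neg1_def lambda1_def by (simp add: minus_equation_iff eq_commute[of "-1"])

lemma (in weighted_problem) sol_closure_reflect:
"sol_closure \<Omega> p (%x. - V x) (%l. g (- l)) = reflect ` S"
proof -
have e: "{(lam, u). nontrivial_on \<Omega> u&weak_solution \<Omega> p (%x. - V x) (%l. g (- l)) lam u} = reflect ` nts"
 unfolding weak_solution_reflect weak_solution_iff by (auto simp: reflect_mem nts_def)
show ?thesis
 unfolding S_eq sol_closure_def[of \<Omega> p "%x. - V x"] e Etop_eq
 by (rule homeomorphic_map_closure_of[OF homeomorphic_map_reflect]) (use nts_carr in simp)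
qed

theorem theorem3p2:
  fixes \<Omega> :: "'a::euclidean_space set"
    and p :: real and \<alpha> :: real
    and V :: "'a \<Rightarrow> real"
    and g :: "real \<Rightarrow> 'a \<Rightarrow> real \<Rightarrow> real"
    and \<mu>1 :: real
  assumes p_gt1: "p > 1"
    and N_gt_p: "real DIM('a) > p"
    and open_\<Omega>: "open \<Omega>" and bounded_\<Omega>: "bounded \<Omega>" and connected_\<Omega>: "connected \<Omega>"
    and \<alpha>: "0 < \<alpha>" "\<alpha> \<le> 1"
    and bdry: "C1alpha_boundary \<Omega> \<alpha>"
    and V_meas: "V \<in> borel_measurable (lebesgue_on \<Omega>)"
    and V_bdd: "\<exists>M. AE x in lebesgue_on \<Omega>. \<bar>V x\<bar> \<le> M"
    and V_pos: "emeasure lebesgue {x \<in> \<Omega>. V x > 0} > 0"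
    and V_neg: "emeasure lebesgue {x \<in> \<Omega>. V x < 0} > 0"
    and g_car: "caratheodory \<Omega> g"
    and g_growth: "\<forall>J::real set. bounded J \<longrightarrow>
        (\<exists>f. good_majorant p (real DIM('a) * p / (real DIM('a) - p)) f \<and>
             (AE x in lebesgue_on \<Omega>. \<forall>lam\<in>J. \<forall>s. \<bar>g lam x s\<bar> \<le> f \<bar>s\<bar>))"
    and \<mu>1: "\<mu>1 = lambda1 \<Omega> p V \<or> \<mu>1 = lambda_neg1 \<Omega> p V"
  shows "\<exists>C. C \<subseteq> sol_closure \<Omega> p V g \<and> closedin (Etop \<Omega> p) C \<and> connectedin (Etop \<Omega> p) C \<and>
           (\<mu>1, (\<lambda>_. 0)) \<in> C \<and>
           (\<forall>D. D \<subseteq> sol_closure \<Omega> p V g \<and> closedin (Etop \<Omega> p) D \<and> connectedin (Etop \<Omega> p) D \<and>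
                C \<subseteq> D \<longrightarrow> D = C) \<and>
           ((\<forall>M. \<exists>z\<in>C. Edist \<Omega> p (0, (\<lambda>_. 0)) z > M) \<or>
            (\<exists>lam'. (lam', (\<lambda>_. 0)) \<in> C \<and> lam' \<noteq> \<mu>1 \<and> is_eigenvalue \<Omega> p V lam'))"
proof -
obtain R where R: "\<Omega> \<subseteq> ball 0 R" using bounded_\<Omega> bounded_subset_ballD by blast
obtain Vb where Vb: "AE x in lebesgue_on \<Omega>. abs (V x)<=Vb" using V_bdd by blast
have grow: "EX f. good_majorant p (DIM('a) * p / (DIM('a) - p)) f &
   (AE x in lebesgue_on \<Omega>. ALL l:{-L..L}. ALL s. abs (g l x s)<=f (abs s))" for L
 using g_growth[rule_format, of "{-L..L}"] by simp
interpret P: weighted_problem \<Omega> p R V g Vb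
 by unfold_locales (use p_gt1 N_gt_p open_\<Omega> R V_meas Vb V_pos g_car grow in \<open>auto simp: caratheodory_def\<close>)
show ?thesis
proof (cases "\<mu>1 = lambda1 \<Omega> p V")
 case True
 show ?thesis using P.bifurcation_from_l1 unfolding P.l1_def True .
next
 case False
 hence \<mu>: "\<mu>1 = - lambda1 \<Omega> p (%x. - V x)" using \<mu>1 lambda_neg1_reflect by metis
 \<comment> \<open>For the negative principal eigenvalue the result is applied to the weight
   \<open>- V x\<close>, with \<open>V_neg\<close> in the role of \<open>V_pos\<close>, and the
   continuum is transported back.\<close>
 interpret Q: weighted_problem \<Omega> p R "%x. - V x" "%l. g (- l)" Vb
 proof unfold_locales
  show "AE x in lebesgue_on \<Omega>. continuous_on UNIV (%(l, s). g (- l) x s)" using P.g_cont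
  proof eventually_elim
   case (elim x)
   have "continuous_on UNIV (%z::real \<times> real. (- fst z, snd z))" by (intro continuous_intros)
   from continuous_on_compose2[OF elim this] show ?case by (simp add: case_prod_unfold)
  qed
  show "EX f. good_majorant p (DIM('a) * p / (DIM('a) - p)) f &
   (AE x in lebesgue_on \<Omega>. ALL l:{-L..L}. ALL s. abs (g (- l) x s)<=f (abs s))" for L
  proof -
   obtain f where f: "good_majorant p (DIM('a) * p / (DIM('a) - p)) f" "AE x in lebesgue_on \<Omega>. ALL l:{-L..L}. ALL s. abs (g l x s)<=f (abs s)"
    using grow[of L] by blast
   from f(2) have "AE x in lebesgue_on \<Omega>. ALL l:{-L..L}. ALL s. abs (g (- l) x s)<=f (abs s)" by eventually_elim auto
   thus ?thesis using f(1) by blast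
  qed
 qed (use Vb V_neg V_meas P.g_meas in auto)
 have homeo: "homeomorphic_map (Etop \<Omega> p) (Etop \<Omega> p) reflect" unfolding P.Etop_eq by (rule P.homeomorphic_map_reflect)
 have closed: "closedin (Etop \<Omega> p) (reflect ` A)" if "closedin (Etop \<Omega> p) A" for A
  using homeomorphic_map_closedness_eq[OF homeo, of A] that by simp
 have conn: "connectedin (Etop \<Omega> p) (reflect ` A)" if "connectedin (Etop \<Omega> p) A" for A
  using connectedin_continuous_map_image[OF homeomorphic_imp_continuous_map[OF homeo] that] .
 obtain C where C: "C \<subseteq> reflect ` sol_closure \<Omega> p V g" "closedin (Etop \<Omega> p) C" "connectedin (Etop \<Omega> p) C" "(Q.l1, %_. 0):C"
  "ALL D. D \<subseteq> reflect ` sol_closure \<Omega> p V g&closedin (Etop \<Omega> p) D&connectedin (Etop \<Omega> p) D&C \<subseteq> D-->D = C"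
  "(ALL m. EX z:C. Edist \<Omega> p (0, (%_. 0)) z > m) \<or> (EX l'. (l', (%_. 0)):C&l'~=Q.l1&is_eigenvalue \<Omega> p (%x. - V x) l')"
  using Q.bifurcation_from_l1 unfolding P.sol_closure_reflect by (elim exE conjE) (rule that)
 have \<mu>l: "\<mu>1 = - Q.l1" by (simp add: \<mu> Q.l1_def)
 show ?thesis
 proof (intro exI[of _ "reflect ` C"] conjI allI impI)
  show "reflect ` C \<subseteq> sol_closure \<Omega> p V g" using image_mono[OF C(1), of reflect] by simp
  show "closedin (Etop \<Omega> p) (reflect ` C)" "connectedin (Etop \<Omega> p) (reflect ` C)" using closed C(2) conn C(3) by auto
  show "(\<mu>1, %_. 0):reflect ` C" using C(4) by (simp add: reflect_mem \<mu>l)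
 next
  fix D assume D: "D \<subseteq> sol_closure \<Omega> p V g&closedin (Etop \<Omega> p) D&connectedin (Etop \<Omega> p) D&reflect ` C \<subseteq> D"
  have "reflect ` D = C"
   by (rule C(5)[rule_format]) (use D closed conn image_mono[of "reflect ` C" D reflect] in \<open>auto intro: image_mono\<close>)
  thus "D = reflect ` C" by (metis reflect_image_image)
 next
  show "(ALL M. EX z:reflect ` C. Edist \<Omega> p (0, (%_. 0)) z > M) \<or>
     (EX lam'. (lam', (%_. 0)):reflect ` C&lam'~=\<mu>1&is_eigenvalue \<Omega> p V lam')"
   using C(6)
  proof
   assume a: "ALL m. EX z:C. Edist \<Omega> p (0, (%_. 0)) z > m"
   have "Edist \<Omega> p (0, (%_. 0)) (reflect z) = Edist \<Omega> p (0, (%_. 0)) z" for z :: "real \<times> ('a => real)"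
    by (simp add: Edist_def)
   thus ?thesis using a by simp
  next
   assume "EX l'. (l', (%_. 0)):C&l'~=Q.l1&is_eigenvalue \<Omega> p (%x. - V x) l'"
   then obtain l' where l': "(l', (%_. 0)):C" "l'~=Q.l1" "is_eigenvalue \<Omega> p (%x. - V x) l'" by blast
   thus ?thesis by (intro disjI2 exI[of _ "- l'"]) (auto simp: reflect_mem \<mu>l is_eigenvalue_reflect)
  qed
 qed
qed
qed

end
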